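(* Let $(\Sigma,w)$ be a weighted fan in $\mathfrak{t}$ and $\mathcal{X}_{\Sigma,w}$ the associated toric orbifold. Then the group $\mathrm{Pic}^{\mathbb{T}}\mathcal{X}_{\Sigma,w}$ of equivalence classes of $\mathbb{T}$-linearized orbi-line bundles admits the following combinatorial descriptions (with the correspondences specified in the context): (a) it is in bijection with the collections of characters $$\left\{ m_\sigma \in \widetilde{\mathfrak{t}}^\ast_{\sigma,\mathbb{Z}} \right\}_{\sigma\in\Sigma(n)} \text{ such that } m_{\sigma_1}-m_{\sigma_2} \in (\sigma_1\cap\sigma_2)^\perp \text{ for all } \sigma_1,\sigma_2\in\Sigma(n);$$ (b) it is in bijection with the arbitrary collections $\left\{ h_\rho \in \frac{1}{w_\rho}\rho^\ast_{\mathbb{Z}} \right\}_{\rho\in\Sigma(1)}$, equivalently with the arbitrary collections of integers $\left\{ l_\rho = h_\rho(w_\rho\nu_\rho)\in\mathbb{Z} \right\}_{\rho\in\Sigma(1)}$, where $l_\rho = m_\sigma(w_\rho\nu_\rho)$ for any $\sigma \in \Sigma(n)$ containing $\rho$. In other words, there is an isomorphism $\mathrm{Pic}^{\mathbb{T}}\mathcal{X}_{\Sigma,w}\cong\bigoplus_{\rho\in\Sigma(1)}\frac{1}{w_\rho}\rho^\ast_{\mathbb{Z}}$ which maps the subgroup $\mathrm{Pic}^{\mathbb{T}}X_\Sigma\subset \mathrm{Pic}^{\mathbb{T}}\mathcal{X}_{\Sigma,w}$ (pull-backs of $\mathbb{T}$-linearized line bundles on $X_\Sigma$) injectively into the subgroup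 $\bigoplus_{\rho\in\Sigma(1)}\rho^\ast_{\mathbb{Z}}\subset\bigoplus_{\rho\in\Sigma(1)}\frac{1}{w_\rho}\rho^\ast_{\mathbb{Z}}$, i.e. the square formed by these maps and the two inclusions commutes.
   Context: $\mathbb{T}\cong\mathbb{R}^n/\mathbb{Z}^n$ is a fixed torus with Lie algebra $\mathfrak{t}$, lattice $\mathfrak{t}_{\mathbb{Z}}=\pi_1(\mathbb{T})\subset\mathfrak{t}$, and character lattice $\mathfrak{t}^\ast_{\mathbb{Z}}\subset\mathfrak{t}^\ast$; $\chi_m$ is the character given by $m$. A weighted fan $(\Sigma,w)$ is a complete simplicial rational fan $\Sigma$ of convex cones in $\mathfrak{t}$ with a function $w:\Sigma(1)\to\mathbb{N}_+$, where $\Sigma(k)$ is the set of $k$-dimensional cones. For a ray $\rho\in\Sigma(1)$, $\nu_\rho$ generates the semigroup $\rho\cap\mathfrak{t}_{\mathbb{Z}}$; $\rho^\ast_{\mathbb{Z}}=\mathrm{Hom}(\mathbb{Z}\nu_\rho,\mathbb{Z})$, and $\frac{1}{w_\rho}\rho^\ast_{\mathbb{Z}}$ consists of linear forms $h$ on $\mathbb{R}\nu_\rho$ with $h(w_\rho\nu_\rho)\in\mathbb{Z}$. For a cone $\tau$, $\tau^\perp\subset\mathfrak{t}^\ast$ is its annihilator. $X_\Sigma$ is the complete toric variety over $\mathbb{C}$ of $\Sigma$ with affine toric open subsets $U_\tau$ ($\tau\in\Sigma$). For $\sigma\in\Sigma(n)$ let $\widetilde{\mathfrak{t}}_{\sigma,\mathbb{Z}}=\langle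 w_\rho\nu_\rho:\rho\in\Sigma(1),\rho\subset\sigma\rangle\subset\mathfrak{t}_{\mathbb{Z}}$, and for $\tau\in\Sigma$ let $\widetilde{\mathfrak{t}}_{\tau,\mathbb{Z}}=\bigcap_{\sigma\in\Sigma(n),\sigma\supset\tau}\widetilde{\mathfrak{t}}_{\sigma,\mathbb{Z}}$. Let $\widetilde{\mathbb{T}}_\tau\to\mathbb{T}$ be the cover with $\pi_1\widetilde{\mathbb{T}}_\tau=\widetilde{\mathfrak{t}}_{\tau,\mathbb{Z}}$, $\widetilde\Gamma_\tau$ its (finite) kernel, and $\widetilde{\mathfrak{t}}^\ast_{\tau,\mathbb{Z}}\subset\mathfrak{t}^\ast$ the dual lattice of $\widetilde{\mathfrak{t}}_{\tau,\mathbb{Z}}$ (the characters of $\widetilde{\mathbb{T}}_\tau$; it contains $\mathfrak{t}^\ast_{\mathbb{Z}}$). Let $\widetilde U_\tau$ be the (nonsingular) affine toric variety of $\tau$ with respect to the lattice $\widetilde{\mathfrak{t}}_{\tau,\mathbb{Z}}$, so $\widetilde U_\tau/\widetilde\Gamma_\tau=U_\tau$. The toric orbifold $\pi:\mathcal{X}_{\Sigma,w}\to X_\Sigma$ is the orbifold structure on $X_\Sigma$ with uniformizing charts $\widetilde\Gamma_\tau\circlearrowright\widetilde U_\tau\to U_\tau$, glued for $\tau'\subset\tau$ by the natural toric maps $\psi^{\tau'}_\tau:\widetilde U_{\tau'}\to\widetilde U_\tau$. An orbi-line bundle on $\mathcal{X}_{\Sigma,w}$ is a collection of $\widetilde\Gamma_\tau$-equivariant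 (analytic/algebraic) line bundles $L_\tau\to\widetilde U_\tau$ with $\widetilde\Gamma_{\tau'}$-equivariant isomorphisms $(\psi^{\tau'}_\tau)^\ast L_\tau\to L_{\tau'}$ for $\tau'\subset\tau$, whose induced transition functions satisfy the usual cocycle condition. It is $\mathbb{T}$-linearized if the $L_\tau$ are $\widetilde{\mathbb{T}}_\tau$-equivariant and the isomorphisms are $\widetilde{\mathbb{T}}_{\tau'}$-equivariant. $\mathrm{Pic}^{\mathbb{T}}$ denotes the group of equivalence classes of $\mathbb{T}$-linearized (orbi-)line bundles under tensor product. Correspondence: for $\sigma\in\Sigma(n)$, $\widetilde U_\sigma\cong\mathbb{C}^n$ and $L_\sigma$ is equivariantly trivial; $m_\sigma$ is the character of $\widetilde{\mathbb{T}}_\sigma$ defining the action on the fiber $\mathbb{C}$ of this trivialization $\widetilde U_\sigma\times\mathbb{C}$, so that the trivializing section has weight $m_\sigma$, with weights normalized so that the monomial $\chi_m$ has weight $m$. Then $h_\rho$ is the restriction of $m_\sigma$ to $\mathbb{R}\nu_\rho$ for any maximal $\sigma\supset\rho$. *)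

theory Defs
  imports
    "HOL-Analysis.Analysis"
    "HOL-Computational_Algebra.Group_Closure"
    "HOL-Algebra.Product_Groups"
begin

section \<open>Lattices and weighted fans\<close>

text \<open>
  The Lie algebra of the torus is an arbitrary Euclidean space \<open>'a\<close>, of which only the structure of
  a real vector space of dimension \<open>n = DIM('a)\<close> is used.  The lattice \<open>N\<close> is the fundamental group
  of the torus, so that the torus is \<open>'a\<close> modulo \<open>N\<close>.  Elements of the dual space are functionals
  \<open>'a \<Rightarrow> real\<close>.
\<close>

definition is_lattice :: "'a::euclidean_space set \<Rightarrow> bool" where
  "is_lattice N \<longleftrightarrow> (\<exists>B. independent B \<and> span B = UNIV \<and> N = group_closure B)"

definition dual_lattice :: "'a::euclidean_space set \<Rightarrow> ('a \<Rightarrow> real) set" where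
  "dual_lattice \<Lambda> = {m. linear m \<and> (\<forall>v\<in>\<Lambda>. m v \<in> \<int>)}"

definition annihilator :: "'a::euclidean_space set \<Rightarrow> ('a \<Rightarrow> real) set" where
  "annihilator \<tau> = {m. linear m \<and> (\<forall>v\<in>\<tau>. m v = 0)}"

definition rational_simplicial_cone :: "'a::euclidean_space set \<Rightarrow> 'a set \<Rightarrow> bool" where
  "rational_simplicial_cone N \<tau> \<longleftrightarrow> (\<exists>B\<subseteq>N. independent B \<and> \<tau> = convex_cone hull B)"

definition complete_simplicial_fan :: "'a::euclidean_space set \<Rightarrow> 'a set set \<Rightarrow> bool" where
  "complete_simplicial_fan N \<Sigma> \<longleftrightarrow>
     finite \<Sigma> \<and>
     (\<forall>\<tau>\<in>\<Sigma>. rational_simplicial_cone N \<tau>) \<and>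
     (\<forall>\<tau>\<in>\<Sigma>. \<forall>\<tau>'. \<tau>' face_of \<tau> \<and> \<tau>' \<noteq> {} \<longrightarrow> \<tau>' \<in> \<Sigma>) \<and>
     (\<forall>\<tau>\<in>\<Sigma>. \<forall>\<tau>'\<in>\<Sigma>. \<tau> \<inter> \<tau>' face_of \<tau> \<and> \<tau> \<inter> \<tau>' face_of \<tau>') \<and>
     \<Union>\<Sigma> = UNIV"

definition cones :: "nat \<Rightarrow> 'a::euclidean_space set set \<Rightarrow> 'a set set" where
  "cones k \<Sigma> = {\<tau>\<in>\<Sigma>. dim \<tau> = k}"

abbreviation rays :: "'a::euclidean_space set set \<Rightarrow> 'a set set" where
  "rays \<equiv> cones 1"

abbreviation max_cones :: "'a::euclidean_space set set \<Rightarrow> 'a set set" where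
  "max_cones \<equiv> cones DIM('a)"

definition weighted_fan ::
  "'a::euclidean_space set \<Rightarrow> 'a set set \<Rightarrow> ('a set \<Rightarrow> nat) \<Rightarrow> bool" where
  "weighted_fan N \<Sigma> w \<longleftrightarrow> complete_simplicial_fan N \<Sigma> \<and> (\<forall>\<rho>\<in>rays \<Sigma>. w \<rho> > 0)"

text \<open>The generator of the semigroup \<open>\<rho> \<inter> N\<close>.\<close>

definition ray_gen :: "'a::euclidean_space set \<Rightarrow> 'a set \<Rightarrow> 'a" where
  "ray_gen N \<rho> = (THE v. \<rho> \<inter> N = range (\<lambda>k. real k *\<^sub>R v))"

definition max_cone_lattice ::
  "'a::euclidean_space set \<Rightarrow> 'a set set \<Rightarrow> ('a set \<Rightarrow> nat) \<Rightarrow> 'a set \<Rightarrow> 'a set" where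
  "max_cone_lattice N \<Sigma> w \<sigma> =
     group_closure {real (w \<rho>) *\<^sub>R ray_gen N \<rho> |\<rho>. \<rho> \<in> rays \<Sigma> \<and> \<rho> \<subseteq> \<sigma>}"

definition cone_lattice ::
  "'a::euclidean_space set \<Rightarrow> 'a set set \<Rightarrow> ('a set \<Rightarrow> nat) \<Rightarrow> 'a set \<Rightarrow> 'a set" where
  "cone_lattice N \<Sigma> w \<tau> = (\<Inter>\<sigma>\<in>{\<sigma>\<in>max_cones \<Sigma>. \<tau> \<subseteq> \<sigma>}. max_cone_lattice N \<Sigma> w \<sigma>)"


section \<open>Affine toric varieties\<close>

text \<open>
  The affine toric variety of a cone \<open>\<tau>\<close> with respect to a lattice \<open>\<Lambda>\<close> is given by its complex
  points: the homomorphisms from the semigroup of characters of \<open>\<Lambda>\<close> that are nonnegative on \<open>\<tau>\<close> to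
  the multiplicative monoid of complex numbers.  They are extended by 0 outside that semigroup, so
  that a point is determined by its values.  The monomial of \<open>m\<close> is the function \<open>\<lambda>x. x m\<close>.
\<close>

type_synonym 'a point = "('a \<Rightarrow> real) \<Rightarrow> complex"

definition cone_chars :: "'a::euclidean_space set \<Rightarrow> 'a set \<Rightarrow> ('a \<Rightarrow> real) set" where
  "cone_chars \<tau> \<Lambda> = {m \<in> dual_lattice \<Lambda>. \<forall>v\<in>\<tau>. m v \<ge> 0}"

definition affine_toric :: "'a::euclidean_space set \<Rightarrow> 'a set \<Rightarrow> 'a point set" where
  "affine_toric \<tau> \<Lambda> =
     {x. x (\<lambda>_. 0) = 1 \<and>
         (\<forall>m\<in>cone_chars \<tau> \<Lambda>. \<forall>m'\<in>cone_chars \<tau> \<Lambda>. x (\<lambda>v. m v + m' v) = x m * x m') \<and>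
         (\<forall>m. m \<notin> cone_chars \<tau> \<Lambda> \<longrightarrow> x m = 0)}"

definition coord_ring :: "'a::euclidean_space set \<Rightarrow> 'a set \<Rightarrow> ('a point \<Rightarrow> complex) set" where
  "coord_ring \<tau> \<Lambda> = {\<lambda>x. \<Sum>m\<in>A. c m * x m |A c. finite A \<and> A \<subseteq> cone_chars \<tau> \<Lambda>}"

definition zariski_open :: "'a::euclidean_space set \<Rightarrow> 'a set \<Rightarrow> 'a point set \<Rightarrow> bool" where
  "zariski_open \<tau> \<Lambda> V \<longleftrightarrow>
     V \<subseteq> affine_toric \<tau> \<Lambda> \<and>
     (\<forall>x\<in>V. \<exists>q\<in>coord_ring \<tau> \<Lambda>. q x \<noteq> 0 \<and> {y\<in>affine_toric \<tau> \<Lambda>. q y \<noteq> 0} \<subseteq> V)"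

definition regular_on ::
  "'a::euclidean_space set \<Rightarrow> 'a set \<Rightarrow> 'a point set \<Rightarrow> ('a point \<Rightarrow> complex) \<Rightarrow> bool" where
  "regular_on \<tau> \<Lambda> V f \<longleftrightarrow>
     (\<forall>x\<in>V. \<exists>p\<in>coord_ring \<tau> \<Lambda>. \<exists>q\<in>coord_ring \<tau> \<Lambda>.
        q x \<noteq> 0 \<and> (\<forall>y\<in>V. q y \<noteq> 0 \<longrightarrow> f y = p y / q y))"

text \<open>
  An element of a torus \<open>'a / \<Lambda>\<close> is represented by any \<open>v\<close> in \<open>'a\<close>.  The following is the value at
  \<open>v\<close> of the character given by \<open>m\<close>.
\<close>

definition character :: "('a::euclidean_space \<Rightarrow> real) \<Rightarrow> 'a \<Rightarrow> complex" where
  "character m v = cis (2 * pi * m v)"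

text \<open>
  The sign in the action on points is the one for which the monomial of \<open>m\<close> has weight \<open>m\<close> under
  the induced action \<open>(t f)(x) = f (t\<^sup>-\<^sup>1 x)\<close> on functions.
\<close>

definition torus_act :: "'a::euclidean_space \<Rightarrow> 'a point \<Rightarrow> 'a point" where
  "torus_act v x = (\<lambda>m. character m (- v) * x m)"

text \<open>
  The natural map from the affine toric variety of a cone and lattice contained in \<open>\<tau>\<close> and \<open>\<Lambda>\<close>
  respectively to that of \<open>\<tau>\<close> and \<open>\<Lambda>\<close>: restriction of semigroup homomorphisms.
\<close>

definition toric_map :: "'a::euclidean_space set \<Rightarrow> 'a set \<Rightarrow> 'a point \<Rightarrow> 'a point" where
  "toric_map \<tau> \<Lambda> x = (\<lambda>m. if m \<in> cone_chars \<tau> \<Lambda> then x m else 0)"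


section \<open>Equivariant line bundles\<close>

text \<open>
  Choosing a nonzero vector in every fibre (without any regularity), the underlying family of
  one-dimensional vector spaces of a line bundle over \<open>D\<close> becomes \<open>D \<times> complex\<close>.  The structure of an
  algebraic line bundle on this family is then an atlas of local frames: pairs \<open>(V, s)\<close> of an open
  set \<open>V\<close> and a nowhere vanishing section \<open>s\<close> over \<open>V\<close>, with regular transition functions.  Fibrewise
  linear maps between such families are given by complex-valued functions.

  An action of a torus \<open>'a / \<Lambda>\<close> on a line bundle is a function \<open>a\<close>, where multiplication by \<open>a v x\<close> is
  the map from the fibre at \<open>x\<close> to the fibre at \<open>v x\<close>.  An equivariant bundle is a pair of an atlas
  and an action.
\<close>

type_synonym 'p frames = "('p set \<times> ('p \<Rightarrow> complex)) set"

type_synonym ('a, 'p) eq_bundle = "'p frames \<times> ('a \<Rightarrow> 'p \<Rightarrow> complex)"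

definition pull_frames :: "'p set \<Rightarrow> ('p \<Rightarrow> 'q) \<Rightarrow> 'q frames \<Rightarrow> 'p frames" where
  "pull_frames D g F = (\<lambda>(V, s). ({x\<in>D. g x \<in> V}, \<lambda>x. s (g x))) ` F"

definition pull_eq :: "'p set \<Rightarrow> ('p \<Rightarrow> 'q) \<Rightarrow> ('a, 'q) eq_bundle \<Rightarrow> ('a, 'p) eq_bundle" where
  "pull_eq D g L = (pull_frames D g (fst L), \<lambda>v x. snd L v (g x))"

definition tensor_eq :: "('a, 'p) eq_bundle \<Rightarrow> ('a, 'p) eq_bundle \<Rightarrow> ('a, 'p) eq_bundle" where
  "tensor_eq L L' =
     ({(V \<inter> V', \<lambda>x. s x * s' x) |V s V' s'. (V, s) \<in> fst L \<and> (V', s') \<in> fst L'},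
      \<lambda>v x. snd L v x * snd L' v x)"

definition trivial_eq :: "'p set \<Rightarrow> ('a \<Rightarrow> complex) \<Rightarrow> ('a, 'p) eq_bundle" where
  "trivial_eq D c = ({(D, \<lambda>_. 1)}, \<lambda>v _. c v)"

definition line_bundle :: "'a::euclidean_space set \<Rightarrow> 'a set \<Rightarrow> 'a point frames \<Rightarrow> bool" where
  "line_bundle \<tau> \<Lambda> F \<longleftrightarrow>
     (\<forall>(V, s)\<in>F. zariski_open \<tau> \<Lambda> V \<and> (\<forall>x\<in>V. s x \<noteq> 0)) \<and>
     (\<forall>x\<in>affine_toric \<tau> \<Lambda>. \<exists>(V, s)\<in>F. x \<in> V) \<and>
     (\<forall>(V, s)\<in>F. \<forall>(V', s')\<in>F. regular_on \<tau> \<Lambda> (V \<inter> V') (\<lambda>x. s x / s' x))"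

text \<open>Isomorphisms covering the identity; their inverses are automatically regular.\<close>

definition bundle_iso ::
  "'a::euclidean_space set \<Rightarrow> 'a set \<Rightarrow> 'a point frames \<Rightarrow> 'a point frames \<Rightarrow>
   ('a point \<Rightarrow> complex) \<Rightarrow> bool" where
  "bundle_iso \<tau> \<Lambda> F F' f \<longleftrightarrow>
     (\<forall>x\<in>affine_toric \<tau> \<Lambda>. f x \<noteq> 0) \<and>
     (\<forall>(V, s)\<in>F. \<forall>(V', s')\<in>F'. regular_on \<tau> \<Lambda> (V \<inter> V') (\<lambda>x. f x * s x / s' x))"

text \<open>
  A line bundle with a continuous action of the compact torus \<open>'a / \<Lambda>\<close>, by isomorphisms of algebraic
  line bundles over the action on the base.  Continuity is joint in the torus element and the point,
  for the classical topology, which is the topology of pointwise convergence on semigroup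
  homomorphisms.
\<close>

definition equivariant_line_bundle ::
  "'a::euclidean_space set \<Rightarrow> 'a set \<Rightarrow> ('a, 'a point) eq_bundle \<Rightarrow> bool" where
  "equivariant_line_bundle \<tau> \<Lambda> L \<longleftrightarrow>
     (let U = affine_toric \<tau> \<Lambda>; F = fst L; a = snd L in
       line_bundle \<tau> \<Lambda> F \<and>
       (\<forall>v. bundle_iso \<tau> \<Lambda> F (pull_frames U (torus_act v) F) (a v)) \<and>
       (\<forall>v u. \<forall>x\<in>U. a (v + u) x = a v (torus_act u x) * a u x) \<and>
       (\<forall>v\<in>\<Lambda>. \<forall>x\<in>U. a v x = 1) \<and>
       (\<forall>(V, s)\<in>F. \<forall>(V', s')\<in>F.
          continuous_on {(v, x). x \<in> V \<and> torus_act v x \<in> V'}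
            (\<lambda>(v, x). a v x * s x / s' (torus_act v x))))"

definition equivariant_iso ::
  "'a::euclidean_space set \<Rightarrow> 'a set \<Rightarrow> ('a, 'a point) eq_bundle \<Rightarrow> ('a, 'a point) eq_bundle \<Rightarrow>
   ('a point \<Rightarrow> complex) \<Rightarrow> bool" where
  "equivariant_iso \<tau> \<Lambda> L L' f \<longleftrightarrow>
     bundle_iso \<tau> \<Lambda> (fst L) (fst L') f \<and>
     (\<forall>v. \<forall>x\<in>affine_toric \<tau> \<Lambda>. snd L' v x * f x = f (torus_act v x) * snd L v x)"


section \<open>Linearized orbi-line bundles on the toric orbifold\<close>

text \<open>
  The uniformizing chart of \<open>\<tau>\<close> is the affine toric variety of \<open>\<tau>\<close> with respect to
  \<open>cone_lattice N \<Sigma> w \<tau>\<close>.  Its local group is \<open>N / cone_lattice N \<Sigma> w \<tau>\<close>, a subgroup of the covering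
  torus \<open>'a / cone_lattice N \<Sigma> w \<tau>\<close>, so that equivariance for the local group is part of equivariance
  for the covering torus.  The function \<open>gluing L \<tau>' \<tau>\<close> is the isomorphism from the pull-back of the
  bundle on the chart of \<open>\<tau>\<close> to the bundle on the chart of its face \<open>\<tau>'\<close>.
\<close>

record 'a orbi_bundle =
  chart :: "'a set \<Rightarrow> ('a, 'a point) eq_bundle"
  gluing :: "'a set \<Rightarrow> 'a set \<Rightarrow> 'a point \<Rightarrow> complex"

definition orbi_chart ::
  "'a::euclidean_space set \<Rightarrow> 'a set set \<Rightarrow> ('a set \<Rightarrow> nat) \<Rightarrow> 'a set \<Rightarrow> 'a point set" where
  "orbi_chart N \<Sigma> w \<tau> = affine_toric \<tau> (cone_lattice N \<Sigma> w \<tau>)"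

definition linearized_orbi_bundles ::
  "'a::euclidean_space set \<Rightarrow> 'a set set \<Rightarrow> ('a set \<Rightarrow> nat) \<Rightarrow> 'a orbi_bundle set" where
  "linearized_orbi_bundles N \<Sigma> w =
     {L. (\<forall>\<tau>\<in>\<Sigma>. equivariant_line_bundle \<tau> (cone_lattice N \<Sigma> w \<tau>) (chart L \<tau>)) \<and>
         (\<forall>\<tau>\<in>\<Sigma>. \<forall>\<tau>'\<in>\<Sigma>. \<tau>' \<subseteq> \<tau> \<longrightarrow>
            equivariant_iso \<tau>' (cone_lattice N \<Sigma> w \<tau>')
              (pull_eq (orbi_chart N \<Sigma> w \<tau>') (toric_map \<tau> (cone_lattice N \<Sigma> w \<tau>)) (chart L \<tau>))
              (chart L \<tau>') (gluing L \<tau>' \<tau>)) \<and>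
         (\<forall>\<tau>\<in>\<Sigma>. \<forall>\<tau>'\<in>\<Sigma>. \<forall>\<tau>''\<in>\<Sigma>. \<tau>'' \<subseteq> \<tau>' \<and> \<tau>' \<subseteq> \<tau> \<longrightarrow>
            (\<forall>x\<in>orbi_chart N \<Sigma> w \<tau>''.
               gluing L \<tau>'' \<tau> x =
               gluing L \<tau>'' \<tau>' x * gluing L \<tau>' \<tau> (toric_map \<tau>' (cone_lattice N \<Sigma> w \<tau>') x)))}"

definition orbi_equiv ::
  "'a::euclidean_space set \<Rightarrow> 'a set set \<Rightarrow> ('a set \<Rightarrow> nat) \<Rightarrow>
   ('a orbi_bundle \<times> 'a orbi_bundle) set" where
  "orbi_equiv N \<Sigma> w =
     {(L, L'). L \<in> linearized_orbi_bundles N \<Sigma> w \<and> L' \<in> linearized_orbi_bundles N \<Sigma> w \<and>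
       (\<exists>f. (\<forall>\<tau>\<in>\<Sigma>. equivariant_iso \<tau> (cone_lattice N \<Sigma> w \<tau>) (chart L \<tau>) (chart L' \<tau>) (f \<tau>)) \<and>
            (\<forall>\<tau>\<in>\<Sigma>. \<forall>\<tau>'\<in>\<Sigma>. \<tau>' \<subseteq> \<tau> \<longrightarrow>
               (\<forall>x\<in>orbi_chart N \<Sigma> w \<tau>'.
                  gluing L' \<tau>' \<tau> x * f \<tau> (toric_map \<tau> (cone_lattice N \<Sigma> w \<tau>) x) =
                  f \<tau>' x * gluing L \<tau>' \<tau> x)))}"

definition orbi_class ::
  "'a::euclidean_space set \<Rightarrow> 'a set set \<Rightarrow> ('a set \<Rightarrow> nat) \<Rightarrow> 'a orbi_bundle \<Rightarrow>
   'a orbi_bundle set" where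
  "orbi_class N \<Sigma> w L = orbi_equiv N \<Sigma> w `` {L}"

definition orbi_tensor :: "'a orbi_bundle \<Rightarrow> 'a orbi_bundle \<Rightarrow> 'a orbi_bundle" where
  "orbi_tensor L L' =
     \<lparr>chart = (\<lambda>\<tau>. tensor_eq (chart L \<tau>) (chart L' \<tau>)),
      gluing = (\<lambda>\<tau>' \<tau> x. gluing L \<tau>' \<tau> x * gluing L' \<tau>' \<tau> x)\<rparr>"

definition orbi_unit ::
  "'a::euclidean_space set \<Rightarrow> 'a set set \<Rightarrow> ('a set \<Rightarrow> nat) \<Rightarrow> 'a orbi_bundle" where
  "orbi_unit N \<Sigma> w =
     \<lparr>chart = (\<lambda>\<tau>. trivial_eq (orbi_chart N \<Sigma> w \<tau>) (\<lambda>_. 1)), gluing = (\<lambda>_ _ _. 1)\<rparr>"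

definition orbi_Pic ::
  "'a::euclidean_space set \<Rightarrow> 'a set set \<Rightarrow> ('a set \<Rightarrow> nat) \<Rightarrow> 'a orbi_bundle set monoid" where
  "orbi_Pic N \<Sigma> w =
     \<lparr>carrier = linearized_orbi_bundles N \<Sigma> w // orbi_equiv N \<Sigma> w,
      mult = (\<lambda>C C'. \<Union>L\<in>C. \<Union>L'\<in>C'. orbi_class N \<Sigma> w (orbi_tensor L L')),
      one = orbi_class N \<Sigma> w (orbi_unit N \<Sigma> w)\<rparr>"


section \<open>Linearized line bundles on the toric variety\<close>

text \<open>
  The toric variety is the disjoint union of the affine toric varieties of all cones \<open>\<tau>\<close> with respect
  to \<open>N\<close>, where those of \<open>\<tau>\<close> and \<open>\<tau>'\<close> are glued along that of \<open>\<tau> \<inter> \<tau>'\<close>.  Its points are equivalence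
  classes of pairs of a cone and a point.
\<close>

type_synonym 'a glued_point = "('a set \<times> 'a point) set"

definition chart_incl ::
  "'a::euclidean_space set \<Rightarrow> 'a set set \<Rightarrow> 'a set \<Rightarrow> 'a point \<Rightarrow> 'a glued_point" where
  "chart_incl N \<Sigma> \<tau> x =
     {(\<tau>', x'). \<tau>' \<in> \<Sigma> \<and>
        (\<exists>y\<in>affine_toric (\<tau> \<inter> \<tau>') N. toric_map \<tau> N y = x \<and> toric_map \<tau>' N y = x')}"

definition toric_variety :: "'a::euclidean_space set \<Rightarrow> 'a set set \<Rightarrow> 'a glued_point set" where
  "toric_variety N \<Sigma> = (\<Union>\<tau>\<in>\<Sigma>. chart_incl N \<Sigma> \<tau> ` affine_toric \<tau> N)"

definition restrict_chart ::
  "'a::euclidean_space set \<Rightarrow> 'a set set \<Rightarrow> 'a set \<Rightarrow> ('a, 'a glued_point) eq_bundle \<Rightarrow>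
   ('a, 'a point) eq_bundle" where
  "restrict_chart N \<Sigma> \<tau> L = pull_eq (affine_toric \<tau> N) (chart_incl N \<Sigma> \<tau>) L"

text \<open>
  The affine charts form an open cover, invariant under the torus.  Open sets, regular functions and
  continuous functions on the toric variety are those that are so in every chart; hence frames and an
  action define a linearized line bundle if and only if their restrictions to all charts do.
\<close>

definition linearized_bundles ::
  "'a::euclidean_space set \<Rightarrow> 'a set set \<Rightarrow> ('a, 'a glued_point) eq_bundle set" where
  "linearized_bundles N \<Sigma> =
     {L. (\<forall>(V, s)\<in>fst L. V \<subseteq> toric_variety N \<Sigma>) \<and>
         (\<forall>\<tau>\<in>\<Sigma>. equivariant_line_bundle \<tau> N (restrict_chart N \<Sigma> \<tau> L))}"

definition bundle_equiv ::
  "'a::euclidean_space set \<Rightarrow> 'a set set \<Rightarrow>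
   (('a, 'a glued_point) eq_bundle \<times> ('a, 'a glued_point) eq_bundle) set" where
  "bundle_equiv N \<Sigma> =
     {(L, L'). L \<in> linearized_bundles N \<Sigma> \<and> L' \<in> linearized_bundles N \<Sigma> \<and>
       (\<exists>f. \<forall>\<tau>\<in>\<Sigma>. equivariant_iso \<tau> N (restrict_chart N \<Sigma> \<tau> L) (restrict_chart N \<Sigma> \<tau> L')
                      (\<lambda>x. f (chart_incl N \<Sigma> \<tau> x)))}"

definition bundle_class ::
  "'a::euclidean_space set \<Rightarrow> 'a set set \<Rightarrow> ('a, 'a glued_point) eq_bundle \<Rightarrow>
   ('a, 'a glued_point) eq_bundle set" where
  "bundle_class N \<Sigma> L = bundle_equiv N \<Sigma> `` {L}"

definition variety_Pic ::
  "'a::euclidean_space set \<Rightarrow> 'a set set \<Rightarrow> ('a, 'a glued_point) eq_bundle set monoid" where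
  "variety_Pic N \<Sigma> =
     \<lparr>carrier = linearized_bundles N \<Sigma> // bundle_equiv N \<Sigma>,
      mult = (\<lambda>C C'. \<Union>L\<in>C. \<Union>L'\<in>C'. bundle_class N \<Sigma> (tensor_eq L L')),
      one = bundle_class N \<Sigma> (trivial_eq (toric_variety N \<Sigma>) (\<lambda>_. 1))\<rparr>"

text \<open>
  Pull-back along the map from the orbifold to the toric variety, which on the chart of \<open>\<tau>\<close> is the
  quotient map from the uniformizing chart to the affine toric variety of \<open>\<tau>\<close> with respect to \<open>N\<close>.
\<close>

definition orbi_pullback ::
  "'a::euclidean_space set \<Rightarrow> 'a set set \<Rightarrow> ('a set \<Rightarrow> nat) \<Rightarrow> ('a, 'a glued_point) eq_bundle \<Rightarrow>
   'a orbi_bundle" where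
  "orbi_pullback N \<Sigma> w L =
     \<lparr>chart = (\<lambda>\<tau>. pull_eq (orbi_chart N \<Sigma> w \<tau>) (\<lambda>x. chart_incl N \<Sigma> \<tau> (toric_map \<tau> N x)) L),
      gluing = (\<lambda>_ _ _. 1)\<rparr>"

definition Pic_pullback ::
  "'a::euclidean_space set \<Rightarrow> 'a set set \<Rightarrow> ('a set \<Rightarrow> nat) \<Rightarrow> ('a, 'a glued_point) eq_bundle set \<Rightarrow>
   'a orbi_bundle set" where
  "Pic_pullback N \<Sigma> w C = (\<Union>L\<in>C. orbi_class N \<Sigma> w (orbi_pullback N \<Sigma> w L))"


section \<open>Combinatorial data\<close>

text \<open>
  \<open>m\<close> is the character by which the covering torus acts on the fibre of an equivariant trivialization
  of \<open>L\<close> on the chart of the maximal cone \<open>\<sigma>\<close>.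
\<close>

definition fibre_character ::
  "'a::euclidean_space set \<Rightarrow> 'a set set \<Rightarrow> ('a set \<Rightarrow> nat) \<Rightarrow> 'a orbi_bundle \<Rightarrow> 'a set \<Rightarrow>
   ('a \<Rightarrow> real) \<Rightarrow> bool" where
  "fibre_character N \<Sigma> w L \<sigma> m \<longleftrightarrow>
     m \<in> dual_lattice (cone_lattice N \<Sigma> w \<sigma>) \<and>
     (\<exists>f. equivariant_iso \<sigma> (cone_lattice N \<Sigma> w \<sigma>)
            (trivial_eq (orbi_chart N \<Sigma> w \<sigma>) (character m)) (chart L \<sigma>) f)"

definition compatible_characters ::
  "'a::euclidean_space set \<Rightarrow> 'a set set \<Rightarrow> ('a set \<Rightarrow> nat) \<Rightarrow> ('a set \<Rightarrow> 'a \<Rightarrow> real) set" where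
  "compatible_characters N \<Sigma> w =
     {m \<in> \<Pi>\<^sub>E \<sigma>\<in>max_cones \<Sigma>. dual_lattice (cone_lattice N \<Sigma> w \<sigma>).
        \<forall>\<sigma>\<^sub>1\<in>max_cones \<Sigma>. \<forall>\<sigma>\<^sub>2\<in>max_cones \<Sigma>. (\<lambda>v. m \<sigma>\<^sub>1 v - m \<sigma>\<^sub>2 v) \<in> annihilator (\<sigma>\<^sub>1 \<inter> \<sigma>\<^sub>2)}"

definition ray_line :: "'a::euclidean_space set \<Rightarrow> 'a set \<Rightarrow> 'a set" where
  "ray_line N \<rho> = span {ray_gen N \<rho>}"

text \<open>
  The linear forms on \<open>ray_line N \<rho>\<close> that are integral on \<open>k\<close> times the generator of \<open>\<rho>\<close>, as functions
  undefined outside \<open>ray_line N \<rho>\<close>.  For \<open>k = 1\<close> this is the dual of the lattice spanned by the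
  generator.
\<close>

definition ray_forms :: "'a::euclidean_space set \<Rightarrow> 'a set \<Rightarrow> nat \<Rightarrow> ('a \<Rightarrow> real) set" where
  "ray_forms N \<rho> k =
     {h \<in> extensional (ray_line N \<rho>).
        (\<forall>x\<in>ray_line N \<rho>. \<forall>y\<in>ray_line N \<rho>. h (x + y) = h x + h y) \<and>
        (\<forall>c. \<forall>x\<in>ray_line N \<rho>. h (c *\<^sub>R x) = c * h x) \<and>
        h (real k *\<^sub>R ray_gen N \<rho>) \<in> \<int>}"

definition ray_forms_group :: "'a::euclidean_space set \<Rightarrow> 'a set \<Rightarrow> nat \<Rightarrow> ('a \<Rightarrow> real) monoid" where
  "ray_forms_group N \<rho> k =
     \<lparr>carrier = ray_forms N \<rho> k,
      mult = (\<lambda>h h'. restrict (\<lambda>v. h v + h' v) (ray_line N \<rho>)),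
      one = restrict (\<lambda>_. 0) (ray_line N \<rho>)\<rparr>"

end

theory Submission
  imports Defs "HOL-Complex_Analysis.Complex_Analysis"
begin

text \<open>
  The heart of the proof is that an equivariant line bundle on the affine toric variety \<open>U\<close> of a
  maximal cone is equivariantly trivial, although the action is only assumed continuous.  In a
  frame \<open>s\<close> around the fixed point, the action is given by a cocycle \<open>g\<close>, normalized to be 1 at the
  fixed point.  Averaging \<open>g\<close> over a circle that contracts \<open>U\<close> to the fixed point gives a function
  \<open>h\<close> such that \<open>s / h\<close> is a section of weight \<open>m\<^sub>\<sigma>\<close>.  To see that \<open>h\<close> is regular, note that there are
  only countably many sets of monomials, so that infinitely many elements of the circle act by
  quotients of polynomials with the same monomials; a linear dependence between these and the
  multiples by \<open>h\<close>, which depends holomorphically on the parameter of the flow, persists in the limit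
  at the fixed point and exhibits \<open>h\<close> as a quotient of polynomials.  It has neither zeros nor
  poles near the fixed point, and \<open>s / h\<close> extends to \<open>U\<close> by equivariance.

  Over the chart of a face, trivializations coming from two maximal cones are weight sections of one
  bundle, so that they differ by a constant times the monomial of \<open>m\<^sub>\<sigma> - m\<^sub>\<sigma>'\<close>; this monomial is
  invertible, whence the compatibility of the characters.  Normalizing the trivializations on the
  chart of the zero cone removes the constants and shows that the characters determine the bundle,
  and conversely these monomials glue trivial bundles.  The group structure, and the case of the toric
  variety, follow since equivalence is equality of the families of characters.  Finally, a
  maximal cone is spanned by its weighted ray generators, which form a basis of its lattice; hence
  compatible characters are given by arbitrary integers on the rays.
\<close>

section \<open>Regular functions on affine toric varieties\<close>

text \<open>The obstacle is uniformity. Each single torus element acts by regular functions, but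
  nothing bounds their degrees or denominators as the element varies, and the compact torus gives no
  complex parameter to differentiate in. The average \<open>h\<close> is therefore at first only a
  function on a classical neighbourhood \<open>B\<close> of the fixed point, known to be holomorphic
  along the flow lines of \<open>\<kappa>\<close>; all analysis takes place in one variable along
  such lines. The set \<open>B'\<close> collects the points at parameter 1/2 of flow lines whose
  unit disc stays in \<open>B\<close>, so that the identity theorem carries statements from near the
  fixed point to all of \<open>B'\<close>, which is Zariski dense. The argument uses only lattice
  vectors that generate the cone and span the space. Hence it applies to the orbifold charts and to
  the possibly singular charts with respect to \<open>N\<close> alike, and the toric variety
  requires no second analysis.\<close>

lemma dual_latticeD: "m \<in> dual_lattice \<Lambda> \<Longrightarrow> linear m"
  by (simp add: dual_lattice_def)

lemma cone_chars_linear: "m \<in> cone_chars \<tau> \<Lambda> \<Longrightarrow> linear m"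
  by (simp add: cone_chars_def dual_lattice_def)

lemma dual_lattice_zero [simp]: "(\<lambda>_. 0) \<in> dual_lattice \<Lambda>"
  by (simp add: dual_lattice_def linear_zero)

lemma dual_lattice_add:
  "m \<in> dual_lattice \<Lambda> \<Longrightarrow> m' \<in> dual_lattice \<Lambda> \<Longrightarrow> (\<lambda>v. m v + m' v) \<in> dual_lattice \<Lambda>"
  by (auto simp: dual_lattice_def intro: linear_compose_add)

lemma dual_lattice_diff:
  "m \<in> dual_lattice \<Lambda> \<Longrightarrow> m' \<in> dual_lattice \<Lambda> \<Longrightarrow> (\<lambda>v. m v - m' v) \<in> dual_lattice \<Lambda>"
  by (auto simp: dual_lattice_def intro: linear_compose_sub)

lemma dual_lattice_minus: "m \<in> dual_lattice \<Lambda> \<Longrightarrow> (\<lambda>v. - m v) \<in> dual_lattice \<Lambda>"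
  using dual_lattice_diff[of "\<lambda>_. 0"] by fastforce

lemma dual_lattice_antimono: "\<Lambda>' \<subseteq> \<Lambda> \<Longrightarrow> dual_lattice \<Lambda> \<subseteq> dual_lattice \<Lambda>'"
  by (auto simp: dual_lattice_def)

lemma cone_chars_zero [simp]: "(\<lambda>_. 0) \<in> cone_chars \<tau> \<Lambda>"
  by (simp add: cone_chars_def)

lemma cone_chars_add:
  "m \<in> cone_chars \<tau> \<Lambda> \<Longrightarrow> m' \<in> cone_chars \<tau> \<Lambda> \<Longrightarrow> (\<lambda>v. m v + m' v) \<in> cone_chars \<tau> \<Lambda>"
  by (auto simp: cone_chars_def intro: dual_lattice_add)

lemma cone_chars_antimono:
  "\<tau>' \<subseteq> \<tau> \<Longrightarrow> \<Lambda>' \<subseteq> \<Lambda> \<Longrightarrow> cone_chars \<tau> \<Lambda> \<subseteq> cone_chars \<tau>' \<Lambda>'"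
  by (auto simp: cone_chars_def dual_lattice_def)

lemma affine_toric_zero: "x \<in> affine_toric \<tau> \<Lambda> \<Longrightarrow> x (\<lambda>_. 0) = 1"
  by (simp add: affine_toric_def)

lemma affine_toric_add:
  "x \<in> affine_toric \<tau> \<Lambda> \<Longrightarrow> m \<in> cone_chars \<tau> \<Lambda> \<Longrightarrow> m' \<in> cone_chars \<tau> \<Lambda> \<Longrightarrow>
   x (\<lambda>v. m v + m' v) = x m * x m'"
  by (simp add: affine_toric_def)

lemma affine_toric_outside: "x \<in> affine_toric \<tau> \<Lambda> \<Longrightarrow> m \<notin> cone_chars \<tau> \<Lambda> \<Longrightarrow> x m = 0"
  by (simp add: affine_toric_def)

lemma character_zero [simp]: "character (\<lambda>_. 0) v = 1"
  by (simp add: character_def)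

lemma character_nonzero [simp]: "character m v \<noteq> 0"
  by (simp add: character_def)

lemma character_add_left: "character (\<lambda>v. m v + m' v) v = character m v * character m' v"
  by (simp add: character_def cis_mult distrib_left)

lemma character_diff_left: "character (\<lambda>v. m v - m' v) v = character m v / character m' v"
  by (simp add: character_def cis_divide right_diff_distrib)

lemma character_add_right:
  "linear m \<Longrightarrow> character m (v + u) = character m v * character m u"
  by (simp add: character_def cis_mult distrib_left linear_add)

lemma character_zero_right: "linear m \<Longrightarrow> character m 0 = 1"
  by (simp add: character_def linear_0)

lemma character_minus_right: "linear m \<Longrightarrow> character m (- v) = inverse (character m v)"
  by (simp add: character_def linear_neg cis_inverse)

lemma character_eq_1_iff: "character m v = 1 \<longleftrightarrow> m v \<in> \<int>"
  unfolding character_def cis_conv_exp exp_eq_1 by (auto simp: Ints_def)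

lemma torus_act_in:
  assumes "x \<in> affine_toric \<tau> \<Lambda>" shows "torus_act v x \<in> affine_toric \<tau> \<Lambda>"
  using assms by (auto simp: affine_toric_def torus_act_def character_add_left)

lemma torus_act_zero: "x \<in> affine_toric \<tau> \<Lambda> \<Longrightarrow> torus_act 0 x = x"
  by (rule ext) (metis affine_toric_outside character_zero_right cone_chars_linear minus_zero
    mult_1 mult_zero_right torus_act_def)

lemma torus_act_add:
  "x \<in> affine_toric \<tau> \<Lambda> \<Longrightarrow> torus_act (v + u) x = torus_act v (torus_act u x)"
proof
  fix m assume x: "x \<in> affine_toric \<tau> \<Lambda>"
  show "torus_act (v + u) x m = torus_act v (torus_act u x) m"
  proof (cases "m \<in> cone_chars \<tau> \<Lambda>")
    case True
    then have "character m (- v + - u) = character m (- v) * character m (- u)"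
      by (intro character_add_right cone_chars_linear)
    then show ?thesis by (simp add: torus_act_def)
  qed (use x in \<open>simp add: torus_act_def affine_toric_outside\<close>)
qed

lemma torus_act_minus:
  "x \<in> affine_toric \<tau> \<Lambda> \<Longrightarrow> torus_act (- v) (torus_act v x) = x"
  "x \<in> affine_toric \<tau> \<Lambda> \<Longrightarrow> torus_act v (torus_act (- v) x) = x"
  using torus_act_add[of x \<tau> \<Lambda> "-v" v] torus_act_add[of x \<tau> \<Lambda> v "-v"] torus_act_zero by fastforce+

lemma toric_map_in:
  assumes "\<tau>' \<subseteq> \<tau>" "\<Lambda>' \<subseteq> \<Lambda>" "x \<in> affine_toric \<tau>' \<Lambda>'"
  shows "toric_map \<tau> \<Lambda> x \<in> affine_toric \<tau> \<Lambda>"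
  using assms cone_chars_antimono[OF assms(1,2)]
  by (auto simp: affine_toric_def toric_map_def cone_chars_add subset_iff)

lemma toric_map_id: "x \<in> affine_toric \<tau> \<Lambda> \<Longrightarrow> toric_map \<tau> \<Lambda> x = x"
  by (auto simp: toric_map_def affine_toric_outside)

lemma toric_map_toric_map:
  "\<tau>' \<subseteq> \<tau> \<Longrightarrow> \<Lambda>' \<subseteq> \<Lambda> \<Longrightarrow> toric_map \<tau> \<Lambda> (toric_map \<tau>' \<Lambda>' x) = toric_map \<tau> \<Lambda> x"
  using cone_chars_antimono[of \<tau>' \<tau> \<Lambda>' \<Lambda>] by (auto simp: toric_map_def fun_eq_iff)

lemma toric_map_torus_act: "toric_map \<tau> \<Lambda> (torus_act v x) = torus_act v (toric_map \<tau> \<Lambda> x)"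
  by (auto simp: toric_map_def torus_act_def)

section \<open>The algebra of polynomial functions and their local fractions\<close>

text \<open>As a set of functions on the whole type, \<open>coord_ring\<close> is not closed under
  products, because multiplicativity holds only at points of the chart. Working up to equality on
  the chart gives an algebra.\<close>

definition poly_fun :: "'a::euclidean_space set \<Rightarrow> 'a set \<Rightarrow> ('a point \<Rightarrow> complex) \<Rightarrow> bool" where
  "poly_fun \<tau> \<Lambda> f \<longleftrightarrow> (\<exists>p\<in>coord_ring \<tau> \<Lambda>. \<forall>x\<in>affine_toric \<tau> \<Lambda>. f x = p x)"

lemma poly_fun_iff:
  "poly_fun \<tau> \<Lambda> f \<longleftrightarrow>
   (\<exists>A c. finite A \<and> A \<subseteq> cone_chars \<tau> \<Lambda> \<and> (\<forall>x\<in>affine_toric \<tau> \<Lambda>. f x = (\<Sum>m\<in>A. c m * x m)))"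
  unfolding poly_fun_def coord_ring_def by fast

lemma poly_fun_sum_monomials:
  "finite A \<Longrightarrow> A \<subseteq> cone_chars \<tau> \<Lambda> \<Longrightarrow> poly_fun \<tau> \<Lambda> (\<lambda>x. \<Sum>m\<in>A. c m * x m)"
  unfolding poly_fun_iff by blast

lemma poly_fun_cong:
  "poly_fun \<tau> \<Lambda> f \<Longrightarrow> (\<And>x. x \<in> affine_toric \<tau> \<Lambda> \<Longrightarrow> f x = g x) \<Longrightarrow> poly_fun \<tau> \<Lambda> g"
  unfolding poly_fun_def by fastforce

lemma poly_fun_monomial: "m \<in> cone_chars \<tau> \<Lambda> \<Longrightarrow> poly_fun \<tau> \<Lambda> (\<lambda>x. c * x m)"
  using poly_fun_sum_monomials[of "{m}" \<tau> \<Lambda> "\<lambda>_. c"] by simp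

lemma poly_fun_const: "poly_fun \<tau> \<Lambda> (\<lambda>_. c)"
  by (rule poly_fun_cong[OF poly_fun_monomial[OF cone_chars_zero, of _ _ c]])
    (simp add: affine_toric_zero)

lemma poly_fun_add:
  assumes "poly_fun \<tau> \<Lambda> f" "poly_fun \<tau> \<Lambda> g" shows "poly_fun \<tau> \<Lambda> (\<lambda>x. f x + g x)"
proof -
  obtain A c where A: "finite A" "A \<subseteq> cone_chars \<tau> \<Lambda>"
    and f: "\<And>x. x \<in> affine_toric \<tau> \<Lambda> \<Longrightarrow> f x = (\<Sum>m\<in>A. c m * x m)"
    using assms(1) unfolding poly_fun_iff by blast
  obtain A' c' where A': "finite A'" "A' \<subseteq> cone_chars \<tau> \<Lambda>"
    and g: "\<And>x. x \<in> affine_toric \<tau> \<Lambda> \<Longrightarrow> g x = (\<Sum>m\<in>A'. c' m * x m)"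
    using assms(2) unfolding poly_fun_iff by blast
  define d where "d m = (if m \<in> A then c m else 0) + (if m \<in> A' then c' m else 0)" for m
  have *: "(\<Sum>m\<in>A \<union> A'. d m * x m) = (\<Sum>m\<in>A. c m * x m) + (\<Sum>m\<in>A'. c' m * x m)"
    for x :: "'a point"
  proof -
    have "(\<Sum>m\<in>A \<union> A'. (if m \<in> A then c m else 0) * x m) = (\<Sum>m\<in>A. c m * x m)"
      by (rule sum.mono_neutral_cong_right) (use A A' in auto)
    moreover have "(\<Sum>m\<in>A \<union> A'. (if m \<in> A' then c' m else 0) * x m) = (\<Sum>m\<in>A'. c' m * x m)"
      by (rule sum.mono_neutral_cong_right) (use A A' in auto)
    ultimately show ?thesis by (simp add: d_def distrib_right sum.distrib)
  qed
  show ?thesis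
    by (rule poly_fun_cong[OF poly_fun_sum_monomials[of "A \<union> A'" _ _ d]])
      (use A A' f g in \<open>auto simp: *\<close>)
qed

lemma poly_fun_sum:
  "(\<And>i. i \<in> I \<Longrightarrow> poly_fun \<tau> \<Lambda> (f i)) \<Longrightarrow> poly_fun \<tau> \<Lambda> (\<lambda>x. \<Sum>i\<in>I. f i x)"
  by (induction I rule: infinite_finite_induct) (auto intro: poly_fun_const poly_fun_add)

lemma poly_fun_mult:
  assumes "poly_fun \<tau> \<Lambda> f" "poly_fun \<tau> \<Lambda> g" shows "poly_fun \<tau> \<Lambda> (\<lambda>x. f x * g x)"
proof -
  obtain A c where A: "finite A" "A \<subseteq> cone_chars \<tau> \<Lambda>"
    and f: "\<And>x. x \<in> affine_toric \<tau> \<Lambda> \<Longrightarrow> f x = (\<Sum>m\<in>A. c m * x m)"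
    using assms(1) unfolding poly_fun_iff by blast
  obtain A' c' where A': "finite A'" "A' \<subseteq> cone_chars \<tau> \<Lambda>"
    and g: "\<And>x. x \<in> affine_toric \<tau> \<Lambda> \<Longrightarrow> g x = (\<Sum>m\<in>A'. c' m * x m)"
    using assms(2) unfolding poly_fun_iff by blast
  have *: "(\<Sum>m\<in>A. \<Sum>m'\<in>A'. (c m * c' m') * x (\<lambda>v. m v + m' v)) = f x * g x"
    if "x \<in> affine_toric \<tau> \<Lambda>" for x
  proof -
    have "(c m * c' m') * x (\<lambda>v. m v + m' v) = (c m * x m) * (c' m' * x m')"
      if "m \<in> A" "m' \<in> A'" for m m'
      using that A A' affine_toric_add[OF \<open>x \<in> _\<close>, of m m'] by auto
    then have "(\<Sum>m\<in>A. \<Sum>m'\<in>A'. (c m * c' m') * x (\<lambda>v. m v + m' v)) =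
        (\<Sum>m\<in>A. \<Sum>m'\<in>A'. (c m * x m) * (c' m' * x m'))" by (intro sum.cong refl)
    then show ?thesis using that by (simp add: f g sum_product)
  qed
  have "poly_fun \<tau> \<Lambda> (\<lambda>x. \<Sum>m\<in>A. \<Sum>m'\<in>A'. (c m * c' m') * x (\<lambda>v. m v + m' v))"
    using A A' by (intro poly_fun_sum poly_fun_monomial cone_chars_add) auto
  then show ?thesis by (rule poly_fun_cong) (rule *)
qed

lemma poly_fun_uminus: "poly_fun \<tau> \<Lambda> f \<Longrightarrow> poly_fun \<tau> \<Lambda> (\<lambda>x. - f x)"
  using poly_fun_mult[OF poly_fun_const[of _ _ "-1"]] by fastforce

lemma poly_fun_diff:
  "poly_fun \<tau> \<Lambda> f \<Longrightarrow> poly_fun \<tau> \<Lambda> g \<Longrightarrow> poly_fun \<tau> \<Lambda> (\<lambda>x. f x - g x)"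
  using poly_fun_add[OF _ poly_fun_uminus, of \<tau> \<Lambda> f g] by simp

text \<open>Inside the chart both notions of polynomial agree, so numerators and denominators may be
  built with the closure properties of \<open>poly_fun\<close>.\<close>

lemma regular_on_iff:
  assumes "V \<subseteq> affine_toric \<tau> \<Lambda>"
  shows "regular_on \<tau> \<Lambda> V f \<longleftrightarrow>
     (\<forall>x\<in>V. \<exists>p q. poly_fun \<tau> \<Lambda> p \<and> poly_fun \<tau> \<Lambda> q \<and>
        q x \<noteq> 0 \<and> (\<forall>y\<in>V. q y \<noteq> 0 \<longrightarrow> f y = p y / q y))"
proof -
  have "(\<exists>p\<in>coord_ring \<tau> \<Lambda>. \<exists>q\<in>coord_ring \<tau> \<Lambda>. q x \<noteq> 0 \<and> (\<forall>y\<in>V. q y \<noteq> 0 \<longrightarrow> f y = p y / q y))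
     \<longleftrightarrow> (\<exists>p q. poly_fun \<tau> \<Lambda> p \<and> poly_fun \<tau> \<Lambda> q \<and> q x \<noteq> 0 \<and>
           (\<forall>y\<in>V. q y \<noteq> 0 \<longrightarrow> f y = p y / q y))" if "x \<in> V" for x
  proof (intro iffI; clarify)
    fix p q assume *: "p \<in> coord_ring \<tau> \<Lambda>" "q \<in> coord_ring \<tau> \<Lambda>" "q x \<noteq> 0"
      "\<forall>y\<in>V. q y \<noteq> 0 \<longrightarrow> f y = p y / q y"
    then show "\<exists>p q. poly_fun \<tau> \<Lambda> p \<and> poly_fun \<tau> \<Lambda> q \<and> q x \<noteq> 0 \<and>
           (\<forall>y\<in>V. q y \<noteq> 0 \<longrightarrow> f y = p y / q y)"
      unfolding poly_fun_def by blast
  next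
    fix p q assume *: "poly_fun \<tau> \<Lambda> p" "poly_fun \<tau> \<Lambda> q" "q x \<noteq> 0"
      "\<forall>y\<in>V. q y \<noteq> 0 \<longrightarrow> f y = p y / q y"
    obtain p' q' where **: "p' \<in> coord_ring \<tau> \<Lambda>" "q' \<in> coord_ring \<tau> \<Lambda>"
      "\<forall>x\<in>affine_toric \<tau> \<Lambda>. p x = p' x" "\<forall>x\<in>affine_toric \<tau> \<Lambda>. q x = q' x"
      using * unfolding poly_fun_def by blast
    show "\<exists>p\<in>coord_ring \<tau> \<Lambda>. \<exists>q\<in>coord_ring \<tau> \<Lambda>. q x \<noteq> 0 \<and>
          (\<forall>y\<in>V. q y \<noteq> 0 \<longrightarrow> f y = p y / q y)"
      by (rule bexI[of _ p'], rule bexI[of _ q']) (use * ** that assms in auto)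
  qed
  then show ?thesis unfolding regular_on_def by auto
qed

lemma zariski_open_iff:
  "zariski_open \<tau> \<Lambda> V \<longleftrightarrow> V \<subseteq> affine_toric \<tau> \<Lambda> \<and>
     (\<forall>x\<in>V. \<exists>q. poly_fun \<tau> \<Lambda> q \<and> q x \<noteq> 0 \<and> {y\<in>affine_toric \<tau> \<Lambda>. q y \<noteq> 0} \<subseteq> V)"
proof -
  have "(\<exists>q\<in>coord_ring \<tau> \<Lambda>. q x \<noteq> 0 \<and> {y\<in>affine_toric \<tau> \<Lambda>. q y \<noteq> 0} \<subseteq> V) \<longleftrightarrow>
    (\<exists>q. poly_fun \<tau> \<Lambda> q \<and> q x \<noteq> 0 \<and> {y\<in>affine_toric \<tau> \<Lambda>. q y \<noteq> 0} \<subseteq> V)"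
    if "x \<in> affine_toric \<tau> \<Lambda>" for x
  proof (intro iffI; clarify)
    fix q assume *: "poly_fun \<tau> \<Lambda> q" "q x \<noteq> 0" "{y\<in>affine_toric \<tau> \<Lambda>. q y \<noteq> 0} \<subseteq> V"
    then obtain q' where "q' \<in> coord_ring \<tau> \<Lambda>" "\<forall>x\<in>affine_toric \<tau> \<Lambda>. q x = q' x"
      unfolding poly_fun_def by blast
    with * that show "\<exists>q\<in>coord_ring \<tau> \<Lambda>. q x \<noteq> 0 \<and> {y\<in>affine_toric \<tau> \<Lambda>. q y \<noteq> 0} \<subseteq> V"
      by (intro bexI[of _ q']) auto
  qed (auto simp: poly_fun_def)
  then show ?thesis unfolding zariski_open_def by blast
qed

lemma zariski_open_subset: "zariski_open \<tau> \<Lambda> V \<Longrightarrow> V \<subseteq> affine_toric \<tau> \<Lambda>"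
  by (simp add: zariski_open_def)

lemma zariski_openE:
  assumes "zariski_open \<tau> \<Lambda> V" "x \<in> V"
  obtains q where "poly_fun \<tau> \<Lambda> q" "q x \<noteq> 0" "\<And>y. y \<in> affine_toric \<tau> \<Lambda> \<Longrightarrow> q y \<noteq> 0 \<Longrightarrow> y \<in> V"
  using assms unfolding zariski_open_iff by blast

lemma zariski_open_UNIV: "zariski_open \<tau> \<Lambda> (affine_toric \<tau> \<Lambda>)"
  unfolding zariski_open_iff using poly_fun_const[of \<tau> \<Lambda> 1]
  by (intro conjI ballI exI[of _ "\<lambda>_. 1"]) auto

lemma zariski_open_nonzero:
  "poly_fun \<tau> \<Lambda> q \<Longrightarrow> zariski_open \<tau> \<Lambda> {y\<in>affine_toric \<tau> \<Lambda>. q y \<noteq> 0}"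
  unfolding zariski_open_iff by blast

lemma zariski_open_Int:
  assumes "zariski_open \<tau> \<Lambda> V" "zariski_open \<tau> \<Lambda> W" shows "zariski_open \<tau> \<Lambda> (V \<inter> W)"
  unfolding zariski_open_iff
proof (intro conjI ballI)
  show "V \<inter> W \<subseteq> affine_toric \<tau> \<Lambda>" using assms zariski_open_subset by blast
  fix x assume x: "x \<in> V \<inter> W"
  obtain q where q: "poly_fun \<tau> \<Lambda> q" "q x \<noteq> 0" "\<And>y. y \<in> affine_toric \<tau> \<Lambda> \<Longrightarrow> q y \<noteq> 0 \<Longrightarrow> y \<in> V"
    using zariski_openE[OF assms(1)] x by blast
  obtain q' where q': "poly_fun \<tau> \<Lambda> q'" "q' x \<noteq> 0"
      "\<And>y. y \<in> affine_toric \<tau> \<Lambda> \<Longrightarrow> q' y \<noteq> 0 \<Longrightarrow> y \<in> W"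
    using zariski_openE[OF assms(2)] x by blast
  show "\<exists>q. poly_fun \<tau> \<Lambda> q \<and> q x \<noteq> 0 \<and> {y \<in> affine_toric \<tau> \<Lambda>. q y \<noteq> 0} \<subseteq> V \<inter> W"
    by (rule exI[of _ "\<lambda>x. q x * q' x"]) (use q q' in \<open>auto intro: poly_fun_mult\<close>)
qed

lemma regular_onE:
  assumes "regular_on \<tau> \<Lambda> V f" "V \<subseteq> affine_toric \<tau> \<Lambda>" "x \<in> V"
  obtains p q where "poly_fun \<tau> \<Lambda> p" "poly_fun \<tau> \<Lambda> q" "q x \<noteq> 0"
    "\<And>y. y \<in> V \<Longrightarrow> q y \<noteq> 0 \<Longrightarrow> f y = p y / q y"
proof -
  have "\<exists>p q. poly_fun \<tau> \<Lambda> p \<and> poly_fun \<tau> \<Lambda> q \<and> q x \<noteq> 0 \<and> (\<forall>y\<in>V. q y \<noteq> 0 \<longrightarrow> f y = p y / q y)"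
    using assms(1,3) unfolding regular_on_iff[OF assms(2)] by (rule bspec)
  then obtain p q where "poly_fun \<tau> \<Lambda> p" "poly_fun \<tau> \<Lambda> q" "q x \<noteq> 0"
    "\<forall>y\<in>V. q y \<noteq> 0 \<longrightarrow> f y = p y / q y" by (elim exE conjE)
  then show ?thesis by (intro that[of p q]) simp_all
qed

lemma regular_on_subset_cong:
  assumes "regular_on \<tau> \<Lambda> V f" "W \<subseteq> V" "\<And>x. x \<in> W \<Longrightarrow> f x = g x"
  shows "regular_on \<tau> \<Lambda> W g"
  unfolding regular_on_def
proof
  fix x assume x: "x \<in> W"
  then have "\<exists>p\<in>coord_ring \<tau> \<Lambda>. \<exists>q\<in>coord_ring \<tau> \<Lambda>. q x \<noteq> 0 \<and> (\<forall>y\<in>V. q y \<noteq> 0 \<longrightarrow> f y = p y / q y)"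
    using bspec[OF assms(1)[unfolded regular_on_def]] assms(2) by blast
  then obtain p q where *: "p \<in> coord_ring \<tau> \<Lambda>" "q \<in> coord_ring \<tau> \<Lambda>" "q x \<noteq> 0"
    "\<forall>y\<in>V. q y \<noteq> 0 \<longrightarrow> f y = p y / q y" by (elim bexE conjE)
  show "\<exists>p\<in>coord_ring \<tau> \<Lambda>. \<exists>q\<in>coord_ring \<tau> \<Lambda>. q x \<noteq> 0 \<and> (\<forall>y\<in>W. q y \<noteq> 0 \<longrightarrow> g y = p y / q y)"
    by (rule bexI[of _ p], rule bexI[of _ q]) (use * assms(2,3) in \<open>auto simp: subset_iff\<close>)
qed

lemma regular_on_subset: "regular_on \<tau> \<Lambda> V f \<Longrightarrow> W \<subseteq> V \<Longrightarrow> regular_on \<tau> \<Lambda> W f"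
  by (rule regular_on_subset_cong[of _ _ V f]) auto

lemma regular_on_cong: "regular_on \<tau> \<Lambda> V f \<Longrightarrow> (\<And>x. x \<in> V \<Longrightarrow> f x = g x) \<Longrightarrow> regular_on \<tau> \<Lambda> V g"
  by (rule regular_on_subset_cong[of _ _ V f]) auto

lemma regular_onI:
  assumes "V \<subseteq> affine_toric \<tau> \<Lambda>"
    and "\<And>x. x \<in> V \<Longrightarrow> \<exists>p q. poly_fun \<tau> \<Lambda> p \<and> poly_fun \<tau> \<Lambda> q \<and>
        q x \<noteq> 0 \<and> (\<forall>y\<in>V. q y \<noteq> 0 \<longrightarrow> f y = p y / q y)"
  shows "regular_on \<tau> \<Lambda> V f"
  unfolding regular_on_iff[OF assms(1)] using assms(2) by (rule ballI)

lemma regular_on_poly_fun: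
  "poly_fun \<tau> \<Lambda> f \<Longrightarrow> V \<subseteq> affine_toric \<tau> \<Lambda> \<Longrightarrow> regular_on \<tau> \<Lambda> V f"
  by (intro regular_onI, assumption, rule exI[of _ f], rule exI[of _ "\<lambda>_. 1"])
    (auto simp: poly_fun_const)

lemma regular_on_const: "V \<subseteq> affine_toric \<tau> \<Lambda> \<Longrightarrow> regular_on \<tau> \<Lambda> V (\<lambda>_. c)"
  by (intro regular_on_poly_fun poly_fun_const)

lemma regular_on_mult:
  assumes "regular_on \<tau> \<Lambda> V f" "regular_on \<tau> \<Lambda> V g" "V \<subseteq> affine_toric \<tau> \<Lambda>"
  shows "regular_on \<tau> \<Lambda> V (\<lambda>x. f x * g x)"
  unfolding regular_on_iff[OF assms(3)]
proof
  fix x assume x: "x \<in> V"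
  obtain p q where 1: "poly_fun \<tau> \<Lambda> p" "poly_fun \<tau> \<Lambda> q" "q x \<noteq> 0"
    "\<And>y. y \<in> V \<Longrightarrow> q y \<noteq> 0 \<Longrightarrow> f y = p y / q y"
    using regular_onE[OF assms(1,3) x] by blast
  obtain p' q' where 2: "poly_fun \<tau> \<Lambda> p'" "poly_fun \<tau> \<Lambda> q'" "q' x \<noteq> 0"
    "\<And>y. y \<in> V \<Longrightarrow> q' y \<noteq> 0 \<Longrightarrow> g y = p' y / q' y"
    using regular_onE[OF assms(2,3) x] by blast
  show "\<exists>p q. poly_fun \<tau> \<Lambda> p \<and> poly_fun \<tau> \<Lambda> q \<and> q x \<noteq> 0 \<and>
     (\<forall>y\<in>V. q y \<noteq> 0 \<longrightarrow> f y * g y = p y / q y)"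
    by (rule exI[of _ "\<lambda>x. p x * p' x"], rule exI[of _ "\<lambda>x. q x * q' x"])
      (use 1 2 in \<open>auto intro: poly_fun_mult\<close>)
qed

lemma regular_on_inverse:
  assumes "regular_on \<tau> \<Lambda> V f" "\<And>x. x \<in> V \<Longrightarrow> f x \<noteq> 0" "V \<subseteq> affine_toric \<tau> \<Lambda>"
  shows "regular_on \<tau> \<Lambda> V (\<lambda>x. inverse (f x))"
  unfolding regular_on_iff[OF assms(3)]
proof
  fix x assume x: "x \<in> V"
  obtain p q where 1: "poly_fun \<tau> \<Lambda> p" "poly_fun \<tau> \<Lambda> q" "q x \<noteq> 0"
    "\<And>y. y \<in> V \<Longrightarrow> q y \<noteq> 0 \<Longrightarrow> f y = p y / q y"
    using regular_onE[OF assms(1,3) x] by blast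
  have px: "p x \<noteq> 0" using 1 assms(2) x by fastforce
  \<comment> \<open>The fraction \<open>q / p\<close> is expanded by \<open>q\<close>: where the
    denominator \<open>q * p\<close> is nonzero, so is \<open>q\<close>, and the known formula for
    \<open>f\<close> applies.\<close>
  show "\<exists>p q. poly_fun \<tau> \<Lambda> p \<and> poly_fun \<tau> \<Lambda> q \<and> q x \<noteq> 0 \<and>
     (\<forall>y\<in>V. q y \<noteq> 0 \<longrightarrow> inverse (f y) = p y / q y)"
    by (rule exI[of _ "\<lambda>x. q x * q x"], rule exI[of _ "\<lambda>x. q x * p x"])
      (use 1 px in \<open>auto intro: poly_fun_mult\<close>)
qed

lemma regular_on_divide:
  "regular_on \<tau> \<Lambda> V f \<Longrightarrow> regular_on \<tau> \<Lambda> V g \<Longrightarrow> (\<And>x. x \<in> V \<Longrightarrow> g x \<noteq> 0) \<Longrightarrow>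
   V \<subseteq> affine_toric \<tau> \<Lambda> \<Longrightarrow> regular_on \<tau> \<Lambda> V (\<lambda>x. f x / g x)"
  unfolding divide_inverse by (intro regular_on_mult regular_on_inverse)

lemma regular_on_local:
  assumes "V \<subseteq> affine_toric \<tau> \<Lambda>"
    and "\<And>x. x \<in> V \<Longrightarrow> \<exists>W. zariski_open \<tau> \<Lambda> W \<and> x \<in> W \<and> regular_on \<tau> \<Lambda> (V \<inter> W) f"
  shows "regular_on \<tau> \<Lambda> V f"
  unfolding regular_on_iff[OF assms(1)]
proof
  fix x assume x: "x \<in> V"
  obtain W where W: "zariski_open \<tau> \<Lambda> W" "x \<in> W" "regular_on \<tau> \<Lambda> (V \<inter> W) f"
    using assms(2)[OF x] by blast
  obtain p q where 1: "poly_fun \<tau> \<Lambda> p" "poly_fun \<tau> \<Lambda> q" "q x \<noteq> 0"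
    "\<And>y. y \<in> V \<inter> W \<Longrightarrow> q y \<noteq> 0 \<Longrightarrow> f y = p y / q y"
    using regular_onE[OF W(3)] assms(1) x W(2) by blast
  obtain r where r: "poly_fun \<tau> \<Lambda> r" "r x \<noteq> 0" "\<And>y. y \<in> affine_toric \<tau> \<Lambda> \<Longrightarrow> r y \<noteq> 0 \<Longrightarrow> y \<in> W"
    using zariski_openE[OF W(1,2)] by blast
  \<comment> \<open>Expanding by \<open>r\<close> leaves the quotient unchanged but shrinks the set
    where the denominator is nonzero into \<open>W\<close>.\<close>
  show "\<exists>p q. poly_fun \<tau> \<Lambda> p \<and> poly_fun \<tau> \<Lambda> q \<and> q x \<noteq> 0 \<and>
     (\<forall>y\<in>V. q y \<noteq> 0 \<longrightarrow> f y = p y / q y)"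
    by (rule exI[of _ "\<lambda>x. p x * r x"], rule exI[of _ "\<lambda>x. q x * r x"])
      (use 1 r assms(1) in \<open>auto intro!: poly_fun_mult\<close>)
qed

text \<open>Algebraic maps are recorded by their effect on polynomial functions; preimages of open
  sets and composites with regular functions then follow formally. Torus translations and toric maps
  are the two instances.\<close>

definition toric_morphism ::
  "'a::euclidean_space set \<Rightarrow> 'a set \<Rightarrow> 'a set \<Rightarrow> 'a set \<Rightarrow> ('a point \<Rightarrow> 'a point) \<Rightarrow> bool" where
  "toric_morphism \<tau>' \<Lambda>' \<tau> \<Lambda> g \<longleftrightarrow>
     g \<in> affine_toric \<tau>' \<Lambda>' \<rightarrow> affine_toric \<tau> \<Lambda> \<and> (\<forall>p. poly_fun \<tau> \<Lambda> p \<longrightarrow> poly_fun \<tau>' \<Lambda>' (p \<circ> g))"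

lemma toric_morphism_torus_act: "toric_morphism \<tau> \<Lambda> \<tau> \<Lambda> (torus_act v)"
  unfolding toric_morphism_def
proof (intro conjI allI impI)
  fix p assume "poly_fun \<tau> \<Lambda> p"
  then obtain A c where A: "finite A" "A \<subseteq> cone_chars \<tau> \<Lambda>"
    and p: "\<And>x. x \<in> affine_toric \<tau> \<Lambda> \<Longrightarrow> p x = (\<Sum>m\<in>A. c m * x m)"
    unfolding poly_fun_iff by blast
  show "poly_fun \<tau> \<Lambda> (p \<circ> torus_act v)"
    by (rule poly_fun_cong[OF poly_fun_sum_monomials[OF A, of "\<lambda>m. c m * character m (- v)"]])
      (simp add: p torus_act_in, simp add: torus_act_def mult.assoc)
qed (auto simp: torus_act_in)

lemma toric_morphism_toric_map:
  assumes "\<tau>' \<subseteq> \<tau>" "\<Lambda>' \<subseteq> \<Lambda>" shows "toric_morphism \<tau>' \<Lambda>' \<tau> \<Lambda> (toric_map \<tau> \<Lambda>)"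
  unfolding toric_morphism_def
proof (intro conjI allI impI)
  fix p assume "poly_fun \<tau> \<Lambda> p"
  then obtain A c where A: "finite A" "A \<subseteq> cone_chars \<tau> \<Lambda>"
    and p: "\<And>x. x \<in> affine_toric \<tau> \<Lambda> \<Longrightarrow> p x = (\<Sum>m\<in>A. c m * x m)"
    unfolding poly_fun_iff by blast
  have "A \<subseteq> cone_chars \<tau>' \<Lambda>'" using A cone_chars_antimono[OF assms] by blast
  then show "poly_fun \<tau>' \<Lambda>' (p \<circ> toric_map \<tau> \<Lambda>)"
    by (rule poly_fun_cong[OF poly_fun_sum_monomials[OF A(1), of _ _ c]])
      (use A in \<open>simp add: p toric_map_in[OF assms], auto simp: toric_map_def intro!: sum.cong\<close>)
qed (auto simp: toric_map_in[OF assms])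

lemma toric_morphism_in:
  "toric_morphism \<tau>' \<Lambda>' \<tau> \<Lambda> g \<Longrightarrow> x \<in> affine_toric \<tau>' \<Lambda>' \<Longrightarrow> g x \<in> affine_toric \<tau> \<Lambda>"
  by (auto simp: toric_morphism_def)

lemma toric_morphism_poly_fun:
  "toric_morphism \<tau>' \<Lambda>' \<tau> \<Lambda> g \<Longrightarrow> poly_fun \<tau> \<Lambda> p \<Longrightarrow> poly_fun \<tau>' \<Lambda>' (\<lambda>x. p (g x))"
  by (auto simp: toric_morphism_def comp_def)

lemma toric_morphism_zariski_open:
  assumes g: "toric_morphism \<tau>' \<Lambda>' \<tau> \<Lambda> g" and V: "zariski_open \<tau> \<Lambda> V"
  shows "zariski_open \<tau>' \<Lambda>' {x \<in> affine_toric \<tau>' \<Lambda>'. g x \<in> V}"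
  unfolding zariski_open_iff
proof (intro conjI ballI)
  fix x assume x: "x \<in> {x \<in> affine_toric \<tau>' \<Lambda>'. g x \<in> V}"
  then obtain q where q: "poly_fun \<tau> \<Lambda> q" "q (g x) \<noteq> 0"
      "\<And>y. y \<in> affine_toric \<tau> \<Lambda> \<Longrightarrow> q y \<noteq> 0 \<Longrightarrow> y \<in> V"
    using zariski_openE[OF V, of "g x"] by blast
  show "\<exists>q. poly_fun \<tau>' \<Lambda>' q \<and> q x \<noteq> 0 \<and>
      {y \<in> affine_toric \<tau>' \<Lambda>'. q y \<noteq> 0} \<subseteq> {x \<in> affine_toric \<tau>' \<Lambda>'. g x \<in> V}"
    by (rule exI[of _ "\<lambda>x. q (g x)"])
      (use q toric_morphism_in[OF g] toric_morphism_poly_fun[OF g] in auto)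
qed auto

lemma toric_morphism_regular_on:
  assumes g: "toric_morphism \<tau>' \<Lambda>' \<tau> \<Lambda> g" and f: "regular_on \<tau> \<Lambda> V f" and V: "V \<subseteq> affine_toric \<tau> \<Lambda>"
  and W: "W \<subseteq> affine_toric \<tau>' \<Lambda>'" "\<And>x. x \<in> W \<Longrightarrow> g x \<in> V"
  shows "regular_on \<tau>' \<Lambda>' W (\<lambda>x. f (g x))"
  unfolding regular_on_iff[OF W(1)]
proof
  fix x assume x: "x \<in> W"
  then obtain p q where 1: "poly_fun \<tau> \<Lambda> p" "poly_fun \<tau> \<Lambda> q" "q (g x) \<noteq> 0"
    "\<And>y. y \<in> V \<Longrightarrow> q y \<noteq> 0 \<Longrightarrow> f y = p y / q y"
    using regular_onE[OF f V W(2)] by blast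
  show "\<exists>p q. poly_fun \<tau>' \<Lambda>' p \<and> poly_fun \<tau>' \<Lambda>' q \<and> q x \<noteq> 0 \<and>
     (\<forall>y\<in>W. q y \<noteq> 0 \<longrightarrow> f (g y) = p y / q y)"
    by (rule exI[of _ "\<lambda>x. p (g x)"], rule exI[of _ "\<lambda>x. q (g x)"])
      (use 1 W toric_morphism_poly_fun[OF g] in auto)
qed

section \<open>Independence of characters and Zariski density\<close>

text \<open>The operators in \<open>step\<close> are translation by a torus element minus a scalar.
  If the scalar is the eigenvalue of one unwanted monomial, that monomial disappears, while for
  suitable \<open>v\<close> the monomial \<open>m\<^sub>0\<close> survives; finitely many rounds
  leave \<open>m\<^sub>0\<close> alone. This serves both for the independence of characters and for
  reducing the denominator of \<open>h\<close> to a monomial.\<close>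

lemma monomial_by_torus_stability:
  fixes R :: "(('a::euclidean_space \<Rightarrow> real) \<Rightarrow> complex) \<Rightarrow> bool"
  assumes step: "\<And>c v k. R c \<Longrightarrow> R (\<lambda>m. (character m (- v) - k) * c m)"
    and "R c" "finite {m. c m \<noteq> 0}" "\<And>m. c m \<noteq> 0 \<Longrightarrow> linear m" "c m\<^sub>0 \<noteq> 0"
  shows "\<exists>d. d \<noteq> 0 \<and> R (\<lambda>m. if m = m\<^sub>0 then d else 0)"
  using assms(2-)
proof (induction "card ({m. c m \<noteq> 0} - {m\<^sub>0})" arbitrary: c rule: less_induct)
  case less
  show ?case
  proof (cases "{m. c m \<noteq> 0} - {m\<^sub>0} = {}")
    case True
    then have "c = (\<lambda>m. if m = m\<^sub>0 then c m\<^sub>0 else 0)" by (intro ext) auto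
    then show ?thesis using less.prems by metis
  next
    case False
    then obtain m1 where m1: "c m1 \<noteq> 0" "m1 \<noteq> m\<^sub>0" by auto
    then obtain u where u: "m1 u \<noteq> m\<^sub>0 u" by blast
    have lin: "linear m1" "linear m\<^sub>0" using less.prems m1 by auto
    \<comment> \<open>The scaling makes the two functionals differ by 1/2 at \<open>v\<close>, so
      that the values of their characters differ by the factor -1.\<close>
    define v where "v = (1 / (2 * (m1 u - m\<^sub>0 u))) *\<^sub>R u"
    have "m1 v - m\<^sub>0 v = (m1 u - m\<^sub>0 u) / (2 * (m1 u - m\<^sub>0 u))"
      using lin by (simp add: v_def linear_cmul diff_divide_distrib)
    also have "\<dots> = 1/2" using u by simp
    finally have half: "m1 v - m\<^sub>0 v = 1/2" .
    have ne: "character m1 (- v) \<noteq> character m\<^sub>0 (- v)"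
    proof
      assume "character m1 (- v) = character m\<^sub>0 (- v)"
      then have "character (\<lambda>v. m1 v - m\<^sub>0 v) v = 1"
        using lin by (simp add: character_diff_left character_minus_right)
      then have "(1/2::real) \<in> \<int>" using half by (simp add: character_eq_1_iff)
      then show False by (auto elim!: Ints_cases simp: field_simps)
    qed
    define c' where "c' = (\<lambda>m. (character m (- v) - character m1 (- v)) * c m)"
    have sub: "{m. c' m \<noteq> 0} - {m\<^sub>0} \<subset> {m. c m \<noteq> 0} - {m\<^sub>0}"
      using m1 by (auto simp: c'_def)
    show ?thesis
    proof (rule less.hyps)
      show "card ({m. c' m \<noteq> 0} - {m\<^sub>0}) < card ({m. c m \<noteq> 0} - {m\<^sub>0})"
        using sub less.prems by (intro psubset_card_mono) auto
      show "R c'" unfolding c'_def using less.prems step by blast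
      show "finite {m. c' m \<noteq> 0}"
        by (rule finite_subset[OF _ less.prems(2)]) (auto simp: c'_def)
      show "linear m" if "c' m \<noteq> 0" for m using that less.prems by (auto simp: c'_def)
      show "c' m\<^sub>0 \<noteq> 0" using ne less.prems by (auto simp: c'_def)
    qed
  qed
qed

text \<open>Vanishing on the whole torus is stable under translations and scalars, so by the
  preceding lemma it would also hold for a nonzero multiple of the single character of
  \<open>m\<^sub>0\<close>; evaluation at 0 refutes this.\<close>

lemma characters_independent:
  assumes "finite A" "\<And>m. m \<in> A \<Longrightarrow> linear m"
    and "\<And>v. (\<Sum>m\<in>A. c m * character m (- v)) = 0" and "m\<^sub>0 \<in> A"
  shows "c m\<^sub>0 = 0"
proof (rule ccontr)
  assume c0: "c m\<^sub>0 \<noteq> 0"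
  define R where "R c \<longleftrightarrow> (\<forall>v. (\<Sum>m\<in>A. c m * character m (- v)) = 0)" for c
  define c' where "c' m = (if m \<in> A then c m else 0)" for m
  have "\<exists>d. d \<noteq> 0 \<and> R (\<lambda>m. if m = m\<^sub>0 then d else 0)"
  proof (rule monomial_by_torus_stability[of R c'])
    fix c v k assume R: "R c"
    show "R (\<lambda>m. (character m (- v) - k) * c m)" unfolding R_def
    proof
      fix u
      have "(\<Sum>m\<in>A. (character m (- v) - k) * c m * character m (- u)) =
        (\<Sum>m\<in>A. c m * character m (- (v + u))) - k * (\<Sum>m\<in>A. c m * character m (- u))"
        using character_add_right[OF assms(2), of _ "-v" "-u"]
        by (simp add: sum_distrib_left sum_subtractf[symmetric] algebra_simps)
      also have "\<dots> = 0" using R unfolding R_def by (metis diff_self mult_zero_right)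
      finally show "(\<Sum>m\<in>A. (character m (- v) - k) * c m * character m (- u)) = 0" .
    qed
  next
    show "R c'" using assms(3) by (simp add: R_def c'_def)
    show "finite {m. c' m \<noteq> 0}" by (rule finite_subset[OF _ assms(1)]) (auto simp: c'_def)
    show "linear m" if "c' m \<noteq> 0" for m
      using that assms(2) by (auto simp: c'_def split: if_splits)
    show "c' m\<^sub>0 \<noteq> 0" using c0 assms(4) by (simp add: c'_def)
  qed
  then obtain d where d: "d \<noteq> 0" "\<And>v. (\<Sum>m\<in>A. (if m = m\<^sub>0 then d else 0) * character m (- v)) = 0"
    unfolding R_def by blast
  have "(\<Sum>m\<in>A. (if m = m\<^sub>0 then d else 0) * character m (- 0)) = d * character m\<^sub>0 0"
    using assms(1,4) by (subst sum.remove[of _ m\<^sub>0]) (auto intro: sum.neutral)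
  then show False using d(1) d(2)[of 0] character_zero_right[OF assms(2)[OF assms(4)]] by simp
qed

text \<open>The identity of the torus contained in the chart. It is the base point for density
  arguments and for the normalization of trivializations.\<close>

definition unit_point :: "'a::euclidean_space set \<Rightarrow> 'a set \<Rightarrow> 'a point" where
  "unit_point \<tau> \<Lambda> = (\<lambda>m. if m \<in> cone_chars \<tau> \<Lambda> then 1 else 0)"

lemma unit_point_in [simp]: "unit_point \<tau> \<Lambda> \<in> affine_toric \<tau> \<Lambda>"
  by (auto simp: unit_point_def affine_toric_def cone_chars_add)

text \<open>The orbit of the unit point under the compact torus is Zariski dense: a polynomial
  restricted to it is a combination of characters with the same coefficients.\<close>

lemma poly_fun_eq_0_if_torus:
  assumes "poly_fun \<tau> \<Lambda> p" "\<And>v. p (torus_act v (unit_point \<tau> \<Lambda>)) = 0" "x \<in> affine_toric \<tau> \<Lambda>"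
  shows "p x = 0"
proof -
  obtain A c where A: "finite A" "A \<subseteq> cone_chars \<tau> \<Lambda>"
    and p: "\<And>x. x \<in> affine_toric \<tau> \<Lambda> \<Longrightarrow> p x = (\<Sum>m\<in>A. c m * x m)"
    using assms(1) unfolding poly_fun_iff by blast
  have "(\<Sum>m\<in>A. c m * character m (- v)) = p (torus_act v (unit_point \<tau> \<Lambda>))" for v
    unfolding p[OF torus_act_in[OF unit_point_in]]
    using A by (auto simp: torus_act_def unit_point_def intro!: sum.cong)
  then have "c m = 0" if "m \<in> A" for m
    using characters_independent[OF A(1) _ _ that, of c] A assms(2) cone_chars_linear by fastforce
  then show ?thesis using p assms(3) by simp
qed

section \<open>Equivariant line bundles\<close>

context
  fixes \<tau> \<Lambda> :: "'a::euclidean_space set" and L :: "('a, 'a point) eq_bundle"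
  assumes L: "equivariant_line_bundle \<tau> \<Lambda> L"
begin

lemma elb_line_bundle: "line_bundle \<tau> \<Lambda> (fst L)"
  using L by (simp add: equivariant_line_bundle_def Let_def)

lemma elb_open: "(V, s) \<in> fst L \<Longrightarrow> zariski_open \<tau> \<Lambda> V"
  using elb_line_bundle by (auto simp: line_bundle_def)

lemma elb_subset: "(V, s) \<in> fst L \<Longrightarrow> V \<subseteq> affine_toric \<tau> \<Lambda>"
  using elb_open zariski_open_subset by blast

lemma elb_nonzero: "(V, s) \<in> fst L \<Longrightarrow> x \<in> V \<Longrightarrow> s x \<noteq> 0"
  using elb_line_bundle by (auto simp: line_bundle_def)

lemma elb_cover:
  assumes "x \<in> affine_toric \<tau> \<Lambda>" obtains V s where "(V, s) \<in> fst L" "x \<in> V"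
  using elb_line_bundle assms unfolding line_bundle_def by (elim conjE) (drule (1) bspec, auto)

lemma elb_transition:
  assumes "(V, s) \<in> fst L" "(V', s') \<in> fst L"
  shows "regular_on \<tau> \<Lambda> (V \<inter> V') (\<lambda>x. s x / s' x)"
  using elb_line_bundle assms unfolding line_bundle_def by (elim conjE) (drule (1) bspec, auto)

lemma elb_act_iso: "bundle_iso \<tau> \<Lambda> (fst L) (pull_frames (affine_toric \<tau> \<Lambda>) (torus_act v) (fst L)) (snd L v)"
  using L by (simp add: equivariant_line_bundle_def Let_def)

lemma elb_act_nonzero: "x \<in> affine_toric \<tau> \<Lambda> \<Longrightarrow> snd L v x \<noteq> 0"
  using elb_act_iso[of v] by (simp add: bundle_iso_def)

lemma elb_act_regular:
  assumes "(V, s) \<in> fst L" "(V', s') \<in> fst L"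
  shows "regular_on \<tau> \<Lambda> (V \<inter> {x \<in> affine_toric \<tau> \<Lambda>. torus_act v x \<in> V'})
    (\<lambda>x. snd L v x * s x / s' (torus_act v x))"
proof -
  have "({x \<in> affine_toric \<tau> \<Lambda>. torus_act v x \<in> V'}, \<lambda>x. s' (torus_act v x)) \<in>
      pull_frames (affine_toric \<tau> \<Lambda>) (torus_act v) (fst L)"
    unfolding pull_frames_def using assms(2) by (rule rev_image_eqI) simp
  with elb_act_iso[of v] assms(1) show ?thesis
    unfolding bundle_iso_def by fast
qed

lemma elb_act_add:
  "x \<in> affine_toric \<tau> \<Lambda> \<Longrightarrow> snd L (v + u) x = snd L v (torus_act u x) * snd L u x"
  using L by (simp add: equivariant_line_bundle_def Let_def)

lemma elb_act_lattice: "v \<in> \<Lambda> \<Longrightarrow> x \<in> affine_toric \<tau> \<Lambda> \<Longrightarrow> snd L v x = 1"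
  using L by (simp add: equivariant_line_bundle_def Let_def)

lemma elb_continuous:
  assumes "(V, s) \<in> fst L" "(V', s') \<in> fst L"
  shows "continuous_on {(v, x). x \<in> V \<and> torus_act v x \<in> V'}
            (\<lambda>(v, x). snd L v x * s x / s' (torus_act v x))"
  using L assms unfolding equivariant_line_bundle_def Let_def
  by (elim conjE) (drule (1) bspec, auto)

end

lemma equivariant_line_bundleI:
  assumes "\<And>V s. (V, s) \<in> fst L \<Longrightarrow> zariski_open \<tau> \<Lambda> V"
    and "\<And>V s x. (V, s) \<in> fst L \<Longrightarrow> x \<in> V \<Longrightarrow> s x \<noteq> 0"
    and "\<And>x. x \<in> affine_toric \<tau> \<Lambda> \<Longrightarrow> \<exists>V s. (V, s) \<in> fst L \<and> x \<in> V"
    and "\<And>V s V' s'. (V, s) \<in> fst L \<Longrightarrow> (V', s') \<in> fst L \<Longrightarrow>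
       regular_on \<tau> \<Lambda> (V \<inter> V') (\<lambda>x. s x / s' x)"
    and "\<And>v x. x \<in> affine_toric \<tau> \<Lambda> \<Longrightarrow> snd L v x \<noteq> 0"
    and "\<And>V s V' s' v. (V, s) \<in> fst L \<Longrightarrow> (V', s') \<in> fst L \<Longrightarrow>
       regular_on \<tau> \<Lambda> (V \<inter> {x \<in> affine_toric \<tau> \<Lambda>. torus_act v x \<in> V'})
         (\<lambda>x. snd L v x * s x / s' (torus_act v x))"
    and "\<And>v u x. x \<in> affine_toric \<tau> \<Lambda> \<Longrightarrow> snd L (v + u) x = snd L v (torus_act u x) * snd L u x"
    and "\<And>v x. v \<in> \<Lambda> \<Longrightarrow> x \<in> affine_toric \<tau> \<Lambda> \<Longrightarrow> snd L v x = 1"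
    and "\<And>V s V' s'. (V, s) \<in> fst L \<Longrightarrow> (V', s') \<in> fst L \<Longrightarrow>
       continuous_on {(v, x). x \<in> V \<and> torus_act v x \<in> V'}
            (\<lambda>(v, x). snd L v x * s x / s' (torus_act v x))"
  shows "equivariant_line_bundle \<tau> \<Lambda> L"
proof -
  have "line_bundle \<tau> \<Lambda> (fst L)"
    unfolding line_bundle_def using assms(1-4) by fast
  moreover have "bundle_iso \<tau> \<Lambda> (fst L) (pull_frames (affine_toric \<tau> \<Lambda>) (torus_act v) (fst L)) (snd L v)" for v
    unfolding bundle_iso_def pull_frames_def using assms(5,6) by fastforce
  ultimately show ?thesis
    unfolding equivariant_line_bundle_def Let_def using assms(7-9) by fast
qed

lemma equivariant_isoI:
  assumes "\<And>x. x \<in> affine_toric \<tau> \<Lambda> \<Longrightarrow> f x \<noteq> 0"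
    and "\<And>V s V' s'. (V, s) \<in> fst L \<Longrightarrow> (V', s') \<in> fst L' \<Longrightarrow>
       regular_on \<tau> \<Lambda> (V \<inter> V') (\<lambda>x. f x * s x / s' x)"
    and "\<And>v x. x \<in> affine_toric \<tau> \<Lambda> \<Longrightarrow> snd L' v x * f x = f (torus_act v x) * snd L v x"
  shows "equivariant_iso \<tau> \<Lambda> L L' f"
  unfolding equivariant_iso_def bundle_iso_def using assms by fast

lemma equivariant_iso_nonzero:
  "equivariant_iso \<tau> \<Lambda> L L' f \<Longrightarrow> x \<in> affine_toric \<tau> \<Lambda> \<Longrightarrow> f x \<noteq> 0"
  by (simp add: equivariant_iso_def bundle_iso_def)

lemma equivariant_iso_regular:
  assumes "equivariant_iso \<tau> \<Lambda> L L' f" "(V, s) \<in> fst L" "(V', s') \<in> fst L'"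
  shows "regular_on \<tau> \<Lambda> (V \<inter> V') (\<lambda>x. f x * s x / s' x)"
  using assms unfolding equivariant_iso_def bundle_iso_def
  by (elim conjE) (drule (1) bspec, auto)

lemma equivariant_iso_act:
  "equivariant_iso \<tau> \<Lambda> L L' f \<Longrightarrow> x \<in> affine_toric \<tau> \<Lambda> \<Longrightarrow>
   snd L' v x * f x = f (torus_act v x) * snd L v x"
  by (simp add: equivariant_iso_def)

lemma equivariant_iso_cong:
  assumes "equivariant_iso \<tau> \<Lambda> L L' f" "equivariant_line_bundle \<tau> \<Lambda> L"
    "\<And>x. x \<in> affine_toric \<tau> \<Lambda> \<Longrightarrow> f x = g x"
  shows "equivariant_iso \<tau> \<Lambda> L L' g"
proof (rule equivariant_isoI)
  fix V s V' s' assume *: "(V, s) \<in> fst L" "(V', s') \<in> fst L'"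
  show "regular_on \<tau> \<Lambda> (V \<inter> V') (\<lambda>x. g x * s x / s' x)"
    by (rule regular_on_cong[OF equivariant_iso_regular[OF assms(1) *]])
      (use elb_subset[OF assms(2) *(1)] assms(3) in auto)
qed (use equivariant_iso_nonzero[OF assms(1)] equivariant_iso_act[OF assms(1)] assms(3) torus_act_in
      in metis)+

lemma equivariant_iso_scale:
  assumes "equivariant_iso \<tau> \<Lambda> L L' f" "equivariant_line_bundle \<tau> \<Lambda> L" "c \<noteq> 0"
  shows "equivariant_iso \<tau> \<Lambda> L L' (\<lambda>x. c * f x)"
proof (rule equivariant_isoI)
  fix V s V' s' assume *: "(V, s) \<in> fst L" "(V', s') \<in> fst L'"
  have sub: "V \<inter> V' \<subseteq> affine_toric \<tau> \<Lambda>" using elb_subset[OF assms(2) *(1)] by auto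
  show "regular_on \<tau> \<Lambda> (V \<inter> V') (\<lambda>x. c * f x * s x / s' x)"
    by (rule regular_on_cong[OF regular_on_mult[OF regular_on_const[OF sub, of c]
            equivariant_iso_regular[OF assms(1) *] sub]]) simp
qed (use equivariant_iso_nonzero[OF assms(1)] equivariant_iso_act[OF assms(1)] assms(3) in auto)

lemma equivariant_iso_refl:
  assumes "equivariant_line_bundle \<tau> \<Lambda> L" shows "equivariant_iso \<tau> \<Lambda> L L (\<lambda>_. 1)"
  by (rule equivariant_isoI) (use elb_transition[OF assms] in auto)

lemma equivariant_iso_sym:
  assumes f: "equivariant_iso \<tau> \<Lambda> L L' f"
    and L: "equivariant_line_bundle \<tau> \<Lambda> L" and L': "equivariant_line_bundle \<tau> \<Lambda> L'"
  shows "equivariant_iso \<tau> \<Lambda> L' L (\<lambda>x. inverse (f x))"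
proof (rule equivariant_isoI)
  fix V s V' s' assume *: "(V, s) \<in> fst L'" "(V', s') \<in> fst L"
  have "regular_on \<tau> \<Lambda> (V' \<inter> V) (\<lambda>x. inverse (f x * s' x / s x))"
    by (rule regular_on_inverse[OF equivariant_iso_regular[OF f *(2,1)]])
      (use elb_nonzero[OF L *(2)] elb_nonzero[OF L' *(1)] equivariant_iso_nonzero[OF f]
        elb_subset[OF L' *(1)] in auto)
  then show "regular_on \<tau> \<Lambda> (V \<inter> V') (\<lambda>x. inverse (f x) * s x / s' x)"
    by (simp add: Int_commute field_simps)
next
  fix v x assume x: "x \<in> affine_toric \<tau> \<Lambda>"
  show "snd L v x * inverse (f x) = inverse (f (torus_act v x)) * snd L' v x"
    using equivariant_iso_act[OF f x, of v] equivariant_iso_nonzero[OF f x]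
      equivariant_iso_nonzero[OF f torus_act_in[OF x]] by (simp add: field_simps)
qed (use equivariant_iso_nonzero[OF f] in auto)

lemma equivariant_iso_trans:
  assumes f: "equivariant_iso \<tau> \<Lambda> L L' f" and g: "equivariant_iso \<tau> \<Lambda> L' L'' g"
    and L: "equivariant_line_bundle \<tau> \<Lambda> L" and L': "equivariant_line_bundle \<tau> \<Lambda> L'"
  shows "equivariant_iso \<tau> \<Lambda> L L'' (\<lambda>x. g x * f x)"
proof (rule equivariant_isoI)
  fix V s V'' s'' assume *: "(V, s) \<in> fst L" "(V'', s'') \<in> fst L''"
  have sub: "V \<inter> V'' \<subseteq> affine_toric \<tau> \<Lambda>" using elb_subset[OF L *(1)] by blast
  show "regular_on \<tau> \<Lambda> (V \<inter> V'') (\<lambda>x. g x * f x * s x / s'' x)"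
  proof (rule regular_on_local[OF sub])
    fix x assume x: "x \<in> V \<inter> V''"
    \<comment> \<open>A frame of the middle bundle near \<open>x\<close> is inserted, which splits
      the quotient into two factors known to be regular.\<close>
    then obtain V' s' where 1: "(V', s') \<in> fst L'" "x \<in> V'" using elb_cover[OF L', of x] sub by blast
    have "regular_on \<tau> \<Lambda> (V \<inter> V'' \<inter> V') (\<lambda>x. (g x * s' x / s'' x) * (f x * s x / s' x))"
      using sub by (intro regular_on_mult regular_on_subset[OF equivariant_iso_regular[OF f *(1) 1(1)]]
        regular_on_subset[OF equivariant_iso_regular[OF g 1(1) *(2)]]) auto
    then have "regular_on \<tau> \<Lambda> (V \<inter> V'' \<inter> V') (\<lambda>x. g x * f x * s x / s'' x)"
      by (rule regular_on_cong) (use elb_nonzero[OF L' 1(1)] in auto)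
    then show "\<exists>W. zariski_open \<tau> \<Lambda> W \<and> x \<in> W \<and> regular_on \<tau> \<Lambda> (V \<inter> V'' \<inter> W) (\<lambda>x. g x * f x * s x / s'' x)"
      using 1 elb_open[OF L' 1(1)] by blast
  qed
next
  fix v x assume x: "x \<in> affine_toric \<tau> \<Lambda>"
  show "snd L'' v x * (g x * f x) = g (torus_act v x) * f (torus_act v x) * snd L v x"
    using equivariant_iso_act[OF f x, of v] equivariant_iso_act[OF g x, of v]
    by (simp add: mult.assoc[symmetric])
qed (use equivariant_iso_nonzero[OF f] equivariant_iso_nonzero[OF g] in auto)

section \<open>Tensor products, trivial bundles and duals\<close>

lemma fst_tensor_eq:
  "W \<in> fst (tensor_eq L L') \<longleftrightarrow>
   (\<exists>V s V' s'. W = (V \<inter> V', \<lambda>x. s x * s' x) \<and> (V, s) \<in> fst L \<and> (V', s') \<in> fst L')"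
  by (auto simp: tensor_eq_def)

lemma tensor_eqI:
  "(V, s) \<in> fst L \<Longrightarrow> (V', s') \<in> fst L' \<Longrightarrow> (V \<inter> V', \<lambda>x. s x * s' x) \<in> fst (tensor_eq L L')"
  unfolding tensor_eq_def by fastforce

lemma snd_tensor_eq: "snd (tensor_eq L L') v x = snd L v x * snd L' v x"
  by (simp add: tensor_eq_def)

lemma equivariant_iso_tensor:
  assumes f: "equivariant_iso \<tau> \<Lambda> L\<^sub>1 L\<^sub>1' f" and g: "equivariant_iso \<tau> \<Lambda> L\<^sub>2 L\<^sub>2' g"
    and L: "equivariant_line_bundle \<tau> \<Lambda> L\<^sub>1"
  shows "equivariant_iso \<tau> \<Lambda> (tensor_eq L\<^sub>1 L\<^sub>2) (tensor_eq L\<^sub>1' L\<^sub>2') (\<lambda>x. f x * g x)"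
proof (rule equivariant_isoI)
  fix V s V' s' assume *: "(V, s) \<in> fst (tensor_eq L\<^sub>1 L\<^sub>2)" "(V', s') \<in> fst (tensor_eq L\<^sub>1' L\<^sub>2')"
  obtain V1 s1 V2 s2 where 1: "V = V1 \<inter> V2" "s = (\<lambda>x. s1 x * s2 x)" "(V1, s1) \<in> fst L\<^sub>1" "(V2, s2) \<in> fst L\<^sub>2"
    using *(1) unfolding fst_tensor_eq by blast
  obtain V1' s1' V2' s2' where 2: "V' = V1' \<inter> V2'" "s' = (\<lambda>x. s1' x * s2' x)" "(V1', s1') \<in> fst L\<^sub>1'" "(V2', s2') \<in> fst L\<^sub>2'"
    using *(2) unfolding fst_tensor_eq by blast
  have "regular_on \<tau> \<Lambda> (V \<inter> V') (\<lambda>x. (f x * s1 x / s1' x) * (g x * s2 x / s2' x))"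
    by (intro regular_on_mult regular_on_subset[OF equivariant_iso_regular[OF f 1(3) 2(3)]]
        regular_on_subset[OF equivariant_iso_regular[OF g 1(4) 2(4)]])
      (use elb_subset[OF L 1(3)] 1 2 in auto)
  then show "regular_on \<tau> \<Lambda> (V \<inter> V') (\<lambda>x. f x * g x * s x / s' x)"
    by (rule regular_on_cong) (simp add: 1 2)
next
  fix v x assume x: "x \<in> affine_toric \<tau> \<Lambda>"
  show "snd (tensor_eq L\<^sub>1' L\<^sub>2') v x * (f x * g x) =
      f (torus_act v x) * g (torus_act v x) * snd (tensor_eq L\<^sub>1 L\<^sub>2) v x"
    using arg_cong2[OF equivariant_iso_act[OF f x, of v] equivariant_iso_act[OF g x, of v], of "(*)"]
    by (simp add: snd_tensor_eq mult_ac)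
qed (use equivariant_iso_nonzero[OF f] equivariant_iso_nonzero[OF g] in auto)

lemma equivariant_line_bundle_tensor:
  assumes L: "equivariant_line_bundle \<tau> \<Lambda> L" and L': "equivariant_line_bundle \<tau> \<Lambda> L'"
  shows "equivariant_line_bundle \<tau> \<Lambda> (tensor_eq L L')"
proof (rule equivariant_line_bundleI)
  fix V s V' s' v assume *: "(V, s) \<in> fst (tensor_eq L L')" "(V', s') \<in> fst (tensor_eq L L')"
  obtain V1 s1 V2 s2 where 1: "V = V1 \<inter> V2" "s = (\<lambda>x. s1 x * s2 x)" "(V1, s1) \<in> fst L" "(V2, s2) \<in> fst L'"
    using *(1) unfolding fst_tensor_eq by blast
  obtain V1' s1' V2' s2' where 2: "V' = V1' \<inter> V2'" "s' = (\<lambda>x. s1' x * s2' x)" "(V1', s1') \<in> fst L" "(V2', s2') \<in> fst L'"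
    using *(2) unfolding fst_tensor_eq by blast
  have sub: "V1 \<subseteq> affine_toric \<tau> \<Lambda>" using elb_subset[OF L 1(3)] .
  have "regular_on \<tau> \<Lambda> (V \<inter> V') (\<lambda>x. (s1 x / s1' x) * (s2 x / s2' x))"
    by (intro regular_on_mult regular_on_subset[OF elb_transition[OF L 1(3) 2(3)]]
        regular_on_subset[OF elb_transition[OF L' 1(4) 2(4)]])
      (use sub 1 2 in auto)
  then show "regular_on \<tau> \<Lambda> (V \<inter> V') (\<lambda>x. s x / s' x)"
    by (rule regular_on_cong) (simp add: 1 2)
  have "regular_on \<tau> \<Lambda> (V \<inter> {x \<in> affine_toric \<tau> \<Lambda>. torus_act v x \<in> V'})
     (\<lambda>x. (snd L v x * s1 x / s1' (torus_act v x)) * (snd L' v x * s2 x / s2' (torus_act v x)))"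
    by (intro regular_on_mult regular_on_subset[OF elb_act_regular[OF L 1(3) 2(3)]]
        regular_on_subset[OF elb_act_regular[OF L' 1(4) 2(4)]])
      (use sub 1 2 in auto)
  then show "regular_on \<tau> \<Lambda> (V \<inter> {x \<in> affine_toric \<tau> \<Lambda>. torus_act v x \<in> V'})
         (\<lambda>x. snd (tensor_eq L L') v x * s x / s' (torus_act v x))"
    by (rule regular_on_cong) (simp add: 1 2 snd_tensor_eq)
  have "continuous_on {(v, x). x \<in> V \<and> torus_act v x \<in> V'}
            (\<lambda>p. (case p of (v, x) \<Rightarrow> snd L v x * s1 x / s1' (torus_act v x)) *
              (case p of (v, x) \<Rightarrow> snd L' v x * s2 x / s2' (torus_act v x)))"
    by (intro continuous_on_mult continuous_on_subset[OF elb_continuous[OF L 1(3) 2(3)]]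
        continuous_on_subset[OF elb_continuous[OF L' 1(4) 2(4)]])
      (use 1 2 in auto)
  then show "continuous_on {(v, x). x \<in> V \<and> torus_act v x \<in> V'}
            (\<lambda>(v, x). snd (tensor_eq L L') v x * s x / s' (torus_act v x))"
    by (rule continuous_on_eq) (auto simp: 1 2 snd_tensor_eq)
next
  fix V s assume "(V, s) \<in> fst (tensor_eq L L')"
  then show "zariski_open \<tau> \<Lambda> V"
    unfolding fst_tensor_eq using elb_open[OF L] elb_open[OF L'] by (auto intro: zariski_open_Int)
next
  fix V s x assume "(V, s) \<in> fst (tensor_eq L L')" "x \<in> V"
  then show "s x \<noteq> 0"
    unfolding fst_tensor_eq using elb_nonzero[OF L] elb_nonzero[OF L'] by auto
next
  fix x assume x: "x \<in> affine_toric \<tau> \<Lambda>"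
  obtain V s where 1: "(V, s) \<in> fst L" "x \<in> V" using elb_cover[OF L x] by blast
  obtain V' s' where 2: "(V', s') \<in> fst L'" "x \<in> V'" using elb_cover[OF L' x] by blast
  show "\<exists>V s. (V, s) \<in> fst (tensor_eq L L') \<and> x \<in> V"
    using tensor_eqI[OF 1(1) 2(1)] 1(2) 2(2) by blast
qed (auto simp: snd_tensor_eq elb_act_nonzero[OF L] elb_act_nonzero[OF L'] elb_act_add[OF L]
    elb_act_add[OF L'] elb_act_lattice[OF L] elb_act_lattice[OF L'])

lemma continuous_on_character:
  assumes "linear m" shows "continuous_on A (character m)"
  unfolding character_def
  by (intro continuous_on_cis continuous_intros linear_continuous_on)
    (use assms in \<open>simp add: linear_linear\<close>)

lemma fst_trivial_eq: "(V, s) \<in> fst (trivial_eq D c) \<longleftrightarrow> V = D \<and> s = (\<lambda>_. 1)"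
  by (simp add: trivial_eq_def)

lemma snd_trivial_eq: "snd (trivial_eq D c) v x = c v"
  by (simp add: trivial_eq_def)

lemma equivariant_line_bundle_trivial:
  assumes m: "m \<in> dual_lattice \<Lambda>"
  shows "equivariant_line_bundle \<tau> \<Lambda> (trivial_eq (affine_toric \<tau> \<Lambda>) (character m))"
proof (rule equivariant_line_bundleI)
  note lin = dual_latticeD[OF m]
  show "snd (trivial_eq (affine_toric \<tau> \<Lambda>) (character m)) (v + u) x =
    snd (trivial_eq (affine_toric \<tau> \<Lambda>) (character m)) v (torus_act u x) *
    snd (trivial_eq (affine_toric \<tau> \<Lambda>) (character m)) u x" for v u x
    by (simp add: snd_trivial_eq character_add_right lin)
  show "snd (trivial_eq (affine_toric \<tau> \<Lambda>) (character m)) v x = 1" if "v \<in> \<Lambda>" for v x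
    using that m by (simp add: snd_trivial_eq character_eq_1_iff dual_lattice_def)
  fix V s V' s'
  assume "(V, s) \<in> fst (trivial_eq (affine_toric \<tau> \<Lambda>) (character m))"
    "(V', s') \<in> fst (trivial_eq (affine_toric \<tau> \<Lambda>) (character m))"
  moreover have "continuous_on A (\<lambda>(v, x). character m v)" for A :: "('a \<times> 'a point) set"
    unfolding case_prod_unfold
    by (intro continuous_on_compose2[OF continuous_on_character[OF lin, of UNIV]]
      continuous_on_fst continuous_on_id) auto
  ultimately show "continuous_on {(v, x). x \<in> V \<and> torus_act v x \<in> V'}
            (\<lambda>(v, x). snd (trivial_eq (affine_toric \<tau> \<Lambda>) (character m)) v x * s x / s' (torus_act v x))"
    by (simp add: fst_trivial_eq snd_trivial_eq)
qed (auto simp: fst_trivial_eq snd_trivial_eq zariski_open_UNIV intro!: regular_on_const)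

lemma tensor_trivial_eq:
  "tensor_eq (trivial_eq D c) (trivial_eq D c') = trivial_eq D (\<lambda>v. c v * c' v)"
  by (simp add: tensor_eq_def trivial_eq_def)

text \<open>Supplies inverses in the Picard group of the toric variety. For the orbifold they come
  from realizing every compatible family of characters by a bundle instead.\<close>

definition dual_eq :: "('a, 'p) eq_bundle \<Rightarrow> ('a, 'p) eq_bundle" where
  "dual_eq L = ((\<lambda>(V, s). (V, \<lambda>x. inverse (s x))) ` fst L, \<lambda>v x. inverse (snd L v x))"

lemma fst_dual_eq: "(V, s) \<in> fst (dual_eq L) \<longleftrightarrow> (\<exists>t. (V, t) \<in> fst L \<and> s = (\<lambda>x. inverse (t x)))"
  by (auto simp: dual_eq_def)

lemma snd_dual_eq: "snd (dual_eq L) v x = inverse (snd L v x)"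
  by (simp add: dual_eq_def)

lemma equivariant_line_bundle_dual:
  assumes L: "equivariant_line_bundle \<tau> \<Lambda> L"
  shows "equivariant_line_bundle \<tau> \<Lambda> (dual_eq L)"
proof (rule equivariant_line_bundleI)
  fix V s V' s' v assume *: "(V, s) \<in> fst (dual_eq L)" "(V', s') \<in> fst (dual_eq L)"
  obtain t where t: "(V, t) \<in> fst L" "s = (\<lambda>x. inverse (t x))" using * unfolding fst_dual_eq by blast
  obtain t' where t': "(V', t') \<in> fst L" "s' = (\<lambda>x. inverse (t' x))" using * unfolding fst_dual_eq by blast
  have sub: "V \<subseteq> affine_toric \<tau> \<Lambda>" using elb_subset[OF L t(1)] .
  have "regular_on \<tau> \<Lambda> (V' \<inter> V) (\<lambda>x. t' x / t x)" by (rule elb_transition[OF L t'(1) t(1)])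
  then show "regular_on \<tau> \<Lambda> (V \<inter> V') (\<lambda>x. s x / s' x)"
    by (simp add: t t' Int_commute field_simps)
  have "regular_on \<tau> \<Lambda> (V \<inter> {x \<in> affine_toric \<tau> \<Lambda>. torus_act v x \<in> V'})
         (\<lambda>x. inverse (snd L v x * t x / t' (torus_act v x)))"
    by (rule regular_on_inverse[OF elb_act_regular[OF L t(1) t'(1)]])
      (use sub elb_act_nonzero[OF L] elb_nonzero[OF L t(1)] elb_nonzero[OF L t'(1)] in auto)
  then show "regular_on \<tau> \<Lambda> (V \<inter> {x \<in> affine_toric \<tau> \<Lambda>. torus_act v x \<in> V'})
         (\<lambda>x. snd (dual_eq L) v x * s x / s' (torus_act v x))"
    by (rule regular_on_cong) (simp add: t t' snd_dual_eq field_simps)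
  have "continuous_on {(v, x). x \<in> V \<and> torus_act v x \<in> V'}
            (\<lambda>p. inverse (case p of (v, x) \<Rightarrow> snd L v x * t x / t' (torus_act v x)))"
    by (rule continuous_on_inverse[OF elb_continuous[OF L t(1) t'(1)]])
      (use sub elb_act_nonzero[OF L] elb_nonzero[OF L t(1)] elb_nonzero[OF L t'(1)] in auto)
  then show "continuous_on {(v, x). x \<in> V \<and> torus_act v x \<in> V'}
            (\<lambda>(v, x). snd (dual_eq L) v x * s x / s' (torus_act v x))"
    by (rule continuous_on_eq) (auto simp: t t' snd_dual_eq field_simps)
next
  fix x assume "x \<in> affine_toric \<tau> \<Lambda>"
  then obtain V s where "(V, s) \<in> fst L" "x \<in> V" using elb_cover[OF L] by blast
  then show "\<exists>V s. (V, s) \<in> fst (dual_eq L) \<and> x \<in> V" unfolding fst_dual_eq by blast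
qed (auto simp: fst_dual_eq snd_dual_eq elb_open[OF L] elb_nonzero[OF L] elb_act_nonzero[OF L]
  elb_act_add[OF L] elb_act_lattice[OF L])

lemma equivariant_iso_dual:
  assumes f: "equivariant_iso \<tau> \<Lambda> L L' f"
    and L: "equivariant_line_bundle \<tau> \<Lambda> L" and L': "equivariant_line_bundle \<tau> \<Lambda> L'"
  shows "equivariant_iso \<tau> \<Lambda> (dual_eq L) (dual_eq L') (\<lambda>x. inverse (f x))"
proof (rule equivariant_isoI)
  fix V s V' s' assume *: "(V, s) \<in> fst (dual_eq L)" "(V', s') \<in> fst (dual_eq L')"
  obtain t where t: "(V, t) \<in> fst L" "s = (\<lambda>x. inverse (t x))" using * unfolding fst_dual_eq by blast
  obtain t' where t': "(V', t') \<in> fst L'" "s' = (\<lambda>x. inverse (t' x))" using * unfolding fst_dual_eq by blast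
  have "regular_on \<tau> \<Lambda> (V \<inter> V') (\<lambda>x. inverse (f x * t x / t' x))"
    by (rule regular_on_inverse[OF equivariant_iso_regular[OF f t(1) t'(1)]])
      (use elb_subset[OF L t(1)] equivariant_iso_nonzero[OF f] elb_nonzero[OF L t(1)]
        elb_nonzero[OF L' t'(1)] in auto)
  then show "regular_on \<tau> \<Lambda> (V \<inter> V') (\<lambda>x. inverse (f x) * s x / s' x)"
    by (rule regular_on_cong) (simp add: t t' field_simps)
next
  fix v x assume x: "x \<in> affine_toric \<tau> \<Lambda>"
  show "snd (dual_eq L') v x * inverse (f x) = inverse (f (torus_act v x)) * snd (dual_eq L) v x"
    using equivariant_iso_act[OF f x, of v]
    by (simp add: snd_dual_eq inverse_mult_distrib[symmetric] del: inverse_mult_distrib)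
qed (use equivariant_iso_nonzero[OF f] in auto)

lemma dual_trivial_eq: "dual_eq (trivial_eq D c) = trivial_eq D (\<lambda>v. inverse (c v))"
  by (simp add: dual_eq_def trivial_eq_def)

section \<open>Pull-back of equivariant bundles\<close>

text \<open>Collects what pulling back an action requires: the inclusion of lattices keeps the
  action of the smaller lattice trivial, and continuity preserves joint continuity. Toric maps
  between charts of faces and the quotient maps to the charts for \<open>N\<close> are both of this
  kind.\<close>

definition equivariant_morphism ::
  "'a::euclidean_space set \<Rightarrow> 'a set \<Rightarrow> 'a set \<Rightarrow> 'a set \<Rightarrow> ('a point \<Rightarrow> 'a point) \<Rightarrow> bool" where
  "equivariant_morphism \<tau>' \<Lambda>' \<tau> \<Lambda> g \<longleftrightarrow> toric_morphism \<tau>' \<Lambda>' \<tau> \<Lambda> g \<and> continuous_on UNIV g \<and>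
     (\<forall>v x. g (torus_act v x) = torus_act v (g x)) \<and> \<Lambda>' \<subseteq> \<Lambda>"

lemma equivariant_morphism_toric_map:
  assumes "\<tau>' \<subseteq> \<tau>" "\<Lambda>' \<subseteq> \<Lambda>" shows "equivariant_morphism \<tau>' \<Lambda>' \<tau> \<Lambda> (toric_map \<tau> \<Lambda>)"
proof -
  have "continuous_on UNIV (\<lambda>x. toric_map \<tau> \<Lambda> x)"
  proof (rule continuous_on_coordinatewise_then_product)
    fix m show "continuous_on UNIV (\<lambda>x. toric_map \<tau> \<Lambda> x m)"
      by (cases "m \<in> cone_chars \<tau> \<Lambda>") (simp_all add: toric_map_def)
  qed
  then show ?thesis
    using toric_morphism_toric_map[OF assms] assms(2)
    by (simp add: equivariant_morphism_def toric_map_torus_act)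
qed

lemma pull_eq_pull_eq:
  assumes "\<And>x. x \<in> D \<Longrightarrow> g x \<in> E"
  shows "pull_eq D g (pull_eq E k L) = pull_eq D (\<lambda>x. k (g x)) L"
proof -
  have "{x \<in> D. g x \<in> {x \<in> E. k x \<in> V}} = {x \<in> D. k (g x) \<in> V}" for V using assms by blast
  then show ?thesis by (simp add: pull_eq_def pull_frames_def image_image case_prod_unfold)
qed

lemma pull_eq_trivial_eq:
  assumes "\<And>x. x \<in> D \<Longrightarrow> g x \<in> E" shows "pull_eq D g (trivial_eq E c) = trivial_eq D c"
proof -
  have "{x \<in> D. g x \<in> E} = D" using assms by blast
  then show ?thesis by (simp add: pull_eq_def pull_frames_def trivial_eq_def)
qed

lemma fst_pull_eq:
  "(V, s) \<in> fst (pull_eq D g L) \<longleftrightarrow>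
   (\<exists>W t. (W, t) \<in> fst L \<and> V = {x \<in> D. g x \<in> W} \<and> s = (\<lambda>x. t (g x)))"
  by (auto simp: pull_eq_def pull_frames_def)

lemma pull_eqI: "(W, t) \<in> fst L \<Longrightarrow> ({x \<in> D. g x \<in> W}, \<lambda>x. t (g x)) \<in> fst (pull_eq D g L)"
  unfolding pull_eq_def pull_frames_def by (simp add: rev_image_eqI)

lemma snd_pull_eq: "snd (pull_eq D g L) v x = snd L v (g x)"
  by (simp add: pull_eq_def)

lemma pull_eq_tensor_eq: "pull_eq D g (tensor_eq L L') = tensor_eq (pull_eq D g L) (pull_eq D g L')"
proof (rule prod_eqI)
  show "fst (pull_eq D g (tensor_eq L L')) = fst (tensor_eq (pull_eq D g L) (pull_eq D g L'))"
  proof (intro equalityI subsetI)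
    fix Z assume "Z \<in> fst (pull_eq D g (tensor_eq L L'))"
    then obtain V s V' s' where *: "Z = ({x \<in> D. g x \<in> V \<inter> V'}, \<lambda>x. s (g x) * s' (g x))"
      "(V, s) \<in> fst L" "(V', s') \<in> fst L'"
      by (cases Z) (auto simp: fst_pull_eq fst_tensor_eq)
    have "({x \<in> D. g x \<in> V} \<inter> {x \<in> D. g x \<in> V'}, \<lambda>x. s (g x) * s' (g x))
        \<in> fst (tensor_eq (pull_eq D g L) (pull_eq D g L'))"
      by (intro tensor_eqI pull_eqI *)
    moreover have "Z = ({x \<in> D. g x \<in> V} \<inter> {x \<in> D. g x \<in> V'}, \<lambda>x. s (g x) * s' (g x))" using * by auto
    ultimately show "Z \<in> fst (tensor_eq (pull_eq D g L) (pull_eq D g L'))" by (simp only:)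
  next
    fix Z assume "Z \<in> fst (tensor_eq (pull_eq D g L) (pull_eq D g L'))"
    then obtain V s V' s' where *: "Z = ({x \<in> D. g x \<in> V} \<inter> {x \<in> D. g x \<in> V'}, \<lambda>x. s (g x) * s' (g x))"
      "(V, s) \<in> fst L" "(V', s') \<in> fst L'" unfolding fst_tensor_eq fst_pull_eq by blast
    have "({x \<in> D. g x \<in> V \<inter> V'}, \<lambda>x. s (g x) * s' (g x)) \<in> fst (pull_eq D g (tensor_eq L L'))"
      using pull_eqI[OF tensor_eqI[OF *(2,3)]] .
    moreover have "Z = ({x \<in> D. g x \<in> V \<inter> V'}, \<lambda>x. s (g x) * s' (g x))" using * by auto
    ultimately show "Z \<in> fst (pull_eq D g (tensor_eq L L'))" by (simp only:)
  qed
qed (auto simp: snd_tensor_eq snd_pull_eq intro!: ext)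

lemma pull_eq_dual_eq: "pull_eq D g (dual_eq L) = dual_eq (pull_eq D g L)"
  by (simp add: pull_eq_def pull_frames_def dual_eq_def image_image case_prod_unfold)

context
  fixes \<tau>' \<Lambda>' \<tau> \<Lambda> :: "'a::euclidean_space set" and g :: "'a point \<Rightarrow> 'a point"
  assumes g: "equivariant_morphism \<tau>' \<Lambda>' \<tau> \<Lambda> g"
begin

lemma equivariant_morphism_in: "x \<in> affine_toric \<tau>' \<Lambda>' \<Longrightarrow> g x \<in> affine_toric \<tau> \<Lambda>"
  using g by (auto simp: equivariant_morphism_def intro: toric_morphism_in)

lemma equivariant_morphism_act: "g (torus_act v x) = torus_act v (g x)"
  using g by (auto simp: equivariant_morphism_def)

lemma equivariant_morphism_toric: "toric_morphism \<tau>' \<Lambda>' \<tau> \<Lambda> g"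
  using g by (auto simp: equivariant_morphism_def)

lemma equivariant_line_bundle_pull:
  assumes L: "equivariant_line_bundle \<tau> \<Lambda> L"
  shows "equivariant_line_bundle \<tau>' \<Lambda>' (pull_eq (affine_toric \<tau>' \<Lambda>') g L)"
proof (rule equivariant_line_bundleI)
  let ?U = "affine_toric \<tau> \<Lambda>" and ?U' = "affine_toric \<tau>' \<Lambda>'"
  fix V s V' s' v assume *: "(V, s) \<in> fst (pull_eq ?U' g L)" "(V', s') \<in> fst (pull_eq ?U' g L)"
  obtain W t where t: "(W, t) \<in> fst L" "V = {x \<in> ?U'. g x \<in> W}" "s = (\<lambda>x. t (g x))"
    using *(1) unfolding fst_pull_eq by blast
  obtain W' t' where t': "(W', t') \<in> fst L" "V' = {x \<in> ?U'. g x \<in> W'}" "s' = (\<lambda>x. t' (g x))"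
    using *(2) unfolding fst_pull_eq by blast
  have sub: "W \<subseteq> ?U" using elb_subset[OF L t(1)] .
  have "regular_on \<tau>' \<Lambda>' (V \<inter> V') (\<lambda>x. (\<lambda>y. t y / t' y) (g x))"
    by (rule toric_morphism_regular_on[OF equivariant_morphism_toric elb_transition[OF L t(1) t'(1)]]) (use t t' sub in auto)
  then show "regular_on \<tau>' \<Lambda>' (V \<inter> V') (\<lambda>x. s x / s' x)" by (simp add: t t')
  have "regular_on \<tau>' \<Lambda>' (V \<inter> {x \<in> ?U'. torus_act v x \<in> V'})
      (\<lambda>x. (\<lambda>y. snd L v y * t y / t' (torus_act v y)) (g x))"
    by (rule toric_morphism_regular_on[OF equivariant_morphism_toric elb_act_regular[OF L t(1) t'(1)]])
      (use t t' sub equivariant_morphism_act equivariant_morphism_in in auto)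
  then show "regular_on \<tau>' \<Lambda>' (V \<inter> {x \<in> ?U'. torus_act v x \<in> V'})
      (\<lambda>x. snd (pull_eq ?U' g L) v x * s x / s' (torus_act v x))"
    by (simp add: t t' snd_pull_eq equivariant_morphism_act)
  have "continuous_on {(v, x). x \<in> V \<and> torus_act v x \<in> V'} (\<lambda>p. (fst p, g (snd p)))"
    using g by (intro continuous_on_Pair continuous_on_fst continuous_on_id
        continuous_on_compose2[of UNIV g _ snd] continuous_on_snd)
      (auto simp: equivariant_morphism_def)
  moreover have "(\<lambda>p. (fst p, g (snd p))) ` {(v, x). x \<in> V \<and> torus_act v x \<in> V'} \<subseteq>
      {(v, x). x \<in> W \<and> torus_act v x \<in> W'}"
    using t t' equivariant_morphism_act by auto
  ultimately have "continuous_on {(v, x). x \<in> V \<and> torus_act v x \<in> V'}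
     (\<lambda>p. (\<lambda>(v, x). snd L v x * t x / t' (torus_act v x)) (fst p, g (snd p)))"
    by (rule continuous_on_compose2[OF elb_continuous[OF L t(1) t'(1)]])
  then show "continuous_on {(v, x). x \<in> V \<and> torus_act v x \<in> V'}
            (\<lambda>(v, x). snd (pull_eq ?U' g L) v x * s x / s' (torus_act v x))"
    by (simp add: t t' snd_pull_eq equivariant_morphism_act case_prod_unfold)
next
  fix V s assume "(V, s) \<in> fst (pull_eq (affine_toric \<tau>' \<Lambda>') g L)"
  then show "zariski_open \<tau>' \<Lambda>' V"
    unfolding fst_pull_eq using toric_morphism_zariski_open[OF equivariant_morphism_toric elb_open[OF L]] by blast
next
  fix V s x assume "(V, s) \<in> fst (pull_eq (affine_toric \<tau>' \<Lambda>') g L)" "x \<in> V"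
  then show "s x \<noteq> 0" unfolding fst_pull_eq using elb_nonzero[OF L] by auto
next
  fix x assume x: "x \<in> affine_toric \<tau>' \<Lambda>'"
  obtain V s where "(V, s) \<in> fst L" "g x \<in> V" using elb_cover[OF L equivariant_morphism_in[OF x]] by blast
  then show "\<exists>V s. (V, s) \<in> fst (pull_eq (affine_toric \<tau>' \<Lambda>') g L) \<and> x \<in> V"
    using pull_eqI x by blast
next
  fix v x assume "v \<in> \<Lambda>'" "x \<in> affine_toric \<tau>' \<Lambda>'"
  then show "snd (pull_eq (affine_toric \<tau>' \<Lambda>') g L) v x = 1"
    using g elb_act_lattice[OF L _ equivariant_morphism_in] by (auto simp: snd_pull_eq equivariant_morphism_def)
qed (auto simp: snd_pull_eq equivariant_morphism_in equivariant_morphism_act elb_act_nonzero[OF L] elb_act_add[OF L])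

lemma equivariant_iso_pull:
  assumes f: "equivariant_iso \<tau> \<Lambda> L L' f" and L: "equivariant_line_bundle \<tau> \<Lambda> L"
  shows "equivariant_iso \<tau>' \<Lambda>' (pull_eq (affine_toric \<tau>' \<Lambda>') g L)
           (pull_eq (affine_toric \<tau>' \<Lambda>') g L') (\<lambda>x. f (g x))"
proof (rule equivariant_isoI)
  let ?U' = "affine_toric \<tau>' \<Lambda>'"
  fix V s V' s' assume *: "(V, s) \<in> fst (pull_eq ?U' g L)" "(V', s') \<in> fst (pull_eq ?U' g L')"
  obtain W t where t: "(W, t) \<in> fst L" "V = {x \<in> ?U'. g x \<in> W}" "s = (\<lambda>x. t (g x))"
    using *(1) unfolding fst_pull_eq by blast
  obtain W' t' where t': "(W', t') \<in> fst L'" "V' = {x \<in> ?U'. g x \<in> W'}" "s' = (\<lambda>x. t' (g x))"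
    using *(2) unfolding fst_pull_eq by blast
  have "regular_on \<tau>' \<Lambda>' (V \<inter> V') (\<lambda>x. (\<lambda>y. f y * t y / t' y) (g x))"
    by (rule toric_morphism_regular_on[OF equivariant_morphism_toric equivariant_iso_regular[OF f t(1) t'(1)]])
      (use t t' elb_subset[OF L t(1)] in auto)
  then show "regular_on \<tau>' \<Lambda>' (V \<inter> V') (\<lambda>x. f (g x) * s x / s' x)" by (simp add: t t')
qed (auto simp: snd_pull_eq equivariant_morphism_in equivariant_morphism_act equivariant_iso_nonzero[OF f] equivariant_iso_act[OF f])

end

text \<open>Frames are functions on the whole type, so pull-backs along maps that agree only on the
  chart are isomorphic by the constant 1, but not equal.\<close>

lemma equivariant_iso_pull_cong:
  assumes L: "equivariant_line_bundle \<tau> \<Lambda> (pull_eq (affine_toric \<tau> \<Lambda>) g L)"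
    and eq: "\<And>x. x \<in> affine_toric \<tau> \<Lambda> \<Longrightarrow> g x = g' x"
  shows "equivariant_iso \<tau> \<Lambda> (pull_eq (affine_toric \<tau> \<Lambda>) g L) (pull_eq (affine_toric \<tau> \<Lambda>) g' L) (\<lambda>_. 1)"
proof (rule equivariant_isoI)
  let ?U = "affine_toric \<tau> \<Lambda>"
  fix V s V' s' assume *: "(V, s) \<in> fst (pull_eq ?U g L)" "(V', s') \<in> fst (pull_eq ?U g' L)"
  obtain W' t' where t': "(W', t') \<in> fst L" "V' = {x \<in> ?U. g' x \<in> W'}" "s' = (\<lambda>x. t' (g' x))"
    using *(2) unfolding fst_pull_eq by blast
  from elb_transition[OF L *(1) pull_eqI[OF t'(1)]]
  show "regular_on \<tau> \<Lambda> (V \<inter> V') (\<lambda>x. 1 * s x / s' x)"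
    by (rule regular_on_subset_cong) (use t' eq in auto)
qed (auto simp: snd_pull_eq eq)

section \<open>Holomorphic families\<close>

text \<open>Translation invariance of the mean over a circle, parametrized by the unit interval; it
  gives the transformation rule of \<open>h\<close> in \<open>h_circle\<close>.\<close>

lemma integral_periodic_shift:
  fixes F :: "real \<Rightarrow> complex"
  assumes F: "continuous_on UNIV F" and per: "\<And>t. F (t + 1) = F t" and s: "0 \<le> s" "s \<le> 1"
  shows "integral {0..1} (\<lambda>t. F (t + s)) = integral {0..1} F"
proof -
  have int: "F integrable_on {a..b}" for a b
    by (intro integrable_continuous_real continuous_on_subset[OF F]) auto
  have shift: "integral {a..b} (\<lambda>t. F (t + c)) = integral {a + c..b + c} F" for a b c
  proof -
    have "((\<lambda>t. F (1 *\<^sub>R t + c)) has_integral (1 / (\<bar>1\<bar> ^ DIM(real))) *\<^sub>R integral (cbox (a + c) (b + c)) F)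
      ((\<lambda>x. (1 / 1) *\<^sub>R x + -((1 / 1) *\<^sub>R c)) ` cbox (a + c) (b + c))"
      by (rule has_integral_affinity) (use int[of "a+c" "b+c"] in \<open>auto simp: cbox_interval has_integral_integral\<close>)
    moreover have "(\<lambda>x. x - c) ` {a + c..b + c} = {a..b}"
      using image_add_atLeastAtMost[of "-c" "a+c" "b+c"] by simp
    ultimately show ?thesis by (auto simp: cbox_interval intro!: integral_unique)
  qed
  have "integral {0..1} (\<lambda>t. F (t + s)) = integral {s..1 + s} F" by (simp add: shift)
  also have "\<dots> = integral {s..1} F + integral {1..1 + s} F"
    using s int by (intro Henstock_Kurzweil_Integration.integral_combine[symmetric]) auto
  also have "integral {1..1 + s} F = integral {0..s} F"
    using shift[of 0 s 1] per by (simp add: add.commute)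
  also have "integral {s..1} F + integral {0..s} F = integral {0..1} F"
    using s int Henstock_Kurzweil_Integration.integral_combine[of 0 s 1 F] by (simp add: add.commute)
  finally show ?thesis .
qed

text \<open>By Fubini the integral over the boundary of a triangle may be taken under the parameter
  integral, where Cauchy's theorem makes it vanish; Morera's theorem concludes.\<close>

lemma holomorphic_on_integral:
  fixes G :: "real \<Rightarrow> complex \<Rightarrow> complex"
  assumes hol: "\<And>t. t \<in> {0..1} \<Longrightarrow> G t holomorphic_on S" and S: "open S"
    and cont: "continuous_on ({0..1} \<times> S) (\<lambda>(t, z). G t z)"
  shows "(\<lambda>z. integral {0..1} (\<lambda>t. G t z)) holomorphic_on S"
proof -
  let ?H = "\<lambda>z. integral {0..1} (\<lambda>t. G t z)"
  have "continuous_on (S \<times> cbox 0 1) (\<lambda>(z, t). G t z)"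
  proof -
    have "continuous_on (S \<times> cbox 0 1) (\<lambda>p. (\<lambda>(t, z). G t z) (snd p, fst p :: complex))"
      by (rule continuous_on_compose2[OF cont]) (auto intro!: continuous_intros simp: cbox_interval)
    then show ?thesis by (simp add: case_prod_unfold)
  qed
  from integral_continuous_on_param[OF this] have contH: "continuous_on S ?H"
    by (simp add: cbox_interval)
  \<comment> \<open>The real parameter is read as the real part of a point on a segment, so that the
    interchange of two contour integrals applies.\<close>
  have H: "?H z = contour_integral (linepath 0 1) (\<lambda>w. G (Re w) z)" for z
    by (simp add: contour_integral_integral linepath_def vector_derivative_linepath_at)
  have swap: "contour_integral (linepath a b) ?H =
     contour_integral (linepath 0 1) (\<lambda>w. contour_integral (linepath a b) (G (Re w)))"
    if "closed_segment a b \<subseteq> S" for a b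
    unfolding H
  proof (rule contour_integral_swap)
    have "continuous_on (closed_segment a b \<times> closed_segment 0 1) (\<lambda>p. (Re (snd p), fst p))"
      by (intro continuous_intros)
    moreover have "(\<lambda>p. (Re (snd p), fst p)) ` (closed_segment a b \<times> closed_segment 0 1) \<subseteq> {0..1} \<times> S"
      using that by (auto simp: closed_segment_def)
    ultimately show "continuous_on (path_image (linepath a b) \<times> path_image (linepath 0 1))
     (\<lambda>(y1, y2). G (Re y2) y1)"
      using continuous_on_compose2[OF cont, of "closed_segment a b \<times> closed_segment 0 1" "\<lambda>p. (Re (snd p), fst p)"]
      by (simp add: case_prod_unfold)
  qed (auto intro!: continuous_intros simp: vector_derivative_linepath_at)
  have "?H analytic_on S"
  proof (rule Morera_triangle[OF contH S], rule impI)
    fix a b c assume abc: "convex hull {a, b, c} \<subseteq> S"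
    then have seg: "closed_segment a b \<subseteq> S" "closed_segment b c \<subseteq> S" "closed_segment c a \<subseteq> S"
      using order_trans[OF segments_subset_convex_hull(1) abc] order_trans[OF segments_subset_convex_hull(3) abc]
        order_trans[OF segments_subset_convex_hull(5) abc] by simp_all
    have ci: "G t contour_integrable_on linepath a' b'" if "t \<in> {0..1}" "closed_segment a' b' \<subseteq> S" for t a' b'
      using that hol by (intro contour_integrable_continuous_linepath continuous_on_subset[OF holomorphic_on_imp_continuous_on])
    have zero: "contour_integral (linepath a b) (G t) + contour_integral (linepath b c) (G t) +
        contour_integral (linepath c a) (G t) = 0" if "t \<in> {0..1}" for t
    proof -
      have "(G t has_contour_integral 0) (linepath a b +++ linepath b c +++ linepath c a)"
        by (rule Cauchy_theorem_triangle) (use hol[OF that] abc holomorphic_on_subset in blast)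
      from has_chain_integral_chain_integral3[OF this] show ?thesis by simp
    qed
    have cc: "continuous_on {0..1} (\<lambda>t. contour_integral (linepath a' b') (G t))"
      if seg: "closed_segment a' b' \<subseteq> S" for a' b'
    proof -
      have "continuous_on ({0..1} \<times> {0..1}) (\<lambda>p. (fst p, linepath a' b' (snd p)))"
        unfolding linepath_def by (intro continuous_intros)
      moreover have "(\<lambda>p. (fst p, linepath a' b' (snd p))) ` ({0..1} \<times> {0..1}) \<subseteq> {0..1} \<times> S"
        using seg linepath_in_path by fastforce
      ultimately have "continuous_on ({0..1} \<times> cbox 0 1) (\<lambda>(t, x). G t (linepath a' b' x) * (b' - a'))"
        using continuous_on_compose2[OF cont, of "{0..1} \<times> {0..1}" "\<lambda>p. (fst p, linepath a' b' (snd p))"]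
        by (auto simp: case_prod_unfold cbox_interval intro!: continuous_intros)
      from integral_continuous_on_param[OF this] show ?thesis
        by (simp add: contour_integral_integral cbox_interval)
    qed
    have I: "contour_integral (linepath a' b') ?H = integral {0..1} (\<lambda>t. contour_integral (linepath a' b') (G t))"
      if "closed_segment a' b' \<subseteq> S" for a' b'
    proof -
      have "linepath 0 1 t = complex_of_real t" for t by (simp add: linepath_def scaleR_conv_of_real)
      then show ?thesis
        unfolding swap[OF that] contour_integral_integral[of "linepath 0 1"]
        by (simp add: vector_derivative_linepath_at)
    qed
    have ii: "(\<lambda>t. contour_integral (linepath a' b') (G t)) integrable_on {0..1}"
      if "closed_segment a' b' \<subseteq> S" for a' b'
      by (intro integrable_continuous_real cc that)
    have "contour_integral (linepath a b) ?H + contour_integral (linepath b c) ?H + contour_integral (linepath c a) ?H =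
      integral {0..1} (\<lambda>t. contour_integral (linepath a b) (G t) + contour_integral (linepath b c) (G t) +
        contour_integral (linepath c a) (G t))"
      by (simp add: I seg ii integrable_add Henstock_Kurzweil_Integration.integral_add)
    also have "\<dots> = integral {0..1} (\<lambda>t::real. 0)"
      by (rule Henstock_Kurzweil_Integration.integral_cong) (use zero in auto)
    finally show "contour_integral (linepath a b) ?H + contour_integral (linepath b c) ?H + contour_integral (linepath c a) ?H = 0"
      by simp
  qed
  then show ?thesis by (rule analytic_imp_holomorphic)
qed

text \<open>Gaussian elimination: every pivot has finitely many zeros in the compact set.\<close>

lemma finite_dependent_parameters:
  fixes f :: "'i \<Rightarrow> complex \<Rightarrow> 'x \<Rightarrow> complex"
  assumes "finite I" and D: "open D" "connected D" "compact K" "K \<subseteq> D" "z\<^sub>0 \<in> D"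
    and "\<And>i x. i \<in> I \<Longrightarrow> x \<in> X \<Longrightarrow> (\<lambda>z. f i z x) holomorphic_on D"
    and "\<And>c. (\<forall>x\<in>X. (\<Sum>i\<in>I. c i * f i z\<^sub>0 x) = 0) \<Longrightarrow> \<forall>i\<in>I. c i = 0"
  shows "finite {z\<in>K. \<exists>c. (\<exists>i\<in>I. c i \<noteq> 0) \<and> (\<forall>x\<in>X. (\<Sum>i\<in>I. c i * f i z x) = 0)}"
  using assms(1,7,8)
proof (induction I arbitrary: f rule: finite_induct)
  case empty
  then show ?case by simp
next
  case (insert j I)
  have "\<exists>y\<in>X. f j z\<^sub>0 y \<noteq> 0"
  proof (rule ccontr)
    assume "\<not> ?thesis"
    then have "\<forall>x\<in>X. (\<Sum>i\<in>insert j I. (if i = j then 1 else 0) * f i z\<^sub>0 x) = 0"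
      using insert.hyps by (auto intro: sum.neutral)
    from insert.prems(2)[OF this] show False by simp
  qed
  then obtain y where y: "y \<in> X" "f j z\<^sub>0 y \<noteq> 0" by blast
  \<comment> \<open>Elimination of \<open>f j\<close> at the coordinate \<open>y\<close>.
    Multiplying by the pivot \<open>f j z y\<close> instead of dividing by it keeps everything
    holomorphic.\<close>
  define f' where "f' i z x = f i z x * f j z y - f i z y * f j z x" for i z x
  have eq: "(\<Sum>i\<in>I. c i * f' i z x) = (\<Sum>i\<in>I. c i * f i z x) * f j z y - (\<Sum>i\<in>I. c i * f i z y) * f j z x"
    for c z x
    by (simp add: f'_def right_diff_distrib sum_subtractf sum_distrib_left mult_ac)
  have fin1: "finite {z\<in>K. \<exists>c. (\<exists>i\<in>I. c i \<noteq> 0) \<and> (\<forall>x\<in>X. (\<Sum>i\<in>I. c i * f' i z x) = 0)}"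
  proof (rule insert.IH)
    show "(\<lambda>z. f' i z x) holomorphic_on D" if "i \<in> I" "x \<in> X" for i x
      unfolding f'_def using that y insert.prems(1) by (intro holomorphic_intros) auto
    fix c assume c: "\<forall>x\<in>X. (\<Sum>i\<in>I. c i * f' i z\<^sub>0 x) = 0"
    \<comment> \<open>The coefficient of \<open>j\<close> is the one that turns a relation among the
      eliminated functions at \<open>z\<^sub>0\<close> back into a relation among the original
      ones.\<close>
    define c' where "c' i = (if i = j then - (\<Sum>i\<in>I. c i * f i z\<^sub>0 y) else c i * f j z\<^sub>0 y)" for i
    have "(\<Sum>i\<in>insert j I. c' i * f i z\<^sub>0 x) = (\<Sum>i\<in>I. c i * f' i z\<^sub>0 x)" for x
    proof -
      have "(\<Sum>i\<in>I. c' i * f i z\<^sub>0 x) = (\<Sum>i\<in>I. c i * f i z\<^sub>0 x) * f j z\<^sub>0 y"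
        unfolding sum_distrib_right by (rule sum.cong) (use insert.hyps in \<open>auto simp: c'_def\<close>)
      then show ?thesis using insert.hyps by (simp add: eq c'_def)
    qed
    then have "\<forall>i\<in>insert j I. c' i = 0" using c by (intro insert.prems(2)) auto
    then show "\<forall>i\<in>I. c i = 0" using insert.hyps y by (auto simp: c'_def split: if_splits)
  qed
  \<comment> \<open>The pivot is nonzero at \<open>z\<^sub>0\<close>, so its zeros are isolated
    unless it is a nonzero constant.\<close>
  have fin2: "finite {z\<in>K. f j z y = 0}"
  proof (cases "(\<lambda>z. f j z y) constant_on D")
    case True
    then have "{z\<in>K. f j z y = 0} = {}" using y D unfolding constant_on_def by force
    then show ?thesis by (simp only: finite.emptyI)
  next
    case False
    then show ?thesis using D y insert.prems(1)
      by (intro holomorphic_compact_finite_zeros[of _ D]) auto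
  qed
  show ?case
  proof (rule finite_subset[OF _ finite_UnI[OF fin1 fin2]], rule subsetI)
    fix z assume "z \<in> {z\<in>K. \<exists>c. (\<exists>i\<in>insert j I. c i \<noteq> 0) \<and> (\<forall>x\<in>X. (\<Sum>i\<in>insert j I. c i * f i z x) = 0)}"
    then obtain c where z: "z \<in> K" and c: "\<forall>x\<in>X. (\<Sum>i\<in>insert j I. c i * f i z x) = 0"
      and i: "\<exists>i\<in>insert j I. c i \<noteq> 0" by blast
    \<comment> \<open>A relation survives elimination: if all other coefficients were zero,
      evaluation at \<open>y\<close> would make \<open>c j\<close> zero as well.\<close>
    have "\<exists>c. (\<exists>i\<in>I. c i \<noteq> 0) \<and> (\<forall>x\<in>X. (\<Sum>i\<in>I. c i * f' i z x) = 0)" if nz: "f j z y \<noteq> 0"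
    proof -
      have 1: "(\<Sum>i\<in>I. c i * f i z x) = - c j * f j z x" if "x \<in> X" for x
        using c that insert.hyps by (auto simp: add_eq_0_iff)
      then have "\<forall>x\<in>X. (\<Sum>i\<in>I. c i * f' i z x) = 0" using y by (simp add: eq)
      moreover have "\<exists>i\<in>I. c i \<noteq> 0"
      proof (rule ccontr)
        assume "\<not> ?thesis"
        then show False using 1[OF y(1)] nz i by auto
      qed
      ultimately show ?thesis by blast
    qed
    then show "z \<in> {z\<in>K. \<exists>c. (\<exists>i\<in>I. c i \<noteq> 0) \<and> (\<forall>x\<in>X. (\<Sum>i\<in>I. c i * f' i z x) = 0)} \<union>
        {z\<in>K. f j z y = 0}"
      using z by blast
  qed
qed

section \<open>Orders of vanishing, rotation invariance, continuous characters\<close>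

text \<open>A polynomial of size O(z^M) at 0 is divisible by z^M: letting z tend to 0 kills the
  constant term, and cancelling one factor z reduces M by one.\<close>

lemma poly_coeff_zero_if_small:
  fixes p :: "complex poly"
  assumes "\<And>z. 0 < norm z \<Longrightarrow> norm z \<le> 1 \<Longrightarrow> norm (poly p z) \<le> C * norm z ^ M" "j < M"
  shows "coeff p j = 0"
  using assms
proof (induction M arbitrary: p j)
  case 0
  then show ?case by simp
next
  case (Suc M)
  have ev: "eventually (\<lambda>z::complex. norm z < 1 \<and> z \<noteq> 0) (at 0)"
    by (auto simp: eventually_at dist_norm intro!: exI[of _ 1])
  have "(poly p \<longlongrightarrow> 0) (at 0)"
  proof (rule Lim_null_comparison)
    show "eventually (\<lambda>z. norm (poly p z) \<le> C * norm z ^ Suc M) (at 0)"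
      using ev by eventually_elim (rule Suc.prems(1), auto)
    show "((\<lambda>z::complex. C * norm z ^ Suc M) \<longlongrightarrow> 0) (at 0)"
      by (rule tendsto_eq_intros refl)+ auto
  qed
  moreover have "(poly p \<longlongrightarrow> poly p 0) (at 0)" by (intro tendsto_intros)
  ultimately have p0: "poly p 0 = 0" using LIM_unique by blast
  obtain a q where pq: "p = pCons a q" by (cases p)
  then have a: "a = 0" using p0 by simp
  show ?case
  proof (cases j)
    case 0
    then show ?thesis using a pq by simp
  next
    case (Suc i)
    have "coeff q i = 0"
    proof (rule Suc.IH)
      fix z :: complex assume z: "0 < norm z" "norm z \<le> 1"
      have "norm z * norm (poly q z) \<le> norm z * (C * norm z ^ M)"
        using Suc.prems(1)[OF z] by (simp add: pq a norm_mult algebra_simps)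
      then show "norm (poly q z) \<le> C * norm z ^ M" using z by (simp add: mult_le_cancel_left_pos)
    qed (use Suc Suc.prems in auto)
    then show ?thesis using pq Suc by simp
  qed
qed

text \<open>Several indices may share an exponent; collecting them gives a polynomial in
  \<open>z\<close>, and what vanishes is the total coefficient of each low degree. In the
  application \<open>e m\<close> is the degree of a monomial along one ray generator.\<close>

lemma sum_powers_zero_if_small:
  fixes c :: "'b \<Rightarrow> complex"
  assumes "finite A"
    and "\<And>z. 0 < norm z \<Longrightarrow> norm z \<le> 1 \<Longrightarrow> norm (\<Sum>m\<in>A. c m * z ^ e m) \<le> C * norm z ^ M" "j < M"
  shows "(\<Sum>m | m \<in> A \<and> e m = j. c m) = 0"
proof -
  define p where "p = (\<Sum>m\<in>A. monom (c m) (e m))"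
  have "poly p z = (\<Sum>m\<in>A. c m * z ^ e m)" for z by (simp add: p_def poly_sum poly_monom)
  then have "coeff p j = 0" using assms(2,3) by (intro poly_coeff_zero_if_small[of p C M]) auto
  moreover have "coeff p j = (\<Sum>m | m \<in> A \<and> e m = j. c m)"
    using assms(1) by (simp add: p_def coeff_sum sum.If_cases if_distrib Int_def conj_commute)
  ultimately show ?thesis by simp
qed

text \<open>The rotations sweep out the circle through \<open>z\<close>, on which \<open>K\<close>
  is therefore constant. The circle is connected with more than one point, so \<open>z\<close> is a
  limit point of it, and the identity theorem applies.\<close>

lemma rotation_invariant_imp_constant:
  assumes hol: "K holomorphic_on ball 0 r" and z: "z \<in> ball 0 r"
    and inv: "\<And>t w. 0 \<le> t \<Longrightarrow> t \<le> 1 \<Longrightarrow> w \<in> ball 0 r \<Longrightarrow> K (cis (2 * pi * t) * w) = K w"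
  shows "K z = K 0"
proof (cases "z = 0")
  case False
  have r: "norm z < r" using z by simp
  have K: "K w = K z" if "norm w = norm z" for w
  proof -
    define u where "u = w / z"
    have "norm u = 1" using that False by (simp add: u_def norm_divide)
    then obtain t where t: "0 \<le> t" "t < 2 * pi" "u = Complex (cos t) (sin t)"
      by (rule complex_unimodular_polar)
    then have "u = cis (2 * pi * (t / (2 * pi)))" by (simp add: cis.code)
    moreover have "0 \<le> t / (2 * pi)" "t / (2 * pi) \<le> 1" using t by auto
    ultimately have "K (u * z) = K z" using inv[of "t / (2*pi)" z] z by simp
    then show ?thesis using False by (simp add: u_def)
  qed
  have "(\<lambda>w. K w - K z) 0 = 0"
  proof (rule analytic_continuation[of "\<lambda>w. K w - K z" "ball 0 r" "sphere 0 (norm z)" z])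
    show "(\<lambda>w. K w - K z) holomorphic_on ball 0 r" by (intro holomorphic_intros hol)
    have "connected (sphere (0::complex) (norm z))" by (rule connected_sphere) simp
    moreover have "sphere (0::complex) (norm z) \<noteq> {x}" for x
    proof
      assume "sphere (0::complex) (norm z) = {x}"
      moreover have "z \<in> sphere 0 (norm z)" "- z \<in> sphere 0 (norm z)" by simp_all
      ultimately have "- z = x" "z = x" by blast+
      then have "- z = z" by simp
      then show False using False by simp
    qed
    ultimately show "z islimpt sphere 0 (norm z)"
      by (intro connected_imp_perfect) simp_all
    have "0 < r" using r norm_ge_zero[of z] by linarith
    then show "(0::complex) \<in> ball 0 r" by simp
    show "K w - K z = 0" if "w \<in> sphere 0 (norm z)" for w using that K[of w] by simp
  qed (use r in auto)
  then show ?thesis by simp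
qed auto

text \<open>A continuous logarithm \<open>k\<close> of \<open>f\<close> exists because the space is
  contractible. Its failure to be additive is a continuous function with values in 2 pi i times the
  integers, hence constant, and it is 0 at the origin. So \<open>k\<close> is additive and
  continuous, thus real linear. Its real part vanishes on \<open>G\<close>, where \<open>f\<close>
  is 1, hence everywhere.\<close>

lemma continuous_hom_is_character:
  fixes f :: "'a::euclidean_space \<Rightarrow> complex"
  assumes cont: "continuous_on UNIV f" and nz: "\<And>v. f v \<noteq> 0" and add: "\<And>u v. f (u + v) = f u * f v"
    and one: "\<And>v. v \<in> G \<Longrightarrow> f v = 1" and span: "span G = UNIV"
  obtains m where "linear m" "f = character m"
proof -
  obtain g where g: "continuous_on UNIV g" "\<And>v. f v = exp (g v)"
    using continuous_logarithm_on_contractible[OF cont] nz contractible_UNIV by (metis UNIV_I)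
  define k where "k v = g v - g 0" for v
  have f0: "f 0 = 1" using add[of 0 0] nz[of 0] by simp
  have fk: "f v = exp (k v)" for v
    using g(2)[of v] g(2)[of 0] f0 by (simp add: k_def exp_diff)
  have contk: "continuous_on UNIV k" unfolding k_def by (intro continuous_intros g)
  define d where "d p = k (fst p + snd p) - k (fst p) - k (snd p)" for p
  have contd: "continuous_on UNIV d"
    unfolding d_def by (intro continuous_intros continuous_on_compose2[OF contk]) auto
  have expd: "exp (d p) = 1" for p
    using add[of "fst p" "snd p"] nz by (simp add: d_def exp_diff fk[symmetric])
  have "d constant_on UNIV"
  proof (rule continuous_discrete_range_constant[OF connected_UNIV contd])
    fix p :: "'a \<times> 'a"
    show "\<exists>e>0. \<forall>q. q \<in> UNIV \<and> d q \<noteq> d p \<longrightarrow> e \<le> norm (d q - d p)"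
    proof (intro exI[of _ "2*pi"] conjI allI impI)
      fix q assume "q \<in> UNIV \<and> d q \<noteq> d p"
      then have ne: "d q - d p \<noteq> 0" by simp
      have "exp (d q - d p) = 1" by (simp add: exp_diff expd)
      then obtain n :: int where "Re (d q - d p) = 0" "Im (d q - d p) = of_int (2 * n) * pi"
        unfolding exp_eq_1 by blast
      then have n: "d q - d p = 2 * of_int n * pi * \<i>" by (simp add: complex_eq_iff)
      then have "n \<noteq> 0" using ne by auto
      then have "1 \<le> \<bar>real_of_int n\<bar>" by linarith
      then show "2 * pi \<le> norm (d q - d p)"
        by (simp add: n norm_mult)
    qed auto
  qed
  then have d0: "d p = 0" for p
    unfolding constant_on_def d_def k_def by (metis UNIV_I add.right_neutral cancel_comm_monoid_add_class.diff_cancel diff_self fst_conv snd_conv)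
  then have kadd: "k (u + v) = k u + k v" for u v using d0[of "(u, v)"] by (simp add: d_def algebra_simps)
  define n where "n v = Im (k v) / (2 * pi)" for v
  have lin: "linear (\<lambda>v. k v)"
  proof -
    have k0: "k 0 = 0" by (simp add: k_def)
    have kneg: "k (- v) = - k v" for v using kadd[of v "- v"] k0 by (simp add: add_eq_0_iff)
    have knat: "k (real n *\<^sub>R v) = real n *\<^sub>R k v" for n v
      by (induction n) (auto simp: k0 kadd scaleR_add_left)
    have kint: "k (real_of_int n *\<^sub>R v) = real_of_int n *\<^sub>R k v" for n v
      by (cases n rule: int_cases2) (auto simp: knat kneg)
    have krat: "k (t *\<^sub>R v) = t *\<^sub>R k v" if rat: "t \<in> \<rat>" for t v
    proof -
      obtain a b :: int where ab: "t = of_int a / of_int b" "b \<noteq> 0"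
        using rat by (cases rule: Rats_cases') auto
      have "real_of_int b *\<^sub>R k (t *\<^sub>R v) = real_of_int a *\<^sub>R k v"
        using kint[of b "t *\<^sub>R v"] kint[of a v] ab by simp
      then have "(1 / real_of_int b) *\<^sub>R real_of_int b *\<^sub>R k (t *\<^sub>R v) =
          (1 / real_of_int b) *\<^sub>R real_of_int a *\<^sub>R k v" by (simp only:)
      then show ?thesis using ab by simp
    qed
    \<comment> \<open>Homogeneity passes from rational to real scalars by continuity and
      density.\<close>
    have kr: "k (t *\<^sub>R v) - t *\<^sub>R k v = 0" for t v
    proof (rule continuous_constant_on_closure[of \<rat> "\<lambda>t. k (t *\<^sub>R v) - t *\<^sub>R k v"])
      show "continuous_on (closure \<rat>) (\<lambda>t. k (t *\<^sub>R v) - t *\<^sub>R k v)"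
        by (intro continuous_intros continuous_on_compose2[OF contk]) auto
    qed (auto simp: krat Rats_closure_real)
    show ?thesis
      by (rule linearI) (use kadd kr in auto)
  qed
  have Rek: "Re (k v) = 0" for v
  proof -
    have "linear (\<lambda>v. Re (k v))" using linear_compose[OF lin, of Re] by (simp add: o_def bounded_linear.linear[OF bounded_linear_Re])
    moreover have "Re (k v) = 0" if "v \<in> G" for v
      using one[OF that] fk[of v] by (metis exp_eq_1)
    ultimately show ?thesis using linear_eq_0_on_span[of "\<lambda>v. Re (k v)" G v] span by auto
  qed
  have "f v = character n v" for v
  proof -
    have "k v = \<i> * complex_of_real (2 * pi * n v)"
      using Rek[of v] by (simp add: n_def complex_eq_iff)
    then show ?thesis unfolding fk character_def cis_conv_exp by (simp only:)
  qed
  then have "f = character n" by blast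
  moreover have "linear n"
  proof -
    have "linear (\<lambda>v. Im (k v))" using linear_compose[OF lin, of Im] by (simp add: o_def bounded_linear.linear[OF bounded_linear_Im])
    then have "linear (\<lambda>v. (1 / (2*pi)) *\<^sub>R Im (k v))" by (rule linear_compose_scale_right)
    then show ?thesis by (simp add: n_def[abs_def])
  qed
  ultimately show ?thesis using that by blast
qed

section \<open>Triviality on a chart with a fixed point\<close>

text \<open>Otherwise some multiple of \<open>v\<close> would have the value 1/2.\<close>

lemma integer_valued_linear_zero:
  fixes m :: "'a::real_vector \<Rightarrow> real"
  assumes "linear m" "subspace S" "\<And>v. v \<in> S \<Longrightarrow> m v \<in> \<int>" "v \<in> S" shows "m v = 0"
proof (rule ccontr)
  assume nz: "m v \<noteq> 0"
  have half: "m ((1 / (2 * m v)) *\<^sub>R v) = 1/2" using nz by (simp add: linear_cmul[OF assms(1)])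
  then have "(1/2::real) \<in> \<int>" using assms(3)[OF subspace_scale[OF assms(2,4)], of "1 / (2 * m v)"] by (simp only: half)
  then show False by (auto elim!: Ints_cases simp: field_simps)
qed

lemma character_inj:
  assumes "linear m" "linear m'" "\<And>v. character m v = character m' v" shows "m = m'"
proof
  fix v
  have "character (\<lambda>v. m v - m' v) v = 1" for v by (simp add: character_diff_left assms(3))
  then have "(\<lambda>v. m v - m' v) v = 0"
    by (intro integer_valued_linear_zero[of _ UNIV] linear_compose_sub assms)
      (auto simp: character_eq_1_iff)
  then show "m v = m' v" by simp
qed

text \<open>The vectors in \<open>G\<close> generate the cone but possibly not the lattice, so that
  the orbifold chart and the chart with respect to \<open>N\<close> of a maximal cone are both
  covered, with the weighted ray generators as \<open>G\<close>.\<close>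

locale fixed_point_chart =
  fixes \<tau> \<Lambda> G :: "'a::euclidean_space set"
  assumes finite_G: "finite G" and G_lattice: "G \<subseteq> \<Lambda>" and span_G: "span G = UNIV"
    and cone: "\<tau> = convex_cone hull G"
begin

abbreviation "U \<equiv> affine_toric \<tau> \<Lambda>"
abbreviation "S \<equiv> cone_chars \<tau> \<Lambda>"

text \<open>An interior vector of the cone. Every nonzero character in \<open>S\<close> is positive
  on it, which makes its one-parameter subgroup contracting.\<close>

definition \<kappa> :: 'a where "\<kappa> = \<Sum>G"

text \<open>For \<open>\<nu>\<close> in \<open>insert \<kappa> G\<close> the flow of \<open>\<nu>\<close> is the action of the corresponding one-parameter subgroup,
  extended to the parameter 0.  The flow of \<open>\<kappa>\<close> contracts the chart to the fixed point as the
  parameter tends to 0.\<close>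

definition flow :: "'a \<Rightarrow> complex \<Rightarrow> 'a point \<Rightarrow> 'a point" where
  "flow \<nu> z x = (\<lambda>m. z ^ nat \<lfloor>m \<nu>\<rfloor> * x m)"

definition fixed_point :: "'a point" where
  "fixed_point = (\<lambda>m. if m = (\<lambda>_. 0) then 1 else 0)"

lemma S_iff: "m \<in> S \<longleftrightarrow> m \<in> dual_lattice \<Lambda> \<and> (\<forall>\<nu>\<in>G. 0 \<le> m \<nu>)"
proof
  assume "m \<in> S"
  then show "m \<in> dual_lattice \<Lambda> \<and> (\<forall>\<nu>\<in>G. 0 \<le> m \<nu>)"
    using hull_inc[of _ G convex_cone] by (auto simp: cone_chars_def cone)
next
  assume m: "m \<in> dual_lattice \<Lambda> \<and> (\<forall>\<nu>\<in>G. 0 \<le> m \<nu>)"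
  then have lin: "linear m" by (simp add: dual_lattice_def)
  have "convex_cone {v. 0 \<le> m v}"
    using lin by (auto simp: convex_cone_iff linear_add linear_cmul linear_0)
  then have "\<tau> \<subseteq> {v. 0 \<le> m v}" unfolding cone using m by (intro hull_minimal) auto
  then show "m \<in> S" using m by (auto simp: cone_chars_def)
qed

lemma deg_G:
  assumes "m \<in> S" "\<nu> \<in> G" shows "real (nat \<lfloor>m \<nu>\<rfloor>) = m \<nu>"
proof -
  have "m \<nu> \<in> \<int>" "0 \<le> m \<nu>" using assms G_lattice by (auto simp: S_iff dual_lattice_def)
  then show ?thesis by (auto elim!: Ints_cases)
qed

lemma \<kappa>_eq: "m \<in> S \<Longrightarrow> m \<kappa> = real (\<Sum>\<nu>\<in>G. nat \<lfloor>m \<nu>\<rfloor>)"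
  using cone_chars_linear[of m \<tau> \<Lambda>] by (simp add: \<kappa>_def linear_sum deg_G)

text \<open>The rounding in \<open>flow\<close> is exact on \<open>S\<close>, the only place where
  coordinates of points can be nonzero.\<close>

lemma deg:
  assumes "m \<in> S" "\<nu> \<in> insert \<kappa> G" shows "real (nat \<lfloor>m \<nu>\<rfloor>) = m \<nu>"
  using assms deg_G \<kappa>_eq[OF assms(1)] by (metis floor_of_nat insertE nat_int)

lemma deg_add:
  assumes "m \<in> S" "m' \<in> S" "\<nu> \<in> insert \<kappa> G"
  shows "nat \<lfloor>m \<nu> + m' \<nu>\<rfloor> = nat \<lfloor>m \<nu>\<rfloor> + nat \<lfloor>m' \<nu>\<rfloor>"
proof -
  have "m \<nu> + m' \<nu> = real (nat \<lfloor>m \<nu>\<rfloor> + nat \<lfloor>m' \<nu>\<rfloor>)" using deg assms by simp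
  then show ?thesis by (metis floor_of_nat nat_int)
qed

lemma eq_zero_if_G:
  assumes "linear m" "\<And>\<nu>. \<nu> \<in> G \<Longrightarrow> m \<nu> = 0" shows "m = (\<lambda>_. 0)"
  using linear_eq_0_on_span[OF assms(1), of G] assms(2) span_G by auto

lemma deg_\<kappa>_pos:
  assumes "m \<in> S" "m \<noteq> (\<lambda>_. 0)" shows "nat \<lfloor>m \<kappa>\<rfloor> > 0"
proof (rule ccontr)
  assume "\<not> ?thesis"
  then have "m \<kappa> = 0" using deg[of m \<kappa>] assms by simp
  then have "real (\<Sum>\<nu>\<in>G. nat \<lfloor>m \<nu>\<rfloor>) = 0" using \<kappa>_eq[OF assms(1)] by (simp only:)
  then have "(\<Sum>\<nu>\<in>G. nat \<lfloor>m \<nu>\<rfloor>) = 0" by (simp only: of_nat_eq_0_iff)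
  then have "m \<nu> = 0" if "\<nu> \<in> G" for \<nu> using deg_G[OF assms(1) that] finite_G that by simp
  then have "m = (\<lambda>_. 0)" using eq_zero_if_G cone_chars_linear[OF assms(1)] by blast
  then show False using assms by simp
qed

lemma flow_in: "x \<in> U \<Longrightarrow> \<nu> \<in> insert \<kappa> G \<Longrightarrow> flow \<nu> z x \<in> U"
  using deg_add by (auto simp: affine_toric_def flow_def power_add)

lemma flow_flow: "flow \<nu> z (flow \<nu> w x) = flow \<nu> (z * w) x"
  by (simp add: flow_def power_mult_distrib mult.assoc)

lemma flow_commute: "flow \<nu> z (flow \<nu>' w x) = flow \<nu>' w (flow \<nu> z x)"
  by (simp add: flow_def mult_ac)

lemma flow_1 [simp]: "flow \<nu> 1 x = x"
  by (simp add: flow_def)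

lemma flow_torus_act: "flow \<nu> z (torus_act v x) = torus_act v (flow \<nu> z x)"
  by (simp add: flow_def torus_act_def mult_ac)

text \<open>On the unit circle the flow is part of the torus action; the minus sign compensates the
  one in \<open>torus_act\<close>.\<close>

lemma flow_cis:
  assumes "x \<in> U" "\<nu> \<in> insert \<kappa> G"
  shows "flow \<nu> (cis (2 * pi * t)) x = torus_act (- (t *\<^sub>R \<nu>)) x"
proof
  fix m
  show "flow \<nu> (cis (2 * pi * t)) x m = torus_act (- (t *\<^sub>R \<nu>)) x m"
  proof (cases "m \<in> S")
    case True
    then have "m (t *\<^sub>R \<nu>) = t * real (nat \<lfloor>m \<nu>\<rfloor>)"
      using deg[OF True assms(2)] cone_chars_linear[OF True] by (simp add: linear_cmul)
    then show ?thesis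
      by (simp add: flow_def torus_act_def character_def Complex.DeMoivre mult_ac)
  qed (use assms in \<open>simp add: flow_def torus_act_def affine_toric_outside\<close>)
qed

lemma fixed_point_in [simp]: "fixed_point \<in> U"
proof -
  \<comment> \<open>\<open>S\<close> is pointed: two characters that are nonnegative on the spanning
    set \<open>G\<close> and add up to 0 are both 0.\<close>
  have zero: "m = (\<lambda>_. 0) \<and> m' = (\<lambda>_. 0)" if mm: "m \<in> S" "m' \<in> S" "(\<lambda>v. m v + m' v) = (\<lambda>_. 0)" for m m'
  proof -
    have "m \<nu> = 0 \<and> m' \<nu> = 0" if "\<nu> \<in> G" for \<nu>
    proof -
      have "m \<nu> + m' \<nu> = 0" using mm(3) by (rule fun_cong)
      moreover have "0 \<le> m \<nu>" "0 \<le> m' \<nu>" using mm(1,2) that by (auto simp: S_iff)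
      ultimately show ?thesis by linarith
    qed
    then show ?thesis using eq_zero_if_G[of m] eq_zero_if_G[of m'] cone_chars_linear[OF mm(1)]
        cone_chars_linear[OF mm(2)] by simp
  qed
  have "fixed_point (\<lambda>v. m v + m' v) = fixed_point m * fixed_point m'" if "m \<in> S" "m' \<in> S" for m m'
  proof -
    consider "m = (\<lambda>_. 0)" | "m' = (\<lambda>_. 0)" | "m \<noteq> (\<lambda>_. 0)" "m' \<noteq> (\<lambda>_. 0)" by argo
    then show ?thesis
    proof cases
      case 3
      then have "(\<lambda>v. m v + m' v) \<noteq> (\<lambda>_. 0)" using zero[OF that] by argo
      then show ?thesis unfolding fixed_point_def using 3 by (simp only: if_False mult_zero_left)
    qed (simp_all add: fixed_point_def)
  qed
  moreover have "fixed_point m = 0" if "m \<notin> S" for m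
    using that by (cases "m = (\<lambda>_. 0)") (simp_all add: fixed_point_def)
  ultimately show ?thesis by (simp add: affine_toric_def) (simp add: fixed_point_def)
qed

lemma flow_0: "x \<in> U \<Longrightarrow> flow \<kappa> 0 x = fixed_point"
proof
  fix m assume x: "x \<in> U"
  consider "m = (\<lambda>_. 0)" | "m \<in> S" "m \<noteq> (\<lambda>_. 0)" | "m \<notin> S" "m \<noteq> (\<lambda>_. 0)" by blast
  then show "flow \<kappa> 0 x m = fixed_point m"
  proof cases
    case 2
    then show ?thesis using deg_\<kappa>_pos[of m] by (simp add: flow_def fixed_point_def)
  qed (use x in \<open>auto simp: flow_def fixed_point_def affine_toric_zero affine_toric_outside\<close>)
qed

lemma torus_act_fixed_point [simp]: "torus_act v fixed_point = fixed_point"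
  by (auto simp: torus_act_def fixed_point_def)

lemma continuous_on_flow:
  "continuous_on A f \<Longrightarrow> continuous_on A (\<lambda>p. flow \<nu> (f p) x)"
  by (rule continuous_on_coordinatewise_then_product) (auto simp: flow_def intro!: continuous_intros)

lemma holomorphic_poly_fun_flow:
  assumes "poly_fun \<tau> \<Lambda> p" "x \<in> U" "\<nu> \<in> insert \<kappa> G"
  shows "(\<lambda>z. p (flow \<nu> z x)) holomorphic_on A"
proof -
  obtain A c where A: "finite A" "A \<subseteq> S" and p: "\<And>x. x \<in> U \<Longrightarrow> p x = (\<Sum>m\<in>A. c m * x m)"
    using assms(1) unfolding poly_fun_iff by blast
  have "(\<lambda>z. p (flow \<nu> z x)) = (\<lambda>z. \<Sum>m\<in>A. c m * (z ^ nat \<lfloor>m \<nu>\<rfloor> * x m))"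
    using p[OF flow_in[OF assms(2,3)]] by (simp add: flow_def)
  then show ?thesis by (auto intro!: holomorphic_intros)
qed

text \<open>Along a flow line a polynomial is an entire function of the parameter. The identity
  theorem carries its vanishing from near 0 to the parameter 1, which is the point
  \<open>x\<close>.\<close>

lemma poly_fun_eq_0_if_flow:
  assumes "poly_fun \<tau> \<Lambda> p" "x \<in> U" "\<delta> > 0" "\<And>z. norm z < \<delta> \<Longrightarrow> p (flow \<kappa> z x) = 0"
  shows "p x = 0"
proof -
  have "(\<lambda>z. p (flow \<kappa> z x)) 1 = (\<lambda>_. 0) 1"
  proof (rule analytic_continuation_open[of "ball 0 \<delta>" UNIV "\<lambda>z. p (flow \<kappa> z x)" "\<lambda>_. 0"])
    show "(\<lambda>z. p (flow \<kappa> z x)) holomorphic_on UNIV"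
      by (rule holomorphic_poly_fun_flow) (use assms in auto)
  qed (use assms in auto)
  then show ?thesis by simp
qed

text \<open>A character is determined by its integral values on the finite spanning set
  \<open>G\<close>. Countability feeds the pigeonhole argument of
  \<open>common_circle_support\<close>.\<close>

lemma countable_S: "countable S"
proof -
  have inj: "inj_on (\<lambda>m. restrict m G) (dual_lattice \<Lambda>)"
  proof (rule inj_onI)
    fix m m' assume *: "m \<in> dual_lattice \<Lambda>" "m' \<in> dual_lattice \<Lambda>" "restrict m G = restrict m' G"
    then have "m \<nu> = m' \<nu>" if "\<nu> \<in> G" for \<nu> by (metis restrict_apply' that)
    then have "(\<lambda>v. m v - m' v) = (\<lambda>_. 0)"
      using * by (intro eq_zero_if_G dual_latticeD[of _ \<Lambda>] dual_lattice_diff) auto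
    then show "m = m'" by (metis (no_types) eq_iff_diff_eq_0 ext)
  qed
  have "countable (\<int> :: real set)" by (simp add: Ints_def)
  then have "countable (\<Pi>\<^sub>E \<nu>\<in>G. (\<int> :: real set))" using finite_G by (intro countable_PiE)
  moreover have "(\<lambda>m. restrict m G) ` dual_lattice \<Lambda> \<subseteq> (\<Pi>\<^sub>E \<nu>\<in>G. \<int>)"
    using G_lattice by (auto simp: dual_lattice_def)
  ultimately have "countable ((\<lambda>m. restrict m G) ` dual_lattice \<Lambda>)" by (rule countable_subset[rotated])
  then have "countable (dual_lattice \<Lambda>)" using inj countable_image_inj_on by blast
  then show ?thesis by (rule countable_subset[rotated]) (auto simp: cone_chars_def)
qed

end

text \<open>The polynomial with support \<open>A\<close> and coefficients \<open>c\<close> defines a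
  principal open neighbourhood of the fixed point inside the domain of the frame. It is given by
  explicit data so that a torus-invariant neighbourhood can be described by bounds on finitely many
  monomials.\<close>

locale framed_chart = fixed_point_chart \<tau> \<Lambda> G for \<tau> \<Lambda> G :: "'a::euclidean_space set" +
  fixes L :: "('a, 'a point) eq_bundle" and V s A c
  assumes L: "equivariant_line_bundle \<tau> \<Lambda> L" and Vs: "(V, s) \<in> fst L"
    and A: "finite A" "A \<subseteq> cone_chars \<tau> \<Lambda>"
    and q_fixed_point: "(\<Sum>m\<in>A. c m * fixed_point m) \<noteq> 0"
    and q_V: "\<And>x. x \<in> affine_toric \<tau> \<Lambda> \<Longrightarrow> (\<Sum>m\<in>A. c m * x m) \<noteq> 0 \<Longrightarrow> x \<in> V"
begin

section \<open>An invariant neighbourhood of the fixed point\<close>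

definition q :: "'a point \<Rightarrow> complex" where "q x = (\<Sum>m\<in>A. c m * x m)"

lemma q_poly: "poly_fun \<tau> \<Lambda> q"
  unfolding q_def by (rule poly_fun_sum_monomials[OF A])

text \<open>Small enough that on \<open>B\<close> the distance of \<open>q\<close> from its value at
  the fixed point is less than the modulus of that value, so that \<open>q\<close> has no zero
  there. The summand 1 keeps the denominator positive and the estimate strict.\<close>

definition \<epsilon> :: real where "\<epsilon> = norm (q fixed_point) / (1 + (\<Sum>m\<in>A. norm (c m)))"

text \<open>Only moduli of monomials are bounded, which makes the set invariant under the compact
  torus and under flows with parameter in the closed unit disc.\<close>

definition B :: "'a point set" where "B = {x \<in> U. \<forall>m\<in>A. m \<noteq> (\<lambda>_. 0) \<longrightarrow> norm (x m) < \<epsilon>}"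

text \<open>Each of these points lies at parameter 1/2 of a flow line that stays in \<open>B\<close>
  over the closed unit disc. This leaves room for analytic continuation from the parameter
  0.\<close>

definition B' :: "'a point set" where "B' = flow \<kappa> (1/2) ` B"

lemma \<epsilon>_pos: "\<epsilon> > 0"
proof -
  have "0 < 1 + (\<Sum>m\<in>A. norm (c m))" by (intro add_pos_nonneg sum_nonneg) auto
  then show ?thesis using q_fixed_point by (simp add: \<epsilon>_def q_def)
qed

lemma B_U: "x \<in> B \<Longrightarrow> x \<in> U"
  by (simp add: B_def)

lemma B_V: assumes "x \<in> B" shows "x \<in> V"
proof -
  have x: "x \<in> U" using assms B_U by blast
  have "norm (q x - q fixed_point) = norm (\<Sum>m\<in>A. c m * (x m - fixed_point m))"
    by (simp add: q_def sum_subtractf right_diff_distrib)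
  also have "\<dots> \<le> (\<Sum>m\<in>A. norm (c m) * \<epsilon>)"
  proof (rule sum_norm_le)
    fix m assume m: "m \<in> A"
    have "norm (x m - fixed_point m) \<le> \<epsilon>"
      using assms m \<epsilon>_pos by (cases "m = (\<lambda>_. 0)") (auto simp: B_def fixed_point_def affine_toric_zero)
    then show "norm (c m * (x m - fixed_point m)) \<le> norm (c m) * \<epsilon>"
      by (simp add: norm_mult mult_left_mono)
  qed
  also have "\<dots> = (\<Sum>m\<in>A. norm (c m)) * \<epsilon>" by (simp add: sum_distrib_right)
  also have "\<dots> < (1 + (\<Sum>m\<in>A. norm (c m))) * \<epsilon>" using \<epsilon>_pos by (simp add: algebra_simps)
  also have "\<dots> = norm (q fixed_point)"
  proof -
    have "0 < 1 + (\<Sum>m\<in>A. norm (c m))" by (intro add_pos_nonneg sum_nonneg) auto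
    then show ?thesis by (simp add: \<epsilon>_def)
  qed
  finally have "q x \<noteq> 0" by auto
  then show ?thesis using q_V x by (simp add: q_def)
qed

lemma B_act: "x \<in> B \<Longrightarrow> torus_act v x \<in> B"
  using torus_act_in[of x \<tau> \<Lambda> v] by (simp add: B_def) (simp add: torus_act_def character_def norm_mult)

lemma B_flow:
  assumes "x \<in> B" "\<nu> \<in> insert \<kappa> G" "norm z \<le> 1" shows "flow \<nu> z x \<in> B"
proof -
  have "norm (flow \<nu> z x m) \<le> norm (x m)" for m
    using assms(3) by (simp add: flow_def norm_mult norm_power mult_left_le_one_le power_le_one)
  then show ?thesis
    using assms flow_in[of x \<nu> z] unfolding B_def mem_Collect_eq
    by (meson le_less_trans)
qed

lemma fixed_point_B [simp]: "fixed_point \<in> B"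
  using \<epsilon>_pos by (simp add: B_def) (simp add: fixed_point_def)

lemma B_small:
  assumes x: "x \<in> U" shows "\<exists>\<delta>>0. \<forall>z. norm z < \<delta> \<longrightarrow> flow \<kappa> z x \<in> B"
proof -
  define C where "C = 1 + (\<Sum>m\<in>A. norm (x m))"
  have C: "C > 0" unfolding C_def by (intro add_pos_nonneg sum_nonneg) auto
  show ?thesis
  \<comment> \<open>A nonconstant monomial has positive degree along \<open>\<kappa>\<close>. With
    the modulus of \<open>z\<close> at most 1, a single factor \<open>z\<close> already scales its
    value, bounded by \<open>C\<close>, below \<open>\<epsilon>\<close>.\<close>
  proof (intro exI[of _ "min 1 (\<epsilon> / C)"] conjI allI impI)
    show "0 < min 1 (\<epsilon> / C)" using \<epsilon>_pos C by simp
    fix z :: complex assume z: "norm z < min 1 (\<epsilon> / C)"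
    have "norm (flow \<kappa> z x m) < \<epsilon>" if "m \<in> A" "m \<noteq> (\<lambda>_. 0)" for m
    proof -
      have "m \<in> S" using that(1) A(2) by (rule rev_subsetD)
      then have "nat \<lfloor>m \<kappa>\<rfloor> > 0" using that(2) by (rule deg_\<kappa>_pos)
      then obtain k where k: "nat \<lfloor>m \<kappa>\<rfloor> = Suc k" using gr0_implies_Suc by metis
      have xC: "norm (x m) < C"
        unfolding C_def using member_le_sum[of m A "\<lambda>m. norm (x m)"] A(1) that by simp
      have "norm (flow \<kappa> z x m) = norm z * (norm z ^ k * norm (x m))"
        by (simp add: flow_def k norm_mult norm_power)
      also have "\<dots> \<le> norm z * norm (x m)"
        using z by (intro mult_left_mono mult_left_le_one_le power_le_one) auto
      also have "\<dots> \<le> norm z * C" using xC by (intro mult_left_mono) auto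
      also have "\<dots> < \<epsilon>" using z C by (simp add: field_simps)
      finally show ?thesis .
    qed
    then show "flow \<kappa> z x \<in> B" using flow_in[OF x, of \<kappa> z] by (simp add: B_def)
  qed
qed

lemma B'_B: "x \<in> B' \<Longrightarrow> x \<in> B"
  using B_flow by (auto simp: B'_def)

lemma B'_U: "x \<in> B' \<Longrightarrow> x \<in> U"
  using B'_B B_U by blast

lemma B'_act: "x \<in> B' \<Longrightarrow> torus_act v x \<in> B'"
  unfolding B'_def using B_act by (auto simp: flow_torus_act[symmetric])

lemma B'_flow: "x \<in> B' \<Longrightarrow> \<nu> \<in> insert \<kappa> G \<Longrightarrow> norm z \<le> 1 \<Longrightarrow> flow \<nu> z x \<in> B'"
  unfolding B'_def using B_flow flow_commute by fastforce

lemma B'_small: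
  assumes x: "x \<in> U" shows "\<exists>\<delta>>0. \<forall>z. norm z < \<delta> \<longrightarrow> flow \<kappa> z x \<in> B'"
proof -
  obtain \<delta> where \<delta>: "\<delta> > 0" "\<And>z. norm z < \<delta> \<Longrightarrow> flow \<kappa> z x \<in> B" using B_small[OF x] by blast
  show ?thesis
  \<comment> \<open>Half the radius, because \<open>B'\<close> arises from \<open>B\<close> by the
    factor 1/2 in the parameter.\<close>
  proof (intro exI[of _ "\<delta> / 2"] conjI allI impI)
    fix z :: complex assume "norm z < \<delta> / 2"
    then have "flow \<kappa> (2 * z) x \<in> B" by (intro \<delta>) (simp add: norm_mult)
    then have "flow \<kappa> (1/2) (flow \<kappa> (2 * z) x) \<in> B'" unfolding B'_def by (rule imageI)
    then show "flow \<kappa> z x \<in> B'" by (simp add: flow_flow)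
  qed (use \<delta> in auto)
qed

text \<open>Every point flows into \<open>B'\<close>, so vanishing there propagates backwards along
  flow lines: \<open>B'\<close> is Zariski dense.\<close>

lemma poly_fun_eq_0_if_B':
  assumes "poly_fun \<tau> \<Lambda> p" "\<And>x. x \<in> B' \<Longrightarrow> p x = 0" "x \<in> U" shows "p x = 0"
proof -
  obtain \<delta> where "\<delta> > 0" "\<And>z. norm z < \<delta> \<Longrightarrow> flow \<kappa> z x \<in> B'" using B'_small[OF assms(3)] by blast
  then show ?thesis using assms by (intro poly_fun_eq_0_if_flow[of p x \<delta>]) auto
qed

text \<open>A relation between monomials extends from \<open>B'\<close> to the chart and becomes one
  between characters on the orbit of the unit point.\<close>

lemma coeffs_zero_if_B':
  assumes "finite D" "D \<subseteq> S" "\<And>x. x \<in> B' \<Longrightarrow> (\<Sum>m\<in>D. d m * x m) = 0" "m \<in> D" shows "d m = 0"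
proof (rule characters_independent[of D d, OF assms(1) _ _ assms(4)])
  fix v
  have "(\<Sum>m\<in>D. d m * torus_act v (unit_point \<tau> \<Lambda>) m) = 0"
    using poly_fun_eq_0_if_B'[OF poly_fun_sum_monomials[OF assms(1,2)] assms(3) torus_act_in[OF unit_point_in]] .
  then show "(\<Sum>m\<in>D. d m * character m (- v)) = 0"
    using assms(2) by (simp add: torus_act_def unit_point_def subset_iff)
next
  show "linear m'" if "m' \<in> D" for m'
    using cone_chars_linear[OF rev_subsetD[OF that assms(2)]] .
qed

text \<open>The identity theorem along flow lines: the parameter 1/2 lies inside the disc on which
  \<open>F\<close> is holomorphic and near whose centre it vanishes.\<close>

lemma zero_on_B':
  assumes hol: "\<And>y. y \<in> B \<Longrightarrow> (\<lambda>z. F (flow \<kappa> z y)) holomorphic_on ball 0 1"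
    and zero: "\<And>y. y \<in> B \<Longrightarrow> \<exists>\<delta>>0. \<forall>z. norm z < \<delta> \<longrightarrow> F (flow \<kappa> z y) = 0"
    and x: "x \<in> B'"
  shows "F x = 0"
proof -
  obtain y where y: "y \<in> B" "x = flow \<kappa> (1/2) y" using x by (auto simp: B'_def)
  obtain \<delta> where \<delta>: "\<delta> > 0" "\<And>z. norm z < \<delta> \<Longrightarrow> F (flow \<kappa> z y) = 0" using zero[OF y(1)] by blast
  have "(\<lambda>z. F (flow \<kappa> z y)) (1/2) = (\<lambda>_. 0) (1/2)"
    by (rule analytic_continuation_open[of "ball 0 (min \<delta> 1)" "ball 0 1" "\<lambda>z. F (flow \<kappa> z y)" "\<lambda>_. 0"])
      (use \<delta> hol[OF y(1)] in auto)
  then show ?thesis using y by simp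
qed

section \<open>The cocycle of the action in a frame\<close>

text \<open>The fixed point does not move, so the cocycle rule makes this a homomorphism. It becomes
  the character of the trivialization.\<close>

definition fib :: "'a \<Rightarrow> complex" where "fib v = snd L v fixed_point"

text \<open>The action in the frame \<open>s\<close>, normalized by the character of the fibre at the fixed point.  A function
  \<open>h\<close> with \<open>h (v x) g v x = h x\<close> makes \<open>s / h\<close> a section of that weight.\<close>

definition g :: "'a \<Rightarrow> 'a point \<Rightarrow> complex" where
  "g v x = snd L v x * s x / (s (torus_act v x) * fib v)"

lemma fib_nonzero [simp]: "fib v \<noteq> 0"
  by (simp add: fib_def elb_act_nonzero[OF L])

lemma fib_add: "fib (u + v) = fib u * fib v"
  using elb_act_add[OF L fixed_point_in, of u v] by (simp add: fib_def)

lemma fib_lattice: "v \<in> \<Lambda> \<Longrightarrow> fib v = 1"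
  by (simp add: fib_def elb_act_lattice[OF L])

lemma s_nonzero: "x \<in> V \<Longrightarrow> s x \<noteq> 0"
  by (rule elb_nonzero[OF L Vs])

lemma V_U: "x \<in> V \<Longrightarrow> x \<in> U"
  using elb_subset[OF L Vs] by blast

lemma continuous_fib: "continuous_on UNIV fib"
proof -
  have "continuous_on UNIV (\<lambda>v. (\<lambda>(v, x). snd L v x * s x / s (torus_act v x)) (v, fixed_point))"
    by (rule continuous_on_compose2[OF elb_continuous[OF L Vs Vs]])
      (auto intro!: continuous_intros simp: B_V)
  then show ?thesis using s_nonzero[OF B_V[OF fixed_point_B]] by (simp add: fib_def[abs_def])
qed

lemma fib_character:
  obtains m where "m \<in> dual_lattice \<Lambda>" "fib = character m"
proof -
  obtain m where m: "linear m" "fib = character m"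
    using continuous_hom_is_character[OF continuous_fib fib_nonzero fib_add _ span_G] fib_lattice G_lattice
    by blast
  then have "m v \<in> \<int>" if "v \<in> \<Lambda>" for v using fib_lattice[OF that] by (simp add: character_eq_1_iff)
  then show ?thesis using m that by (auto simp: dual_lattice_def)
qed

lemma g_add: "x \<in> B \<Longrightarrow> g (v + u) x = g v (torus_act u x) * g u x"
  using s_nonzero[OF B_V[OF B_act]]
  by (simp add: g_def torus_act_add[OF B_U] elb_act_add[OF L B_U] fib_add)

lemma g_fixed_point [simp]: "g v fixed_point = 1"
  using s_nonzero[OF B_V[OF fixed_point_B]] by (simp add: g_def fib_def[symmetric])

text \<open>The locale provides only the membership of each generator in \<open>\<Lambda>\<close>,
  so the trivial action of their sum \<open>\<kappa>\<close> is assembled by the cocycle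
  rule.\<close>

lemma snd_L_sum: "finite D \<Longrightarrow> D \<subseteq> \<Lambda> \<Longrightarrow> x \<in> U \<Longrightarrow> snd L (\<Sum>D) x = 1"
proof (induction D rule: finite_induct)
  case empty
  have "snd L 0 x = snd L 0 x * snd L 0 x"
    using elb_act_add[OF L empty(2), of 0 0] torus_act_zero[OF empty(2)] by simp
  then show ?case using elb_act_nonzero[OF L empty(2), of 0] by simp
next
  case (insert v D)
  then show ?case using elb_act_add[OF L insert.prems(2), of v "\<Sum>D"]
    by (simp add: elb_act_lattice[OF L] torus_act_in)
qed

text \<open>\<open>\<kappa>\<close> acts trivially on points and on fibres, so the cocycle along the
  circle has period 1, as averaging requires.\<close>

lemma g_period: assumes "x \<in> B" shows "g (v - \<kappa>) x = g v x"
proof -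
  have 1: "g \<kappa> y = 1" if "y \<in> B" for y
  proof -
    have "flow \<kappa> (cis (2 * pi * (-1))) y = torus_act \<kappa> y" using flow_cis[of y \<kappa> "-1"] B_U[OF that] by simp
    moreover have "cis (2 * pi * (-1)) = 1" by (rule cis_multiple_2pi) simp
    ultimately have "torus_act \<kappa> y = y" by simp
    moreover have "snd L \<kappa> y = 1" "fib \<kappa> = 1"
      using snd_L_sum[OF finite_G G_lattice] B_U[OF that] by (auto simp: \<kappa>_def fib_def)
    ultimately show ?thesis using s_nonzero[OF B_V[OF that]] by (simp add: g_def)
  qed
  have "\<kappa> + (v - \<kappa>) = v" by simp
  then show ?thesis
    using g_add[OF assms, of \<kappa> "v - \<kappa>"] 1[OF B_act[OF assms]] by (simp only: mult_1)
qed

lemma continuous_g: "continuous_on (UNIV \<times> B) (\<lambda>(v, x). g v x)"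
proof -
  have "continuous_on (UNIV \<times> B) (\<lambda>p. (case p of (v, x) \<Rightarrow> snd L v x * s x / s (torus_act v x)) / fib (fst p))"
    by (intro continuous_on_divide continuous_on_subset[OF elb_continuous[OF L Vs Vs]]
        continuous_on_compose2[OF continuous_fib] continuous_on_fst continuous_on_id)
      (auto simp: B_V B_act)
  then show ?thesis by (rule continuous_on_eq) (auto simp: g_def)
qed

lemma g_local:
  assumes "x \<in> V" "torus_act v x \<in> V"
  obtains p r where "poly_fun \<tau> \<Lambda> p" "poly_fun \<tau> \<Lambda> r" "r x \<noteq> 0"
    "\<And>y. y \<in> V \<Longrightarrow> torus_act v y \<in> V \<Longrightarrow> r y \<noteq> 0 \<Longrightarrow> g v y = p y / r y"
proof -
  have x: "x \<in> V \<inter> {x \<in> U. torus_act v x \<in> V}" using assms V_U by blast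
  obtain p r where pr: "poly_fun \<tau> \<Lambda> p" "poly_fun \<tau> \<Lambda> r" "r x \<noteq> 0"
    "\<And>y. y \<in> V \<inter> {x \<in> U. torus_act v x \<in> V} \<Longrightarrow> r y \<noteq> 0 \<Longrightarrow>
       snd L v y * s y / s (torus_act v y) = p y / r y"
    by (rule regular_onE[OF elb_act_regular[OF L Vs Vs] _ x]) (use V_U in auto)
  show ?thesis
  proof (rule that[of "\<lambda>x. inverse (fib v) * p x" r])
    fix y assume y: "y \<in> V" "torus_act v y \<in> V" "r y \<noteq> 0"
    have "g v y = snd L v y * s y / s (torus_act v y) / fib v" by (simp add: g_def)
    also have "\<dots> = p y / r y / fib v" using pr(4)[of y] y V_U by simp
    finally show "g v y = inverse (fib v) * p y / r y" by (simp add: field_simps)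
  qed (use pr in \<open>auto intro!: poly_fun_mult poly_fun_const\<close>)
qed

text \<open>For fixed \<open>v\<close> the cocycle is locally a quotient of polynomial functions,
  and these are entire along the flow.\<close>

lemma holomorphic_g:
  assumes y: "y \<in> B" shows "(\<lambda>z. g v (flow \<kappa> z y)) holomorphic_on ball 0 1"
  unfolding holomorphic_on_def
proof
  fix z0 :: complex assume z0: "z0 \<in> ball 0 1"
  have inB: "flow \<kappa> z y \<in> B" if "z \<in> ball 0 1" for z using B_flow[OF y, of \<kappa> z] that by simp
  obtain p r where pr: "poly_fun \<tau> \<Lambda> p" "poly_fun \<tau> \<Lambda> r" "r (flow \<kappa> z0 y) \<noteq> 0"
    "\<And>x. x \<in> V \<Longrightarrow> torus_act v x \<in> V \<Longrightarrow> r x \<noteq> 0 \<Longrightarrow> g v x = p x / r x"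
    using g_local[of "flow \<kappa> z0 y" v] B_V inB[OF z0] B_act by metis
  define W where "W = {z \<in> ball 0 1. r (flow \<kappa> z y) \<noteq> 0}"
  have holr: "(\<lambda>z. r (flow \<kappa> z y)) holomorphic_on T" "(\<lambda>z. p (flow \<kappa> z y)) holomorphic_on T" for T
    using holomorphic_poly_fun_flow pr(1,2) B_U[OF y] by auto
  have "open W"
    unfolding W_def using continuous_open_preimage[OF holomorphic_on_imp_continuous_on[OF holr(1)[of "ball 0 1"]], of "-{0}"]
    by (auto simp: vimage_def Int_def)
  moreover have "(\<lambda>z. g v (flow \<kappa> z y)) holomorphic_on W"
  proof (rule holomorphic_transform)
    show "(\<lambda>z. p (flow \<kappa> z y) / r (flow \<kappa> z y)) holomorphic_on W"
      by (intro holomorphic_intros holr) (auto simp: W_def)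
  qed (use pr(4) inB B_V B_act in \<open>auto simp: W_def\<close>)
  moreover have "z0 \<in> W" using z0 pr(3) by (simp add: W_def)
  ultimately have "(\<lambda>z. g v (flow \<kappa> z y)) field_differentiable (at z0)"
    using holomorphic_on_imp_differentiable_at by blast
  then show "(\<lambda>z. g v (flow \<kappa> z y)) field_differentiable (at z0 within ball 0 1)"
    by (rule field_differentiable_at_within)
qed

lemma nonzero_near:
  fixes F :: "complex \<Rightarrow> complex"
  assumes "F holomorphic_on ball 0 1" "F 0 \<noteq> 0"
  shows "\<exists>\<delta>>0. \<delta> \<le> 1 \<and> (\<forall>z. norm z < \<delta> \<longrightarrow> F z \<noteq> 0)"
proof -
  have "continuous (at 0) F"
    using assms(1) by (meson centre_in_ball continuous_on_eq_continuous_at holomorphic_on_imp_continuous_on open_ball zero_less_one)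
  then obtain \<delta> where "\<delta> > 0" "\<And>z. dist 0 z < \<delta> \<Longrightarrow> F z \<noteq> 0"
    using continuous_at_avoid[of 0 F 0] assms(2) by auto
  then show ?thesis by (intro exI[of _ "min \<delta> 1"]) (auto simp: dist_norm)
qed

text \<open>A quotient representation at the fixed point holds near the fixed point along every flow
  line. With the denominator cleared, the identity theorem extends it to all of
  \<open>B'\<close>.\<close>

lemma g_ratio:
  obtains p r where "poly_fun \<tau> \<Lambda> p" "poly_fun \<tau> \<Lambda> r" "r fixed_point \<noteq> 0" "p fixed_point \<noteq> 0"
    "\<forall>x\<in>B'. r x * g v x = p x"
proof -
  obtain p r where pr: "poly_fun \<tau> \<Lambda> p" "poly_fun \<tau> \<Lambda> r" "r fixed_point \<noteq> 0"
    "\<And>x. x \<in> V \<Longrightarrow> torus_act v x \<in> V \<Longrightarrow> r x \<noteq> 0 \<Longrightarrow> g v x = p x / r x"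
    using g_local[of fixed_point v] B_V[OF fixed_point_B] by (metis torus_act_fixed_point)
  show ?thesis
  proof (rule that[OF pr(1-3)], goal_cases)
    case 1
    \<comment> \<open>The normalized cocycle is 1 at the fixed point, so numerator and denominator
      have the same nonzero value there.\<close>
    show ?case using pr(4)[of fixed_point] pr(3) B_V[OF fixed_point_B] by auto
  next
    case 2
    show ?case
    proof
    fix x assume x: "x \<in> B'"
    have "(\<lambda>x. r x * g v x - p x) x = 0"
    proof (rule zero_on_B'[OF _ _ x])
      fix y assume y: "y \<in> B"
      have yU: "y \<in> U" using B_U[OF y] .
      show "(\<lambda>z. r (flow \<kappa> z y) * g v (flow \<kappa> z y) - p (flow \<kappa> z y)) holomorphic_on ball 0 1"
        by (intro holomorphic_intros holomorphic_g[OF y] holomorphic_poly_fun_flow pr yU) auto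
      obtain \<delta> where \<delta>: "\<delta> > 0" "\<delta> \<le> 1" "\<And>z. norm z < \<delta> \<Longrightarrow> r (flow \<kappa> z y) \<noteq> 0"
        using nonzero_near[of "\<lambda>z. r (flow \<kappa> z y)"] holomorphic_poly_fun_flow[OF pr(2) yU, of \<kappa> "ball 0 1"]
          pr(3) flow_0[OF yU] by auto
      show "\<exists>\<delta>>0. \<forall>z. norm z < \<delta> \<longrightarrow> r (flow \<kappa> z y) * g v (flow \<kappa> z y) - p (flow \<kappa> z y) = 0"
      proof (intro exI[of _ \<delta>] conjI allI impI)
        fix z :: complex assume z: "norm z < \<delta>"
        then have "flow \<kappa> z y \<in> B" using \<delta> by (intro B_flow[OF y]) auto
        then show "r (flow \<kappa> z y) * g v (flow \<kappa> z y) - p (flow \<kappa> z y) = 0"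
          using pr(4)[OF B_V B_V[OF B_act]] \<delta>(3)[OF z] by simp
      qed (rule \<delta>)
    qed
    then show "r x * g v x = p x" by simp
    qed
  qed
qed

text \<open>Averaging over the circle of \<open>\<kappa>\<close> gives such an \<open>h\<close> at first for the elements of this circle only.
  The cocycle \<open>h (v x) g v x / h x\<close> is then invariant under the circle and holomorphic along the
  flow of \<open>\<kappa>\<close>, hence constant along the flow and equal to its value 1 at the fixed point.\<close>

definition h :: "'a point \<Rightarrow> complex" where
  "h x = integral {0..1} (\<lambda>t. g (- (t *\<^sub>R \<kappa>)) x)"

lemma continuous_g_circle:
  assumes "x \<in> B" shows "continuous_on T (\<lambda>t. g (- (t *\<^sub>R \<kappa>)) x)"
proof -
  have "continuous_on T (\<lambda>t. (\<lambda>(v, x). g v x) (- (t *\<^sub>R \<kappa>), x))"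
    by (rule continuous_on_compose2[OF continuous_g]) (use assms in \<open>auto intro!: continuous_intros\<close>)
  then show ?thesis by simp
qed

lemma continuous_g_flow:
  assumes "x \<in> B" "\<nu> \<in> insert \<kappa> G"
  shows "continuous_on ({0..1} \<times> cball 0 1) (\<lambda>(t, z). g (- (t *\<^sub>R \<kappa>)) (flow \<nu> z x))"
proof -
  have "continuous_on ({0..1} \<times> cball 0 1) (\<lambda>p. (\<lambda>(v, x). g v x) (- (fst p *\<^sub>R \<kappa>), flow \<nu> (snd p) x))"
    by (rule continuous_on_compose2[OF continuous_g])
      (use assms B_flow in \<open>auto intro!: continuous_intros continuous_on_flow\<close>)
  then show ?thesis by (simp add: case_prod_unfold)
qed

text \<open>By the cocycle rule the factor moves under the integral as a shift of the parameter, and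
  periodicity absorbs the shift.\<close>

lemma h_circle:
  assumes x: "x \<in> B" and t: "0 \<le> t" "t \<le> 1"
  shows "h (torus_act (- (t *\<^sub>R \<kappa>)) x) * g (- (t *\<^sub>R \<kappa>)) x = h x"
proof -
  have "h (torus_act (- (t *\<^sub>R \<kappa>)) x) * g (- (t *\<^sub>R \<kappa>)) x =
     integral {0..1} (\<lambda>t'. g (- (t' *\<^sub>R \<kappa>)) (torus_act (- (t *\<^sub>R \<kappa>)) x) * g (- (t *\<^sub>R \<kappa>)) x)"
    unfolding h_def by (rule Henstock_Kurzweil_Integration.integral_mult_left[symmetric])
  also have "\<dots> = integral {0..1} (\<lambda>t'. g (- ((t' + t) *\<^sub>R \<kappa>)) x)"
    by (simp only: g_add[OF x, symmetric] scaleR_add_left minus_add_distrib)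
  also have "\<dots> = integral {0..1} (\<lambda>t'. g (- (t' *\<^sub>R \<kappa>)) x)"
  proof (rule integral_periodic_shift[of "\<lambda>t'. g (- (t' *\<^sub>R \<kappa>)) x"])
    show "g (- ((t' + 1) *\<^sub>R \<kappa>)) x = g (- (t' *\<^sub>R \<kappa>)) x" for t'
      using g_period[OF x, of "- (t' *\<^sub>R \<kappa>)"] by (simp add: scaleR_add_left)
  qed (use continuous_g_circle[OF x] t in auto)
  finally show ?thesis by (simp add: h_def)
qed

lemma h_fixed_point [simp]: "h fixed_point = 1"
  by (simp add: h_def)

lemma holomorphic_h:
  assumes y: "y \<in> B" shows "(\<lambda>z. h (flow \<kappa> z y)) holomorphic_on ball 0 1"
  unfolding h_def
  by (rule holomorphic_on_integral)
    (use holomorphic_g[OF y] in \<open>auto intro!: continuous_on_subset[OF continuous_g_flow[OF y]]\<close>)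

text \<open>The integrand is continuous on the compact product of circle and disc. For the flow of a
  single generator only this bound is established, and \<open>h_regular\<close> makes do with
  it.\<close>

lemma h_bounded:
  assumes y: "y \<in> B" and \<nu>: "\<nu> \<in> insert \<kappa> G"
  shows "\<exists>C. \<forall>z. norm z \<le> 1 \<longrightarrow> norm (h (flow \<nu> z y)) \<le> C"
proof -
  have "compact ((\<lambda>(t, z). g (- (t *\<^sub>R \<kappa>)) (flow \<nu> z y)) ` ({0..1} \<times> cball 0 1))"
    by (intro compact_continuous_image continuous_g_flow[OF y \<nu>] compact_Times) auto
  then obtain C where C: "\<forall>w \<in> (\<lambda>(t, z). g (- (t *\<^sub>R \<kappa>)) (flow \<nu> z y)) ` ({0..1} \<times> cball 0 1). norm w \<le> C"
    using compact_imp_bounded bounded_iff by metis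
  have "norm (h (flow \<nu> z y)) \<le> C" if "norm z \<le> 1" for z
  proof -
    have "norm (h (flow \<nu> z y)) \<le> C * (1 - 0)"
      unfolding h_def
    proof (rule integral_bound)
      show "norm (g (- (t *\<^sub>R \<kappa>)) (flow \<nu> z y)) \<le> C" if "t \<in> {0..1}" for t
        using C that \<open>norm z \<le> 1\<close> by force
    qed (use continuous_g_circle[OF B_flow[OF y \<nu> that]] in auto)
    then show ?thesis by simp
  qed
  then show ?thesis by blast
qed

lemma h_act:
  assumes x: "x \<in> B'" shows "h (torus_act u x) * g u x = h x"
proof -
  have "(\<lambda>x. h (torus_act u x) * g u x - h x) x = 0"
  proof (rule zero_on_B'[OF _ _ x])
    fix y assume y: "y \<in> B"
    have yU: "y \<in> U" using B_U[OF y] .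
    define H1 where "H1 z = h (torus_act u (flow \<kappa> z y)) * g u (flow \<kappa> z y)" for z
    define H2 where "H2 z = h (flow \<kappa> z y)" for z
    have hol1: "H1 holomorphic_on ball 0 1"
      unfolding H1_def using holomorphic_h[OF B_act[OF y, of u]]
      by (intro holomorphic_intros holomorphic_g[OF y]) (simp add: flow_torus_act)
    have hol2: "H2 holomorphic_on ball 0 1"
      unfolding H2_def by (rule holomorphic_h[OF y])
    show "(\<lambda>z. h (torus_act u (flow \<kappa> z y)) * g u (flow \<kappa> z y) - h (flow \<kappa> z y)) holomorphic_on ball 0 1"
      using holomorphic_on_diff[OF hol1 hol2] by (simp add: H1_def H2_def)
    have H0: "H1 0 = 1" "H2 0 = 1" by (simp_all add: H1_def H2_def flow_0[OF yU])
    \<comment> \<open>Rotation divides \<open>H1\<close> and \<open>H2\<close> by the same factor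
      \<open>g \<omega> x\<close>. The invariance of their quotient is stated in product form
      because \<open>H2\<close> may have zeros away from the fixed point.\<close>
    have rot: "H1 (cis (2 * pi * t) * z) * H2 z = H1 z * H2 (cis (2 * pi * t) * z)"
      if t: "0 \<le> t" "t \<le> 1" and z: "norm z < 1" for t z
    proof -
      define x where "x = flow \<kappa> z y"
      define \<omega> where "\<omega> = - (t *\<^sub>R \<kappa>)"
      have xB: "x \<in> B" unfolding x_def by (rule B_flow[OF y]) (use z in auto)
      have fl: "flow \<kappa> (cis (2 * pi * t) * z) y = torus_act \<omega> x"
        using flow_cis[of x \<kappa> t] B_U[OF xB] by (simp add: flow_flow[symmetric] x_def \<omega>_def)
      have 1: "h (torus_act \<omega> x) * g \<omega> x = h x" using h_circle[OF xB t] by (simp add: \<omega>_def)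
      have 2: "h (torus_act \<omega> (torus_act u x)) * g \<omega> (torus_act u x) = h (torus_act u x)"
        using h_circle[OF B_act[OF xB] t] by (simp add: \<omega>_def)
      have comm: "torus_act \<omega> (torus_act u x) = torus_act u (torus_act \<omega> x)"
        using torus_act_add[OF B_U[OF xB], of \<omega> u] torus_act_add[OF B_U[OF xB], of u \<omega>]
        by (simp add: add.commute)
      \<comment> \<open>The torus is commutative, so the cocycle of the sum of \<open>u\<close> and
        \<open>\<omega>\<close> can be expanded in both orders.\<close>
      have 3: "g u (torus_act \<omega> x) * g \<omega> x = g \<omega> (torus_act u x) * g u x"
        using g_add[OF xB, of u \<omega>] g_add[OF xB, of \<omega> u] by (simp add: add.commute)
      have "h (torus_act u (torus_act \<omega> x)) * g u (torus_act \<omega> x) * g \<omega> x = h (torus_act u x) * g u x"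
        using 2 3 by (metis comm mult.assoc)
      then have 4: "H1 (cis (2 * pi * t) * z) * g \<omega> x = H1 z"
        by (simp only: H1_def fl x_def[symmetric])
      have 5: "H2 (cis (2 * pi * t) * z) * g \<omega> x = H2 z" by (simp only: H2_def fl x_def[symmetric] 1)
      show ?thesis unfolding 4[symmetric] 5[symmetric] by (simp add: mult_ac)
    qed
    obtain \<delta> where \<delta>: "\<delta> > 0" "\<delta> \<le> 1" "\<And>z. norm z < \<delta> \<Longrightarrow> H2 z \<noteq> 0"
      using nonzero_near[OF hol2] H0 by auto
    have "H1 z = H2 z" if z: "norm z < \<delta>" for z
    proof -
      have "(\<lambda>z. H1 z / H2 z) z = (\<lambda>z. H1 z / H2 z) 0"
      proof (rule rotation_invariant_imp_constant)
        show "(\<lambda>z. H1 z / H2 z) holomorphic_on ball 0 \<delta>"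
          using \<delta> by (intro holomorphic_on_divide holomorphic_on_subset[OF hol1] holomorphic_on_subset[OF hol2]) auto
        show "z \<in> ball 0 \<delta>" using z by simp
        fix t :: real and w :: complex assume t: "0 \<le> t" "t \<le> 1" and w: "w \<in> ball 0 \<delta>"
        have "norm (cis (2 * pi * t) * w) < \<delta>" using w by (simp add: norm_mult)
        then have nz: "H2 (cis (2 * pi * t) * w) \<noteq> 0" "H2 w \<noteq> 0" using w \<delta>(3) by auto
        have "norm w < 1" using w \<delta>(2) by simp
        from rot[OF t this] show "H1 (cis (2 * pi * t) * w) / H2 (cis (2 * pi * t) * w) = H1 w / H2 w"
          using nz by (simp add: frac_eq_eq)
      qed
      then show ?thesis using \<delta>(3)[OF z] by (simp add: H0)
    qed
    then show "\<exists>\<delta>>0. \<forall>z. norm z < \<delta> \<longrightarrow> h (torus_act u (flow \<kappa> z y)) * g u (flow \<kappa> z y) - h (flow \<kappa> z y) = 0"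
      using \<delta>(1) unfolding H1_def H2_def by auto
  qed
  then show ?thesis by simp
qed

section \<open>Rationality of the averaged function\<close>

text \<open>Padding with zero coefficients puts numerator and denominator on one finite support
  \<open>D\<close>, the datum to be shared by many elements of the circle. The denominator is
  nonzero because its value at the fixed point is.\<close>

lemma circle_ratio:
  obtains D a b where "finite D" "D \<subseteq> S" "\<exists>m\<in>D. a m \<noteq> 0"
    "\<forall>x\<in>B'. (\<Sum>m\<in>D. a m * x m) * g v x = (\<Sum>m\<in>D. b m * x m)"
proof -
  obtain p r where pr: "poly_fun \<tau> \<Lambda> p" "poly_fun \<tau> \<Lambda> r" "r fixed_point \<noteq> 0" "p fixed_point \<noteq> 0"
    "\<forall>x\<in>B'. r x * g v x = p x"
    by (rule g_ratio[of v])
  obtain D1 a where D1: "finite D1" "D1 \<subseteq> S" "\<And>x. x \<in> U \<Longrightarrow> r x = (\<Sum>m\<in>D1. a m * x m)"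
    using pr(2) unfolding poly_fun_iff by blast
  obtain D2 b where D2: "finite D2" "D2 \<subseteq> S" "\<And>x. x \<in> U \<Longrightarrow> p x = (\<Sum>m\<in>D2. b m * x m)"
    using pr(1) unfolding poly_fun_iff by blast
  define a' where "a' m = (if m \<in> D1 then a m else 0)" for m
  define b' where "b' m = (if m \<in> D2 then b m else 0)" for m
  have ra: "(\<Sum>m\<in>D1 \<union> D2. a' m * x m) = r x" if "x \<in> U" for x
    unfolding D1(3)[OF that]
    by (rule sum.mono_neutral_cong_right) (use D1 D2 in \<open>auto simp: a'_def\<close>)
  have pb: "(\<Sum>m\<in>D1 \<union> D2. b' m * x m) = p x" if "x \<in> U" for x
    unfolding D2(3)[OF that]
    by (rule sum.mono_neutral_cong_right) (use D1 D2 in \<open>auto simp: b'_def\<close>)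
  have "\<exists>m\<in>D1 \<union> D2. a' m \<noteq> 0"
  proof (rule ccontr)
    assume "\<not> ?thesis"
    then have "(\<Sum>m\<in>D1 \<union> D2. a' m * fixed_point m) = 0" by (intro sum.neutral) simp
    then show False using ra[OF fixed_point_in] pr(3) by simp
  qed
  then show ?thesis
    using D1(1,2) D2(1,2) ra pb pr(5) B'_U by (intro that[of "D1 \<union> D2" a' b']) simp_all
qed

text \<open>If each finite support served only finitely many \<open>t\<close>, the interval would be
  a countable union of finite sets. The interval is half-open so that distinct \<open>t\<close> give
  distinct points of the circle in \<open>h_quotient\<close>.\<close>

lemma common_circle_support:
  obtains D where "finite D" "D \<subseteq> S"
    "infinite {t \<in> {0..<1}. \<exists>a b. (\<exists>m\<in>D. a m \<noteq> 0) \<and>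
       (\<forall>x\<in>B'. (\<Sum>m\<in>D. a m * x m) * g (- (t *\<^sub>R \<kappa>)) x = (\<Sum>m\<in>D. b m * x m))}"
proof -
  define good where "good D t \<longleftrightarrow> (\<exists>a b. (\<exists>m\<in>D. a m \<noteq> 0) \<and>
       (\<forall>x\<in>B'. (\<Sum>m\<in>D. a m * x m) * g (- (t *\<^sub>R \<kappa>)) x = (\<Sum>m\<in>D. b m * x m)))" for D t
  have ex: "\<exists>D. D \<in> {D. finite D \<and> D \<subseteq> S} \<and> good D t" for t :: real
  proof -
    obtain D a b where "finite D" "D \<subseteq> S" "\<exists>m\<in>D. a m \<noteq> 0"
      "\<forall>x\<in>B'. (\<Sum>m\<in>D. a m * x m) * g (- (t *\<^sub>R \<kappa>)) x = (\<Sum>m\<in>D. b m * x m)"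
      by (rule circle_ratio[of "- (t *\<^sub>R \<kappa>)"])
    then show ?thesis unfolding good_def by blast
  qed
  have "\<exists>D\<in>{D. finite D \<and> D \<subseteq> S}. infinite {t \<in> {0..<1}. good D t}"
  proof (rule ccontr)
    assume "\<not> ?thesis"
    then have "countable (\<Union>D\<in>{D. finite D \<and> D \<subseteq> S}. {t \<in> {0..<1}. good D t})"
      by (intro countable_UN countable_Collect_finite_subset countable_S) (auto intro: countable_finite)
    moreover have "{0..<1::real} \<subseteq> (\<Union>D\<in>{D. finite D \<and> D \<subseteq> S}. {t \<in> {0..<1}. good D t})"
    proof
      fix t :: real assume t: "t \<in> {0..<1}"
      obtain D where "D \<in> {D. finite D \<and> D \<subseteq> S}" "good D t" using ex[of t] by (elim exE conjE)
      then show "t \<in> (\<Union>D\<in>{D. finite D \<and> D \<subseteq> S}. {t \<in> {0..<1}. good D t})"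
        using t by (intro UN_I[of D]) simp_all
    qed
    ultimately have "countable {0..<1::real}" by (rule countable_subset[rotated])
    then show False using uncountable_half_open_interval_1[of 0 "1::real"] by simp
  qed
  then show ?thesis using that unfolding good_def by blast
qed

lemma h_quotient:
  obtains D a b where "finite D" "D \<subseteq> S" "\<exists>m\<in>D. a m \<noteq> 0"
    "\<forall>x\<in>B'. (\<Sum>m\<in>D. a m * x m) * h x = (\<Sum>m\<in>D. b m * x m)"
proof -
  obtain D where D: "finite D" "D \<subseteq> S" and
    inf: "infinite {t \<in> {0..<1}. \<exists>a b. (\<exists>m\<in>D. a m \<noteq> 0) \<and>
       (\<forall>x\<in>B'. (\<Sum>m\<in>D. a m * x m) * g (- (t *\<^sub>R \<kappa>)) x = (\<Sum>m\<in>D. b m * x m))}" (is "infinite ?T")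
    by (rule common_circle_support)
  \<comment> \<open>With \<open>x\<close> at parameter 1/2 of the flow line of \<open>y\<close>, the
    family consists of the monomials of \<open>x\<close> times \<open>h x\<close>, and of the same
    monomials times \<open>h\<close> at the point flowed from \<open>x\<close> by \<open>z\<close>.
    Only the second kind depends on \<open>z\<close>.\<close>
  define f :: "(('a \<Rightarrow> real) \<times> bool) \<Rightarrow> complex \<Rightarrow> 'a point \<Rightarrow> complex" where
    "f i z y = flow \<kappa> (1/2) y (fst i) * (if snd i then h (flow \<kappa> (z/2) y) else h (flow \<kappa> (1/2) y))" for i z y
  let ?I = "D \<times> (UNIV :: bool set)"
  have split: "(\<Sum>i\<in>?I. k i * f i z y) =
      (\<Sum>m\<in>D. k (m, False) * flow \<kappa> (1/2) y m) * h (flow \<kappa> (1/2) y) +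
      (\<Sum>m\<in>D. k (m, True) * flow \<kappa> (1/2) y m) * h (flow \<kappa> (z/2) y)" for k z y
  proof -
    have "(\<Sum>i\<in>?I. k i * f i z y) = (\<Sum>m\<in>D. k (m, False) * f (m, False) z y + k (m, True) * f (m, True) z y)"
      using sum.cartesian_product[of "\<lambda>m c. k (m, c) * f (m, c) z y" UNIV D]
      by (simp add: UNIV_bool add.commute case_prod_unfold)
    then show ?thesis by (simp add: f_def sum.distrib sum_distrib_right mult.assoc)
  qed
  \<comment> \<open>Starting the flow at \<open>y\<close> and halving the parameter gives holomorphy
    on the disc of radius 2, whose interior contains the unit circle.\<close>
  have holf: "(\<lambda>z. f i z y) holomorphic_on ball 0 2" if "y \<in> B" for i y
  proof (cases "snd i")
    case True
    have "(\<lambda>z. h (flow \<kappa> z y)) \<circ> (\<lambda>z. z / 2) holomorphic_on ball 0 2"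
      by (rule holomorphic_on_compose_gen[OF _ holomorphic_h[OF that]])
        (auto intro!: holomorphic_intros simp: norm_divide)
    then show ?thesis using True by (auto simp: f_def o_def intro!: holomorphic_intros)
  qed (auto simp: f_def)
  \<comment> \<open>Multiplying the relation for \<open>g\<close> by \<open>h\<close> at the rotated
    point and applying \<open>h_circle\<close> yields a dependence at this parameter.\<close>
  have dep: "cis (2 * pi * t) \<in> {z \<in> cball 0 1. \<exists>k. (\<exists>i\<in>?I. k i \<noteq> 0) \<and> (\<forall>y\<in>B. (\<Sum>i\<in>?I. k i * f i z y) = 0)}"
    if t: "t \<in> ?T" for t
  proof -
    obtain a b where ab: "\<exists>m\<in>D. a m \<noteq> 0"
      "\<And>x. x \<in> B' \<Longrightarrow> (\<Sum>m\<in>D. a m * x m) * g (- (t *\<^sub>R \<kappa>)) x = (\<Sum>m\<in>D. b m * x m)"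
      using t by blast
    define k where "k i = (if snd i then - b (fst i) else a (fst i))" for i :: "('a \<Rightarrow> real) \<times> bool"
    have "(\<Sum>i\<in>?I. k i * f i (cis (2 * pi * t)) y) = 0" if y: "y \<in> B" for y
    proof -
      define x where "x = flow \<kappa> (1/2) y"
      have x: "x \<in> B'" using y by (simp add: x_def B'_def)
      have "flow \<kappa> (cis (2 * pi * t) / 2) y = torus_act (- (t *\<^sub>R \<kappa>)) x"
        using flow_cis[OF B'_U[OF x], of \<kappa> t] by (simp add: x_def flow_flow)
      then have "(\<Sum>i\<in>?I. k i * f i (cis (2 * pi * t)) y) =
        (\<Sum>m\<in>D. a m * x m) * h x - (\<Sum>m\<in>D. b m * x m) * h (torus_act (- (t *\<^sub>R \<kappa>)) x)"
        unfolding split by (simp add: k_def x_def[symmetric] sum_negf)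
      also have "\<dots> = 0"
        using h_circle[OF B'_B[OF x], of t] t ab(2)[OF x, symmetric] by (simp add: mult_ac)
      finally show ?thesis .
    qed
    moreover have "\<exists>i\<in>?I. k i \<noteq> 0" using ab(1) by (force simp: k_def)
    ultimately show ?thesis by auto
  qed
  \<comment> \<open>Independence at 0 would leave only finitely many dependent parameters in the
    closed unit disc, against infinitely many on the circle.\<close>
  have "\<exists>k. (\<exists>i\<in>?I. k i \<noteq> 0) \<and> (\<forall>y\<in>B. (\<Sum>i\<in>?I. k i * f i 0 y) = 0)"
  proof (rule ccontr)
    assume no: "\<not> ?thesis"
    have "finite {z \<in> cball 0 1. \<exists>k. (\<exists>i\<in>?I. k i \<noteq> 0) \<and> (\<forall>y\<in>B. (\<Sum>i\<in>?I. k i * f i z y) = 0)}"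
    proof (rule finite_dependent_parameters[of ?I "ball 0 2" "cball 0 1" 0 B f])
      show "\<forall>i\<in>?I. k i = 0" if "\<forall>y\<in>B. (\<Sum>i\<in>?I. k i * f i 0 y) = 0" for k
        using no that by (meson bexI)
    qed (use D(1) holf in auto)
    then have "finite ((\<lambda>t. cis (2 * pi * t)) ` ?T)"
      by (rule finite_subset[rotated]) (use dep in blast)
    moreover have "inj_on (\<lambda>t. cis (2 * pi * t)) ?T"
    proof (rule inj_onI)
      fix t t' :: real assume *: "t \<in> ?T" "t' \<in> ?T" "cis (2 * pi * t) = cis (2 * pi * t')"
      then have "cis (2 * pi * t - 2 * pi * t') = 1" by (simp flip: cis_divide)
      \<comment> \<open>The criterion for the value 1 of a character is applied to a constant
        function.\<close>
      then have "character (\<lambda>_. t - t') (0::'a) = 1" by (simp add: character_def right_diff_distrib)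
      then have "t - t' \<in> \<int>" unfolding character_eq_1_iff .
      moreover have "\<bar>t - t'\<bar> < 1" using * by auto
      ultimately have "t - t' = 0" using Ints_nonzero_abs_less1 by blast
      then show "t = t'" by simp
    qed
    ultimately show False using inf finite_imageD by blast
  qed
  then obtain k where k: "\<exists>i\<in>?I. k i \<noteq> 0" "\<And>y. y \<in> B \<Longrightarrow> (\<Sum>i\<in>?I. k i * f i 0 y) = 0" by blast
  define a where "a m = k (m, False)" for m
  define b where "b m = - k (m, True)" for m
  \<comment> \<open>At parameter 0 the moving point is the fixed point, where \<open>h\<close> is 1,
    so the second kind of functions has become plain monomials.\<close>
  have eq: "(\<Sum>m\<in>D. a m * x m) * h x = (\<Sum>m\<in>D. b m * x m)" if "x \<in> B'" for x
  proof -
    obtain y where y: "y \<in> B" "x = flow \<kappa> (1/2) y" using \<open>x \<in> B'\<close> by (auto simp: B'_def)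
    show ?thesis using k(2)[OF y(1)] unfolding split
      by (simp add: a_def b_def y(2)[symmetric] flow_0[OF B_U[OF y(1)]] sum_negf add_eq_0_iff)
  qed
  \<comment> \<open>Without a denominator the numerator would vanish on \<open>B'\<close>, hence
    have zero coefficients, and the whole relation would be trivial.\<close>
  have "\<exists>m\<in>D. a m \<noteq> 0"
  proof (rule ccontr)
    assume "\<not> ?thesis"
    then have a0: "a m = 0" if "m \<in> D" for m using that by blast
    have "(\<Sum>m\<in>D. b m * x m) = 0" if "x \<in> B'" for x
      using eq[OF that] by (simp add: a0)
    then have b0: "b m = 0" if "m \<in> D" for m using coeffs_zero_if_B'[OF D _ that] by blast
    obtain m c where "m \<in> D" "k (m, c) \<noteq> 0" using k(1) by auto
    then show False using a0[of m] b0[of m] by (cases c) (auto simp: a_def b_def)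
  qed
  then show ?thesis using that D eq by blast
qed

text \<open>The denominators of \<open>h\<close>, up to factors that are nonzero at the fixed point,
  are stable under the torus: by \<open>h_act\<close> a translation changes \<open>h\<close> by
  \<open>g\<close>, which by \<open>g_ratio\<close> is a quotient of polynomials nonzero there. So
  \<open>monomial_by_torus_stability\<close> shrinks the denominator to a single monomial.\<close>

lemma h_monomial_quotient:
  obtains m\<^sub>0 P Q where "m\<^sub>0 \<in> S" "poly_fun \<tau> \<Lambda> P" "poly_fun \<tau> \<Lambda> Q" "Q fixed_point \<noteq> 0"
    "\<forall>x\<in>B'. x m\<^sub>0 * h x * Q x = P x"
proof -
  obtain D a b where D: "finite D" "D \<subseteq> S" and a: "\<exists>m\<in>D. a m \<noteq> 0" and
    eq: "\<forall>x\<in>B'. (\<Sum>m\<in>D. a m * x m) * h x = (\<Sum>m\<in>D. b m * x m)"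
    by (rule h_quotient)
  obtain m\<^sub>0 where m0: "m\<^sub>0 \<in> D" "a m\<^sub>0 \<noteq> 0" using a by blast
  define R where "R c \<longleftrightarrow> (\<exists>P Q. poly_fun \<tau> \<Lambda> P \<and> poly_fun \<tau> \<Lambda> Q \<and> Q fixed_point \<noteq> 0 \<and>
     (\<forall>x\<in>B'. (\<Sum>m\<in>D. c m * x m) * h x * Q x = P x))" for c
  have "\<exists>d. d \<noteq> 0 \<and> R (\<lambda>m. if m = m\<^sub>0 then d else 0)"
  proof (rule monomial_by_torus_stability[of R "\<lambda>m. if m \<in> D then a m else 0"])
    fix c v k assume "R c"
    then obtain P Q where PQ: "poly_fun \<tau> \<Lambda> P" "poly_fun \<tau> \<Lambda> Q" "Q fixed_point \<noteq> 0"
      "\<And>x. x \<in> B' \<Longrightarrow> (\<Sum>m\<in>D. c m * x m) * h x * Q x = P x" unfolding R_def by blast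
    obtain p r where pr: "poly_fun \<tau> \<Lambda> p" "poly_fun \<tau> \<Lambda> r" "r fixed_point \<noteq> 0" "p fixed_point \<noteq> 0"
      "\<forall>x\<in>B'. r x * g v x = p x"
      by (rule g_ratio[of v])
    note tm = toric_morphism_poly_fun[OF toric_morphism_torus_act[of \<tau> \<Lambda> v]]
    show "R (\<lambda>m. (character m (- v) - k) * c m)"
      unfolding R_def
    proof (intro exI conjI ballI)
      \<comment> \<open>The relation at \<open>torus_act v x\<close> times \<open>p x\<close>, minus
        \<open>k\<close> times the relation at \<open>x\<close>, both expanded to the common factor
        that the next goal uses as new \<open>Q\<close>.\<close>
      show "poly_fun \<tau> \<Lambda> (\<lambda>x. P (torus_act v x) * p x * Q x - k * (P x * (r x * Q (torus_act v x))))"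
        by (intro poly_fun_diff poly_fun_mult poly_fun_const tm PQ pr)
      show "poly_fun \<tau> \<Lambda> (\<lambda>x. r x * Q (torus_act v x) * Q x)"
        by (intro poly_fun_mult tm PQ pr)
      show "r fixed_point * Q (torus_act v fixed_point) * Q fixed_point \<noteq> 0"
        using PQ pr by simp
      fix x assume x: "x \<in> B'"
      define p1 where "p1 = (\<Sum>m\<in>D. c m * torus_act v x m)"
      define p0 where "p0 = (\<Sum>m\<in>D. c m * x m)"
      have sum: "(\<Sum>m\<in>D. (character m (- v) - k) * c m * x m) = p1 - k * p0"
        by (simp add: p1_def p0_def torus_act_def sum_distrib_left sum_subtractf algebra_simps)
      have 1: "p1 * h (torus_act v x) * Q (torus_act v x) = P (torus_act v x)"
        using PQ(4)[OF B'_act[OF x]] by (simp add: p1_def)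
      have 2: "p0 * h x * Q x = P x" using PQ(4)[OF x] by (simp add: p0_def)
      have "P (torus_act v x) * p x = p1 * h x * (r x * Q (torus_act v x))"
        using h_act[OF x, of v] by (simp add: 1[symmetric] pr(5)[rule_format, OF x, symmetric] mult_ac)
      then show "(\<Sum>m\<in>D. (character m (- v) - k) * c m * x m) * h x * (r x * Q (torus_act v x) * Q x) =
         P (torus_act v x) * p x * Q x - k * (P x * (r x * Q (torus_act v x)))"
        unfolding sum 2[symmetric] by (simp add: algebra_simps)
    qed
  next
    show "R (\<lambda>m. if m \<in> D then a m else 0)"
      unfolding R_def
    proof (intro exI conjI ballI)
      show "poly_fun \<tau> \<Lambda> (\<lambda>x. \<Sum>m\<in>D. b m * x m)" by (rule poly_fun_sum_monomials[OF D])
      show "poly_fun \<tau> \<Lambda> (\<lambda>_. 1)" by (rule poly_fun_const)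
      show "(\<Sum>m\<in>D. (if m \<in> D then a m else 0) * x m) * h x * 1 = (\<Sum>m\<in>D. b m * x m)" if "x \<in> B'" for x
        using eq that by simp
    qed simp
    show "finite {m. (if m \<in> D then a m else 0) \<noteq> 0}"
      by (rule finite_subset[OF _ D(1)]) (auto split: if_splits)
    show "linear m" if "(if m \<in> D then a m else 0) \<noteq> 0" for m
      using that D(2) cone_chars_linear[of m \<tau> \<Lambda>] by (auto split: if_splits)
    show "(if m\<^sub>0 \<in> D then a m\<^sub>0 else 0) \<noteq> 0" using m0 by simp
  qed
  then obtain d P Q where d: "d \<noteq> 0" and PQ: "poly_fun \<tau> \<Lambda> P" "poly_fun \<tau> \<Lambda> Q" "Q fixed_point \<noteq> 0"
    "\<And>x. x \<in> B' \<Longrightarrow> (\<Sum>m\<in>D. (if m = m\<^sub>0 then d else 0) * x m) * h x * Q x = P x"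
    unfolding R_def by blast
  have sum: "(\<Sum>m\<in>D. (if m = m\<^sub>0 then d else 0) * x m) = d * x m\<^sub>0" for x :: "'a point"
  proof -
    have "(\<Sum>m\<in>D. (if m = m\<^sub>0 then d else 0) * x m) = (\<Sum>m\<in>D. if m = m\<^sub>0 then d * x m\<^sub>0 else 0)"
      by (rule sum.cong) auto
    then show ?thesis using D(1) m0(1) by simp
  qed
  show ?thesis
  proof (rule that[of m\<^sub>0 "\<lambda>x. inverse d * P x" Q])
    show "m\<^sub>0 \<in> S" using m0(1) D(2) by (rule rev_subsetD)
    show "\<forall>x\<in>B'. x m\<^sub>0 * h x * Q x = inverse d * P x"
      using d PQ(4)[symmetric] by (simp add: sum)
  qed (use PQ in \<open>auto intro: poly_fun_mult poly_fun_const\<close>)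
qed

text \<open>Boundedness of \<open>h\<close> along the flows of the generators rules out poles along the toric divisors.\<close>

lemma h_regular:
  obtains m\<^sub>0 P Q where "m\<^sub>0 \<in> S" "poly_fun \<tau> \<Lambda> P" "poly_fun \<tau> \<Lambda> Q" "Q fixed_point \<noteq> 0" "P fixed_point \<noteq> 0"
    "\<forall>x\<in>B'. x m\<^sub>0 \<noteq> 0 \<longrightarrow> h x * Q x = P x"
proof -
  obtain m\<^sub>0 P Q where m0: "m\<^sub>0 \<in> S" and PQ: "poly_fun \<tau> \<Lambda> P" "poly_fun \<tau> \<Lambda> Q" "Q fixed_point \<noteq> 0"
    "\<forall>x\<in>B'. x m\<^sub>0 * h x * Q x = P x"
    by (rule h_monomial_quotient)
  obtain D b where D: "finite D" "D \<subseteq> S" and P: "\<And>x. x \<in> U \<Longrightarrow> P x = (\<Sum>m\<in>D. b m * x m)"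
    using PQ(1) unfolding poly_fun_iff by blast
  \<comment> \<open>Along the flow of \<open>\<nu>\<close> the polynomial \<open>P\<close> is the
    monomial \<open>m\<^sub>0\<close> times a bounded function, so its components of degree below
    that of \<open>m\<^sub>0\<close> vanish on \<open>B'\<close>, and with them their
    coefficients.\<close>
  have b0: "b m = 0" if m: "m \<in> D" and \<nu>: "\<nu> \<in> G" and less: "nat \<lfloor>m \<nu>\<rfloor> < nat \<lfloor>m\<^sub>0 \<nu>\<rfloor>" for m \<nu>
  proof (rule coeffs_zero_if_B'[of "{m' \<in> D. nat \<lfloor>m' \<nu>\<rfloor> = nat \<lfloor>m \<nu>\<rfloor>}" b])
    fix x assume x: "x \<in> B'"
    note xB = B'_B[OF x] and xU = B'_U[OF x]
    have \<nu>': "\<nu> \<in> insert \<kappa> G" using \<nu> by simp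
    obtain C1 where C1: "\<And>z. norm z \<le> 1 \<Longrightarrow> norm (h (flow \<nu> z x)) \<le> C1"
      using h_bounded[OF xB \<nu>'] by blast
    have "compact ((\<lambda>z. Q (flow \<nu> z x)) ` cball 0 1)"
      by (intro compact_continuous_image holomorphic_on_imp_continuous_on
          holomorphic_poly_fun_flow[OF PQ(2) xU \<nu>']) auto
    then obtain C2 where C2: "\<And>z. norm z \<le> 1 \<Longrightarrow> norm (Q (flow \<nu> z x)) \<le> C2"
      using compact_imp_bounded[THEN bounded_iff[THEN iffD1]] by fastforce
    show "(\<Sum>m' | m' \<in> D \<and> nat \<lfloor>m' \<nu>\<rfloor> = nat \<lfloor>m \<nu>\<rfloor>. b m' * x m') = 0"
    proof (rule sum_powers_zero_if_small[OF D(1) _ less])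
      fix z :: complex assume z: "0 < norm z" "norm z \<le> 1"
      have "(\<Sum>m\<in>D. b m * x m * z ^ nat \<lfloor>m \<nu>\<rfloor>) = P (flow \<nu> z x)"
        unfolding P[OF flow_in[OF xU \<nu>']] by (simp add: flow_def mult_ac)
      also have "\<dots> = flow \<nu> z x m\<^sub>0 * (h (flow \<nu> z x) * Q (flow \<nu> z x))"
        using PQ(4)[rule_format, OF B'_flow[OF x \<nu>' z(2)]] by (simp add: mult_ac)
      also have "norm \<dots> = norm z ^ nat \<lfloor>m\<^sub>0 \<nu>\<rfloor> * norm (x m\<^sub>0) *
          (norm (h (flow \<nu> z x)) * norm (Q (flow \<nu> z x)))"
        by (simp add: flow_def[of \<nu> z x] norm_mult norm_power)
      also have "\<dots> \<le> norm z ^ nat \<lfloor>m\<^sub>0 \<nu>\<rfloor> * norm (x m\<^sub>0) * (C1 * C2)"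
        using order_trans[OF norm_ge_zero C1[OF z(2)]]
        by (intro mult_left_mono mult_mono C1 C2 z) auto
      finally show "norm (\<Sum>m\<in>D. b m * x m * z ^ nat \<lfloor>m \<nu>\<rfloor>) \<le> (norm (x m\<^sub>0) * (C1 * C2)) * norm z ^ nat \<lfloor>m\<^sub>0 \<nu>\<rfloor>"
        by (simp add: mult_ac)
    qed
  qed (use D m in auto)
  \<comment> \<open>The monomials of \<open>D\<close> divisible by \<open>m\<^sub>0\<close>; by
    \<open>b0\<close> the others have coefficient 0.\<close>
  define D' where "D' = {m \<in> D. \<forall>\<nu>\<in>G. nat \<lfloor>m\<^sub>0 \<nu>\<rfloor> \<le> nat \<lfloor>m \<nu>\<rfloor>}"
  define P' where "P' = (\<lambda>x::'a point. \<Sum>m\<in>D'. b m * x (\<lambda>v. m v - m\<^sub>0 v))"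
  have diff: "(\<lambda>v. m v - m\<^sub>0 v) \<in> S" if "m \<in> D'" for m
  proof -
    have m: "m \<in> S" using that D(2) by (auto simp: D'_def)
    then have "0 \<le> m \<nu> - m\<^sub>0 \<nu>" if "\<nu> \<in> G" for \<nu>
      using \<open>m \<in> D'\<close> that deg_G[OF m that] deg_G[OF m0 that] unfolding D'_def
      by (metis (mono_tags, lifting) diff_ge_0_iff_ge mem_Collect_eq of_nat_le_iff)
    then show ?thesis using m m0 by (auto simp: S_iff intro: dual_lattice_diff)
  qed
  have polyP': "poly_fun \<tau> \<Lambda> P'"
    unfolding P'_def by (intro poly_fun_sum poly_fun_monomial diff)
  have PP': "P x = x m\<^sub>0 * P' x" if "x \<in> U" for x
  proof -
    have "P x = (\<Sum>m\<in>D'. b m * x m)"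
      unfolding P[OF that]
    proof (rule sum.mono_neutral_right)
      show "\<forall>m\<in>D - D'. b m * x m = 0"
        using b0 unfolding D'_def by (force simp: not_le simp del: nat_less_eq_zless zless_nat_conj)
    qed (auto simp: D D'_def)
    also have "\<dots> = (\<Sum>m\<in>D'. x m\<^sub>0 * (b m * x (\<lambda>v. m v - m\<^sub>0 v)))"
    proof (rule sum.cong[OF refl])
      fix m assume "m \<in> D'"
      from affine_toric_add[OF that diff[OF this] m0]
      show "b m * x m = x m\<^sub>0 * (b m * x (\<lambda>v. m v - m\<^sub>0 v))" by (simp add: mult_ac)
    qed
    finally show ?thesis by (simp add: P'_def sum_distrib_left)
  qed
  have hQ: "h x * Q x = P' x" if "x \<in> B'" "x m\<^sub>0 \<noteq> 0" for x
    using PQ(4)[rule_format, OF that(1)] PP'[OF B'_U[OF that(1)]] that(2) by simp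
  \<comment> \<open>The product of \<open>h\<close> and \<open>Q\<close> is nonzero at the fixed
    point, but \<open>hQ\<close> says nothing where \<open>m\<^sub>0\<close> vanishes. The fixed
    point is therefore approached along a flow line in the open torus orbit.\<close>
  have "P' fixed_point \<noteq> 0"
  proof -
    let ?e = "unit_point \<tau> \<Lambda>"
    obtain \<delta> where \<delta>: "\<delta> > 0" "\<And>z. norm z < \<delta> \<Longrightarrow> flow \<kappa> z ?e \<in> B'"
      using B'_small[OF unit_point_in] by blast
    define w where "w = complex_of_real (\<delta> / 2)"
    have w: "norm w < \<delta>" "w \<noteq> 0" using \<delta>(1) by (auto simp: w_def)
    define y where "y = flow \<kappa> w ?e"
    have y: "y \<in> B'" using \<delta>(2)[OF w(1)] by (simp add: y_def)
    \<comment> \<open>The small disc avoids the parameter 0, so \<open>m\<^sub>0\<close> stays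
      nonzero over it.\<close>
    have "(\<lambda>z. h (flow \<kappa> z y) * Q (flow \<kappa> z y)) 0 = (\<lambda>z. P' (flow \<kappa> z y)) 0"
    proof (rule analytic_continuation_open[of "ball (1/2) (1/4)" "ball 0 1"
        "\<lambda>z. h (flow \<kappa> z y) * Q (flow \<kappa> z y)" "\<lambda>z. P' (flow \<kappa> z y)"])
      show "(\<lambda>z. h (flow \<kappa> z y) * Q (flow \<kappa> z y)) holomorphic_on ball 0 1"
        by (intro holomorphic_intros holomorphic_h[OF B'_B[OF y]] holomorphic_poly_fun_flow PQ B'_U[OF y]) simp
      show "(\<lambda>z. P' (flow \<kappa> z y)) holomorphic_on ball 0 1"
        by (intro holomorphic_poly_fun_flow polyP' B'_U[OF y]) simp
      show sub: "ball (1/2) (1/4) \<subseteq> ball (0::complex) 1"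
        using ball_subset_ball_iff[of "1/2::complex" "1/4" 0 1] by (simp add: dist_norm)
      fix z :: complex assume z: "z \<in> ball (1/2) (1/4)"
      have "norm z < 1" using sub z by auto
      then have "flow \<kappa> z y \<in> B'" by (intro B'_flow[OF y]) auto
      moreover have "z \<noteq> 0" using z by (auto simp: dist_norm)
      then have "flow \<kappa> z y m\<^sub>0 \<noteq> 0" using w m0 by (simp add: y_def flow_def unit_point_def)
      ultimately show "h (flow \<kappa> z y) * Q (flow \<kappa> z y) = P' (flow \<kappa> z y)" by (rule hQ)
    qed auto
    then show ?thesis using PQ(3) by (simp add: flow_0[OF B'_U[OF y]])
  qed
  then show ?thesis using that m0 polyP' PQ hQ by blast
qed

section \<open>Extending the section to the whole chart\<close>

text \<open>\<open>t\<close> is the section \<open>s / h\<close>, written with polynomials on the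
  open set \<open>W\<close> where they are invertible. Every orbit meets \<open>W\<close>, so the
  action transports \<open>t\<close> to the whole chart, and its weight makes the result independent
  of the torus element used.\<close>

lemma equivariant_trivialization:
  obtains m f where "m \<in> dual_lattice \<Lambda>" "equivariant_iso \<tau> \<Lambda> (trivial_eq U (character m)) L f"
proof -
  obtain m\<^sub>0 P Q where m0: "m\<^sub>0 \<in> S" and PQ: "poly_fun \<tau> \<Lambda> P" "poly_fun \<tau> \<Lambda> Q" "Q fixed_point \<noteq> 0"
    "P fixed_point \<noteq> 0" "\<forall>x\<in>B'. x m\<^sub>0 \<noteq> 0 \<longrightarrow> h x * Q x = P x"
    by (rule h_regular)
  define Q\<^sub>0 where "Q\<^sub>0 x = q x * P x * Q x" for x
  define W where "W = {x \<in> U. Q\<^sub>0 x \<noteq> 0}"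
  define t where "t x = s x * Q x / P x" for x
  have polyQ0: "poly_fun \<tau> \<Lambda> Q\<^sub>0" unfolding Q\<^sub>0_def by (intro poly_fun_mult q_poly PQ)
  have W: "x \<in> U" "x \<in> V" "P x \<noteq> 0" "Q x \<noteq> 0" "s x \<noteq> 0" if "x \<in> W" for x
  proof -
    show xU: "x \<in> U" and "P x \<noteq> 0" "Q x \<noteq> 0" using that by (auto simp: W_def Q\<^sub>0_def)
    show "x \<in> V" using that q_V[OF xU] by (auto simp: W_def Q\<^sub>0_def q_def)
    then show "s x \<noteq> 0" by (rule s_nonzero)
  qed
  have t_nz: "t x \<noteq> 0" if "x \<in> W" for x using W[OF that] by (simp add: t_def)
  \<comment> \<open>If an orbit missed \<open>W\<close>, every term \<open>b m * x m\<close> would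
    vanish by independence of characters. The constant monomial is 1 at \<open>x\<close>, so the
    constant term, which is the value at the fixed point, would vanish too.\<close>
  have cover: "\<exists>u. torus_act u x \<in> W" if x: "x \<in> U" for x
  proof (rule ccontr)
    assume no: "\<not> ?thesis"
    obtain D b where D: "finite D" "D \<subseteq> S" and Q0: "\<And>x. x \<in> U \<Longrightarrow> Q\<^sub>0 x = (\<Sum>m\<in>D. b m * x m)"
      using polyQ0 unfolding poly_fun_iff by blast
    have "(\<Sum>m\<in>D. (b m * x m) * character m (- u)) = 0" for u
    proof -
      have "Q\<^sub>0 (torus_act u x) = 0" using no torus_act_in[OF x] by (auto simp: W_def)
      then show ?thesis using Q0[OF torus_act_in[OF x, of u]] by (simp add: torus_act_def mult_ac)
    qed
    then have zero: "b m * x m = 0" if "m \<in> D" for m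
      using characters_independent[OF D(1) _ _ that, of "\<lambda>m. b m * x m"] cone_chars_linear D(2) by blast
    have "Q\<^sub>0 fixed_point = 0"
      unfolding Q0[OF fixed_point_in]
    proof (rule sum.neutral, rule ballI)
      fix m assume "m \<in> D"
      then show "b m * fixed_point m = 0"
        using zero[of m] affine_toric_zero[OF x] by (cases "m = (\<lambda>_. 0)") (auto simp: fixed_point_def)
    qed
    then show False using PQ q_fixed_point by (simp add: Q\<^sub>0_def q_def)
  qed
  have t_act: "t (torus_act u x) * fib u = snd L u x * t x" if x: "x \<in> W" and ux: "torus_act u x \<in> W" for x u
  proof -
    note tm = toric_morphism_poly_fun[OF toric_morphism_torus_act[of \<tau> \<Lambda> u]]
    obtain p r where pr: "poly_fun \<tau> \<Lambda> p" "poly_fun \<tau> \<Lambda> r" "r x \<noteq> 0"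
      "\<And>y. y \<in> V \<Longrightarrow> torus_act u y \<in> V \<Longrightarrow> r y \<noteq> 0 \<Longrightarrow> g u y = p y / r y"
      using g_local[OF W(2)[OF x] W(2)[OF ux]] by metis
    \<comment> \<open>The weight identity for \<open>t\<close> as a polynomial. It follows from
      \<open>h_act\<close> on \<open>B'\<close> where \<open>m\<^sub>0\<close> and \<open>r\<close>
      are nonzero; multiplying by both removes the exceptions and density extends it. Then
      \<open>m\<^sub>0\<close> is cancelled on the torus orbit, and \<open>r\<close> at
      \<open>x\<close>.\<close>
    define \<Phi> where "\<Phi> y = P (torus_act u y) * Q y * p y - P y * Q (torus_act u y) * r y" for y
    have poly\<Phi>: "poly_fun \<tau> \<Lambda> \<Phi>"
      unfolding \<Phi>_def by (intro poly_fun_diff poly_fun_mult tm PQ pr)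
    have 1: "y m\<^sub>0 * (r y * \<Phi> y) = 0" if y: "y \<in> B'" for y
    proof (cases "y m\<^sub>0 = 0 \<or> r y = 0")
      case False
      then have nz: "y m\<^sub>0 \<noteq> 0" "torus_act u y m\<^sub>0 \<noteq> 0" by (auto simp: torus_act_def)
      have gp: "p y = g u y * r y"
        using pr(4)[OF B_V[OF B'_B[OF y]] B_V[OF B_act[OF B'_B[OF y]]]] False by simp
      have hh: "h y = h (torus_act u y) * g u y" using h_act[OF y, of u] by simp
      show ?thesis
        unfolding \<Phi>_def PQ(5)[rule_format, OF y nz(1), symmetric] PQ(5)[rule_format, OF B'_act[OF y] nz(2), symmetric] gp hh
        by (simp add: mult_ac)
    qed auto
    have 2: "y m\<^sub>0 * (r y * \<Phi> y) = 0" if y: "y \<in> U" for y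
    proof (rule poly_fun_eq_0_if_B'[OF _ 1 y])
      have "poly_fun \<tau> \<Lambda> (\<lambda>x. 1 * x m\<^sub>0)" by (rule poly_fun_monomial[OF m0])
      then show "poly_fun \<tau> \<Lambda> (\<lambda>y. y m\<^sub>0 * (r y * \<Phi> y))" by (intro poly_fun_mult pr poly\<Phi>) simp
    qed
    have "r x * \<Phi> x = 0"
    proof (rule poly_fun_eq_0_if_torus[OF _ _ W(1)[OF x]])
      show "poly_fun \<tau> \<Lambda> (\<lambda>y. r y * \<Phi> y)" by (intro poly_fun_mult pr poly\<Phi>)
      fix v
      have "torus_act v (unit_point \<tau> \<Lambda>) m\<^sub>0 \<noteq> 0" using m0 by (simp add: torus_act_def unit_point_def)
      then show "r (torus_act v (unit_point \<tau> \<Lambda>)) * \<Phi> (torus_act v (unit_point \<tau> \<Lambda>)) = 0"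
        using 2[OF torus_act_in[OF unit_point_in], of v] by (metis mult_eq_0_iff)
    qed
    then have "P (torus_act u x) * Q x * p x = P x * Q (torus_act u x) * r x"
      using pr(3) by (simp add: \<Phi>_def)
    moreover have gx: "p x = g u x * r x" using pr(4)[OF W(2)[OF x] W(2)[OF ux]] pr(3) by simp
    ultimately have "P (torus_act u x) * Q x * g u x = P x * Q (torus_act u x)"
      using pr(3) by (simp add: mult.assoc[symmetric])
    then have "P (torus_act u x) * Q x * (snd L u x * s x) = P x * Q (torus_act u x) * (s (torus_act u x) * fib u)"
      using W(5)[OF ux] by (simp add: g_def field_simps)
    then show ?thesis
      using W(3)[OF x] W(3)[OF ux] by (simp add: t_def field_simps)
  qed
  \<comment> \<open>Transports \<open>t\<close> back from some translate in \<open>W\<close> and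
    divides out the weight; by \<open>t_act\<close> the choice of the translate does not affect the
    value.\<close>
  define f where "f x = (let u = (SOME u. torus_act u x \<in> W); y = torus_act u x in snd L (- u) y * t y / fib (- u))" for x
  have f: "f (torus_act v y) = snd L v y * t y / fib v" if y: "y \<in> W" for v y
  proof -
    define x where "x = torus_act v y"
    have yU: "y \<in> U" using W(1)[OF y] .
    define u where "u = (SOME u. torus_act u x \<in> W)"
    have "torus_act u x \<in> W" unfolding u_def by (rule someI_ex[OF cover]) (simp add: x_def torus_act_in yU)
    then have y': "torus_act (u + v) y \<in> W" by (simp add: x_def torus_act_add[OF yU])
    have "f x = snd L (- u) (torus_act (u + v) y) * t (torus_act (u + v) y) / fib (- u)"
      by (simp add: f_def u_def[symmetric] Let_def) (simp add: x_def torus_act_add[OF yU])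
    also have "\<dots> = snd L (- u) (torus_act (u + v) y) * (t (torus_act (u + v) y) * fib (u + v)) / (fib (- u) * fib (u + v))"
      by simp
    also have "\<dots> = snd L (- u) (torus_act (u + v) y) * snd L (u + v) y * t y / fib (- u + (u + v))"
      unfolding t_act[OF y y'] fib_add[of "- u" "u + v"] by (simp only: mult.assoc)
    also have "\<dots> = snd L (- u + (u + v)) y * t y / fib (- u + (u + v))"
      unfolding elb_act_add[OF L yU, of "- u"] ..
    also have "- u + (u + v) = v" by simp
    finally show ?thesis by (simp add: x_def)
  qed
  have ex: "\<exists>w y. y \<in> W \<and> x = torus_act w y" if x: "x \<in> U" for x
  proof -
    obtain u where u: "torus_act u x \<in> W" using cover[OF x] by blast
    have "x = torus_act (- u) (torus_act u x)" using torus_act_minus(1)[OF x] by simp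
    then show ?thesis using u by blast
  qed
  obtain m where m: "m \<in> dual_lattice \<Lambda>" "fib = character m" by (rule fib_character)
  have "equivariant_iso \<tau> \<Lambda> (trivial_eq U (character m)) L f"
  proof (rule equivariant_isoI)
    fix x assume x: "x \<in> U"
    obtain w y where wy: "y \<in> W" "x = torus_act w y" using ex[OF x] by blast
    note yU = W(1)[OF wy(1)]
    show "f x \<noteq> 0" using f[OF wy(1)] t_nz[OF wy(1)] elb_act_nonzero[OF L yU] by (simp add: wy)
    fix v
    have "f (torus_act v x) = f (torus_act (v + w) y)" by (simp add: wy torus_act_add[OF yU])
    also have "\<dots> = snd L (v + w) y * t y / fib (v + w)" by (rule f[OF wy(1)])
    finally show "snd L v x * f x = f (torus_act v x) * snd (trivial_eq U (character m)) v x"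
      using f[OF wy(1), of w] by (simp add: wy(2) elb_act_add[OF L yU] fib_add snd_trivial_eq m(2)[symmetric])
  next
    fix V1 s1 V' s' assume *: "(V1, s1) \<in> fst (trivial_eq U (character m))" "(V', s') \<in> fst L"
    then have V1: "V1 = U" "s1 = (\<lambda>_. 1)" by (auto simp: fst_trivial_eq)
    have sub: "V' \<subseteq> U" using elb_subset[OF L *(2)] .
    have "regular_on \<tau> \<Lambda> V' (\<lambda>x. f x / s' x)"
    proof (rule regular_on_local[OF sub])
      fix x assume x: "x \<in> V'"
      obtain w y where wy: "y \<in> W" "x = torus_act w y" using ex[of x] sub x by blast
      note yU = W(1)[OF wy(1)]
      define W' where "W' = {z \<in> U. torus_act (- w) z \<in> W}"
      have oW: "zariski_open \<tau> \<Lambda> W"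
        unfolding W_def by (rule zariski_open_nonzero[OF polyQ0])
      have oW': "zariski_open \<tau> \<Lambda> W'"
        unfolding W'_def by (rule toric_morphism_zariski_open[OF toric_morphism_torus_act oW])
      have subW: "W \<subseteq> U" using W by blast
      have rQ: "regular_on \<tau> \<Lambda> W (\<lambda>y. Q y / P y)"
        by (intro regular_on_divide regular_on_poly_fun PQ subW) (use W in auto)
      \<comment> \<open>Regularity is checked at a translate in \<open>W\<close>, where
        \<open>f\<close> is the action in frames times \<open>Q / P\<close>, and then moved to
        \<open>x\<close> by the translation.\<close>
      have "regular_on \<tau> \<Lambda> (W \<inter> {y \<in> U. torus_act w y \<in> V'})
          (\<lambda>y. (inverse (fib w) * (snd L w y * s y / s' (torus_act w y))) * (Q y / P y))"
        using subW W(2)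
        by (intro regular_on_mult regular_on_const regular_on_subset[OF elb_act_regular[OF L Vs *(2), of w]]
          regular_on_subset[OF rQ]) auto
      then have r: "regular_on \<tau> \<Lambda> (W \<inter> {y \<in> U. torus_act w y \<in> V'}) (\<lambda>y. f (torus_act w y) / s' (torus_act w y))"
        by (rule regular_on_cong) (simp add: f t_def field_simps)
      have "regular_on \<tau> \<Lambda> (V' \<inter> W')
          (\<lambda>z. (\<lambda>y. f (torus_act w y) / s' (torus_act w y)) (torus_act (- w) z))"
        by (rule toric_morphism_regular_on[OF toric_morphism_torus_act r])
          (use sub subW torus_act_minus(2)[of _ \<tau> \<Lambda> w] torus_act_in in \<open>auto simp: W'_def\<close>)
      then have "regular_on \<tau> \<Lambda> (V' \<inter> W') (\<lambda>z. f z / s' z)"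
        by (rule regular_on_cong) (use sub torus_act_minus(2)[of _ \<tau> \<Lambda> w] in \<open>auto simp: subset_iff\<close>)
      moreover have "x \<in> W'" using wy yU torus_act_minus(1)[OF yU] by (simp add: W'_def torus_act_in)
      ultimately show "\<exists>W. zariski_open \<tau> \<Lambda> W \<and> x \<in> W \<and> regular_on \<tau> \<Lambda> (V' \<inter> W) (\<lambda>x. f x / s' x)"
        using oW' by blast
    qed
    then show "regular_on \<tau> \<Lambda> (V1 \<inter> V') (\<lambda>x. f x * s1 x / s' x)"
      by (rule regular_on_subset_cong) (auto simp: V1)
  qed
  then show ?thesis using that m(1) by blast
qed

end

context fixed_point_chart
begin

lemma trivialization_exists:
  assumes L: "equivariant_line_bundle \<tau> \<Lambda> L"
  shows "\<exists>m\<in>dual_lattice \<Lambda>. \<exists>f. equivariant_iso \<tau> \<Lambda> (trivial_eq U (character m)) L f"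
proof -
  obtain V s where Vs: "(V, s) \<in> fst L" "fixed_point \<in> V" using elb_cover[OF L fixed_point_in] by blast
  obtain p where p: "poly_fun \<tau> \<Lambda> p" "p fixed_point \<noteq> 0" "\<And>y. y \<in> U \<Longrightarrow> p y \<noteq> 0 \<Longrightarrow> y \<in> V"
    using zariski_openE[OF elb_open[OF L Vs(1)] Vs(2)] by blast
  obtain A c where A: "finite A" "A \<subseteq> S" "\<And>x. x \<in> U \<Longrightarrow> p x = (\<Sum>m\<in>A. c m * x m)"
    using p(1) unfolding poly_fun_iff by blast
  interpret framed_chart \<tau> \<Lambda> G L V s A c
  proof unfold_locales
    show "(\<Sum>m\<in>A. c m * fixed_point m) \<noteq> 0" using p(2) A(3)[OF fixed_point_in] by simp
    show "x \<in> V" if "x \<in> U" "(\<Sum>m\<in>A. c m * x m) \<noteq> 0" for x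
      using p(3)[OF that(1)] A(3)[OF that(1)] that(2) by simp
  qed (use L Vs(1) A in simp_all)
  obtain m f where "m \<in> dual_lattice \<Lambda>" "equivariant_iso \<tau> \<Lambda> (trivial_eq U (character m)) L f"
    by (rule equivariant_trivialization)
  then show ?thesis by blast
qed

text \<open>At the fixed point the isomorphism cancels, so the weight is the action on this fibre;
  it is thereby unique.\<close>

lemma trivialization_character:
  assumes "equivariant_iso \<tau> \<Lambda> (trivial_eq U (character m)) L f"
  shows "character m v = snd L v fixed_point"
  using equivariant_iso_act[OF assms fixed_point_in, of v] equivariant_iso_nonzero[OF assms fixed_point_in]
  by (simp add: snd_trivial_eq)

end

section \<open>Cones and lattices\<close>

lemma convex_cone_hull_finite_iff:
  assumes "finite B"
  shows "x \<in> convex_cone hull B \<longleftrightarrow> (\<exists>c. (\<forall>b\<in>B. 0 \<le> c b) \<and> x = (\<Sum>b\<in>B. c b *\<^sub>R b))"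
proof
  let ?S = "{x. \<exists>c. (\<forall>b\<in>B. 0 \<le> c b) \<and> x = (\<Sum>b\<in>B. c b *\<^sub>R b)}"
  assume "x \<in> convex_cone hull B"
  moreover have "convex_cone hull B \<subseteq> ?S"
  proof (rule hull_minimal)
    show "B \<subseteq> ?S"
    proof
      fix b assume b: "b \<in> B"
      have "(\<Sum>b'\<in>B. (if b' = b then 1 else 0) *\<^sub>R b') = (\<Sum>b'\<in>B. if b' = b then b else 0)"
        by (rule sum.cong) auto
      then have "b = (\<Sum>b'\<in>B. (if b' = b then 1 else 0) *\<^sub>R b')" using assms b by simp
      then show "b \<in> ?S" by (intro CollectI exI[of _ "\<lambda>b'. if b' = b then 1 else 0"]) simp
    qed
    show "convex_cone ?S"
      unfolding convex_cone_iff
    proof (intro conjI ballI allI impI)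
      show "0 \<in> ?S" by (auto intro!: exI[of _ "\<lambda>_. 0"])
      fix x y assume "x \<in> ?S" "y \<in> ?S"
      then obtain c d where "\<forall>b\<in>B. 0 \<le> c b" "x = (\<Sum>b\<in>B. c b *\<^sub>R b)" "\<forall>b\<in>B. 0 \<le> d b" "y = (\<Sum>b\<in>B. d b *\<^sub>R b)"
        by blast
      then show "x + y \<in> ?S"
        by (intro CollectI exI[of _ "\<lambda>b. c b + d b"]) (simp add: scaleR_add_left sum.distrib)
    next
      fix x and k :: real assume "x \<in> ?S" "0 \<le> k"
      then obtain c where "\<forall>b\<in>B. 0 \<le> c b" "x = (\<Sum>b\<in>B. c b *\<^sub>R b)" by blast
      then show "k *\<^sub>R x \<in> ?S" using \<open>0 \<le> k\<close>
        by (intro CollectI exI[of _ "\<lambda>b. k * c b"]) (simp add: scaleR_sum_right)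
    qed
  qed
  ultimately show "\<exists>c. (\<forall>b\<in>B. 0 \<le> c b) \<and> x = (\<Sum>b\<in>B. c b *\<^sub>R b)" by blast
next
  assume "\<exists>c. (\<forall>b\<in>B. 0 \<le> c b) \<and> x = (\<Sum>b\<in>B. c b *\<^sub>R b)"
  then obtain c where c: "\<forall>b\<in>B. 0 \<le> c b" "x = (\<Sum>b\<in>B. c b *\<^sub>R b)" by blast
  have "(\<Sum>b\<in>D. c b *\<^sub>R b) \<in> convex_cone hull B" if "D \<subseteq> B" for D
    using finite_subset[OF that assms] that
  proof (induction D rule: finite_induct)
    case (insert b D)
    then show ?case using c(1) by (auto intro!: convex_cone_hull_add convex_cone_hull_mul intro: hull_inc)
  qed (simp add: convex_cone_hull_contains_0)
  then show "x \<in> convex_cone hull B" using c(2) by blast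
qed

section \<open>Faces of finitely generated cones\<close>

text \<open>With \<open>K\<close> greater than 1 and \<open>k\<close>, the point \<open>x\<close> is
  interior to the segment from 0 to \<open>K *\<^sub>R x\<close>, so the face contains both ends,
  and by convexity \<open>k *\<^sub>R x\<close> between them.\<close>

lemma face_of_convex_cone_scale:
  assumes F: "F face_of \<tau>" and \<tau>: "convex_cone \<tau>" and x: "x \<in> F" and k: "k \<ge> 0"
  shows "k *\<^sub>R x \<in> F"
proof (cases "x = 0")
  case False
  have x\<tau>: "x \<in> \<tau>" using face_of_imp_subset[OF F] x by blast
  define K where "K = 2 + k"
  have K: "K > 1" "k < K" using k by (auto simp: K_def)
  have "x \<in> open_segment 0 (K *\<^sub>R x)"
    unfolding in_segment using K False by (intro conjI exI[of _ "1 / K"]) auto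
  from face_ofD[OF F this _ _ x] have "0 \<in> F" "K *\<^sub>R x \<in> F"
    using \<tau> x\<tau> K by (auto simp: convex_cone_iff)
  then have "(1 - k / K) *\<^sub>R 0 + (k / K) *\<^sub>R (K *\<^sub>R x) \<in> F"
    using K k by (intro convexD[OF face_of_imp_convex[OF F]]) auto
  then show ?thesis using K by simp
qed (use x in simp)

text \<open>The sum is the midpoint of \<open>2 *\<^sub>R a\<close> and
  \<open>2 *\<^sub>R b\<close>. For \<open>a = b\<close> this segment degenerates and scaling is
  used instead.\<close>

lemma face_of_convex_cone_summand:
  assumes F: "F face_of \<tau>" and \<tau>: "convex_cone \<tau>" and ab: "a \<in> \<tau>" "b \<in> \<tau>" "a + b \<in> F"
  shows "a \<in> F"
proof (cases "a = b")
  case True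
  have "(1/2) *\<^sub>R (a + b) \<in> F" by (rule face_of_convex_cone_scale[OF F \<tau> ab(3)]) simp
  then show ?thesis using True by (simp flip: scaleR_2)
next
  case False
  have "a + b \<in> open_segment (2 *\<^sub>R a) (2 *\<^sub>R b)"
    unfolding in_segment using False by (intro conjI exI[of _ "1 / 2"]) auto
  from face_ofD[OF F this _ _ ab(3)] have "2 *\<^sub>R a \<in> F"
    using \<tau> ab by (auto simp: convex_cone_iff)
  from face_of_convex_cone_scale[OF F \<tau> this, of "1/2"] show ?thesis by simp
qed

lemma face_of_convex_cone_sum:
  assumes F: "F face_of \<tau>" and \<tau>: "convex_cone \<tau>" and B: "finite B" "\<And>b. b \<in> B \<Longrightarrow> f b \<in> \<tau>"
    and sum: "(\<Sum>b\<in>B. f b) \<in> F" and b: "b \<in> B"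
  shows "f b \<in> F"
proof (rule face_of_convex_cone_summand[OF F \<tau>])
  have "(\<Sum>b\<in>D. f b) \<in> \<tau>" if "D \<subseteq> B" for D
    using finite_subset[OF that B(1)] that
    by (induction D rule: finite_induct) (use \<tau> B(2) in \<open>auto simp: convex_cone_iff\<close>)
  then show "(\<Sum>b\<in>B - {b}. f b) \<in> \<tau>" by blast
  show "f b + (\<Sum>b\<in>B - {b}. f b) \<in> F" using sum sum.remove[OF B(1) b, of f] by simp
qed (use B b in auto)

text \<open>If a nonnegative combination lies in a face, so does each of its terms; only generators
  inside the face can occur with a nonzero coefficient.\<close>

lemma face_of_finite_convex_cone_hull:
  assumes F: "F face_of convex_cone hull B" and ne: "F \<noteq> {}" and B: "finite B"
  shows "F = convex_cone hull (B \<inter> F)"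
proof
  note cc = convex_cone_convex_cone_hull[of B]
  show "F \<subseteq> convex_cone hull (B \<inter> F)"
  proof
    fix x assume x: "x \<in> F"
    then have "x \<in> convex_cone hull B" using face_of_imp_subset[OF F] by blast
    then obtain c where c: "\<forall>b\<in>B. 0 \<le> c b" "x = (\<Sum>b\<in>B. c b *\<^sub>R b)"
      unfolding convex_cone_hull_finite_iff[OF B] by blast
    have "c b *\<^sub>R b \<in> F" if "b \<in> B" for b
      by (rule face_of_convex_cone_sum[OF F cc B _ _ that, of "\<lambda>b. c b *\<^sub>R b"])
        (use c x in \<open>auto intro!: convex_cone_hull_mul intro: hull_inc\<close>)
    then have bF: "b \<in> F" if "b \<in> B" "c b \<noteq> 0" for b
      using face_of_convex_cone_scale[OF F cc, of "c b *\<^sub>R b" "1 / c b"] that c(1) by simp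
    have "x = (\<Sum>b\<in>B \<inter> F. c b *\<^sub>R b)"
      unfolding c(2) by (rule sum.mono_neutral_right) (use B bF in auto)
    then show "x \<in> convex_cone hull (B \<inter> F)"
      using c(1) B by (subst convex_cone_hull_finite_iff) auto
  qed
  obtain x where "x \<in> F" using ne by blast
  from face_of_convex_cone_scale[OF F cc this, of 0] have "0 \<in> F" by simp
  moreover have "x + y \<in> F" if "x \<in> F" "y \<in> F" for x y
  proof -
    have "(1/2) *\<^sub>R x + (1/2) *\<^sub>R y \<in> F"
      using that by (intro convexD[OF face_of_imp_convex[OF F]]) auto
    from face_of_convex_cone_scale[OF F cc this, of 2] show ?thesis by (simp add: scaleR_add_right)
  qed
  ultimately have "convex_cone F"
    unfolding convex_cone_iff using face_of_convex_cone_scale[OF F cc] by metis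
  then show "convex_cone hull (B \<inter> F) \<subseteq> F" by (intro hull_minimal) auto
qed

text \<open>Coordinates with respect to \<open>B\<close> are unique, so at a point of the subcone
  the averaged coordinates of the end points vanish outside \<open>C\<close>. Being nonnegative with
  positive weights, they vanish separately.\<close>

lemma convex_cone_hull_subset_face_of:
  fixes B :: "'a::euclidean_space set"
  assumes ind: "independent B" and C: "C \<subseteq> B"
  shows "convex_cone hull C face_of convex_cone hull B"
  unfolding face_of_def
proof (intro conjI ballI impI)
  have finB: "finite B" using ind by (rule independent_imp_finite)
  note fin = finB finite_subset[OF C finB]
  show "convex_cone hull C \<subseteq> convex_cone hull B" by (rule hull_mono[OF C])
  show "convex (convex_cone hull C)" by (rule convex_convex_cone_hull)
  fix a b x assume a: "a \<in> convex_cone hull B" and b: "b \<in> convex_cone hull B"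
    and x: "x \<in> convex_cone hull C" "x \<in> open_segment a b"
  obtain \<alpha> where \<alpha>: "\<forall>b\<in>B. 0 \<le> \<alpha> b" "a = (\<Sum>b\<in>B. \<alpha> b *\<^sub>R b)"
    using a unfolding convex_cone_hull_finite_iff[OF fin(1)] by blast
  obtain \<beta> where \<beta>: "\<forall>b\<in>B. 0 \<le> \<beta> b" "b = (\<Sum>b\<in>B. \<beta> b *\<^sub>R b)"
    using b unfolding convex_cone_hull_finite_iff[OF fin(1)] by blast
  obtain \<xi> where \<xi>: "\<forall>b\<in>C. 0 \<le> \<xi> b" "x = (\<Sum>b\<in>C. \<xi> b *\<^sub>R b)"
    using x(1) unfolding convex_cone_hull_finite_iff[OF fin(2)] by blast
  obtain u where u: "0 < u" "u < 1" "x = (1 - u) *\<^sub>R a + u *\<^sub>R b" using x(2) unfolding in_segment by blast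
  define \<gamma> where "\<gamma> e = (1 - u) * \<alpha> e + u * \<beta> e - (if e \<in> C then \<xi> e else 0)" for e
  have "(\<Sum>b\<in>B. (if b \<in> C then \<xi> b else 0) *\<^sub>R b) = x"
    unfolding \<xi>(2) by (rule sum.mono_neutral_cong_right) (use fin C in auto)
  then have "(\<Sum>b\<in>B. \<gamma> b *\<^sub>R b) = 0"
    using u(3) by (simp add: \<gamma>_def \<alpha>(2) \<beta>(2) scaleR_diff_left scaleR_add_left sum_subtractf sum.distrib scaleR_sum_right)
  then have "\<gamma> e = 0" if "e \<in> B" for e using independentD[OF ind fin(1)] that by blast
  then have zero: "\<alpha> e = 0 \<and> \<beta> e = 0" if "e \<in> B - C" for e
  proof -
    have "(1 - u) * \<alpha> e + u * \<beta> e = 0" using that \<open>\<And>e. e \<in> B \<Longrightarrow> \<gamma> e = 0\<close>[of e] by (simp add: \<gamma>_def)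
    moreover have "0 \<le> (1 - u) * \<alpha> e" "0 \<le> u * \<beta> e" using u \<alpha>(1) \<beta>(1) that by auto
    ultimately have "(1 - u) * \<alpha> e = 0" "u * \<beta> e = 0" by linarith+
    then show ?thesis using u by simp
  qed
  have "a = (\<Sum>b\<in>C. \<alpha> b *\<^sub>R b)" "b = (\<Sum>b\<in>C. \<beta> b *\<^sub>R b)"
    unfolding \<alpha>(2) \<beta>(2) by (rule sum.mono_neutral_right; use fin C zero in auto)+
  then show "a \<in> convex_cone hull C" "b \<in> convex_cone hull C"
    using \<alpha>(1) \<beta>(1) C unfolding convex_cone_hull_finite_iff[OF fin(2)] by blast+
qed

lemma span_convex_cone_hull: "span (convex_cone hull B) = span B"
proof -
  have "convex_cone (span B)" by (auto simp: convex_cone_iff span_zero span_add span_scale)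
  then have "convex_cone hull B \<subseteq> span B" by (intro hull_minimal span_superset)
  moreover have "B \<subseteq> span (convex_cone hull B)"
    using order_trans[OF hull_subset span_superset] .
  ultimately show ?thesis by (simp add: span_eq)
qed

lemma dim_convex_cone_hull: "dim (convex_cone hull B) = dim (B :: 'a::euclidean_space set)"
  by (metis dim_span span_convex_cone_hull)

section \<open>Lattices, primitive vectors and denominators\<close>

lemma group_closure_induct_linear:
  fixes m :: "'a::real_vector \<Rightarrow> real"
  assumes "linear m" "\<And>v. v \<in> G \<Longrightarrow> m v \<in> \<int>" "x \<in> group_closure G" shows "m x \<in> \<int>"
  using assms(3)
proof (induction rule: group_closure.induct)
  case (base s)
  then show ?case using assms(2) linear_0[OF assms(1)] by auto
next
  case (diff s t)
  then show ?case using linear_diff[OF assms(1)] by simp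
qed

lemma dual_lattice_group_closure:
  "dual_lattice (group_closure G) = {m. linear m \<and> (\<forall>v\<in>G. m v \<in> \<int>)}"
  using group_closure_induct_linear[of _ G] by (auto simp: dual_lattice_def intro: group_closure.base)

lemma group_closure_sum:
  "(\<And>i. i \<in> I \<Longrightarrow> f i \<in> group_closure S) \<Longrightarrow> sum f I \<in> group_closure S"
  by (induction I rule: infinite_finite_induct) (auto intro: group_closure_add)

lemma group_closure_scaleR_nat:
  fixes v :: "'a::real_vector"
  shows "v \<in> group_closure S \<Longrightarrow> real k *\<^sub>R v \<in> group_closure S"
  by (induction k) (auto simp: scaleR_add_left intro: group_closure_add)

lemma group_closure_scaleR_int:
  fixes v :: "'a::real_vector"
  shows "v \<in> group_closure S \<Longrightarrow> of_int k *\<^sub>R v \<in> group_closure S"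
  using group_closure_scaleR_nat[of v S] by (cases k rule: int_cases2) auto

lemma group_closure_subset: "S \<subseteq> group_closure T \<Longrightarrow> group_closure S \<subseteq> group_closure T"
proof
  fix x assume "S \<subseteq> group_closure T" "x \<in> group_closure S"
  then show "x \<in> group_closure T"
    by (induction rule: group_closure.induct[OF \<open>x \<in> group_closure S\<close>]) (auto intro: group_closure.diff)
qed

text \<open>The coordinates in a lattice basis are integers, and as linear functionals they are
  bounded on a bounded set.\<close>

lemma lattice_finite_bounded:
  fixes N :: "'a::euclidean_space set"
  assumes N: "is_lattice N" and S: "bounded S" shows "finite (N \<inter> S)"
proof -
  obtain B where B: "independent B" "span B = UNIV" "N = group_closure B"
    using N unfolding is_lattice_def by blast
  have fin: "finite B" using B(1) by (rule independent_imp_finite)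
  have "\<exists>r. linear r \<and> (\<forall>e\<in>B. r e = (if e = b then 1 else 0::real))" for b
    using linear_independent_extend[OF B(1), of "\<lambda>e. if e = b then 1 else 0"] by blast
  then obtain r where r: "\<And>b. linear (r b)" "\<And>b e. e \<in> B \<Longrightarrow> r b e = (if e = b then 1 else 0::real)"
    by metis
  have int: "r b x \<in> \<int>" if "x \<in> N" for b x
    using that unfolding B(3) by (rule group_closure_induct_linear[OF r(1), rotated]) (auto simp: r(2))
  obtain K where K: "\<And>x. x \<in> S \<Longrightarrow> norm x \<le> K" using S bounded_iff by blast
  have "\<exists>C. \<forall>x\<in>S. \<bar>r b x\<bar> \<le> C" for b
  proof -
    have "bounded_linear (r b)" using r(1) by (simp add: linear_conv_bounded_linear)
    then have "bounded (r b ` S)" using S by (rule bounded_linear_image[rotated])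
    then show ?thesis by (auto simp: bounded_iff)
  qed
  then obtain C where C: "\<And>b x. x \<in> S \<Longrightarrow> \<bar>r b x\<bar> \<le> C b" by metis
  have inj: "inj_on (\<lambda>x. restrict (\<lambda>b. r b x) B) UNIV"
  proof (rule inj_onI)
    fix x y assume "restrict (\<lambda>b. r b x) B = restrict (\<lambda>b. r b y) B"
    then have eq: "r b x = r b y" if "b \<in> B" for b using that by (metis restrict_apply')
    have "x - y \<in> span B" by (simp add: B(2))
    then obtain u where u: "x - y = (\<Sum>b\<in>B. u b *\<^sub>R b)" using span_finite[OF fin] by auto
    have "u b = r b (x - y)" if "b \<in> B" for b
    proof -
      have "r b (x - y) = (\<Sum>e\<in>B. u e * r b e)" unfolding u using r(1)[of b] by (simp add: linear_sum linear_cmul)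
      also have "\<dots> = (\<Sum>e\<in>B. if e = b then u b else 0)" by (rule sum.cong) (auto simp: r(2))
      finally show ?thesis using fin that by simp
    qed
    then have "u b = 0" if "b \<in> B" for b using that eq[OF that] linear_diff[OF r(1)[of b], of x y] by simp
    then have "x - y = 0" unfolding u by (intro sum.neutral) simp
    then show "x = y" by simp
  qed
  have "finite ({x::real. x \<in> \<int> \<and> \<bar>x\<bar> \<le> C b})" for b
    by (rule finite_abs_int_segment)
  then have "finite (\<Pi>\<^sub>E b\<in>B. {x. x \<in> \<int> \<and> \<bar>x\<bar> \<le> C b})" using fin by (intro finite_PiE) auto
  moreover have "(\<lambda>x. restrict (\<lambda>b. r b x) B) ` (N \<inter> S) \<subseteq> (\<Pi>\<^sub>E b\<in>B. {x. x \<in> \<int> \<and> \<bar>x\<bar> \<le> C b})"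
    using int C by auto
  ultimately have "finite ((\<lambda>x. restrict (\<lambda>b. r b x) B) ` (N \<inter> S))" by (rule finite_subset[rotated])
  then show ?thesis using inj by (meson finite_imageD inj_on_subset subset_UNIV)
qed

lemma lattice_closed:
  assumes "is_lattice N"
  shows "0 \<in> N" "x \<in> N \<Longrightarrow> y \<in> N \<Longrightarrow> x + y \<in> N" "x \<in> N \<Longrightarrow> y \<in> N \<Longrightarrow> x - y \<in> N"
    "x \<in> N \<Longrightarrow> real k *\<^sub>R x \<in> N" "x \<in> N \<Longrightarrow> of_int i *\<^sub>R x \<in> N" "G \<subseteq> N \<Longrightarrow> group_closure G \<subseteq> N"
proof -
  obtain B where B: "N = group_closure B" using assms unfolding is_lattice_def by blast
  show "0 \<in> N" "x \<in> N \<Longrightarrow> y \<in> N \<Longrightarrow> x + y \<in> N" "x \<in> N \<Longrightarrow> y \<in> N \<Longrightarrow> x - y \<in> N"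
    "x \<in> N \<Longrightarrow> real k *\<^sub>R x \<in> N" "x \<in> N \<Longrightarrow> of_int i *\<^sub>R x \<in> N" "G \<subseteq> N \<Longrightarrow> group_closure G \<subseteq> N"
    by (auto simp: B intro: group_closure_add group_closure.diff group_closure_scaleR_nat
        group_closure_scaleR_int group_closure_subset[THEN subsetD])
qed

lemma convex_cone_hull_singleton: "convex_cone hull {b} = {t *\<^sub>R b |t. 0 \<le> t}"
proof -
  have "x \<in> convex_cone hull {b} \<longleftrightarrow> (\<exists>c. 0 \<le> c b \<and> x = c b *\<^sub>R b)" for x
    by (simp add: convex_cone_hull_finite_iff)
  moreover have "(\<exists>c. 0 \<le> c b \<and> x = c b *\<^sub>R b) \<longleftrightarrow> (\<exists>t. 0 \<le> t \<and> x = t *\<^sub>R b)" for x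
  proof
    assume "\<exists>t. 0 \<le> t \<and> x = t *\<^sub>R b"
    then obtain t where "0 \<le> t" "x = t *\<^sub>R b" by blast
    then show "\<exists>c. 0 \<le> c b \<and> x = c b *\<^sub>R b" by (intro exI[of _ "\<lambda>_. t"]) simp
  qed auto
  ultimately show ?thesis by auto
qed

text \<open>Discreteness provides a smallest positive multiple of \<open>b\<close> in the lattice;
  division with remainder shows that it generates the semigroup.\<close>

lemma primitive_generator:
  assumes N: "is_lattice N" and b: "b \<in> N" "b \<noteq> 0"
  obtains s where "s > 0" "s *\<^sub>R b \<in> N" "convex_cone hull {b} \<inter> N = range (\<lambda>k. real k *\<^sub>R s *\<^sub>R b)"
proof -
  let ?T = "{t. 0 < t \<and> t \<le> 1 \<and> t *\<^sub>R b \<in> N}"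
  have "bounded ((\<lambda>t. t *\<^sub>R b) ` {0..1})"
    by (intro compact_imp_bounded compact_continuous_image continuous_intros) auto
  then have "finite (N \<inter> (\<lambda>t. t *\<^sub>R b) ` {0..1})" by (rule lattice_finite_bounded[OF N])
  moreover have "(\<lambda>t. t *\<^sub>R b) ` ?T \<subseteq> N \<inter> (\<lambda>t. t *\<^sub>R b) ` {0..1}" by auto
  ultimately have "finite ((\<lambda>t. t *\<^sub>R b) ` ?T)" by (rule finite_subset[rotated])
  then have fin: "finite ?T" by (rule finite_imageD) (use b(2) in \<open>auto simp: inj_on_def\<close>)
  have "1 \<in> ?T" using b by simp
  define s where "s = Min ?T"
  have s: "s \<in> ?T" unfolding s_def by (rule Min_in) (use fin \<open>1 \<in> ?T\<close> in auto)
  have min: "s \<le> t" if "t \<in> ?T" for t unfolding s_def by (rule Min_le[OF fin that])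
  show ?thesis
  proof (rule that[of s])
    show "convex_cone hull {b} \<inter> N = range (\<lambda>k. real k *\<^sub>R s *\<^sub>R b)"
    proof (intro equalityI subsetI)
      fix x assume x: "x \<in> convex_cone hull {b} \<inter> N"
      then obtain t where t: "x = t *\<^sub>R b" "0 \<le> t" by (auto simp: convex_cone_hull_singleton)
      define k where "k = nat \<lfloor>t / s\<rfloor>"
      define r where "r = t - real k * s"
      have k: "real k \<le> t / s" "t / s < real k + 1"
        using t s by (auto simp: k_def)
      then have r: "0 \<le> r" "r < s" using s by (auto simp: r_def field_simps)
      have "r *\<^sub>R b = x - real k *\<^sub>R (s *\<^sub>R b)" by (simp add: r_def t(1) scaleR_diff_left)
      then have "r *\<^sub>R b \<in> N"
        using lattice_closed(3)[OF N _ lattice_closed(4)[OF N], of x "s *\<^sub>R b" k] s x by simp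
      then have "r = 0" using min[of r] r s by force
      then have "x = real k *\<^sub>R s *\<^sub>R b" by (simp add: r_def t(1))
      then show "x \<in> range (\<lambda>k. real k *\<^sub>R s *\<^sub>R b)" by blast
    next
      fix x assume "x \<in> range (\<lambda>k. real k *\<^sub>R s *\<^sub>R b)"
      then obtain k where "x = real k *\<^sub>R s *\<^sub>R b" by blast
      then show "x \<in> convex_cone hull {b} \<inter> N"
        using s lattice_closed(4)[OF N, of "s *\<^sub>R b" k] by (auto simp: convex_cone_hull_singleton)
    qed
  qed (use s in auto)
qed

text \<open>Pigeonhole: the multiples of \<open>b\<close>, reduced by their fractional coordinates
  in \<open>G\<close>, are lattice points in a bounded set, so two of them coincide and their
  difference is an integral combination of \<open>G\<close>.\<close>

lemma lattice_multiple_in_group_closure: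
  fixes N :: "'a::euclidean_space set"
  assumes N: "is_lattice N" and G: "finite G" "G \<subseteq> N" "span G = UNIV" and b: "b \<in> N"
  shows "\<exists>k>0. real k *\<^sub>R b \<in> group_closure G"
proof -
  have "b \<in> span G" by (simp add: G(3))
  then obtain u where u: "b = (\<Sum>g\<in>G. u g *\<^sub>R g)" unfolding span_finite[OF G(1)] by (elim rangeE)
  define p where "p j = (\<Sum>g\<in>G. frac (real j * u g) *\<^sub>R g)" for j :: nat
  have p: "p j = real j *\<^sub>R b - (\<Sum>g\<in>G. of_int \<lfloor>real j * u g\<rfloor> *\<^sub>R g)" for j
    unfolding u by (simp add: p_def frac_def scaleR_diff_left sum_subtractf scaleR_sum_right)
  have gc: "(\<Sum>g\<in>G. of_int \<lfloor>c g\<rfloor> *\<^sub>R g) \<in> group_closure G" for c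
    by (intro group_closure_sum group_closure_scaleR_int group_closure.base) simp
  have "p j \<in> N" for j
    unfolding p by (rule lattice_closed(3)[OF N lattice_closed(4)[OF N b] subsetD[OF lattice_closed(6)[OF N G(2)] gc]])
  moreover have "norm (p j) \<le> (\<Sum>g\<in>G. norm g)" for j
    unfolding p_def
  proof (rule sum_norm_le)
    fix g
    have "\<bar>frac (real j * u g)\<bar> \<le> 1" using frac_ge_0[of "real j * u g"] frac_lt_1[of "real j * u g"] by linarith
    then show "norm (frac (real j * u g) *\<^sub>R g) \<le> norm g" by (simp add: mult_left_le_one_le)
  qed
  ultimately have "range p \<subseteq> N \<inter> cball 0 (\<Sum>g\<in>G. norm g)" by auto
  then have "finite (range p)" using lattice_finite_bounded[OF N bounded_cball] finite_subset by blast
  then have "\<not> inj p" using finite_imageD infinite_UNIV_nat by blast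
  then obtain i j where ij: "p i = p j" "i \<noteq> j" by (auto simp: inj_def)
  have *: "\<exists>k>0. real k *\<^sub>R b \<in> group_closure G" if "p i = p j" "i < j" for i j
  proof (intro exI[of _ "j - i"] conjI)
    have "real (j - i) *\<^sub>R b = (\<Sum>g\<in>G. of_int \<lfloor>real j * u g\<rfloor> *\<^sub>R g) - (\<Sum>g\<in>G. of_int \<lfloor>real i * u g\<rfloor> *\<^sub>R g)"
      using that p[of i] p[of j] by (simp add: of_nat_diff scaleR_diff_left algebra_simps)
    then show "real (j - i) *\<^sub>R b \<in> group_closure G" using group_closure.diff[OF gc[of "\<lambda>g. real j * u g"] gc[of "\<lambda>g. real i * u g"]] by simp
  qed (use that in auto)
  show ?thesis using ij *[of i j] *[of j i] by (metis nat_neq_iff)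
qed

text \<open>Each lattice basis vector has a positive multiple in the group generated by
  \<open>G\<close>; the product of these multipliers clears all denominators of
  \<open>m\<close>.\<close>

lemma lattice_dual_multiple:
  fixes N :: "'a::euclidean_space set"
  assumes N: "is_lattice N" and G: "finite G" "G \<subseteq> N" "span G = UNIV"
    and m: "linear m" "\<And>v. v \<in> G \<Longrightarrow> m v \<in> \<int>"
  shows "\<exists>k>0. (\<lambda>v. real k * m v) \<in> dual_lattice N"
proof -
  obtain B where B: "independent B" "N = group_closure B" using N unfolding is_lattice_def by blast
  have fin: "finite B" using B(1) by (rule independent_imp_finite)
  have "\<forall>b\<in>B. \<exists>k>0. real k *\<^sub>R b \<in> group_closure G"
    using lattice_multiple_in_group_closure[OF N G] group_closure.base B(2) by blast
  then obtain k where k: "\<And>b. b \<in> B \<Longrightarrow> k b > 0" "\<And>b. b \<in> B \<Longrightarrow> real (k b) *\<^sub>R b \<in> group_closure G" by metis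
  define K where "K = prod k B"
  have "real K * m b \<in> \<int>" if b: "b \<in> B" for b
  proof -
    have "K = prod k (B - {b}) * k b" unfolding K_def using prod.remove[OF fin b, of k] by (simp add: mult.commute)
    moreover have "real (k b) * m b \<in> \<int>"
      using group_closure_induct_linear[OF m k(2)[OF b]] m(1) by (simp add: linear_cmul)
    ultimately show ?thesis by (simp only: of_nat_mult mult.assoc Ints_mult Ints_of_nat)
  qed
  then have "(\<lambda>v. real K * m v) \<in> dual_lattice N"
    unfolding B(2) dual_lattice_group_closure using linear_compose_scale_right[OF m(1), of "real K"] by simp
  moreover have "K > 0" unfolding K_def by (rule prod_pos) (use k in auto)
  ultimately show ?thesis by blast
qed

lemma convex_cone_hull_scaled_singleton:
  assumes "c > 0" shows "convex_cone hull {c *\<^sub>R b} = convex_cone hull {b}"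
proof -
  have "(\<exists>t. x = t *\<^sub>R c *\<^sub>R b \<and> 0 \<le> t) \<longleftrightarrow> (\<exists>t. x = t *\<^sub>R b \<and> 0 \<le> t)" for x
  proof
    assume "\<exists>t. x = t *\<^sub>R b \<and> 0 \<le> t"
    then obtain t where "x = t *\<^sub>R b" "0 \<le> t" by blast
    then show "\<exists>t. x = t *\<^sub>R c *\<^sub>R b \<and> 0 \<le> t" using assms by (intro exI[of _ "t / c"]) simp
  next
    assume "\<exists>t. x = t *\<^sub>R c *\<^sub>R b \<and> 0 \<le> t"
    then obtain t where "x = t *\<^sub>R c *\<^sub>R b" "0 \<le> t" by blast
    then show "\<exists>t. x = t *\<^sub>R b \<and> 0 \<le> t" using assms by (intro exI[of _ "t * c"]) simp
  qed
  then show ?thesis unfolding convex_cone_hull_singleton by blast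
qed

section \<open>Weighted fans\<close>

locale toric_fan =
  fixes N :: "'a::euclidean_space set" and \<Sigma> :: "'a set set" and w :: "'a set \<Rightarrow> nat"
  assumes lattice: "is_lattice N" and fan: "weighted_fan N \<Sigma> w"
begin

lemma fan_complete: "complete_simplicial_fan N \<Sigma>"
  using fan by (simp add: weighted_fan_def)

lemma w_pos: "\<rho> \<in> rays \<Sigma> \<Longrightarrow> w \<rho> > 0"
  using fan by (simp add: weighted_fan_def)

lemma fan_finite: "finite \<Sigma>"
  using fan_complete by (simp add: complete_simplicial_fan_def)

lemma fan_cone:
  assumes "\<tau> \<in> \<Sigma>" obtains B where "B \<subseteq> N" "independent B" "\<tau> = convex_cone hull B"
  using fan_complete assms unfolding complete_simplicial_fan_def rational_simplicial_cone_def by metis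

lemma fan_face: "\<tau> \<in> \<Sigma> \<Longrightarrow> \<tau>' face_of \<tau> \<Longrightarrow> \<tau>' \<noteq> {} \<Longrightarrow> \<tau>' \<in> \<Sigma>"
  using fan_complete by (auto simp: complete_simplicial_fan_def)

lemma fan_Int_face: "\<tau> \<in> \<Sigma> \<Longrightarrow> \<tau>' \<in> \<Sigma> \<Longrightarrow> \<tau> \<inter> \<tau>' face_of \<tau>"
  using fan_complete by (auto simp: complete_simplicial_fan_def)

lemma fan_cover: "\<Union>\<Sigma> = UNIV"
  using fan_complete by (simp add: complete_simplicial_fan_def)

lemma convex_cone_fan: "\<tau> \<in> \<Sigma> \<Longrightarrow> convex_cone \<tau>"
  by (erule fan_cone) (simp add: convex_cone_convex_cone_hull)

lemma zero_in_cone: "\<tau> \<in> \<Sigma> \<Longrightarrow> 0 \<in> \<tau>"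
  using convex_cone_fan convex_cone_iff by blast

lemma fan_Int: "\<tau> \<in> \<Sigma> \<Longrightarrow> \<tau>' \<in> \<Sigma> \<Longrightarrow> \<tau> \<inter> \<tau>' \<in> \<Sigma>"
  using fan_face[OF _ fan_Int_face] zero_in_cone by blast

lemma rays_in_fan: "\<rho> \<in> rays \<Sigma> \<Longrightarrow> \<rho> \<in> \<Sigma>"
  by (simp add: cones_def)

lemma max_in_fan: "\<sigma> \<in> max_cones \<Sigma> \<Longrightarrow> \<sigma> \<in> \<Sigma>"
  by (simp add: cones_def)

text \<open>Two generators of the semigroup are natural multiples of each other, so both factors are
  1; this makes the definite description in \<open>ray_gen\<close> well defined.\<close>

lemma ray_generator:
  assumes "\<rho> \<in> rays \<Sigma>"
  shows "ray_gen N \<rho> \<in> N" "ray_gen N \<rho> \<noteq> 0" "\<rho> = convex_cone hull {ray_gen N \<rho>}"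
proof -
  obtain B where B: "B \<subseteq> N" "independent B" "\<rho> = convex_cone hull B"
    using fan_cone[OF rays_in_fan[OF assms]] .
  have "card B = 1"
    using assms dim_eq_card_independent[OF B(2)] by (simp add: cones_def B(3) dim_convex_cone_hull)
  then obtain b where b: "B = {b}" by (auto simp: card_1_singleton_iff)
  then have bN: "b \<in> N" "b \<noteq> 0" using B dependent_zero by auto
  obtain s where s: "s > 0" "s *\<^sub>R b \<in> N" "convex_cone hull {b} \<inter> N = range (\<lambda>k. real k *\<^sub>R s *\<^sub>R b)"
    by (rule primitive_generator[OF lattice bN])
  have "ray_gen N \<rho> = s *\<^sub>R b"
    unfolding ray_gen_def
  proof (rule the_equality)
    show "\<rho> \<inter> N = range (\<lambda>k. real k *\<^sub>R s *\<^sub>R b)" using s(3) by (simp add: B(3) b)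
    fix v assume v: "\<rho> \<inter> N = range (\<lambda>k. real k *\<^sub>R v)"
    then have eq: "range (\<lambda>k. real k *\<^sub>R v) = range (\<lambda>k. real k *\<^sub>R s *\<^sub>R b)" using s(3) by (simp add: B(3) b)
    have "v \<in> range (\<lambda>k. real k *\<^sub>R v)" by (rule range_eqI[of _ _ 1]) simp
    then obtain k where k: "v = real k *\<^sub>R s *\<^sub>R b" unfolding eq by (elim rangeE)
    have "s *\<^sub>R b \<in> range (\<lambda>k. real k *\<^sub>R s *\<^sub>R b)" by (rule range_eqI[of _ _ 1]) simp
    then obtain k' where k': "s *\<^sub>R b = real k' *\<^sub>R v" unfolding eq[symmetric] by (elim rangeE)
    have "(real k' * real k) *\<^sub>R (s *\<^sub>R b) = real k' *\<^sub>R v" unfolding k by simp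
    also have "\<dots> = 1 *\<^sub>R (s *\<^sub>R b)" unfolding k'[symmetric] by simp
    finally have "(real k' * real k) *\<^sub>R (s *\<^sub>R b) = 1 *\<^sub>R (s *\<^sub>R b)" .
    then have "real k' * real k = 1" using s(1) bN(2) by (subst (asm) scaleR_cancel_right) auto
    then have "k' * k = 1" by (metis of_nat_1 of_nat_eq_iff of_nat_mult)
    then show "v = s *\<^sub>R b" using k by simp
  qed
  then show "ray_gen N \<rho> \<in> N" "ray_gen N \<rho> \<noteq> 0" "\<rho> = convex_cone hull {ray_gen N \<rho>}"
    using s bN by (auto simp: B(3) b convex_cone_hull_scaled_singleton)
qed

definition weighted_gen :: "'a set \<Rightarrow> 'a" where
  "weighted_gen \<rho> = real (w \<rho>) *\<^sub>R ray_gen N \<rho>"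

definition gens :: "'a set \<Rightarrow> 'a set" where
  "gens \<tau> = {real (w \<rho>) *\<^sub>R ray_gen N \<rho> |\<rho>. \<rho> \<in> rays \<Sigma> \<and> \<rho> \<subseteq> \<tau>}"

lemma gens_eq: "gens \<tau> = weighted_gen ` {\<rho> \<in> rays \<Sigma>. \<rho> \<subseteq> \<tau>}"
  by (auto simp: gens_def weighted_gen_def)

lemma weighted_gen:
  assumes "\<rho> \<in> rays \<Sigma>"
  shows "weighted_gen \<rho> \<in> N" "weighted_gen \<rho> \<noteq> 0" "\<rho> = convex_cone hull {weighted_gen \<rho>}"
    "weighted_gen \<rho> \<in> \<rho>"
proof -
  show "weighted_gen \<rho> \<in> N" "weighted_gen \<rho> \<noteq> 0" and *: "\<rho> = convex_cone hull {weighted_gen \<rho>}"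
    using ray_generator[OF assms] w_pos[OF assms] lattice_closed(4)[OF lattice]
    by (auto simp: weighted_gen_def convex_cone_hull_scaled_singleton)
  show "weighted_gen \<rho> \<in> \<rho>" using hull_inc[of "weighted_gen \<rho>" "{weighted_gen \<rho>}" convex_cone] * by simp
qed

lemma finite_gens: "finite (gens \<tau>)"
  unfolding gens_eq by (intro finite_imageI finite_subset[OF _ fan_finite]) (auto simp: cones_def)

lemma gens_subset_N: "gens \<tau> \<subseteq> N"
  unfolding gens_eq using weighted_gen(1) by auto

text \<open>The rays in \<open>\<tau>\<close> are those through the elements of a basis
  \<open>B\<close> that generates it: a ray of the fan contained in \<open>\<tau>\<close> is a face,
  hence generated by the elements of \<open>B\<close> in it, and its dimension leaves just one. So
  \<open>gens \<tau>\<close> is a positive rescaling of \<open>B\<close>.\<close>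

lemma
  assumes \<tau>: "\<tau> \<in> \<Sigma>"
  shows independent_gens: "independent (gens \<tau>)" and cone_eq_hull_gens: "\<tau> = convex_cone hull (gens \<tau>)"
proof -
  obtain B where B: "B \<subseteq> N" "independent B" "\<tau> = convex_cone hull B"
    using fan_cone[OF \<tau>] .
  have finB: "finite B" using B(2) by (rule independent_imp_finite)
  have rays: "{\<rho> \<in> rays \<Sigma>. \<rho> \<subseteq> \<tau>} = (\<lambda>b. convex_cone hull {b}) ` B"
  proof (intro equalityI subsetI)
    fix \<rho> assume "\<rho> \<in> {\<rho> \<in> rays \<Sigma>. \<rho> \<subseteq> \<tau>}"
    then have \<rho>: "\<rho> \<in> rays \<Sigma>" "\<rho> \<subseteq> \<tau>" by auto
    have "\<rho> face_of \<tau>" using fan_Int_face[OF \<tau> rays_in_fan[OF \<rho>(1)]] \<rho>(2) by (simp add: Int_absorb1)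
    then have eq: "\<rho> = convex_cone hull (B \<inter> \<rho>)"
      using weighted_gen(4)[OF \<rho>(1)] by (intro face_of_finite_convex_cone_hull finB) (auto simp: B(3))
    have "independent (B \<inter> \<rho>)" using B(2) by (rule independent_mono) auto
    then have "card (B \<inter> \<rho>) = dim \<rho>" using dim_eq_card_independent dim_convex_cone_hull eq by metis
    then have "card (B \<inter> \<rho>) = 1" using \<rho>(1) by (simp add: cones_def)
    then obtain b where b: "B \<inter> \<rho> = {b}" by (auto simp: card_1_singleton_iff)
    then have "\<rho> = convex_cone hull {b}" "b \<in> B" using eq by auto
    then show "\<rho> \<in> (\<lambda>b. convex_cone hull {b}) ` B" by (rule image_eqI)
  next
    fix \<rho> assume "\<rho> \<in> (\<lambda>b. convex_cone hull {b}) ` B"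
    then obtain b where b: "b \<in> B" "\<rho> = convex_cone hull {b}" by blast
    have face: "\<rho> face_of \<tau>"
      unfolding b(2) B(3) by (rule convex_cone_hull_subset_face_of[OF B(2)]) (use b in auto)
    have "\<rho> \<in> \<Sigma>" by (rule fan_face[OF \<tau> face]) (simp add: b(2) convex_cone_hull_nonempty)
    moreover have "independent {b}" using B(2) by (rule independent_mono) (use b in auto)
    then have "dim \<rho> = 1" unfolding b(2) dim_convex_cone_hull by (simp add: dim_eq_card_independent)
    ultimately show "\<rho> \<in> {\<rho> \<in> rays \<Sigma>. \<rho> \<subseteq> \<tau>}" using face_of_imp_subset[OF face] by (simp add: cones_def)
  qed
  have scal: "\<exists>c>0. weighted_gen (convex_cone hull {b}) = c *\<^sub>R b" if b: "b \<in> B" for b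
  proof -
    have "convex_cone hull {b} \<in> rays \<Sigma>" using rays b by blast
    from weighted_gen(2,4)[OF this] obtain t where "weighted_gen (convex_cone hull {b}) = t *\<^sub>R b" "t \<ge> 0" "t \<noteq> 0"
      by (auto simp: convex_cone_hull_singleton)
    then show ?thesis by (intro exI[of _ t]) simp
  qed
  have gens: "gens \<tau> = (\<lambda>b. weighted_gen (convex_cone hull {b})) ` B"
    unfolding gens_eq rays by (simp add: image_image)
  have "gens \<tau> \<subseteq> \<tau>"
  proof
    fix x assume "x \<in> gens \<tau>"
    then obtain b c where "b \<in> B" "c > 0" "x = c *\<^sub>R b" unfolding gens using scal by blast
    then have "x \<in> convex_cone hull B" by (simp add: convex_cone_hull_mul hull_inc)
    then show "x \<in> \<tau>" using B(3) by simp
  qed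
  have Bsub: "B \<subseteq> convex_cone hull (gens \<tau>)"
  proof
    fix b assume b: "b \<in> B"
    obtain c where c: "c > 0" "weighted_gen (convex_cone hull {b}) = c *\<^sub>R b" using scal[OF b] by blast
    have "c *\<^sub>R b \<in> gens \<tau>" unfolding gens c(2)[symmetric] using b by blast
    then have "(1/c) *\<^sub>R (c *\<^sub>R b) \<in> convex_cone hull (gens \<tau>)"
      using c(1) by (intro convex_cone_hull_mul hull_inc) auto
    then show "b \<in> convex_cone hull (gens \<tau>)" using c(1) by simp
  qed
  show eq: "\<tau> = convex_cone hull (gens \<tau>)"
  proof
    show "\<tau> \<subseteq> convex_cone hull (gens \<tau>)"
      using hull_minimal[OF Bsub] convex_cone_convex_cone_hull B(3) by blast
    show "convex_cone hull (gens \<tau>) \<subseteq> \<tau>"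
      using hull_minimal[OF \<open>gens \<tau> \<subseteq> \<tau>\<close>] convex_cone_fan[OF \<tau>] by blast
  qed
  have span: "span (gens \<tau>) = span B" using eq B(3) span_convex_cone_hull by metis
  \<comment> \<open>There are at most \<open>card B\<close> vectors in \<open>gens \<tau>\<close>,
    and they span the same space as the independent set \<open>B\<close>.\<close>
  show "independent (gens \<tau>)"
  proof (rule card_le_dim_spanning[of _ "span B"])
    have "card (gens \<tau>) \<le> card B" unfolding gens by (rule card_image_le[OF finB])
    then show "card (gens \<tau>) \<le> dim (span B)" using dim_eq_card_independent[OF B(2)] by simp
    show "gens \<tau> \<subseteq> span B" using span span_superset by blast
  qed (use span finite_gens in auto)
qed

lemma card_gens: "\<tau> \<in> \<Sigma> \<Longrightarrow> card (gens \<tau>) = dim \<tau>"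
  using dim_eq_card_independent[OF independent_gens] cone_eq_hull_gens dim_convex_cone_hull by metis

lemma span_gens_max:
  assumes "\<sigma> \<in> max_cones \<Sigma>" shows "span (gens \<sigma>) = UNIV"
proof -
  have "dim (gens \<sigma>) = DIM('a)"
    using assms card_gens[OF max_in_fan[OF assms]] dim_eq_card_independent[OF independent_gens[OF max_in_fan[OF assms]]]
    by (simp add: cones_def)
  then show ?thesis by (simp add: dim_eq_full)
qed

lemma gens_mono: "\<tau> \<subseteq> \<tau>' \<Longrightarrow> gens \<tau> \<subseteq> gens \<tau>'"
  unfolding gens_eq by auto

lemma gens_subset_cone: "\<tau> \<in> \<Sigma> \<Longrightarrow> gens \<tau> \<subseteq> \<tau>"
  unfolding gens_eq using weighted_gen(4) by auto

lemma linear_zero_on_cone: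
  assumes "\<tau> \<in> \<Sigma>" "linear m" "\<And>v. v \<in> gens \<tau> \<Longrightarrow> m v = 0" "v \<in> \<tau>" shows "m v = 0"
proof -
  have "v \<in> span (gens \<tau>)"
    using assms(4) cone_eq_hull_gens[OF assms(1)] span_convex_cone_hull span_superset by blast
  then show ?thesis using linear_eq_0_on_span[OF assms(2,3)] by blast
qed

text \<open>The lower-dimensional cones are negligible, so the complement of the union of the
  maximal cones is open and negligible, hence empty. A maximal cone that contains the sum of the
  generators of \<open>\<tau>\<close> meets \<open>\<tau>\<close> in a face containing this sum,
  thus each generator.\<close>

lemma max_cone_above:
  assumes \<tau>: "\<tau> \<in> \<Sigma>" obtains \<sigma> where "\<sigma> \<in> max_cones \<Sigma>" "\<tau> \<subseteq> \<sigma>"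
proof -
  have closed: "closed \<tau>" if "\<tau> \<in> \<Sigma>" for \<tau>
    using closed_convex_cone_hull[OF finite_gens[of \<tau>]] cone_eq_hull_gens[OF that] by simp
  have finite_max: "finite (max_cones \<Sigma>)" using fan_finite by (simp add: cones_def)
  have cover: "\<Union>(max_cones \<Sigma>) = UNIV"
  proof (rule ccontr)
    assume ne: "\<Union>(max_cones \<Sigma>) \<noteq> UNIV"
    have "negligible (\<Union>(\<Sigma> - max_cones \<Sigma>))"
    proof (rule negligible_Union)
      fix \<tau> assume "\<tau> \<in> \<Sigma> - max_cones \<Sigma>"
      then have "dim \<tau> \<noteq> DIM('a)" by (auto simp: cones_def)
      then have "dim \<tau> < DIM('a)" using dim_subset_UNIV[of \<tau>] by linarith
      then show "negligible \<tau>" by (rule negligible_lowdim)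
    qed (use fan_finite in auto)
    moreover have "- \<Union>(max_cones \<Sigma>) \<subseteq> \<Union>(\<Sigma> - max_cones \<Sigma>)" using fan_cover by blast
    ultimately have "negligible (- \<Union>(max_cones \<Sigma>))" by (rule negligible_subset)
    moreover have "open (- \<Union>(max_cones \<Sigma>))"
      using closed finite_max max_in_fan by (intro open_Compl closed_Union) auto
    ultimately show False using open_not_negligible ne by blast
  qed
  then obtain \<sigma> where \<sigma>: "\<sigma> \<in> max_cones \<Sigma>" "\<Sum>(gens \<tau>) \<in> \<sigma>" by blast
  have face: "\<tau> \<inter> \<sigma> face_of \<tau>" by (rule fan_Int_face[OF \<tau> max_in_fan[OF \<sigma>(1)]])
  have sum: "\<Sum>(gens \<tau>) \<in> \<tau>"
    using convex_cone_hull_finite_iff[OF finite_gens[of \<tau>], of "\<Sum>(gens \<tau>)"] cone_eq_hull_gens[OF \<tau>]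
    by (auto intro!: exI[of _ "\<lambda>_. 1"])
  have "g \<in> \<tau> \<inter> \<sigma>" if "g \<in> gens \<tau>" for g
    by (rule face_of_convex_cone_sum[OF face convex_cone_fan[OF \<tau>] finite_gens _ _ that, of "\<lambda>g. g"])
      (use gens_subset_cone[OF \<tau>] sum \<sigma> in auto)
  then have "convex_cone hull (gens \<tau>) \<subseteq> \<sigma>"
    by (intro hull_minimal convex_cone_fan[OF max_in_fan[OF \<sigma>(1)]]) auto
  then show ?thesis using that[OF \<sigma>(1)] cone_eq_hull_gens[OF \<tau>] by simp
qed

lemma zero_cone: "{0} \<in> \<Sigma>"
proof -
  obtain \<tau> where \<tau>: "\<tau> \<in> \<Sigma>" using fan_cover by blast
  have "convex_cone hull {} face_of convex_cone hull (gens \<tau>)"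
    by (rule convex_cone_hull_subset_face_of[OF independent_gens[OF \<tau>]]) simp
  then have "{0} face_of \<tau>" using cone_eq_hull_gens[OF \<tau>] by simp
  then show ?thesis by (rule fan_face[OF \<tau>]) simp
qed

lemma zero_cone_subset: "\<tau> \<in> \<Sigma> \<Longrightarrow> {0} \<subseteq> \<tau>"
  using zero_in_cone by blast

lemma max_cone_maximal:
  assumes \<sigma>: "\<sigma> \<in> max_cones \<Sigma>" "\<sigma>' \<in> max_cones \<Sigma>" "\<sigma> \<subseteq> \<sigma>'" shows "\<sigma> = \<sigma>'"
proof -
  have "card (gens \<sigma>) = card (gens \<sigma>')"
    using card_gens[OF max_in_fan] \<sigma>(1,2) by (simp add: cones_def)
  then have "gens \<sigma> = gens \<sigma>'" by (intro card_subset_eq finite_gens gens_mono \<sigma>(3))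
  then show ?thesis using cone_eq_hull_gens[OF max_in_fan[OF \<sigma>(1)]] cone_eq_hull_gens[OF max_in_fan[OF \<sigma>(2)]] by simp
qed

section \<open>Chart lattices and supporting characters of faces\<close>

abbreviation \<Lambda> :: "'a set \<Rightarrow> 'a set" where "\<Lambda> \<equiv> cone_lattice N \<Sigma> w"

lemma \<Lambda>_max:
  assumes \<sigma>: "\<sigma> \<in> max_cones \<Sigma>" shows "\<Lambda> \<sigma> = group_closure (gens \<sigma>)"
proof -
  have "{\<sigma>' \<in> max_cones \<Sigma>. \<sigma> \<subseteq> \<sigma>'} = {\<sigma>}" using max_cone_maximal[OF \<sigma>] \<sigma> by blast
  then show ?thesis by (simp add: cone_lattice_def max_cone_lattice_def gens_def)
qed

lemma \<Lambda>_mono: "\<tau>' \<subseteq> \<tau> \<Longrightarrow> \<Lambda> \<tau>' \<subseteq> \<Lambda> \<tau>"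
  unfolding cone_lattice_def by blast

lemma \<Lambda>_subset_N: assumes "\<tau> \<in> \<Sigma>" shows "\<Lambda> \<tau> \<subseteq> N"
proof -
  obtain \<sigma> where \<sigma>: "\<sigma> \<in> max_cones \<Sigma>" "\<tau> \<subseteq> \<sigma>" by (rule max_cone_above[OF assms])
  have "\<Lambda> \<tau> \<subseteq> group_closure (gens \<sigma>)" using \<Lambda>_mono[OF \<sigma>(2)] \<Lambda>_max[OF \<sigma>(1)] by simp
  also have "\<dots> \<subseteq> N" by (rule lattice_closed(6)[OF lattice gens_subset_N])
  finally show ?thesis .
qed

lemma dual_\<Lambda>_max:
  "\<sigma> \<in> max_cones \<Sigma> \<Longrightarrow> m \<in> dual_lattice (\<Lambda> \<sigma>) \<longleftrightarrow> linear m \<and> (\<forall>v\<in>gens \<sigma>. m v \<in> \<int>)"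
  by (simp add: \<Lambda>_max dual_lattice_group_closure)

lemma fixed_point_chart_orbi:
  assumes \<sigma>: "\<sigma> \<in> max_cones \<Sigma>" shows "fixed_point_chart \<sigma> (\<Lambda> \<sigma>) (gens \<sigma>)"
  by unfold_locales
    (use \<sigma> finite_gens span_gens_max cone_eq_hull_gens[OF max_in_fan[OF \<sigma>]] in
      \<open>auto simp: \<Lambda>_max intro: group_closure.base\<close>)

lemma fixed_point_chart_variety:
  assumes \<sigma>: "\<sigma> \<in> max_cones \<Sigma>" shows "fixed_point_chart \<sigma> N (gens \<sigma>)"
  by unfold_locales
    (use \<sigma> finite_gens span_gens_max gens_subset_N cone_eq_hull_gens[OF max_in_fan[OF \<sigma>]] in auto)

text \<open>The functional that is 0 on the generators in \<open>\<tau>\<close> and 1 on the others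
  need only be rational on \<open>N\<close>, so a positive multiple is taken. Inverting its monomial
  localizes the chart of \<open>\<sigma>\<close> to that of \<open>\<tau>\<close>.\<close>

lemma face_defining_character:
  assumes \<sigma>: "\<sigma> \<in> max_cones \<Sigma>" and \<tau>: "\<tau> \<in> \<Sigma>" "\<tau> \<subseteq> \<sigma>"
  obtains m where "m \<in> cone_chars \<sigma> N" "\<And>v. v \<in> \<tau> \<Longrightarrow> m v = 0" "\<And>v. v \<in> gens \<sigma> \<Longrightarrow> v \<notin> \<tau> \<Longrightarrow> 1 \<le> m v"
proof -
  interpret fixed_point_chart \<sigma> N "gens \<sigma>" by (rule fixed_point_chart_variety[OF \<sigma>])
  obtain m where m: "linear m" "\<And>v. v \<in> gens \<sigma> \<Longrightarrow> m v = (if v \<in> \<tau> then 0 else 1::real)"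
    using linear_independent_extend[OF independent_gens[OF max_in_fan[OF \<sigma>]], of "\<lambda>v. if v \<in> \<tau> then 0 else 1"]
    by blast
  obtain k where k: "k > 0" "(\<lambda>v. real k * m v) \<in> dual_lattice N"
    using lattice_dual_multiple[OF lattice finite_gens gens_subset_N span_gens_max[OF \<sigma>] m(1)] m(2) by force
  show ?thesis
  proof (rule that[of "\<lambda>v. real k * m v"])
    show "(\<lambda>v. real k * m v) \<in> cone_chars \<sigma> N" using k by (auto simp: S_iff m(2))
    have "m v = 0" if v: "v \<in> gens \<tau>" for v
      using m(2)[OF subsetD[OF gens_mono[OF \<tau>(2)] v]] subsetD[OF gens_subset_cone[OF \<tau>(1)] v] by simp
    then show "real k * m v = 0" if "v \<in> \<tau>" for v
      using linear_zero_on_cone[OF \<tau>(1) m(1) _ that] by simp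
    show "1 \<le> real k * m v" if "v \<in> gens \<sigma>" "v \<notin> \<tau>" for v using that m(2) k(1) by simp
  qed
qed

end

section \<open>Orbi-line bundles and their characters\<close>

text \<open>An invariant function is constant on the orbit of the unit point, and this orbit is
  Zariski dense.\<close>

lemma invariant_regular_constant:
  assumes reg: "regular_on \<tau> \<Lambda> (affine_toric \<tau> \<Lambda>) k"
    and inv: "\<And>v x. x \<in> affine_toric \<tau> \<Lambda> \<Longrightarrow> k (torus_act v x) = k x" and x: "x \<in> affine_toric \<tau> \<Lambda>"
  shows "k x = k (unit_point \<tau> \<Lambda>)"
proof -
  obtain p r where pr: "poly_fun \<tau> \<Lambda> p" "poly_fun \<tau> \<Lambda> r" "r x \<noteq> 0"
    "\<And>y. y \<in> affine_toric \<tau> \<Lambda> \<Longrightarrow> r y \<noteq> 0 \<Longrightarrow> k y = p y / r y"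
    using regular_onE[OF reg order_refl x] by blast
  \<comment> \<open>The extra factor \<open>r\<close> makes the polynomial vanish on the orbit also
    where the fraction for \<open>k\<close> is undefined.\<close>
  have "r x * (p x - k (unit_point \<tau> \<Lambda>) * r x) = 0"
  proof (rule poly_fun_eq_0_if_torus[OF _ _ x])
    show "poly_fun \<tau> \<Lambda> (\<lambda>x. r x * (p x - k (unit_point \<tau> \<Lambda>) * r x))"
      by (intro poly_fun_mult poly_fun_diff poly_fun_const pr)
    fix v
    define y where "y = torus_act v (unit_point \<tau> \<Lambda>)"
    have "k y = k (unit_point \<tau> \<Lambda>)" unfolding y_def by (rule inv[OF unit_point_in])
    moreover have "y \<in> affine_toric \<tau> \<Lambda>" unfolding y_def by (rule torus_act_in[OF unit_point_in])
    ultimately have "r y * (p y - k (unit_point \<tau> \<Lambda>) * r y) = 0" using pr(4)[of y] by (cases "r y = 0") (auto simp: field_simps)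
    then show "r (torus_act v (unit_point \<tau> \<Lambda>)) * (p (torus_act v (unit_point \<tau> \<Lambda>)) -
        k (unit_point \<tau> \<Lambda>) * r (torus_act v (unit_point \<tau> \<Lambda>))) = 0" by (simp only: y_def)
  qed
  then have "p x = k (unit_point \<tau> \<Lambda>) * r x" using pr(3) by simp
  then show ?thesis using pr(4)[OF x pr(3)] pr(3) by simp
qed

lemma dual_lattice_zero_on_cone_chars:
  assumes "m \<in> dual_lattice \<Lambda>" "\<And>v. v \<in> \<tau> \<Longrightarrow> m v = 0"
  shows "m \<in> cone_chars \<tau> \<Lambda>" "(\<lambda>v. - m v) \<in> cone_chars \<tau> \<Lambda>"
  using assms dual_lattice_minus[OF assms(1)] by (auto simp: cone_chars_def)

text \<open>Both \<open>m\<close> and its negative are nonnegative on \<open>\<tau>\<close>, so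
  their monomials are mutually inverse functions.\<close>

lemma affine_toric_invertible:
  assumes "x \<in> affine_toric \<tau> \<Lambda>" "m \<in> dual_lattice \<Lambda>" "\<And>v. v \<in> \<tau> \<Longrightarrow> m v = 0"
  shows "x m * x (\<lambda>v. - m v) = 1"
  using affine_toric_add[OF assms(1) dual_lattice_zero_on_cone_chars[OF assms(2,3)]] affine_toric_zero[OF assms(1)]
  by simp

text \<open>The monomial of the difference has no zeros and exactly the weight that intertwines the
  two actions.\<close>

lemma equivariant_iso_trivial_monomial:
  assumes m: "m \<in> dual_lattice \<Lambda>" "m' \<in> dual_lattice \<Lambda>" and eq: "\<And>v. v \<in> \<tau> \<Longrightarrow> m v = m' v"
  shows "equivariant_iso \<tau> \<Lambda> (trivial_eq (affine_toric \<tau> \<Lambda>) (character m))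
    (trivial_eq (affine_toric \<tau> \<Lambda>) (character m')) (\<lambda>x. x (\<lambda>v. m v - m' v))"
proof (rule equivariant_isoI)
  let ?d = "\<lambda>v. m v - m' v"
  have d: "?d \<in> dual_lattice \<Lambda>" "\<And>v. v \<in> \<tau> \<Longrightarrow> ?d v = 0" using dual_lattice_diff[OF m] eq by auto
  note dS = dual_lattice_zero_on_cone_chars[OF d]
  fix x assume x: "x \<in> affine_toric \<tau> \<Lambda>"
  show "x ?d \<noteq> 0" using affine_toric_invertible[OF x d] by auto
  fix v
  have "character ?d (- v) * character m v = character m' v"
    using dual_latticeD[OF m(1)] dual_latticeD[OF m(2)]
    by (simp add: character_diff_left character_minus_right field_simps)
  then show "snd (trivial_eq (affine_toric \<tau> \<Lambda>) (character m')) v x * x ?d =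
      torus_act v x ?d * snd (trivial_eq (affine_toric \<tau> \<Lambda>) (character m)) v x"
    by (simp add: snd_trivial_eq torus_act_def mult_ac)
next
  have dS: "(\<lambda>v. m v - m' v) \<in> cone_chars \<tau> \<Lambda>"
    using dual_lattice_zero_on_cone_chars(1)[OF dual_lattice_diff[OF m]] eq by simp
  fix V s V' s' assume "(V, s) \<in> fst (trivial_eq (affine_toric \<tau> \<Lambda>) (character m))"
    "(V', s') \<in> fst (trivial_eq (affine_toric \<tau> \<Lambda>) (character m'))"
  then show "regular_on \<tau> \<Lambda> (V \<inter> V') (\<lambda>x. x (\<lambda>v. m v - m' v) * s x / s' x)"
    using regular_on_poly_fun[OF poly_fun_monomial[OF dS, of 1], of "affine_toric \<tau> \<Lambda>"]
    by (simp add: fst_trivial_eq)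
qed

text \<open>The distinguished point \<open>p\<close> of the chart is fixed by the directions in the
  span of \<open>\<tau>\<close>. There the isomorphism forces the characters to agree on these
  directions, so \<open>m - m'\<close> is integer-valued on a subspace and hence zero.\<close>

lemma equivariant_iso_trivial_eq_on_cone:
  assumes f: "equivariant_iso \<tau> \<Lambda> (trivial_eq (affine_toric \<tau> \<Lambda>) (character m))
    (trivial_eq (affine_toric \<tau> \<Lambda>) (character m')) f"
    and lin: "linear m" "linear m'" and v: "v \<in> \<tau>"
  shows "m v = m' v"
proof -
  define p :: "'a point" where "p = (\<lambda>m. if m \<in> cone_chars \<tau> \<Lambda> \<and> (\<forall>v\<in>\<tau>. m v = 0) then 1 else 0)"
  have p: "p \<in> affine_toric \<tau> \<Lambda>"
  proof -
    have "(\<forall>v\<in>\<tau>. m v + m' v = 0) \<longleftrightarrow> (\<forall>v\<in>\<tau>. m v = 0) \<and> (\<forall>v\<in>\<tau>. m' v = 0)"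
      if "m \<in> cone_chars \<tau> \<Lambda>" "m' \<in> cone_chars \<tau> \<Lambda>" for m m'
      using that by (auto simp: cone_chars_def add_nonneg_eq_0_iff)
    then show ?thesis by (auto simp: p_def affine_toric_def cone_chars_add)
  qed
  have fixed: "torus_act u p = p" if "u \<in> span \<tau>" for u
  proof
    fix m
    show "torus_act u p m = p m"
    proof (cases "m \<in> cone_chars \<tau> \<Lambda> \<and> (\<forall>v\<in>\<tau>. m v = 0)")
      case True
      then have "linear m" using cone_chars_linear by blast
      from linear_eq_0_on_span[OF this _ that] have "m u = 0" using True by simp
      then have "character m (- u) = 1"
        using True cone_chars_linear[of m] by (auto simp: character_eq_1_iff linear_neg)
      then show ?thesis by (simp add: torus_act_def)
    qed (auto simp: torus_act_def p_def)
  qed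
  have "(\<lambda>v. m v - m' v) u \<in> \<int>" if "u \<in> span \<tau>" for u
  proof -
    have "character m' u = character m u"
      using equivariant_iso_act[OF f p, of u] equivariant_iso_nonzero[OF f p] fixed[OF that]
      by (simp add: snd_trivial_eq)
    then have "character (\<lambda>v. m v - m' v) u = 1" by (simp add: character_diff_left)
    then show ?thesis unfolding character_eq_1_iff .
  qed
  then have "(\<lambda>v. m v - m' v) v = 0"
    by (rule integer_valued_linear_zero[OF linear_compose_sub[OF lin] subspace_span])
      (use v span_base in auto)
  then show ?thesis by simp
qed

text \<open>Divided by the monomial of the difference, the isomorphism becomes an invariant regular
  function, hence a constant.\<close>

lemma equivariant_iso_trivial_unique:
  assumes f: "equivariant_iso \<tau> \<Lambda> (trivial_eq (affine_toric \<tau> \<Lambda>) (character m))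
    (trivial_eq (affine_toric \<tau> \<Lambda>) (character m')) f"
    and m: "m \<in> dual_lattice \<Lambda>" "m' \<in> dual_lattice \<Lambda>" and eq: "\<And>v. v \<in> \<tau> \<Longrightarrow> m v = m' v"
    and x: "x \<in> affine_toric \<tau> \<Lambda>"
  shows "f x = f (unit_point \<tau> \<Lambda>) * x (\<lambda>v. m v - m' v)"
proof -
  let ?U = "affine_toric \<tau> \<Lambda>"
  let ?d = "\<lambda>v. m v - m' v"
  note mono = equivariant_iso_trivial_monomial[OF m eq]
  note triv = equivariant_line_bundle_trivial[OF m(1), of \<tau>]
  have d: "?d \<in> dual_lattice \<Lambda>" "\<And>v. v \<in> \<tau> \<Longrightarrow> ?d v = 0" using dual_lattice_diff[OF m] eq by auto
  define k where "k x = inverse (x ?d) * f x" for x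
  have "equivariant_iso \<tau> \<Lambda> (trivial_eq ?U (character m)) (trivial_eq ?U (character m)) k"
    unfolding k_def
    by (rule equivariant_iso_trans[OF f equivariant_iso_sym[OF mono triv] triv])
      (use equivariant_line_bundle_trivial[OF m(2)] in auto)
  note k = this
  have "k x = k (unit_point \<tau> \<Lambda>)"
  proof (rule invariant_regular_constant[OF _ _ x])
    have "regular_on \<tau> \<Lambda> (?U \<inter> ?U) (\<lambda>x. k x * 1 / 1)"
      by (rule equivariant_iso_regular[OF k]) (simp_all add: fst_trivial_eq)
    then show "regular_on \<tau> \<Lambda> ?U k" by simp
    show "k (torus_act v x) = k x" if "x \<in> ?U" for v x
      using equivariant_iso_act[OF k that, of v] by (simp add: snd_trivial_eq)
  qed
  moreover have "x ?d \<noteq> 0" using affine_toric_invertible[OF x d] by auto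
  moreover have "unit_point \<tau> \<Lambda> ?d = 1"
    using dual_lattice_zero_on_cone_chars(1)[OF d] by (simp add: unit_point_def)
  ultimately show ?thesis by (simp add: k_def field_simps)
qed

lemma trivializations_differ_by_monomial:
  assumes f: "equivariant_iso \<tau> \<Lambda> (trivial_eq (affine_toric \<tau> \<Lambda>) (character m)) L f"
    and f': "equivariant_iso \<tau> \<Lambda> (trivial_eq (affine_toric \<tau> \<Lambda>) (character m')) L f'"
    and L: "equivariant_line_bundle \<tau> \<Lambda> L"
    and m: "m \<in> dual_lattice \<Lambda>" "m' \<in> dual_lattice \<Lambda>" and eq: "\<And>v. v \<in> \<tau> \<Longrightarrow> m v = m' v"
    and e: "f (unit_point \<tau> \<Lambda>) = f' (unit_point \<tau> \<Lambda>)" and x: "x \<in> affine_toric \<tau> \<Lambda>"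
  shows "f x = f' x * x (\<lambda>v. m v - m' v)"
proof -
  note T = equivariant_line_bundle_trivial[OF m(1), of \<tau>] equivariant_line_bundle_trivial[OF m(2), of \<tau>]
  have "equivariant_iso \<tau> \<Lambda> (trivial_eq (affine_toric \<tau> \<Lambda>) (character m))
    (trivial_eq (affine_toric \<tau> \<Lambda>) (character m')) (\<lambda>x. inverse (f' x) * f x)"
    by (rule equivariant_iso_trans[OF f equivariant_iso_sym[OF f' T(2) L] T(1) L])
  from equivariant_iso_trivial_unique[OF this m eq x]
  show ?thesis
    using e equivariant_iso_nonzero[OF f' x] equivariant_iso_nonzero[OF f' unit_point_in]
    by (simp add: field_simps)
qed

lemma trivializations_same_cone:
  assumes f: "equivariant_iso \<tau> \<Lambda> (trivial_eq (affine_toric \<tau> \<Lambda>) (character m)) L f"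
    and f': "equivariant_iso \<tau> \<Lambda> (trivial_eq (affine_toric \<tau> \<Lambda>) (character m')) L f'"
    and L: "equivariant_line_bundle \<tau> \<Lambda> L"
    and m: "m \<in> dual_lattice \<Lambda>" "m' \<in> dual_lattice \<Lambda>" and v: "v \<in> \<tau>"
  shows "m v = m' v"
proof -
  note T = equivariant_line_bundle_trivial[OF m(1), of \<tau>] equivariant_line_bundle_trivial[OF m(2), of \<tau>]
  have "equivariant_iso \<tau> \<Lambda> (trivial_eq (affine_toric \<tau> \<Lambda>) (character m))
    (trivial_eq (affine_toric \<tau> \<Lambda>) (character m')) (\<lambda>x. inverse (f' x) * f x)"
    by (rule equivariant_iso_trans[OF f equivariant_iso_sym[OF f' T(2) L] T(1) L])
  then show ?thesis
    by (rule equivariant_iso_trivial_eq_on_cone)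
      (use dual_latticeD[OF m(1)] dual_latticeD[OF m(2)] v in auto)
qed

lemma toric_map_unit_point:
  "\<tau>' \<subseteq> \<tau> \<Longrightarrow> \<Lambda>' \<subseteq> \<Lambda> \<Longrightarrow> toric_map \<tau> \<Lambda> (unit_point \<tau>' \<Lambda>') = unit_point \<tau> \<Lambda>"
  using cone_chars_antimono[of \<tau>' \<tau> \<Lambda>' \<Lambda>] by (auto simp: toric_map_def unit_point_def fun_eq_iff)

section \<open>Picard groups as quotients by a character map\<close>

text \<open>Common pattern of both Picard groups: bundles form no group themselves, but equivalence
  is equality under the map \<open>M\<close> into a group \<open>Z\<close> that respects the tensor
  product. The group laws for classes are then pulled back along the injection that \<open>M\<close>
  induces.\<close>

locale kernel_quotient = comm_group Z for Z (structure) +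
  fixes A :: "'b set" and r and M :: "'b \<Rightarrow> 'c" and t :: "'b \<Rightarrow> 'b \<Rightarrow> 'b" and u :: 'b
  assumes r: "r = {(L, L'). L \<in> A \<and> L' \<in> A \<and> M L = M L'}"
    and t: "L \<in> A \<Longrightarrow> L' \<in> A \<Longrightarrow> t L L' \<in> A" and M_t: "L \<in> A \<Longrightarrow> L' \<in> A \<Longrightarrow> M (t L L') = M L \<otimes> M L'"
    and u: "u \<in> A" and M_u: "M u = \<one>"
    and M_carrier: "L \<in> A \<Longrightarrow> M L \<in> carrier Z" and inverse: "L \<in> A \<Longrightarrow> \<exists>L'\<in>A. M L' = inv (M L)"
begin

definition "P = \<lparr>carrier = A // r, mult = (\<lambda>C C'. \<Union>L\<in>C. \<Union>L'\<in>C'. r `` {t L L'}), one = r `` {u}\<rparr>"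

definition m :: "'b set \<Rightarrow> 'c" where "m C = M (SOME L. L \<in> C)"

lemma class_eq: "L \<in> A \<Longrightarrow> r `` {L} = {L' \<in> A. M L' = M L}"
  unfolding r by auto

lemma class_in: "L \<in> A \<Longrightarrow> r `` {L} \<in> carrier P"
  by (simp add: P_def quotientI)

lemma class_cases:
  assumes "C \<in> carrier P" obtains L where "L \<in> A" "C = r `` {L}"
  using assms by (auto simp: P_def elim: quotientE)

lemma m_class: "L \<in> A \<Longrightarrow> m (r `` {L}) = M L"
  using someI[of "\<lambda>L'. L' \<in> r `` {L}" L] unfolding m_def by (auto simp: class_eq)

lemma mult_class:
  assumes "L \<in> A" "L' \<in> A" shows "r `` {L} \<otimes>\<^bsub>P\<^esub> r `` {L'} = r `` {t L L'}"
proof -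
  have "r `` {t K K'} = r `` {t L L'}" if "K \<in> r `` {L}" "K' \<in> r `` {L'}" for K K'
    using that assms by (simp add: class_eq t M_t)
  moreover have "L \<in> r `` {L}" "L' \<in> r `` {L'}" using assms by (auto simp: class_eq)
  ultimately have "(\<Union>K\<in>r `` {L}. \<Union>K'\<in>r `` {L'}. r `` {t K K'}) = r `` {t L L'}" by blast
  then show ?thesis by (simp add: P_def)
qed

lemma inj_m: "inj_on m (carrier P)"
proof (rule inj_onI)
  fix C C' assume "C \<in> carrier P" "C' \<in> carrier P" and eq: "m C = m C'"
  then obtain L L' where L: "L \<in> A" "C = r `` {L}" "L' \<in> A" "C' = r `` {L'}" by (metis class_cases)
  then have "M L = M L'" using eq by (simp only: m_class)
  then show "C = C'" unfolding L(2,4) by (simp only: class_eq[OF L(1)] class_eq[OF L(3)])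
qed

lemma m_image: "m ` carrier P = M ` A"
proof (intro equalityI subsetI)
  fix x assume "x \<in> m ` carrier P"
  then obtain L where "L \<in> A" "x = m (r `` {L})" by (auto elim: class_cases)
  then show "x \<in> M ` A" by (simp add: m_class)
next
  fix x assume "x \<in> M ` A"
  then obtain L where "L \<in> A" "x = M L" by blast
  then show "x \<in> m ` carrier P" using m_class[of L] class_in[of L] by force
qed

lemma m_hom: "m \<in> hom P Z"
proof (rule homI)
  fix C assume "C \<in> carrier P"
  then show "m C \<in> carrier Z" by (auto elim!: class_cases simp: m_class M_carrier)
  fix C' assume "C' \<in> carrier P"
  then show "m (C \<otimes>\<^bsub>P\<^esub> C') = m C \<otimes> m C'" using \<open>C \<in> carrier P\<close>
    by (auto elim!: class_cases simp: m_class mult_class t M_t)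
qed

lemma comm_group_P: "comm_group P"
proof -
  have closed: "x \<otimes>\<^bsub>P\<^esub> y \<in> carrier P" if "x \<in> carrier P" "y \<in> carrier P" for x y
    using that by (auto elim!: class_cases simp: mult_class t class_in)
  have one: "\<one>\<^bsub>P\<^esub> \<in> carrier P" "m \<one>\<^bsub>P\<^esub> = \<one>"
    using class_in[OF u] m_class[OF u] M_u by (auto simp: P_def)
  note mult = hom_mult[OF m_hom] and cl = hom_in_carrier[OF m_hom]
  show ?thesis
  proof (rule comm_groupI)
    fix x y z assume xyz: "x \<in> carrier P" "y \<in> carrier P" "z \<in> carrier P"
    show "x \<otimes>\<^bsub>P\<^esub> y \<otimes>\<^bsub>P\<^esub> z = x \<otimes>\<^bsub>P\<^esub> (y \<otimes>\<^bsub>P\<^esub> z)"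
      by (rule inj_onD[OF inj_m]) (use xyz in \<open>auto simp: closed mult cl m_assoc\<close>)
  next
    fix x y assume xy: "x \<in> carrier P" "y \<in> carrier P"
    show "x \<otimes>\<^bsub>P\<^esub> y = y \<otimes>\<^bsub>P\<^esub> x"
      by (rule inj_onD[OF inj_m]) (use xy in \<open>auto simp: closed mult cl m_comm\<close>)
  next
    fix x assume x: "x \<in> carrier P"
    show "\<one>\<^bsub>P\<^esub> \<otimes>\<^bsub>P\<^esub> x = x"
      by (rule inj_onD[OF inj_m]) (use x one in \<open>auto simp: closed mult cl\<close>)
    obtain L where L: "L \<in> A" "x = r `` {L}" using x by (rule class_cases)
    obtain L' where L': "L' \<in> A" "M L' = inv (M L)" using inverse[OF L(1)] by blast
    have "r `` {L'} \<otimes>\<^bsub>P\<^esub> x = \<one>\<^bsub>P\<^esub>"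
      by (rule inj_onD[OF inj_m])
        (use x one L L' in \<open>auto simp: closed mult class_in m_class M_carrier\<close>)
    then show "\<exists>y\<in>carrier P. y \<otimes>\<^bsub>P\<^esub> x = \<one>\<^bsub>P\<^esub>" using class_in[OF L'(1)] by blast
  qed (use closed one in auto)
qed

end

section \<open>Families of characters of orbi-line bundles\<close>

context toric_fan
begin

abbreviation "LB \<equiv> linearized_orbi_bundles N \<Sigma> w"
abbreviation "chartU \<tau> \<equiv> affine_toric \<tau> (\<Lambda> \<tau>)"

lemma orbi_chart_eq [simp]: "orbi_chart N \<Sigma> w \<tau> = chartU \<tau>"
  by (simp add: orbi_chart_def)

lemma LB_elb: "L \<in> LB \<Longrightarrow> \<tau> \<in> \<Sigma> \<Longrightarrow> equivariant_line_bundle \<tau> (\<Lambda> \<tau>) (chart L \<tau>)"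
  by (simp add: linearized_orbi_bundles_def)

lemma LB_gluing:
  "L \<in> LB \<Longrightarrow> \<tau> \<in> \<Sigma> \<Longrightarrow> \<tau>' \<in> \<Sigma> \<Longrightarrow> \<tau>' \<subseteq> \<tau> \<Longrightarrow>
   equivariant_iso \<tau>' (\<Lambda> \<tau>') (pull_eq (chartU \<tau>') (toric_map \<tau> (\<Lambda> \<tau>)) (chart L \<tau>)) (chart L \<tau>') (gluing L \<tau>' \<tau>)"
  by (simp add: linearized_orbi_bundles_def)

lemma LB_cocycle:
  assumes "L \<in> LB" "\<tau> \<in> \<Sigma>" "\<tau>' \<in> \<Sigma>" "\<tau>'' \<in> \<Sigma>" "\<tau>'' \<subseteq> \<tau>'" "\<tau>' \<subseteq> \<tau>" "x \<in> chartU \<tau>''"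
  shows "gluing L \<tau>'' \<tau> x = gluing L \<tau>'' \<tau>' x * gluing L \<tau>' \<tau> (toric_map \<tau>' (\<Lambda> \<tau>') x)"
proof -
  have "\<forall>\<tau>\<in>\<Sigma>. \<forall>\<tau>'\<in>\<Sigma>. \<forall>\<tau>''\<in>\<Sigma>. \<tau>'' \<subseteq> \<tau>' \<and> \<tau>' \<subseteq> \<tau> \<longrightarrow> (\<forall>x\<in>orbi_chart N \<Sigma> w \<tau>''.
      gluing L \<tau>'' \<tau> x = gluing L \<tau>'' \<tau>' x * gluing L \<tau>' \<tau> (toric_map \<tau>' (\<Lambda> \<tau>') x))"
    using assms(1) unfolding linearized_orbi_bundles_def mem_Collect_eq by (elim conjE)
  from this[rule_format, OF assms(2-4)] show ?thesis using assms(5-7) unfolding orbi_chart_eq by blast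
qed

lemma toric_map_chart: "\<tau>' \<subseteq> \<tau> \<Longrightarrow> x \<in> chartU \<tau>' \<Longrightarrow> toric_map \<tau> (\<Lambda> \<tau>) x \<in> chartU \<tau>"
  using toric_map_in[OF _ \<Lambda>_mono] by blast

lemma equivariant_morphism_chart:
  "\<tau>' \<subseteq> \<tau> \<Longrightarrow> equivariant_morphism \<tau>' (\<Lambda> \<tau>') \<tau> (\<Lambda> \<tau>) (toric_map \<tau> (\<Lambda> \<tau>))"
  by (intro equivariant_morphism_toric_map \<Lambda>_mono)

lemma dual_\<Lambda>_mono: "\<tau>' \<subseteq> \<tau> \<Longrightarrow> m \<in> dual_lattice (\<Lambda> \<tau>) \<Longrightarrow> m \<in> dual_lattice (\<Lambda> \<tau>')"
  using dual_lattice_antimono[OF \<Lambda>_mono] by blast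

abbreviation "fchar \<equiv> fibre_character N \<Sigma> w"

lemma fchar_iff:
  "fchar L \<sigma> m \<longleftrightarrow> m \<in> dual_lattice (\<Lambda> \<sigma>) \<and>
   (\<exists>f. equivariant_iso \<sigma> (\<Lambda> \<sigma>) (trivial_eq (chartU \<sigma>) (character m)) (chart L \<sigma>) f)"
  by (simp add: fibre_character_def)

lemma fchar_exists:
  assumes "L \<in> LB" "\<sigma> \<in> max_cones \<Sigma>" shows "\<exists>m. fchar L \<sigma> m"
  using fixed_point_chart.trivialization_exists[OF fixed_point_chart_orbi[OF assms(2)] LB_elb[OF assms(1) max_in_fan[OF assms(2)]]]
  unfolding fchar_iff by blast

text \<open>Both characters are the action on the fibre over the fixed point.\<close>

lemma fchar_unique:
  assumes "fchar L \<sigma> m" "fchar L \<sigma> m'" "\<sigma> \<in> max_cones \<Sigma>" shows "m = m'"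
proof -
  interpret fixed_point_chart \<sigma> "\<Lambda> \<sigma>" "gens \<sigma>" by (rule fixed_point_chart_orbi[OF assms(3)])
  show ?thesis
  proof (rule character_inj)
    show "linear m" "linear m'" using assms(1,2) unfolding fchar_iff by (auto intro: dual_latticeD)
    show "character m v = character m' v" for v
      using assms(1,2) trivialization_character[of m _ _ v] trivialization_character[of m' _ _ v]
      unfolding fchar_iff by fastforce
  qed
qed

definition M :: "'a orbi_bundle \<Rightarrow> 'a set \<Rightarrow> 'a \<Rightarrow> real" where
  "M L = restrict (\<lambda>\<sigma>. SOME m. fchar L \<sigma> m) (max_cones \<Sigma>)"

lemma fchar_M_iff:
  assumes "L \<in> LB" "\<sigma> \<in> max_cones \<Sigma>" shows "fchar L \<sigma> m \<longleftrightarrow> m = M L \<sigma>"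
  using someI_ex[OF fchar_exists[OF assms]] fchar_unique[OF _ _ assms(2)] assms(2) by (auto simp: M_def)

lemma M_eqI:
  "L \<in> LB \<Longrightarrow> (\<And>\<sigma>. \<sigma> \<in> max_cones \<Sigma> \<Longrightarrow> fchar L \<sigma> (m \<sigma>)) \<Longrightarrow> m \<in> extensional (max_cones \<Sigma>) \<Longrightarrow> M L = m"
  by (rule extensionalityI[of _ "max_cones \<Sigma>"]) (use fchar_M_iff in \<open>auto simp: M_def\<close>)

text \<open>A trivialization over a maximal cone passes to the chart of a face by pull-back along
  the toric map and composition with the gluing isomorphism.\<close>

lemma chart_trivialization:
  assumes L: "L \<in> LB" and \<sigma>: "\<sigma> \<in> max_cones \<Sigma>" and \<tau>: "\<tau> \<in> \<Sigma>" "\<tau> \<subseteq> \<sigma>"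
    and f: "equivariant_iso \<sigma> (\<Lambda> \<sigma>) (trivial_eq (chartU \<sigma>) (character m)) (chart L \<sigma>) f"
    and m: "m \<in> dual_lattice (\<Lambda> \<sigma>)"
  shows "equivariant_iso \<tau> (\<Lambda> \<tau>) (trivial_eq (chartU \<tau>) (character m)) (chart L \<tau>)
     (\<lambda>x. gluing L \<tau> \<sigma> x * f (toric_map \<sigma> (\<Lambda> \<sigma>) x))"
proof -
  note \<sigma>\<Sigma> = max_in_fan[OF \<sigma>]
  note mor = equivariant_morphism_chart[OF \<tau>(2)]
  have "equivariant_iso \<tau> (\<Lambda> \<tau>) (pull_eq (chartU \<tau>) (toric_map \<sigma> (\<Lambda> \<sigma>)) (trivial_eq (chartU \<sigma>) (character m)))
      (pull_eq (chartU \<tau>) (toric_map \<sigma> (\<Lambda> \<sigma>)) (chart L \<sigma>)) (\<lambda>x. f (toric_map \<sigma> (\<Lambda> \<sigma>) x))"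
    by (rule equivariant_iso_pull[OF mor f equivariant_line_bundle_trivial[OF m]])
  then have "equivariant_iso \<tau> (\<Lambda> \<tau>) (trivial_eq (chartU \<tau>) (character m))
      (pull_eq (chartU \<tau>) (toric_map \<sigma> (\<Lambda> \<sigma>)) (chart L \<sigma>)) (\<lambda>x. f (toric_map \<sigma> (\<Lambda> \<sigma>) x))"
    using toric_map_chart[OF \<tau>(2)] by (simp add: pull_eq_trivial_eq)
  from equivariant_iso_trans[OF this LB_gluing[OF L \<sigma>\<Sigma> \<tau>]
      equivariant_line_bundle_trivial[OF dual_\<Lambda>_mono[OF \<tau>(2) m]]
      equivariant_line_bundle_pull[OF mor LB_elb[OF L \<sigma>\<Sigma>]]]
  show ?thesis .
qed

lemma M_dual: "L \<in> LB \<Longrightarrow> \<sigma> \<in> max_cones \<Sigma> \<Longrightarrow> M L \<sigma> \<in> dual_lattice (\<Lambda> \<sigma>)"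
  using fchar_M_iff[of L \<sigma> "M L \<sigma>"] by (simp add: fchar_iff)

lemma M_compatible: assumes L: "L \<in> LB" shows "M L \<in> compatible_characters N \<Sigma> w"
  unfolding compatible_characters_def
proof (intro CollectI conjI ballI)
  show "M L \<in> (\<Pi>\<^sub>E \<sigma>\<in>max_cones \<Sigma>. dual_lattice (\<Lambda> \<sigma>))"
    using M_dual[OF L] by (auto simp: M_def)
  fix \<sigma>1 \<sigma>2 assume \<sigma>: "\<sigma>1 \<in> max_cones \<Sigma>" "\<sigma>2 \<in> max_cones \<Sigma>"
  define \<tau> where "\<tau> = \<sigma>1 \<inter> \<sigma>2"
  have \<tau>: "\<tau> \<in> \<Sigma>" "\<tau> \<subseteq> \<sigma>1" "\<tau> \<subseteq> \<sigma>2" using fan_Int max_in_fan \<sigma> by (auto simp: \<tau>_def)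
  obtain f1 where f1: "equivariant_iso \<sigma>1 (\<Lambda> \<sigma>1) (trivial_eq (chartU \<sigma>1) (character (M L \<sigma>1))) (chart L \<sigma>1) f1"
    using fchar_M_iff[OF L \<sigma>(1), of "M L \<sigma>1"] unfolding fchar_iff by blast
  obtain f2 where f2: "equivariant_iso \<sigma>2 (\<Lambda> \<sigma>2) (trivial_eq (chartU \<sigma>2) (character (M L \<sigma>2))) (chart L \<sigma>2) f2"
    using fchar_M_iff[OF L \<sigma>(2), of "M L \<sigma>2"] unfolding fchar_iff by blast
  have "M L \<sigma>1 v = M L \<sigma>2 v" if "v \<in> \<tau>" for v
    by (rule trivializations_same_cone[OF chart_trivialization[OF L \<sigma>(1) \<tau>(1,2) f1 M_dual[OF L \<sigma>(1)]]
          chart_trivialization[OF L \<sigma>(2) \<tau>(1,3) f2 M_dual[OF L \<sigma>(2)]] LB_elb[OF L \<tau>(1)]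
          dual_\<Lambda>_mono[OF \<tau>(2) M_dual[OF L \<sigma>(1)]] dual_\<Lambda>_mono[OF \<tau>(3) M_dual[OF L \<sigma>(2)]] that])
  then show "(\<lambda>v. M L \<sigma>1 v - M L \<sigma>2 v) \<in> annihilator (\<sigma>1 \<inter> \<sigma>2)"
    using linear_compose_sub[OF dual_latticeD[OF M_dual[OF L \<sigma>(1)]] dual_latticeD[OF M_dual[OF L \<sigma>(2)]]]
    by (simp add: annihilator_def \<tau>_def)
qed

lemma compatibleD:
  assumes "m \<in> compatible_characters N \<Sigma> w"
  shows "\<sigma> \<in> max_cones \<Sigma> \<Longrightarrow> m \<sigma> \<in> dual_lattice (\<Lambda> \<sigma>)"
    "\<sigma>1 \<in> max_cones \<Sigma> \<Longrightarrow> \<sigma>2 \<in> max_cones \<Sigma> \<Longrightarrow> v \<in> \<sigma>1 \<Longrightarrow> v \<in> \<sigma>2 \<Longrightarrow> m \<sigma>1 v = m \<sigma>2 v"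
    "m \<in> extensional (max_cones \<Sigma>)"
  using assms unfolding compatible_characters_def annihilator_def by (fastforce simp: PiE_def)+

text \<open>The trivializations over the maximal cones are normalized at the unit point of the chart of the
  cone \<open>{0}\<close>; this removes the ambiguity by constants.\<close>

lemma normalized_trivialization:
  assumes L: "L \<in> LB"
  obtains T where
    "\<And>\<sigma> \<tau>. \<sigma> \<in> max_cones \<Sigma> \<Longrightarrow> \<tau> \<in> \<Sigma> \<Longrightarrow> \<tau> \<subseteq> \<sigma> \<Longrightarrow>
       equivariant_iso \<tau> (\<Lambda> \<tau>) (trivial_eq (chartU \<tau>) (character (M L \<sigma>))) (chart L \<tau>) (T \<tau> \<sigma>)"
    "\<And>\<sigma> \<tau> \<tau>' x. \<sigma> \<in> max_cones \<Sigma> \<Longrightarrow> \<tau> \<in> \<Sigma> \<Longrightarrow> \<tau>' \<in> \<Sigma> \<Longrightarrow> \<tau>' \<subseteq> \<tau> \<Longrightarrow> \<tau> \<subseteq> \<sigma> \<Longrightarrow> x \<in> chartU \<tau>' \<Longrightarrow>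
       T \<tau>' \<sigma> x = gluing L \<tau>' \<tau> x * T \<tau> \<sigma> (toric_map \<tau> (\<Lambda> \<tau>) x)"
    "\<And>\<sigma> \<sigma>' \<tau> x. \<sigma> \<in> max_cones \<Sigma> \<Longrightarrow> \<sigma>' \<in> max_cones \<Sigma> \<Longrightarrow> \<tau> \<in> \<Sigma> \<Longrightarrow> \<tau> \<subseteq> \<sigma> \<Longrightarrow> \<tau> \<subseteq> \<sigma>' \<Longrightarrow> x \<in> chartU \<tau> \<Longrightarrow>
       T \<tau> \<sigma> x = T \<tau> \<sigma>' x * x (\<lambda>v. M L \<sigma> v - M L \<sigma>' v)"
proof -
  let ?e = "unit_point {0} (\<Lambda> {0})"
  have "\<exists>f. equivariant_iso \<sigma> (\<Lambda> \<sigma>) (trivial_eq (chartU \<sigma>) (character (M L \<sigma>))) (chart L \<sigma>) f \<and>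
      gluing L {0} \<sigma> ?e * f (toric_map \<sigma> (\<Lambda> \<sigma>) ?e) = 1" if \<sigma>: "\<sigma> \<in> max_cones \<Sigma>" for \<sigma>
  proof -
    note \<sigma>\<Sigma> = max_in_fan[OF \<sigma>]
    have "fchar L \<sigma> (M L \<sigma>)" using fchar_M_iff[OF L \<sigma>] by blast
    then obtain f where f: "equivariant_iso \<sigma> (\<Lambda> \<sigma>) (trivial_eq (chartU \<sigma>) (character (M L \<sigma>))) (chart L \<sigma>) f"
      unfolding fchar_iff by blast
    define c where "c = gluing L {0} \<sigma> ?e * f (toric_map \<sigma> (\<Lambda> \<sigma>) ?e)"
    have "c \<noteq> 0"
      unfolding c_def
      by (rule equivariant_iso_nonzero[OF chart_trivialization[OF L \<sigma> zero_cone zero_cone_subset[OF \<sigma>\<Sigma>] f M_dual[OF L \<sigma>]]]) simp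
    then show ?thesis
      using equivariant_iso_scale[OF f equivariant_line_bundle_trivial[OF M_dual[OF L \<sigma>]], of "inverse c"]
      by (intro exI[of _ "\<lambda>x. inverse c * f x"]) (simp add: c_def field_simps)
  qed
  then obtain f where f: "\<And>\<sigma>. \<sigma> \<in> max_cones \<Sigma> \<Longrightarrow>
      equivariant_iso \<sigma> (\<Lambda> \<sigma>) (trivial_eq (chartU \<sigma>) (character (M L \<sigma>))) (chart L \<sigma>) (f \<sigma>)"
    and f1: "\<And>\<sigma>. \<sigma> \<in> max_cones \<Sigma> \<Longrightarrow> gluing L {0} \<sigma> ?e * f \<sigma> (toric_map \<sigma> (\<Lambda> \<sigma>) ?e) = 1"
    by metis
  define T where "T \<tau> \<sigma> x = gluing L \<tau> \<sigma> x * f \<sigma> (toric_map \<sigma> (\<Lambda> \<sigma>) x)" for \<tau> \<sigma> x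
  have T1: "equivariant_iso \<tau> (\<Lambda> \<tau>) (trivial_eq (chartU \<tau>) (character (M L \<sigma>))) (chart L \<tau>) (T \<tau> \<sigma>)"
    if "\<sigma> \<in> max_cones \<Sigma>" "\<tau> \<in> \<Sigma>" "\<tau> \<subseteq> \<sigma>" for \<sigma> \<tau>
    unfolding T_def by (rule chart_trivialization[OF L that f[OF that(1)] M_dual[OF L that(1)]])
  have T2: "T \<tau>' \<sigma> x = gluing L \<tau>' \<tau> x * T \<tau> \<sigma> (toric_map \<tau> (\<Lambda> \<tau>) x)"
    if "\<sigma> \<in> max_cones \<Sigma>" "\<tau> \<in> \<Sigma>" "\<tau>' \<in> \<Sigma>" "\<tau>' \<subseteq> \<tau>" "\<tau> \<subseteq> \<sigma>" "x \<in> chartU \<tau>'" for \<sigma> \<tau> \<tau>' x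
    using LB_cocycle[OF L max_in_fan[OF that(1)] that(2-6)] that
    by (simp add: T_def toric_map_toric_map \<Lambda>_mono)
  have T3: "T \<tau> \<sigma> x = T \<tau> \<sigma>' x * x (\<lambda>v. M L \<sigma> v - M L \<sigma>' v)"
    if \<sigma>: "\<sigma> \<in> max_cones \<Sigma>" "\<sigma>' \<in> max_cones \<Sigma>" and \<tau>: "\<tau> \<in> \<Sigma>" "\<tau> \<subseteq> \<sigma>" "\<tau> \<subseteq> \<sigma>'" and x: "x \<in> chartU \<tau>" for \<sigma> \<sigma>' \<tau> x
  proof (rule trivializations_differ_by_monomial[OF T1[OF \<sigma>(1) \<tau>(1,2)] T1[OF \<sigma>(2) \<tau>(1,3)] LB_elb[OF L \<tau>(1)]
        dual_\<Lambda>_mono[OF \<tau>(2) M_dual[OF L \<sigma>(1)]] dual_\<Lambda>_mono[OF \<tau>(3) M_dual[OF L \<sigma>(2)]] _ _ x])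
    show "M L \<sigma> v = M L \<sigma>' v" if "v \<in> \<tau>" for v
      using compatibleD(2)[OF M_compatible[OF L] \<sigma>] \<tau> that by blast
    have e\<tau>: "toric_map \<tau> (\<Lambda> \<tau>) ?e = unit_point \<tau> (\<Lambda> \<tau>)"
      by (rule toric_map_unit_point[OF zero_cone_subset[OF \<tau>(1)] \<Lambda>_mono[OF zero_cone_subset[OF \<tau>(1)]]])
    \<comment> \<open>The factor \<open>gluing L {0} \<tau> ?e\<close> does not depend on the
      maximal cone, so all trivializations over \<open>\<tau>\<close> take the same value at the
      unit point.\<close>
    have "gluing L {0} \<tau> ?e * T \<tau> \<sigma>'' (unit_point \<tau> (\<Lambda> \<tau>)) = 1" if "\<sigma>'' \<in> max_cones \<Sigma>" "\<tau> \<subseteq> \<sigma>''" for \<sigma>''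
      using T2[OF that(1) \<tau>(1) zero_cone zero_cone_subset[OF \<tau>(1)] that(2) unit_point_in] f1[OF that(1)]
      by (simp add: e\<tau>) (simp add: T_def)
    from this[OF \<sigma>(1) \<tau>(2)] this[OF \<sigma>(2) \<tau>(3)]
    show "T \<tau> \<sigma> (unit_point \<tau> (\<Lambda> \<tau>)) = T \<tau> \<sigma>' (unit_point \<tau> (\<Lambda> \<tau>))"
      by (metis mult_cancel_left mult_zero_left zero_neq_one)
  qed
  show ?thesis by (rule that[of T]) (fact T1 T2 T3)+
qed

text \<open>An arbitrary choice of a maximal cone over \<open>\<tau>\<close>; compatible characters
  take the same values on \<open>\<tau>\<close> for every choice.\<close>

definition above :: "'a set \<Rightarrow> 'a set" where
  "above \<tau> = (SOME \<sigma>. \<sigma> \<in> max_cones \<Sigma> \<and> \<tau> \<subseteq> \<sigma>)"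

lemma above: "\<tau> \<in> \<Sigma> \<Longrightarrow> above \<tau> \<in> max_cones \<Sigma>" "\<tau> \<in> \<Sigma> \<Longrightarrow> \<tau> \<subseteq> above \<tau>"
  using someI_ex[of "\<lambda>\<sigma>. \<sigma> \<in> max_cones \<Sigma> \<and> \<tau> \<subseteq> \<sigma>"] max_cone_above unfolding above_def by metis+

lemma above_max: "\<sigma> \<in> max_cones \<Sigma> \<Longrightarrow> above \<sigma> = \<sigma>"
  using above[OF max_in_fan] max_cone_maximal by metis

text \<open>The isomorphism over \<open>\<tau>\<close> is the quotient of two normalized
  trivializations. Changing the maximal cone multiplies both by the same monomial, since the
  characters agree, so the quotient is independent of the cone and respects the gluing.\<close>

lemma orbi_equiv_if_M_eq:
  assumes L: "L \<in> LB" and L': "L' \<in> LB" and M: "M L = M L'"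
  shows "(L, L') \<in> orbi_equiv N \<Sigma> w"
proof -
  obtain T where T: 
    "\<And>\<sigma> \<tau>. \<sigma> \<in> max_cones \<Sigma> \<Longrightarrow> \<tau> \<in> \<Sigma> \<Longrightarrow> \<tau> \<subseteq> \<sigma> \<Longrightarrow>
       equivariant_iso \<tau> (\<Lambda> \<tau>) (trivial_eq (chartU \<tau>) (character (M L \<sigma>))) (chart L \<tau>) (T \<tau> \<sigma>)"
    "\<And>\<sigma> \<tau> \<tau>' x. \<sigma> \<in> max_cones \<Sigma> \<Longrightarrow> \<tau> \<in> \<Sigma> \<Longrightarrow> \<tau>' \<in> \<Sigma> \<Longrightarrow> \<tau>' \<subseteq> \<tau> \<Longrightarrow> \<tau> \<subseteq> \<sigma> \<Longrightarrow> x \<in> chartU \<tau>' \<Longrightarrow>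
       T \<tau>' \<sigma> x = gluing L \<tau>' \<tau> x * T \<tau> \<sigma> (toric_map \<tau> (\<Lambda> \<tau>) x)"
    "\<And>\<sigma> \<sigma>' \<tau> x. \<sigma> \<in> max_cones \<Sigma> \<Longrightarrow> \<sigma>' \<in> max_cones \<Sigma> \<Longrightarrow> \<tau> \<in> \<Sigma> \<Longrightarrow> \<tau> \<subseteq> \<sigma> \<Longrightarrow> \<tau> \<subseteq> \<sigma>' \<Longrightarrow> x \<in> chartU \<tau> \<Longrightarrow>
       T \<tau> \<sigma> x = T \<tau> \<sigma>' x * x (\<lambda>v. M L \<sigma> v - M L \<sigma>' v)"
    using normalized_trivialization[OF L] by blast
  obtain T' where T': 
    "\<And>\<sigma> \<tau>. \<sigma> \<in> max_cones \<Sigma> \<Longrightarrow> \<tau> \<in> \<Sigma> \<Longrightarrow> \<tau> \<subseteq> \<sigma> \<Longrightarrow>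
       equivariant_iso \<tau> (\<Lambda> \<tau>) (trivial_eq (chartU \<tau>) (character (M L' \<sigma>))) (chart L' \<tau>) (T' \<tau> \<sigma>)"
    "\<And>\<sigma> \<tau> \<tau>' x. \<sigma> \<in> max_cones \<Sigma> \<Longrightarrow> \<tau> \<in> \<Sigma> \<Longrightarrow> \<tau>' \<in> \<Sigma> \<Longrightarrow> \<tau>' \<subseteq> \<tau> \<Longrightarrow> \<tau> \<subseteq> \<sigma> \<Longrightarrow> x \<in> chartU \<tau>' \<Longrightarrow>
       T' \<tau>' \<sigma> x = gluing L' \<tau>' \<tau> x * T' \<tau> \<sigma> (toric_map \<tau> (\<Lambda> \<tau>) x)"
    "\<And>\<sigma> \<sigma>' \<tau> x. \<sigma> \<in> max_cones \<Sigma> \<Longrightarrow> \<sigma>' \<in> max_cones \<Sigma> \<Longrightarrow> \<tau> \<in> \<Sigma> \<Longrightarrow> \<tau> \<subseteq> \<sigma> \<Longrightarrow> \<tau> \<subseteq> \<sigma>' \<Longrightarrow> x \<in> chartU \<tau> \<Longrightarrow>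
       T' \<tau> \<sigma> x = T' \<tau> \<sigma>' x * x (\<lambda>v. M L' \<sigma> v - M L' \<sigma>' v)"
    using normalized_trivialization[OF L'] by blast
  define F where "F \<tau> x = T' \<tau> (above \<tau>) x * inverse (T \<tau> (above \<tau>) x)" for \<tau> x
  have F: "F \<tau> x = T' \<tau> \<sigma> x * inverse (T \<tau> \<sigma> x)"
    if \<sigma>: "\<sigma> \<in> max_cones \<Sigma>" "\<tau> \<subseteq> \<sigma>" and \<tau>: "\<tau> \<in> \<Sigma>" and x: "x \<in> chartU \<tau>" for \<sigma> \<tau> x
  proof -
    note a = above[OF \<tau>]
    have nz: "T \<tau> (above \<tau>) x \<noteq> 0" by (rule equivariant_iso_nonzero[OF T(1)[OF a(1) \<tau> a(2)] x])
    have e: "T \<tau> (above \<tau>) x = T \<tau> \<sigma> x * x (\<lambda>v. M L (above \<tau>) v - M L \<sigma> v)"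
      by (rule T(3)[OF a(1) \<sigma>(1) \<tau> a(2) \<sigma>(2) x])
    have e': "T' \<tau> (above \<tau>) x = T' \<tau> \<sigma> x * x (\<lambda>v. M L (above \<tau>) v - M L \<sigma> v)"
      using T'(3)[OF a(1) \<sigma>(1) \<tau> a(2) \<sigma>(2) x] by (simp only: M)
    show ?thesis using nz unfolding F_def e e' by (simp add: field_simps)
  qed
  show ?thesis
    unfolding orbi_equiv_def
  proof (clarsimp simp: L L', intro exI[of _ F] conjI ballI impI)
    fix \<tau> assume \<tau>: "\<tau> \<in> \<Sigma>"
    note a = above[OF \<tau>]
    note mm = equivariant_line_bundle_trivial[OF dual_\<Lambda>_mono[OF a(2) M_dual[OF L a(1)]], of \<tau>]
    show "equivariant_iso \<tau> (\<Lambda> \<tau>) (chart L \<tau>) (chart L' \<tau>) (F \<tau>)"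
      unfolding F_def
      by (rule equivariant_iso_trans[OF equivariant_iso_sym[OF T(1)[OF a(1) \<tau> a(2)] mm LB_elb[OF L \<tau>]]
            T'(1)[OF a(1) \<tau> a(2), folded M] LB_elb[OF L \<tau>] mm])
    fix \<tau>' x assume \<tau>': "\<tau>' \<in> \<Sigma>" "\<tau>' \<subseteq> \<tau>" and x: "x \<in> chartU \<tau>'"
    have sub: "\<tau>' \<subseteq> above \<tau>" using \<tau>'(2) a(2) by blast
    have nz: "T \<tau>' (above \<tau>) x \<noteq> 0" by (rule equivariant_iso_nonzero[OF T(1)[OF a(1) \<tau>'(1) sub] x])
    note e = T(2)[OF a(1) \<tau> \<tau>' a(2) x] and e' = T'(2)[OF a(1) \<tau> \<tau>' a(2) x]
    have "F \<tau> (toric_map \<tau> (\<Lambda> \<tau>) x) = T' \<tau> (above \<tau>) (toric_map \<tau> (\<Lambda> \<tau>) x) * inverse (T \<tau> (above \<tau>) (toric_map \<tau> (\<Lambda> \<tau>) x))"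
      by (simp add: F_def)
    then show "gluing L' \<tau>' \<tau> x * F \<tau> (toric_map \<tau> (\<Lambda> \<tau>) x) = F \<tau>' x * gluing L \<tau>' \<tau> x"
      unfolding F[OF a(1) sub \<tau>'(1) x] using nz unfolding e e' by (simp add: field_simps)
  qed
qed

lemma orbi_equiv_iff: "orbi_equiv N \<Sigma> w = {(L, L'). L \<in> LB \<and> L' \<in> LB \<and> M L = M L'}"
proof -
  have "M L = M L'" if e: "(L, L') \<in> orbi_equiv N \<Sigma> w" for L L'
  proof -
    have L: "L \<in> LB" "L' \<in> LB" using e by (auto simp: orbi_equiv_def)
    obtain F where F: "\<And>\<tau>. \<tau> \<in> \<Sigma> \<Longrightarrow> equivariant_iso \<tau> (\<Lambda> \<tau>) (chart L \<tau>) (chart L' \<tau>) (F \<tau>)"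
      using e by (auto simp: orbi_equiv_def)
    have "fchar L' \<sigma> (M L \<sigma>)" if \<sigma>: "\<sigma> \<in> max_cones \<Sigma>" for \<sigma>
    proof -
      obtain f where f: "equivariant_iso \<sigma> (\<Lambda> \<sigma>) (trivial_eq (chartU \<sigma>) (character (M L \<sigma>))) (chart L \<sigma>) f"
        using fchar_M_iff[OF L(1) \<sigma>, of "M L \<sigma>"] unfolding fchar_iff by blast
      from equivariant_iso_trans[OF f F[OF max_in_fan[OF \<sigma>]] equivariant_line_bundle_trivial[OF M_dual[OF L(1) \<sigma>]]
          LB_elb[OF L(1) max_in_fan[OF \<sigma>]]]
      show ?thesis unfolding fchar_iff using M_dual[OF L(1) \<sigma>] by blast
    qed
    then show ?thesis using M_eqI[OF L(2), of "M L"] by (simp add: M_def)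
  qed
  moreover have "L \<in> LB \<and> L' \<in> LB" if "(L, L') \<in> orbi_equiv N \<Sigma> w" for L L'
    using that by (auto simp: orbi_equiv_def)
  ultimately show ?thesis using orbi_equiv_if_M_eq by blast
qed

text \<open>Each chart carries the trivial bundle with the character of a chosen maximal cone above.
  The difference of two such characters vanishes on the smaller cone, so its monomial is an
  admissible gluing function there.\<close>

lemma M_surj:
  assumes m: "m \<in> compatible_characters N \<Sigma> w" shows "\<exists>L\<in>LB. M L = m"
proof -
  define L :: "'a orbi_bundle" where
    "L = \<lparr>chart = (\<lambda>\<tau>. trivial_eq (chartU \<tau>) (character (m (above \<tau>)))),
          gluing = (\<lambda>\<tau>' \<tau> x. x (\<lambda>v. m (above \<tau>) v - m (above \<tau>') v))\<rparr>"
  have dual: "m (above \<tau>) \<in> dual_lattice (\<Lambda> \<tau>')" if "\<tau> \<in> \<Sigma>" "\<tau>' \<subseteq> \<tau>" for \<tau> \<tau>'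
    using dual_\<Lambda>_mono[OF _ compatibleD(1)[OF m above(1)[OF that(1)]]] above(2)[OF that(1)] that(2) by blast
  have eq: "m (above \<tau>) v = m (above \<tau>') v" if "\<tau> \<in> \<Sigma>" "\<tau>' \<in> \<Sigma>" "\<tau>' \<subseteq> \<tau>" "v \<in> \<tau>'" for \<tau> \<tau>' v
    using compatibleD(2)[OF m above(1)[OF that(1)] above(1)[OF that(2)], of v] above(2)[OF that(1)] above(2)[OF that(2)] that
    by blast
  have cc: "(\<lambda>v. m (above \<tau>) v - m (above \<tau>') v) \<in> cone_chars \<tau>'' (\<Lambda> \<tau>'')"
    if "\<tau> \<in> \<Sigma>" "\<tau>' \<in> \<Sigma>" "\<tau>'' \<subseteq> \<tau>'" "\<tau>' \<subseteq> \<tau>" for \<tau> \<tau>' \<tau>''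
    by (rule dual_lattice_zero_on_cone_chars(1)[OF dual_lattice_diff[OF dual dual]])
      (use that eq[of \<tau> \<tau>'] in auto)
  have L: "L \<in> LB"
    unfolding linearized_orbi_bundles_def
  proof (intro CollectI conjI ballI impI)
    fix \<tau> assume \<tau>: "\<tau> \<in> \<Sigma>"
    show "equivariant_line_bundle \<tau> (\<Lambda> \<tau>) (chart L \<tau>)"
      unfolding L_def using equivariant_line_bundle_trivial[OF dual[OF \<tau> order_refl]] by simp
    fix \<tau>' assume \<tau>': "\<tau>' \<in> \<Sigma>"
    show "equivariant_iso \<tau>' (\<Lambda> \<tau>') (pull_eq (orbi_chart N \<Sigma> w \<tau>') (toric_map \<tau> (\<Lambda> \<tau>)) (chart L \<tau>))
        (chart L \<tau>') (gluing L \<tau>' \<tau>)" if sub: "\<tau>' \<subseteq> \<tau>"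
      using equivariant_iso_trivial_monomial[OF dual[OF \<tau> sub] dual[OF \<tau>' order_refl] eq[OF \<tau> \<tau>' sub]]
        toric_map_chart[OF sub] by (simp add: L_def pull_eq_trivial_eq)
    fix \<tau>'' x assume \<tau>'': "\<tau>'' \<in> \<Sigma>" and sub: "\<tau>'' \<subseteq> \<tau>' \<and> \<tau>' \<subseteq> \<tau>" and "x \<in> orbi_chart N \<Sigma> w \<tau>''"
    then have x: "x \<in> chartU \<tau>''" by simp
    \<comment> \<open>The cocycle condition is the telescoping of the exponents.\<close>
    have "x (\<lambda>v. (m (above \<tau>') v - m (above \<tau>'') v) + (m (above \<tau>) v - m (above \<tau>') v)) =
        x (\<lambda>v. m (above \<tau>') v - m (above \<tau>'') v) * x (\<lambda>v. m (above \<tau>) v - m (above \<tau>') v)"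
      by (rule affine_toric_add[OF x cc cc]) (use \<tau> \<tau>' \<tau>'' sub in auto)
    moreover have "toric_map \<tau>' (\<Lambda> \<tau>') x (\<lambda>v. m (above \<tau>) v - m (above \<tau>') v) = x (\<lambda>v. m (above \<tau>) v - m (above \<tau>') v)"
      using cc[OF \<tau> \<tau>' order_refl] sub by (simp add: toric_map_def)
    ultimately show "gluing L \<tau>'' \<tau> x = gluing L \<tau>'' \<tau>' x * gluing L \<tau>' \<tau> (toric_map \<tau>' (\<Lambda> \<tau>') x)"
      by (simp add: L_def)
  qed
  have "fchar L \<sigma> (m \<sigma>)" if \<sigma>: "\<sigma> \<in> max_cones \<Sigma>" for \<sigma>
    using compatibleD(1)[OF m \<sigma>] equivariant_iso_refl[OF equivariant_line_bundle_trivial[OF compatibleD(1)[OF m \<sigma>], of \<sigma>]]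
    unfolding fchar_iff by (auto simp: L_def above_max[OF \<sigma>])
  then show ?thesis using L M_eqI[OF L] compatibleD(3)[OF m] by blast
qed

lemma M_image: "M ` LB = compatible_characters N \<Sigma> w"
  using M_surj M_compatible by blast

section \<open>Group structure on classes of orbi-line bundles\<close>

lemma orbi_tensor_in: assumes L: "L \<in> LB" "L' \<in> LB" shows "orbi_tensor L L' \<in> LB"
  unfolding linearized_orbi_bundles_def
proof (intro CollectI conjI ballI impI)
  fix \<tau> assume \<tau>: "\<tau> \<in> \<Sigma>"
  show "equivariant_line_bundle \<tau> (\<Lambda> \<tau>) (chart (orbi_tensor L L') \<tau>)"
    using equivariant_line_bundle_tensor[OF LB_elb[OF L(1) \<tau>] LB_elb[OF L(2) \<tau>]] by (simp add: orbi_tensor_def)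
  fix \<tau>' assume \<tau>': "\<tau>' \<in> \<Sigma>"
  show "equivariant_iso \<tau>' (\<Lambda> \<tau>') (pull_eq (orbi_chart N \<Sigma> w \<tau>') (toric_map \<tau> (\<Lambda> \<tau>)) (chart (orbi_tensor L L') \<tau>))
        (chart (orbi_tensor L L') \<tau>') (gluing (orbi_tensor L L') \<tau>' \<tau>)" if sub: "\<tau>' \<subseteq> \<tau>"
    using equivariant_iso_tensor[OF LB_gluing[OF L(1) \<tau> \<tau>' sub] LB_gluing[OF L(2) \<tau> \<tau>' sub]
        equivariant_line_bundle_pull[OF equivariant_morphism_chart[OF sub] LB_elb[OF L(1) \<tau>]]]
    by (simp add: orbi_tensor_def pull_eq_tensor_eq)
  fix \<tau>'' x assume \<tau>'': "\<tau>'' \<in> \<Sigma>" and sub: "\<tau>'' \<subseteq> \<tau>' \<and> \<tau>' \<subseteq> \<tau>" and "x \<in> orbi_chart N \<Sigma> w \<tau>''"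
  then have x: "x \<in> chartU \<tau>''" by simp
  show "gluing (orbi_tensor L L') \<tau>'' \<tau> x =
      gluing (orbi_tensor L L') \<tau>'' \<tau>' x * gluing (orbi_tensor L L') \<tau>' \<tau> (toric_map \<tau>' (\<Lambda> \<tau>') x)"
    using LB_cocycle[OF L(1) \<tau> \<tau>' \<tau>'' _ _ x] LB_cocycle[OF L(2) \<tau> \<tau>' \<tau>'' _ _ x] sub
    by (simp add: orbi_tensor_def mult_ac)
qed

text \<open>The group of all families of functions.  The compatible families form a subgroup, but only the
  image of \<open>M\<close> matters for the group structure on classes.\<close>

definition Z :: "('a set \<Rightarrow> 'a \<Rightarrow> real) monoid" where
  "Z = \<lparr>carrier = extensional (max_cones \<Sigma>),
        mult = (\<lambda>a b. restrict (\<lambda>\<sigma> v. a \<sigma> v + b \<sigma> v) (max_cones \<Sigma>)),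
        one = restrict (\<lambda>_ _. 0) (max_cones \<Sigma>)\<rparr>"

lemma comm_group_Z: "comm_group Z"
proof (rule comm_groupI)
  fix x assume "x \<in> carrier Z"
  then show "\<exists>y\<in>carrier Z. y \<otimes>\<^bsub>Z\<^esub> x = \<one>\<^bsub>Z\<^esub>"
    by (intro bexI[of _ "restrict (\<lambda>\<sigma> v. - x \<sigma> v) (max_cones \<Sigma>)"]) (auto simp: Z_def intro!: ext)
qed (auto simp: Z_def restrict_def extensional_def intro!: ext)

lemma fchar_tensor:
  assumes L: "L \<in> LB" and \<sigma>: "\<sigma> \<in> max_cones \<Sigma>" and f: "fchar L \<sigma> m" "fchar L' \<sigma> m'"
  shows "fchar (orbi_tensor L L') \<sigma> (\<lambda>v. m v + m' v)"
proof -
  obtain f f' where "m \<in> dual_lattice (\<Lambda> \<sigma>)" "m' \<in> dual_lattice (\<Lambda> \<sigma>)"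
    and *: "equivariant_iso \<sigma> (\<Lambda> \<sigma>) (trivial_eq (chartU \<sigma>) (character m)) (chart L \<sigma>) f"
    "equivariant_iso \<sigma> (\<Lambda> \<sigma>) (trivial_eq (chartU \<sigma>) (character m')) (chart L' \<sigma>) f'"
    using f unfolding fchar_iff by blast
  moreover have "(\<lambda>v. character m v * character m' v) = character (\<lambda>v. m v + m' v)"
    by (simp add: fun_eq_iff character_add_left)
  ultimately show ?thesis
    unfolding fchar_iff orbi_tensor_def
    using equivariant_iso_tensor[OF * equivariant_line_bundle_trivial] dual_lattice_add
    by (auto simp: tensor_trivial_eq)
qed

lemma M_tensor: assumes "L \<in> LB" "L' \<in> LB" shows "M (orbi_tensor L L') = M L \<otimes>\<^bsub>Z\<^esub> M L'"
proof (rule M_eqI[OF orbi_tensor_in[OF assms]])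
  show "fchar (orbi_tensor L L') \<sigma> ((M L \<otimes>\<^bsub>Z\<^esub> M L') \<sigma>)" if "\<sigma> \<in> max_cones \<Sigma>" for \<sigma>
    using fchar_tensor[OF assms(1) that, of "M L \<sigma>" L' "M L' \<sigma>"] fchar_M_iff[OF assms(1) that] fchar_M_iff[OF assms(2) that] that
    by (simp add: Z_def)
qed (simp add: Z_def)

lemma character_zero_fun: "character (\<lambda>_. 0) = (\<lambda>_. 1)"
  by (simp add: fun_eq_iff)

lemma orbi_unit_in: "orbi_unit N \<Sigma> w \<in> LB"
proof -
  have *: "equivariant_line_bundle \<tau> (\<Lambda> \<tau>) (trivial_eq (chartU \<tau>) (\<lambda>_. 1))" for \<tau>
    using equivariant_line_bundle_trivial[OF dual_lattice_zero, of \<tau> "\<Lambda> \<tau>"] by (simp add: character_zero_fun)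
  show ?thesis
    unfolding linearized_orbi_bundles_def orbi_unit_def
    using * equivariant_iso_refl[OF *] toric_map_chart by (auto simp: pull_eq_trivial_eq)
qed

lemma M_unit: "M (orbi_unit N \<Sigma> w) = \<one>\<^bsub>Z\<^esub>"
proof (rule M_eqI[OF orbi_unit_in])
  show "fchar (orbi_unit N \<Sigma> w) \<sigma> (\<one>\<^bsub>Z\<^esub> \<sigma>)" if "\<sigma> \<in> max_cones \<Sigma>" for \<sigma>
    unfolding fchar_iff using that equivariant_iso_refl[OF equivariant_line_bundle_trivial[OF dual_lattice_zero, of \<sigma> "\<Lambda> \<sigma>"]]
    by (auto simp: orbi_unit_def Z_def character_zero_fun)
qed (simp add: Z_def)

lemma compatible_minus:
  assumes m: "m \<in> compatible_characters N \<Sigma> w"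
  shows "inv\<^bsub>Z\<^esub> m \<in> compatible_characters N \<Sigma> w"
proof -
  interpret Z: comm_group Z by (rule comm_group_Z)
  let ?n = "restrict (\<lambda>\<sigma> v. - m \<sigma> v) (max_cones \<Sigma>)"
  have mZ: "m \<in> carrier Z" using compatibleD(3)[OF m] by (simp add: Z_def)
  have "inv\<^bsub>Z\<^esub> m = ?n" by (rule Z.inv_equality) (use mZ in \<open>auto simp: Z_def intro!: ext\<close>)
  moreover have "?n \<in> compatible_characters N \<Sigma> w"
    unfolding compatible_characters_def annihilator_def
  proof (intro CollectI conjI ballI)
    fix \<sigma>1 \<sigma>2 assume \<sigma>: "\<sigma>1 \<in> max_cones \<Sigma>" "\<sigma>2 \<in> max_cones \<Sigma>"
    show "linear (\<lambda>v. ?n \<sigma>1 v - ?n \<sigma>2 v)"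
      using \<sigma> linear_compose_sub[OF dual_latticeD[OF compatibleD(1)[OF m \<sigma>(2)]] dual_latticeD[OF compatibleD(1)[OF m \<sigma>(1)]]]
      by simp
    show "?n \<sigma>1 v - ?n \<sigma>2 v = 0" if "v \<in> \<sigma>1 \<inter> \<sigma>2" for v
      using compatibleD(2)[OF m \<sigma>] that \<sigma> by simp
  qed (use compatibleD(1)[OF m] dual_lattice_minus in auto)
  ultimately show ?thesis by simp
qed

lemma orbi_kernel_quotient:
  "kernel_quotient Z LB (orbi_equiv N \<Sigma> w) M orbi_tensor (orbi_unit N \<Sigma> w)"
proof -
  interpret Z: comm_group Z by (rule comm_group_Z)
  show ?thesis
  proof unfold_locales
    show "\<exists>L'\<in>LB. M L' = inv\<^bsub>Z\<^esub> M L" if "L \<in> LB" for L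
      using M_surj[OF compatible_minus[OF M_compatible[OF that]]] .
    show "M L \<in> carrier Z" for L by (simp add: Z_def M_def)
  qed (simp_all only: orbi_equiv_iff orbi_tensor_in M_tensor orbi_unit_in M_unit)
qed

lemma orbi_Pic_eq: "orbi_Pic N \<Sigma> w = kernel_quotient.P LB (orbi_equiv N \<Sigma> w) orbi_tensor (orbi_unit N \<Sigma> w)"
  unfolding kernel_quotient.P_def[OF orbi_kernel_quotient] orbi_Pic_def orbi_class_def by simp

end

section \<open>Linear forms on the rays\<close>

lemma subspace_ray_line: "subspace (ray_line N \<rho>)"
  by (simp add: ray_line_def)

lemma ray_lineE:
  assumes "x \<in> ray_line N \<rho>" obtains c where "x = c *\<^sub>R ray_gen N \<rho>"
  using assms by (auto simp: ray_line_def span_singleton)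

lemma scaled_ray_gen_in_ray_line [simp]: "c *\<^sub>R ray_gen N \<rho> \<in> ray_line N \<rho>"
  by (simp add: ray_line_def span_base span_scale)

lemma ray_formsD:
  assumes "h \<in> ray_forms N \<rho> k"
  shows "h \<in> extensional (ray_line N \<rho>)"
    "x \<in> ray_line N \<rho> \<Longrightarrow> y \<in> ray_line N \<rho> \<Longrightarrow> h (x + y) = h x + h y"
    "x \<in> ray_line N \<rho> \<Longrightarrow> h (c *\<^sub>R x) = c * h x"
    "h (real k *\<^sub>R ray_gen N \<rho>) \<in> \<int>"
  using assms by (auto simp: ray_forms_def)

lemma restrict_linear_ray_forms:
  assumes "linear f" "f (real k *\<^sub>R ray_gen N \<rho>) \<in> \<int>"
  shows "restrict f (ray_line N \<rho>) \<in> ray_forms N \<rho> k"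
  using assms subspace_add[OF subspace_ray_line[of N \<rho>]] subspace_scale[OF subspace_ray_line[of N \<rho>]]
  by (auto simp: ray_forms_def linear_add linear_cmul)

lemma ray_forms_add:
  assumes "h \<in> ray_forms N \<rho> k" "h' \<in> ray_forms N \<rho> k"
  shows "restrict (\<lambda>v. h v + h' v) (ray_line N \<rho>) \<in> ray_forms N \<rho> k"
  using ray_formsD[OF assms(1)] ray_formsD[OF assms(2)]
    subspace_add[OF subspace_ray_line[of N \<rho>]] subspace_scale[OF subspace_ray_line[of N \<rho>]]
  by (auto simp: ray_forms_def algebra_simps)

lemma ray_forms_minus:
  assumes "h \<in> ray_forms N \<rho> k"
  shows "restrict (\<lambda>v. - h v) (ray_line N \<rho>) \<in> ray_forms N \<rho> k"
  using ray_formsD[OF assms]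
    subspace_add[OF subspace_ray_line[of N \<rho>]] subspace_scale[OF subspace_ray_line[of N \<rho>]]
  by (auto simp: ray_forms_def)

lemma ray_forms_zero: "restrict (\<lambda>_. 0) (ray_line N \<rho>) \<in> ray_forms N \<rho> k"
  using restrict_linear_ray_forms[OF linear_zero] by simp

lemma group_ray_forms: "group (ray_forms_group N \<rho> k)"
proof (rule groupI)
  fix x assume x: "x \<in> carrier (ray_forms_group N \<rho> k)"
  then show "\<exists>y\<in>carrier (ray_forms_group N \<rho> k). y \<otimes>\<^bsub>ray_forms_group N \<rho> k\<^esub> x = \<one>\<^bsub>ray_forms_group N \<rho> k\<^esub>"
    by (intro bexI[of _ "restrict (\<lambda>v. - x v) (ray_line N \<rho>)"])
      (auto simp: ray_forms_group_def ray_forms_minus intro!: ext)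
  show "\<one>\<^bsub>ray_forms_group N \<rho> k\<^esub> \<otimes>\<^bsub>ray_forms_group N \<rho> k\<^esub> x = x"
    using x ray_formsD(1)[of x N \<rho> k]
    by (auto simp: ray_forms_group_def extensional_def restrict_def intro!: ext)
qed (auto simp: ray_forms_group_def ray_forms_add ray_forms_zero intro!: ext)

lemma ray_forms_value:
  assumes "h \<in> ray_forms N \<rho> k" "k > 0"
  shows "h (c *\<^sub>R ray_gen N \<rho>) = c / real k * h (real k *\<^sub>R ray_gen N \<rho>)"
  using ray_formsD(3)[OF assms(1), of "real k *\<^sub>R ray_gen N \<rho>" "c / real k"] assms(2) by simp

lemma ray_forms_eqI:
  assumes h: "h \<in> ray_forms N \<rho> k" "h' \<in> ray_forms N \<rho> k" and k: "k > 0"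
    and eq: "h (real k *\<^sub>R ray_gen N \<rho>) = h' (real k *\<^sub>R ray_gen N \<rho>)"
  shows "h = h'"
proof (rule extensionalityI[OF ray_formsD(1)[OF h(1)] ray_formsD(1)[OF h(2)]])
  fix x assume "x \<in> ray_line N \<rho>"
  then obtain c where c: "x = c *\<^sub>R ray_gen N \<rho>" by (rule ray_lineE)
  show "h x = h' x"
    unfolding c ray_forms_value[OF h(1) k, of c] ray_forms_value[OF h(2) k, of c] eq ..
qed

lemma ray_forms_exists:
  assumes "ray_gen N \<rho> \<noteq> 0" "k > 0"
  shows "\<exists>h\<in>ray_forms N \<rho> k. h (real k *\<^sub>R ray_gen N \<rho>) = of_int i"
proof -
  have "independent {ray_gen N \<rho>}" using assms(1) by simp
  from linear_independent_extend[OF this, of "\<lambda>_. of_int i / real k"]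
  obtain f where f: "linear f" "f (ray_gen N \<rho>) = of_int i / real k" by auto
  then have "f (real k *\<^sub>R ray_gen N \<rho>) = of_int i" using assms(2) by (simp add: linear_cmul)
  then show ?thesis
    using restrict_linear_ray_forms[OF f(1), of k N \<rho>]
    by (intro bexI[of _ "restrict f (ray_line N \<rho>)"]) auto
qed

section \<open>Compatible characters, forms on rays and integers\<close>

context toric_fan
begin

definition forms :: "('a set \<Rightarrow> 'a \<Rightarrow> real) \<Rightarrow> 'a set \<Rightarrow> 'a \<Rightarrow> real" where
  "forms m = (\<lambda>\<rho>\<in>rays \<Sigma>. restrict (m (above \<rho>)) (ray_line N \<rho>))"

text \<open>The floor only changes the type: forms in \<open>ray_forms N \<rho> (w \<rho>)\<close>
  take an integral value at the weighted generator.\<close>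

definition integers :: "('a set \<Rightarrow> 'a \<Rightarrow> real) \<Rightarrow> 'a set \<Rightarrow> int" where
  "integers h = (\<lambda>\<rho>\<in>rays \<Sigma>. \<lfloor>h \<rho> (weighted_gen \<rho>)\<rfloor>)"

lemma weighted_gen_in_ray_line [simp]: "weighted_gen \<rho> \<in> ray_line N \<rho>"
  by (simp add: weighted_gen_def)

lemma weighted_gen_in_gens: "\<rho> \<in> rays \<Sigma> \<Longrightarrow> \<rho> \<subseteq> \<tau> \<Longrightarrow> weighted_gen \<rho> \<in> gens \<tau>"
  by (auto simp: gens_eq)

lemma compatible_on_ray_line:
  assumes m: "m \<in> compatible_characters N \<Sigma> w" and \<rho>: "\<rho> \<in> rays \<Sigma>"
    and \<sigma>: "\<sigma> \<in> max_cones \<Sigma>" "\<rho> \<subseteq> \<sigma>" "\<sigma>' \<in> max_cones \<Sigma>" "\<rho> \<subseteq> \<sigma>'" and x: "x \<in> ray_line N \<rho>"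
  shows "m \<sigma> x = m \<sigma>' x"
proof -
  obtain c where c: "x = c *\<^sub>R ray_gen N \<rho>" using x by (rule ray_lineE)
  have "ray_gen N \<rho> \<in> \<rho>" using ray_generator(3)[OF \<rho>] hull_inc[of "ray_gen N \<rho>" "{ray_gen N \<rho>}" convex_cone] by simp
  then have "m \<sigma> (ray_gen N \<rho>) = m \<sigma>' (ray_gen N \<rho>)"
    using compatibleD(2)[OF m \<sigma>(1,3)] \<sigma>(2,4) by blast
  then show ?thesis
    using dual_latticeD[OF compatibleD(1)[OF m \<sigma>(1)]] dual_latticeD[OF compatibleD(1)[OF m \<sigma>(3)]]
    by (simp add: c linear_cmul)
qed

lemma forms_eq:
  assumes m: "m \<in> compatible_characters N \<Sigma> w" and \<rho>: "\<rho> \<in> rays \<Sigma>" and \<sigma>: "\<sigma> \<in> max_cones \<Sigma>" "\<rho> \<subseteq> \<sigma>"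
  shows "forms m \<rho> = restrict (m \<sigma>) (ray_line N \<rho>)"
  using compatible_on_ray_line[OF m \<rho> above[OF rays_in_fan[OF \<rho>]] \<sigma>] \<rho> by (auto simp: forms_def)

lemma compatible_integral:
  assumes m: "m \<in> compatible_characters N \<Sigma> w" and \<rho>: "\<rho> \<in> rays \<Sigma>" and \<sigma>: "\<sigma> \<in> max_cones \<Sigma>" "\<rho> \<subseteq> \<sigma>"
  shows "m \<sigma> (weighted_gen \<rho>) \<in> \<int>"
  using compatibleD(1)[OF m \<sigma>(1)] weighted_gen_in_gens[OF \<rho> \<sigma>(2)] unfolding dual_\<Lambda>_max[OF \<sigma>(1)] by blast

lemma forms_in: 
  assumes m: "m \<in> compatible_characters N \<Sigma> w"
  shows "forms m \<in> (\<Pi>\<^sub>E \<rho>\<in>rays \<Sigma>. ray_forms N \<rho> (w \<rho>))"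
proof (rule PiE_I)
  fix \<rho> assume \<rho>: "\<rho> \<in> rays \<Sigma>"
  note a = above[OF rays_in_fan[OF \<rho>]]
  show "forms m \<rho> \<in> ray_forms N \<rho> (w \<rho>)"
    unfolding forms_eq[OF m \<rho> a]
    using dual_latticeD[OF compatibleD(1)[OF m a(1)]] compatible_integral[OF m \<rho> a]
    by (intro restrict_linear_ray_forms) (auto simp: weighted_gen_def)
qed (simp add: forms_def)

lemma integers_forms:
  assumes m: "m \<in> compatible_characters N \<Sigma> w" and \<rho>: "\<rho> \<in> rays \<Sigma>" and \<sigma>: "\<sigma> \<in> max_cones \<Sigma>" "\<rho> \<subseteq> \<sigma>"
  shows "of_int (integers (forms m) \<rho>) = m \<sigma> (weighted_gen \<rho>)"
  using compatible_integral[OF m \<rho> \<sigma>] \<rho> by (auto simp: integers_def forms_eq[OF m \<rho> \<sigma>] elim!: Ints_cases)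

text \<open>On each ray line a form is determined by its value at the nonzero weighted generator,
  and every integer occurs as such a value.\<close>

lemma bij_integers: "bij_betw integers (\<Pi>\<^sub>E \<rho>\<in>rays \<Sigma>. ray_forms N \<rho> (w \<rho>)) (rays \<Sigma> \<rightarrow>\<^sub>E UNIV)"
  unfolding bij_betw_def
proof
  have val: "of_int (integers h \<rho>) = h \<rho> (real (w \<rho>) *\<^sub>R ray_gen N \<rho>)"
    if "h \<in> (\<Pi>\<^sub>E \<rho>\<in>rays \<Sigma>. ray_forms N \<rho> (w \<rho>))" "\<rho> \<in> rays \<Sigma>" for h \<rho>
    using ray_formsD(4)[OF PiE_mem[OF that]] that(2) by (auto simp: integers_def weighted_gen_def elim!: Ints_cases)
  show "inj_on integers (\<Pi>\<^sub>E \<rho>\<in>rays \<Sigma>. ray_forms N \<rho> (w \<rho>))"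
  proof (rule inj_onI)
    fix h h' assume h: "h \<in> (\<Pi>\<^sub>E \<rho>\<in>rays \<Sigma>. ray_forms N \<rho> (w \<rho>))" "h' \<in> (\<Pi>\<^sub>E \<rho>\<in>rays \<Sigma>. ray_forms N \<rho> (w \<rho>))"
      and eq: "integers h = integers h'"
    show "h = h'"
    proof (rule PiE_ext[OF h])
      fix \<rho> assume \<rho>: "\<rho> \<in> rays \<Sigma>"
      show "h \<rho> = h' \<rho>"
        by (rule ray_forms_eqI[OF PiE_mem[OF h(1) \<rho>] PiE_mem[OF h(2) \<rho>] w_pos[OF \<rho>]])
          (metis eq val[OF h(1) \<rho>] val[OF h(2) \<rho>])
    qed
  qed
  show "integers ` (\<Pi>\<^sub>E \<rho>\<in>rays \<Sigma>. ray_forms N \<rho> (w \<rho>)) = (rays \<Sigma> \<rightarrow>\<^sub>E UNIV)"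
  proof (intro equalityI subsetI)
    fix l :: "'a set \<Rightarrow> int" assume l: "l \<in> rays \<Sigma> \<rightarrow>\<^sub>E UNIV"
    have "\<forall>\<rho>\<in>rays \<Sigma>. \<exists>h\<in>ray_forms N \<rho> (w \<rho>). h (real (w \<rho>) *\<^sub>R ray_gen N \<rho>) = of_int (l \<rho>)"
      using ray_forms_exists ray_generator(2) w_pos by blast
    then obtain h where h: "\<And>\<rho>. \<rho> \<in> rays \<Sigma> \<Longrightarrow> h \<rho> \<in> ray_forms N \<rho> (w \<rho>)"
      "\<And>\<rho>. \<rho> \<in> rays \<Sigma> \<Longrightarrow> h \<rho> (real (w \<rho>) *\<^sub>R ray_gen N \<rho>) = of_int (l \<rho>)" by metis
    have "integers (restrict h (rays \<Sigma>)) = l"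
      by (rule PiE_ext[of _ "rays \<Sigma>" "\<lambda>_. UNIV"]) (use h l in \<open>auto simp: integers_def weighted_gen_def\<close>)
    moreover have "restrict h (rays \<Sigma>) \<in> (\<Pi>\<^sub>E \<rho>\<in>rays \<Sigma>. ray_forms N \<rho> (w \<rho>))" using h by auto
    ultimately show "l \<in> integers ` (\<Pi>\<^sub>E \<rho>\<in>rays \<Sigma>. ray_forms N \<rho> (w \<rho>))" by blast
  qed (auto simp: integers_def)
qed

lemma inj_weighted_gen: "inj_on weighted_gen (rays \<Sigma>)"
  using weighted_gen(3) by (metis inj_onI)

text \<open>For a maximal cone the weighted generators are a basis of the space, so prescribed
  integers on its rays extend uniquely. Compatibility is automatic: the intersection of two maximal
  cones is generated by common rays, on which both extensions take the same prescribed
  values.\<close>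

lemma bij_integers_forms:
  "bij_betw (integers \<circ> forms) (compatible_characters N \<Sigma> w) (rays \<Sigma> \<rightarrow>\<^sub>E UNIV)"
  unfolding bij_betw_def
proof
  show "inj_on (integers \<circ> forms) (compatible_characters N \<Sigma> w)"
  proof (rule inj_onI)
    fix m m' assume m: "m \<in> compatible_characters N \<Sigma> w" "m' \<in> compatible_characters N \<Sigma> w"
      and eq: "(integers \<circ> forms) m = (integers \<circ> forms) m'"
    show "m = m'"
    proof (rule extensionalityI[OF compatibleD(3)[OF m(1)] compatibleD(3)[OF m(2)]])
      fix \<sigma> assume \<sigma>: "\<sigma> \<in> max_cones \<Sigma>"
      have lin: "linear (m \<sigma>)" "linear (m' \<sigma>)" using m \<sigma> compatibleD(1) dual_latticeD by blast+
      have "m \<sigma> v = m' \<sigma> v" if v: "v \<in> gens \<sigma>" for v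
      proof -
        obtain \<rho> where \<rho>: "\<rho> \<in> rays \<Sigma>" "\<rho> \<subseteq> \<sigma>" "v = weighted_gen \<rho>" using v unfolding gens_eq by blast
        show ?thesis
          using integers_forms[OF m(1) \<rho>(1) \<sigma> \<rho>(2)] integers_forms[OF m(2) \<rho>(1) \<sigma> \<rho>(2)] eq \<rho>(3) by simp
      qed
      then have "m \<sigma> v = m' \<sigma> v" for v
        using linear_eq_on[OF lin, of v "gens \<sigma>"] span_gens_max[OF \<sigma>] by simp
      then show "m \<sigma> = m' \<sigma>" by blast
    qed
  qed
  show "(integers \<circ> forms) ` compatible_characters N \<Sigma> w = (rays \<Sigma> \<rightarrow>\<^sub>E UNIV)"
  proof (intro equalityI subsetI)
    fix l :: "'a set \<Rightarrow> int" assume l: "l \<in> rays \<Sigma> \<rightarrow>\<^sub>E UNIV"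
    \<comment> \<open>A ray is recovered from its weighted generator, so integers on rays define
      values on the generators.\<close>
    define val where "val v = real_of_int (l (inv_into (rays \<Sigma>) weighted_gen v))" for v
    have val: "val (weighted_gen \<rho>) = of_int (l \<rho>)" if "\<rho> \<in> rays \<Sigma>" for \<rho>
      using inv_into_f_f[OF inj_weighted_gen that] by (simp add: val_def)
    have "\<forall>\<sigma>\<in>max_cones \<Sigma>. \<exists>f. linear f \<and> (\<forall>v\<in>gens \<sigma>. f v = val v)"
      using linear_independent_extend[OF independent_gens[OF max_in_fan]] by blast
    then obtain f where f: "\<And>\<sigma>. \<sigma> \<in> max_cones \<Sigma> \<Longrightarrow> linear (f \<sigma>)"
      "\<And>\<sigma> v. \<sigma> \<in> max_cones \<Sigma> \<Longrightarrow> v \<in> gens \<sigma> \<Longrightarrow> f \<sigma> v = val v" by metis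
    have m: "restrict f (max_cones \<Sigma>) \<in> compatible_characters N \<Sigma> w"
      unfolding compatible_characters_def
    proof (intro CollectI conjI ballI)
      show "restrict f (max_cones \<Sigma>) \<in> (\<Pi>\<^sub>E \<sigma>\<in>max_cones \<Sigma>. dual_lattice (\<Lambda> \<sigma>))"
        using f by (auto simp: dual_\<Lambda>_max val_def)
      fix \<sigma>1 \<sigma>2 assume \<sigma>: "\<sigma>1 \<in> max_cones \<Sigma>" "\<sigma>2 \<in> max_cones \<Sigma>"
      have lin: "linear (\<lambda>v. f \<sigma>1 v - f \<sigma>2 v)" by (intro linear_compose_sub f \<sigma>)
      have eq: "f \<sigma>1 u - f \<sigma>2 u = 0" if u: "u \<in> gens (\<sigma>1 \<inter> \<sigma>2)" for u
        using f(2)[OF \<sigma>(1) subsetD[OF gens_mono[OF Int_lower1] u]]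
          f(2)[OF \<sigma>(2) subsetD[OF gens_mono[OF Int_lower2] u]] by simp
      have "f \<sigma>1 v - f \<sigma>2 v = 0" if "v \<in> \<sigma>1 \<inter> \<sigma>2" for v
        by (rule linear_zero_on_cone[OF fan_Int[OF max_in_fan[OF \<sigma>(1)] max_in_fan[OF \<sigma>(2)]] lin eq that])
      then show "(\<lambda>v. restrict f (max_cones \<Sigma>) \<sigma>1 v - restrict f (max_cones \<Sigma>) \<sigma>2 v) \<in> annihilator (\<sigma>1 \<inter> \<sigma>2)"
        using \<sigma> lin by (simp add: annihilator_def)
    qed
    have "(integers \<circ> forms) (restrict f (max_cones \<Sigma>)) = l"
    proof (rule PiE_ext[of _ "rays \<Sigma>" "\<lambda>_. UNIV"])
      show "(integers \<circ> forms) (restrict f (max_cones \<Sigma>)) \<in> rays \<Sigma> \<rightarrow>\<^sub>E UNIV" by (auto simp: integers_def)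
      fix \<rho> assume \<rho>: "\<rho> \<in> rays \<Sigma>"
      note a = above[OF rays_in_fan[OF \<rho>]]
      show "(integers \<circ> forms) (restrict f (max_cones \<Sigma>)) \<rho> = l \<rho>"
        using integers_forms[OF m \<rho> a] f(2)[OF a(1) weighted_gen_in_gens[OF \<rho> a(2)]] val[OF \<rho>] a(1) by simp
    qed (rule l)
    then show "l \<in> (integers \<circ> forms) ` compatible_characters N \<Sigma> w" using m by blast
  qed (auto simp: integers_def)
qed

text \<open>Two out of three: \<open>integers\<close> and its composite with \<open>forms\<close>
  are bijective.\<close>

lemma bij_forms: "bij_betw forms (compatible_characters N \<Sigma> w) (\<Pi>\<^sub>E \<rho>\<in>rays \<Sigma>. ray_forms N \<rho> (w \<rho>))"
  using bij_betw_comp_iff2[OF bij_integers, of forms "compatible_characters N \<Sigma> w"] bij_integers_forms forms_in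
  by blast

lemma finite_rays: "finite (rays \<Sigma>)"
  using fan_finite by (simp add: cones_def)

lemma carrier_forms_sum_group:
  "carrier (sum_group (rays \<Sigma>) (\<lambda>\<rho>. ray_forms_group N \<rho> (k \<rho>))) = (\<Pi>\<^sub>E \<rho>\<in>rays \<Sigma>. ray_forms N \<rho> (k \<rho>))"
  using finite_rays by (simp add: carrier_sum_group group_ray_forms) (simp add: ray_forms_group_def)

text \<open>The product of forms is given by the same formula for every \<open>k\<close>, so one
  statement covers the weights \<open>w\<close> and the constant 1.\<close>

lemma forms_mult:
  assumes "m \<in> compatible_characters N \<Sigma> w" "m' \<in> compatible_characters N \<Sigma> w"
  shows "forms (m \<otimes>\<^bsub>Z\<^esub> m') = forms m \<otimes>\<^bsub>sum_group (rays \<Sigma>) (\<lambda>\<rho>. ray_forms_group N \<rho> (k \<rho>))\<^esub> forms m'"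
  using above(1)[OF rays_in_fan] by (auto simp: forms_def Z_def ray_forms_group_def intro!: ext)

lemma ray_forms_1_subset:
  "ray_forms N \<rho> 1 \<subseteq> ray_forms N \<rho> k"
proof
  fix h assume h: "h \<in> ray_forms N \<rho> 1"
  have "h (real k *\<^sub>R ray_gen N \<rho>) = real k * h (real 1 *\<^sub>R ray_gen N \<rho>)"
    using ray_forms_value[OF h, of "real k"] by simp
  then have "h (real k *\<^sub>R ray_gen N \<rho>) \<in> \<int>" using ray_formsD(4)[OF h] by simp
  then show "h \<in> ray_forms N \<rho> k" using h by (simp add: ray_forms_def)
qed

text \<open>Product and neutral element of the two groups coincide as functions, so an inverse in
  the smaller group is also one in the larger.\<close>

lemma subgroup_ray_forms_1:
  "subgroup (carrier (sum_group (rays \<Sigma>) (\<lambda>\<rho>. ray_forms_group N \<rho> 1)))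
     (sum_group (rays \<Sigma>) (\<lambda>\<rho>. ray_forms_group N \<rho> (w \<rho>)))"
proof -
  define G where "G k = sum_group (rays \<Sigma>) (\<lambda>\<rho>. ray_forms_group N \<rho> (k \<rho>))" for k :: "'a set \<Rightarrow> nat"
  interpret w: group "G w" by (simp add: G_def group_ray_forms)
  interpret one: group "G (\<lambda>_. 1)" by (simp add: G_def group_ray_forms)
  have mult: "x \<otimes>\<^bsub>G w\<^esub> y = x \<otimes>\<^bsub>G (\<lambda>_. 1)\<^esub> y" for x y by (simp add: G_def ray_forms_group_def)
  have one_eq: "\<one>\<^bsub>G w\<^esub> = \<one>\<^bsub>G (\<lambda>_. 1)\<^esub>" by (simp add: G_def ray_forms_group_def)
  have sub: "carrier (G (\<lambda>_. 1)) \<subseteq> carrier (G w)"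
    unfolding G_def carrier_forms_sum_group by (rule PiE_mono) (rule ray_forms_1_subset)
  have "subgroup (carrier (G (\<lambda>_. 1))) (G w)"
  proof (rule w.subgroupI[OF sub])
    show "carrier (G (\<lambda>_. 1)) \<noteq> {}" using one.one_closed by blast
    fix x assume x: "x \<in> carrier (G (\<lambda>_. 1))"
    have "inv\<^bsub>G w\<^esub> x = inv\<^bsub>G (\<lambda>_. 1)\<^esub> x"
      by (rule w.inv_equality) (use x sub one.inv_closed[OF x] one.l_inv[OF x] mult one_eq in auto)
    then show "inv\<^bsub>G w\<^esub> x \<in> carrier (G (\<lambda>_. 1))" using one.inv_closed[OF x] by simp
    fix y assume "y \<in> carrier (G (\<lambda>_. 1))"
    then show "x \<otimes>\<^bsub>G w\<^esub> y \<in> carrier (G (\<lambda>_. 1))"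
      using one.m_closed[OF x] by (simp only: mult)
  qed
  then show ?thesis unfolding G_def .
qed

section \<open>Line bundles on the toric variety\<close>

abbreviation "XU \<tau> \<equiv> affine_toric \<tau> N"
abbreviation "incl \<equiv> chart_incl N \<Sigma>"
abbreviation "VB \<equiv> linearized_bundles N \<Sigma>"
abbreviation "rchart \<equiv> restrict_chart N \<Sigma>"

text \<open>A point of the chart of the intersection is obtained by inverting a character that defines the
  intersection as a face of \<open>\<sigma>\<close>.\<close>

lemma chart_separation:
  assumes \<sigma>: "\<sigma> \<in> max_cones \<Sigma>" and \<tau>: "\<tau>1 \<in> \<Sigma>" "\<tau>1 \<subseteq> \<sigma>" "\<tau>2 \<in> \<Sigma>" "\<tau>2 \<subseteq> \<sigma>"
    and y: "y \<in> XU \<tau>1" and z: "z \<in> XU \<tau>2" and yz: "toric_map \<sigma> N y = toric_map \<sigma> N z"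
  obtains x where "x \<in> XU (\<tau>1 \<inter> \<tau>2)" "toric_map \<tau>1 N x = y" "toric_map \<tau>2 N x = z"
proof -
  interpret fixed_point_chart \<sigma> N "gens \<sigma>" by (rule fixed_point_chart_variety[OF \<sigma>])
  define \<delta> where "\<delta> = \<tau>1 \<inter> \<tau>2"
  define p where "p = toric_map \<sigma> N y"
  have p: "p \<in> U" unfolding p_def by (rule toric_map_in[OF \<tau>(2) order_refl y])
  have py: "p m = y m" if "m \<in> S" for m using that by (simp add: p_def toric_map_def)
  have pz: "p m = z m" if "m \<in> S" for m
    using that unfolding p_def yz by (simp add: toric_map_def)
  obtain m1 where m1: "m1 \<in> S" "\<And>v. v \<in> \<tau>1 \<Longrightarrow> m1 v = 0" "\<And>v. v \<in> gens \<sigma> \<Longrightarrow> v \<notin> \<tau>1 \<Longrightarrow> 1 \<le> m1 v"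
    using face_defining_character[OF \<sigma> \<tau>(1,2)] by blast
  obtain m2 where m2: "m2 \<in> S" "\<And>v. v \<in> \<tau>2 \<Longrightarrow> m2 v = 0" "\<And>v. v \<in> gens \<sigma> \<Longrightarrow> v \<notin> \<tau>2 \<Longrightarrow> 1 \<le> m2 v"
    using face_defining_character[OF \<sigma> \<tau>(3,4)] by blast
  \<comment> \<open>The sum of the supporting characters of both faces vanishes on
    \<open>\<delta>\<close> and is at least 1 on the other generators. Its monomial is nonzero at
    \<open>p\<close>, because \<open>m1\<close> is invertible at \<open>y\<close> and
    \<open>m2\<close> at \<open>z\<close>.\<close>
  define K where "K v = m1 v + m2 v" for v
  have KS: "K \<in> S" unfolding K_def using m1(1) m2(1) by (rule cone_chars_add)
  have K0: "K v = 0" if "v \<in> \<delta>" for v using that m1(2) m2(2) by (simp add: K_def \<delta>_def)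
  have K1: "1 \<le> K v" if v: "v \<in> gens \<sigma>" "v \<notin> \<delta>" for v
  proof -
    have "0 \<le> m1 v" "0 \<le> m2 v" using m1(1) m2(1) v(1) by (auto simp: S_iff)
    then show ?thesis using m1(3)[OF v(1)] m2(3)[OF v(1)] v(2) by (auto simp: K_def \<delta>_def)
  qed
  have dual: "m1 \<in> dual_lattice N" "m2 \<in> dual_lattice N" using m1(1) m2(1) by (auto simp: cone_chars_def)
  have pK: "p K \<noteq> 0"
  proof -
    have "p m1 \<noteq> 0" using affine_toric_invertible[OF y dual(1) m1(2)] by (auto simp: py[OF m1(1)])
    moreover have "p m2 \<noteq> 0" using affine_toric_invertible[OF z dual(2) m2(2)] by (auto simp: pz[OF m2(1)])
    ultimately show ?thesis using affine_toric_add[OF p m1(1) m2(1)] by (simp add: K_def[abs_def])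
  qed
  have shift_S: "(\<lambda>v. m v + real k * K v) \<in> S" if "m \<in> S" for m k
  proof (induction k)
    case (Suc k)
    from cone_chars_add[OF this KS] show ?case by (simp add: algebra_simps)
  qed (use that in simp)
  have p_shift: "p (\<lambda>v. m v + real k * K v) = p m * p K ^ k" if "m \<in> S" for m k
  proof (induction k)
    case (Suc k)
    from affine_toric_add[OF p shift_S[OF that, of k] KS] show ?case using Suc by (simp add: algebra_simps)
  qed simp
  have ex: "\<exists>k. (\<lambda>v. m v + real k * K v) \<in> S" if m: "m \<in> cone_chars \<delta> N" for m
  proof -
    \<comment> \<open>Large enough to outweigh every negative value of \<open>m\<close>, since
      \<open>K\<close> is at least 1 on the generators outside \<open>\<delta>\<close>.\<close>
    define k where "k = nat \<lceil>\<Sum>v\<in>gens \<sigma>. \<bar>m v\<bar>\<rceil>"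
    have "0 \<le> m v + real k * K v" if v: "v \<in> gens \<sigma>" for v
    proof (cases "v \<in> \<delta>")
      case True
      then show ?thesis using m K0 by (simp add: cone_chars_def)
    next
      case False
      have "\<bar>m v\<bar> \<le> (\<Sum>v\<in>gens \<sigma>. \<bar>m v\<bar>)" by (rule member_le_sum[OF v]) (simp_all add: finite_gens)
      also have "\<dots> \<le> real k" unfolding k_def by (rule real_nat_ceiling_ge)
      also have "\<dots> \<le> real k * K v" using K1[OF v False] by (simp add: mult_le_cancel_left1)
      finally show ?thesis by linarith
    qed
    moreover have "(\<lambda>v. m v + real k * K v) \<in> dual_lattice N"
    proof (induction k)
      case 0
      show ?case using m by (simp add: cone_chars_def)
    next
      case (Suc k)
      have "K \<in> dual_lattice N" using KS by (simp add: cone_chars_def)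
      from dual_lattice_add[OF Suc this] show ?case by (simp add: algebra_simps)
    qed
    ultimately show ?thesis unfolding S_iff by blast
  qed
  \<comment> \<open>Evaluation at \<open>p\<close> extended to the localization at \<open>K\<close>;
    the fraction does not depend on the exponent, as the next fact shows.\<close>
  define x where "x m = (if m \<in> cone_chars \<delta> N then
     let k = (SOME k. (\<lambda>v. m v + real k * K v) \<in> S) in p (\<lambda>v. m v + real k * K v) / p K ^ k else 0)" for m
  have x: "x m = p (\<lambda>v. m v + real k * K v) / p K ^ k"
    if m: "m \<in> cone_chars \<delta> N" and k: "(\<lambda>v. m v + real k * K v) \<in> S" for m k
  proof -
    define j where "j = (SOME k. (\<lambda>v. m v + real k * K v) \<in> S)"
    have j: "(\<lambda>v. m v + real j * K v) \<in> S" unfolding j_def by (rule someI[of _ k]) (rule k)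
    have "p (\<lambda>v. m v + real j * K v) * p K ^ k = p (\<lambda>v. m v + real k * K v) * p K ^ j"
      using p_shift[OF j, of k] p_shift[OF k, of j] by (simp add: algebra_simps)
    then have "p (\<lambda>v. m v + real j * K v) / p K ^ j = p (\<lambda>v. m v + real k * K v) / p K ^ k"
      using pK by (simp add: frac_eq_eq)
    then show ?thesis using m by (simp add: x_def j_def[symmetric] Let_def)
  qed
  have xU: "x \<in> XU \<delta>"
    unfolding affine_toric_def
  proof (intro CollectI conjI ballI allI impI)
    show "x (\<lambda>_. 0) = 1"
      using x[OF cone_chars_zero, of 0] affine_toric_zero[OF p] by simp
    fix m m' assume m: "m \<in> cone_chars \<delta> N" "m' \<in> cone_chars \<delta> N"
    obtain k k' where k: "(\<lambda>v. m v + real k * K v) \<in> S" "(\<lambda>v. m' v + real k' * K v) \<in> S" using ex m by blast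
    have eq: "(\<lambda>v. (m v + real k * K v) + (m' v + real k' * K v)) = (\<lambda>v. (m v + m' v) + real (k + k') * K v)"
      by (simp add: algebra_simps)
    have "(\<lambda>v. (m v + m' v) + real (k + k') * K v) \<in> S" using cone_chars_add[OF k] unfolding eq .
    from x[OF cone_chars_add[OF m] this] show "x (\<lambda>v. m v + m' v) = x m * x m'"
      using affine_toric_add[OF p k] unfolding eq by (simp add: x[OF m(1) k(1)] x[OF m(2) k(2)] power_add)
  qed (auto simp: x_def)
  have restr: "toric_map \<tau> N x = y'"
    if \<tau>: "\<delta> \<subseteq> \<tau>" "\<tau> \<subseteq> \<sigma>" and y': "y' \<in> XU \<tau>" and py': "\<And>m. m \<in> S \<Longrightarrow> p m = y' m" for \<tau> y'
  proof
    fix m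
    show "toric_map \<tau> N x m = y' m"
    proof (cases "m \<in> cone_chars \<tau> N")
      case True
      have m\<delta>: "m \<in> cone_chars \<delta> N" using True cone_chars_antimono[OF \<tau>(1), of N N] by blast
      obtain k where k: "(\<lambda>v. m v + real k * K v) \<in> S" using ex[OF m\<delta>] by blast
      have K\<tau>: "K \<in> cone_chars \<tau> N" using KS cone_chars_antimono[OF \<tau>(2), of N N] by blast
      have shift: "(\<lambda>v. m v + real j * K v) \<in> cone_chars \<tau> N \<and> y' (\<lambda>v. m v + real j * K v) = y' m * y' K ^ j" for j
      proof (induction j)
        case (Suc j)
        from cone_chars_add[OF conjunct1[OF Suc] K\<tau>] affine_toric_add[OF y' conjunct1[OF Suc] K\<tau>]
        show ?case using Suc by (simp add: algebra_simps)
      qed (use True in simp)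
      have "x m = y' (\<lambda>v. m v + real k * K v) / p K ^ k" using x[OF m\<delta> k] py'[OF k] by simp
      also have "\<dots> = y' m" using shift[of k] py'[OF KS] pK by simp
      finally show ?thesis using True by (simp add: toric_map_def)
    qed (use y' in \<open>simp add: toric_map_def affine_toric_outside\<close>)
  qed
  show ?thesis
  proof (rule that[of x])
    show "x \<in> XU (\<tau>1 \<inter> \<tau>2)" using xU by (simp add: \<delta>_def)
    show "toric_map \<tau>1 N x = y" by (rule restr[OF _ \<tau>(2) y py]) (simp_all add: \<delta>_def)
    show "toric_map \<tau>2 N x = z" by (rule restr[OF _ \<tau>(4) z pz]) (simp_all add: \<delta>_def)
  qed
qed

section \<open>Gluing of the affine charts\<close>

text \<open>The substantial inclusion is from right to left: a common point over
  \<open>\<sigma> \<inter> \<tau>'\<close> has the same image as \<open>y\<close> in the chart of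
  \<open>\<sigma>\<close>, so \<open>chart_separation\<close> lifts it to the intersection with
  \<open>\<tau>\<close>.\<close>

lemma incl_max:
  assumes \<sigma>: "\<sigma> \<in> max_cones \<Sigma>" and \<tau>: "\<tau> \<in> \<Sigma>" "\<tau> \<subseteq> \<sigma>" and y: "y \<in> XU \<tau>"
  shows "incl \<tau> y = incl \<sigma> (toric_map \<sigma> N y)"
proof -
  have "(\<exists>u\<in>XU (\<tau> \<inter> \<tau>'). toric_map \<tau> N u = y \<and> toric_map \<tau>' N u = x') \<longleftrightarrow>
        (\<exists>u\<in>XU (\<sigma> \<inter> \<tau>'). toric_map \<sigma> N u = toric_map \<sigma> N y \<and> toric_map \<tau>' N u = x')"
    if \<tau>': "\<tau>' \<in> \<Sigma>" for \<tau>' x'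
  proof
    assume "\<exists>u\<in>XU (\<tau> \<inter> \<tau>'). toric_map \<tau> N u = y \<and> toric_map \<tau>' N u = x'"
    then obtain u where u: "u \<in> XU (\<tau> \<inter> \<tau>')" "toric_map \<tau> N u = y" "toric_map \<tau>' N u = x'" by blast
    have sub: "\<tau> \<inter> \<tau>' \<subseteq> \<sigma> \<inter> \<tau>'" using \<tau>(2) by blast
    show "\<exists>u\<in>XU (\<sigma> \<inter> \<tau>'). toric_map \<sigma> N u = toric_map \<sigma> N y \<and> toric_map \<tau>' N u = x'"
    proof (intro bexI conjI)
      show "toric_map (\<sigma> \<inter> \<tau>') N u \<in> XU (\<sigma> \<inter> \<tau>')" by (rule toric_map_in[OF sub order_refl u(1)])
      show "toric_map \<sigma> N (toric_map (\<sigma> \<inter> \<tau>') N u) = toric_map \<sigma> N y"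
        unfolding u(2)[symmetric] using \<tau>(2) by (simp add: toric_map_toric_map)
      show "toric_map \<tau>' N (toric_map (\<sigma> \<inter> \<tau>') N u) = x'" by (simp add: toric_map_toric_map u(3))
    qed
  next
    assume "\<exists>u\<in>XU (\<sigma> \<inter> \<tau>'). toric_map \<sigma> N u = toric_map \<sigma> N y \<and> toric_map \<tau>' N u = x'"
    then obtain u where u: "u \<in> XU (\<sigma> \<inter> \<tau>')" "toric_map \<sigma> N u = toric_map \<sigma> N y" "toric_map \<tau>' N u = x'" by blast
    obtain v where v: "v \<in> XU (\<tau> \<inter> (\<sigma> \<inter> \<tau>'))" "toric_map \<tau> N v = y" "toric_map (\<sigma> \<inter> \<tau>') N v = u"
      by (rule chart_separation[OF \<sigma> \<tau> fan_Int[OF max_in_fan[OF \<sigma>] \<tau>'] _ y u(1) u(2)[symmetric]]) auto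
    have "\<tau> \<inter> (\<sigma> \<inter> \<tau>') = \<tau> \<inter> \<tau>'" using \<tau>(2) by blast
    moreover have "toric_map \<tau>' N v = x'" unfolding u(3)[symmetric] v(3)[symmetric] by (simp add: toric_map_toric_map)
    ultimately show "\<exists>u\<in>XU (\<tau> \<inter> \<tau>'). toric_map \<tau> N u = y \<and> toric_map \<tau>' N u = x'" using v by auto
  qed
  then show ?thesis unfolding chart_incl_def by auto
qed

text \<open>Separation is proved inside a maximal cone, so both sides are compared in a maximal cone
  above \<open>\<tau>\<close>.\<close>

lemma incl_face:
  assumes \<tau>: "\<tau> \<in> \<Sigma>" "\<tau>' \<in> \<Sigma>" "\<tau>' \<subseteq> \<tau>" and y: "y \<in> XU \<tau>'"
  shows "incl \<tau>' y = incl \<tau> (toric_map \<tau> N y)"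
proof -
  obtain \<sigma> where \<sigma>: "\<sigma> \<in> max_cones \<Sigma>" "\<tau> \<subseteq> \<sigma>" by (rule max_cone_above[OF \<tau>(1)])
  have "incl \<tau> (toric_map \<tau> N y) = incl \<sigma> (toric_map \<sigma> N (toric_map \<tau> N y))"
    by (rule incl_max[OF \<sigma>(1) \<tau>(1) \<sigma>(2) toric_map_in[OF \<tau>(3) order_refl y]])
  also have "\<dots> = incl \<sigma> (toric_map \<sigma> N y)" using \<sigma>(2) by (simp add: toric_map_toric_map)
  also have "\<dots> = incl \<tau>' y" by (rule incl_max[symmetric]) (use \<sigma> \<tau> y in auto)
  finally show ?thesis ..
qed

text \<open>A glued point contains its own representative, so equality of two glued points already
  exhibits a common point of the intersection.\<close>

lemma incl_eqD:
  assumes "incl \<tau> x = incl \<tau>' x'" "\<tau> \<in> \<Sigma>" "x \<in> XU \<tau>"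
  obtains y where "y \<in> XU (\<tau> \<inter> \<tau>')" "toric_map \<tau> N y = x" "toric_map \<tau>' N y = x'"
proof -
  have "(\<tau>, x) \<in> incl \<tau> x" using assms(2,3) toric_map_id[OF assms(3)] by (auto simp: chart_incl_def)
  then have "(\<tau>, x) \<in> incl \<tau>' x'" using assms(1) by simp
  then show ?thesis using that by (auto simp: chart_incl_def Int_commute)
qed

lemma incl_in: "\<tau> \<in> \<Sigma> \<Longrightarrow> x \<in> XU \<tau> \<Longrightarrow> incl \<tau> x \<in> toric_variety N \<Sigma>"
  by (auto simp: toric_variety_def)

lemma VB_elb: "L \<in> VB \<Longrightarrow> \<tau> \<in> \<Sigma> \<Longrightarrow> equivariant_line_bundle \<tau> N (rchart \<tau> L)"
  by (simp add: linearized_bundles_def)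

lemma equivariant_morphism_X: "\<tau>' \<subseteq> \<tau> \<Longrightarrow> equivariant_morphism \<tau>' N \<tau> N (toric_map \<tau> N)"
  by (rule equivariant_morphism_toric_map) auto

lemma pull_rchart:
  assumes "\<tau>' \<subseteq> \<tau>" "\<Lambda>' \<subseteq> N"
  shows "pull_eq (affine_toric \<tau>' \<Lambda>') (toric_map \<tau> N) (rchart \<tau> L) =
     pull_eq (affine_toric \<tau>' \<Lambda>') (\<lambda>x. incl \<tau> (toric_map \<tau> N x)) L"
  unfolding restrict_chart_def by (rule pull_eq_pull_eq) (rule toric_map_in[OF assms])

lemma rchart_iso:
  assumes L: "L \<in> VB" and \<tau>: "\<tau> \<in> \<Sigma>" "\<tau>' \<in> \<Sigma>" "\<tau>' \<subseteq> \<tau>"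
  shows "equivariant_iso \<tau>' N (pull_eq (XU \<tau>') (toric_map \<tau> N) (rchart \<tau> L)) (rchart \<tau>' L) (\<lambda>_. 1)"
    "equivariant_line_bundle \<tau>' N (pull_eq (XU \<tau>') (toric_map \<tau> N) (rchart \<tau> L))"
proof -
  show *: "equivariant_line_bundle \<tau>' N (pull_eq (XU \<tau>') (toric_map \<tau> N) (rchart \<tau> L))"
    by (rule equivariant_line_bundle_pull[OF equivariant_morphism_X[OF \<tau>(3)] VB_elb[OF L \<tau>(1)]])
  show "equivariant_iso \<tau>' N (pull_eq (XU \<tau>') (toric_map \<tau> N) (rchart \<tau> L)) (rchart \<tau>' L) (\<lambda>_. 1)"
    unfolding pull_rchart[OF \<tau>(3) order_refl] restrict_chart_def[of _ _ \<tau>']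
    by (rule equivariant_iso_pull_cong[OF *[unfolded pull_rchart[OF \<tau>(3) order_refl]]])
      (use incl_face[OF \<tau>] in simp)
qed

section \<open>Characters of bundles on the toric variety\<close>

definition vchar :: "('a, 'a glued_point) eq_bundle \<Rightarrow> 'a set \<Rightarrow> ('a \<Rightarrow> real) \<Rightarrow> bool" where
  "vchar L \<sigma> m \<longleftrightarrow> m \<in> dual_lattice N \<and>
     (\<exists>f. equivariant_iso \<sigma> N (trivial_eq (XU \<sigma>) (character m)) (rchart \<sigma> L) f)"

lemma vchar_exists:
  assumes "L \<in> VB" "\<sigma> \<in> max_cones \<Sigma>" shows "\<exists>m. vchar L \<sigma> m"
  using fixed_point_chart.trivialization_exists[OF fixed_point_chart_variety[OF assms(2)] VB_elb[OF assms(1) max_in_fan[OF assms(2)]]]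
  unfolding vchar_def by blast

abbreviation "pullback \<equiv> orbi_pullback N \<Sigma> w"

lemma chart_pullback:
  assumes "\<tau> \<in> \<Sigma>" shows "chart (pullback L) \<tau> = pull_eq (chartU \<tau>) (toric_map \<tau> N) (rchart \<tau> L)"
  using pull_rchart[OF order_refl \<Lambda>_subset_N[OF assms]] by (simp add: orbi_pullback_def)

lemma equivariant_morphism_quotient:
  "\<tau> \<in> \<Sigma> \<Longrightarrow> equivariant_morphism \<tau> (\<Lambda> \<tau>) \<tau> N (toric_map \<tau> N)"
  by (rule equivariant_morphism_toric_map[OF order_refl \<Lambda>_subset_N])

lemma pullback_elb:
  "L \<in> VB \<Longrightarrow> \<tau> \<in> \<Sigma> \<Longrightarrow> equivariant_line_bundle \<tau> (\<Lambda> \<tau>) (chart (pullback L) \<tau>)"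
  by (simp add: chart_pullback equivariant_line_bundle_pull[OF equivariant_morphism_quotient VB_elb])

text \<open>The two ways from the chart of a face to the toric variety agree, so the fibres are
  literally the same and the gluing factor is 1.\<close>

lemma pullback_in: assumes L: "L \<in> VB" shows "pullback L \<in> LB"
  unfolding linearized_orbi_bundles_def
proof (intro CollectI conjI ballI impI)
  fix \<tau> assume \<tau>: "\<tau> \<in> \<Sigma>"
  show elb: "equivariant_line_bundle \<tau> (\<Lambda> \<tau>) (chart (pullback L) \<tau>)" by (rule pullback_elb[OF L \<tau>])
  fix \<tau>' assume \<tau>': "\<tau>' \<in> \<Sigma>"
  show "equivariant_iso \<tau>' (\<Lambda> \<tau>') (pull_eq (orbi_chart N \<Sigma> w \<tau>') (toric_map \<tau> (\<Lambda> \<tau>)) (chart (pullback L) \<tau>))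
        (chart (pullback L) \<tau>') (gluing (pullback L) \<tau>' \<tau>)" if sub: "\<tau>' \<subseteq> \<tau>"
  proof -
    have eq: "pull_eq (chartU \<tau>') (toric_map \<tau> (\<Lambda> \<tau>)) (chart (pullback L) \<tau>) =
        pull_eq (chartU \<tau>') (\<lambda>x. incl \<tau> (toric_map \<tau> N (toric_map \<tau> (\<Lambda> \<tau>) x))) L"
      using pull_eq_pull_eq[OF toric_map_chart[OF sub]] by (simp add: orbi_pullback_def)
    have "equivariant_iso \<tau>' (\<Lambda> \<tau>') (pull_eq (chartU \<tau>') (\<lambda>x. incl \<tau> (toric_map \<tau> N (toric_map \<tau> (\<Lambda> \<tau>) x))) L)
       (pull_eq (chartU \<tau>') (\<lambda>x. incl \<tau>' (toric_map \<tau>' N x)) L) (\<lambda>_. 1)"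
    proof (rule equivariant_iso_pull_cong)
      show "equivariant_line_bundle \<tau>' (\<Lambda> \<tau>')
          (pull_eq (chartU \<tau>') (\<lambda>x. incl \<tau> (toric_map \<tau> N (toric_map \<tau> (\<Lambda> \<tau>) x))) L)"
        unfolding eq[symmetric] by (rule equivariant_line_bundle_pull[OF equivariant_morphism_chart[OF sub] elb])
      fix x assume x: "x \<in> chartU \<tau>'"
      have "incl \<tau>' (toric_map \<tau>' N x) = incl \<tau> (toric_map \<tau> N (toric_map \<tau>' N x))"
        by (rule incl_face[OF \<tau> \<tau>' sub toric_map_in[OF order_refl \<Lambda>_subset_N[OF \<tau>'] x]])
      then show "incl \<tau> (toric_map \<tau> N (toric_map \<tau> (\<Lambda> \<tau>) x)) = incl \<tau>' (toric_map \<tau>' N x)"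
        using sub by (simp add: toric_map_toric_map \<Lambda>_subset_N[OF \<tau>])
    qed
    then show ?thesis unfolding orbi_chart_eq eq by (simp add: orbi_pullback_def)
  qed
qed (simp add: orbi_pullback_def)

lemma vchar_fchar:
  assumes \<sigma>: "\<sigma> \<in> max_cones \<Sigma>" and m: "vchar L \<sigma> m" shows "fchar (pullback L) \<sigma> m"
proof -
  note \<sigma>\<Sigma> = max_in_fan[OF \<sigma>]
  obtain f where mN: "m \<in> dual_lattice N" and f: "equivariant_iso \<sigma> N (trivial_eq (XU \<sigma>) (character m)) (rchart \<sigma> L) f"
    using m unfolding vchar_def by blast
  have "toric_map \<sigma> N x \<in> XU \<sigma>" if "x \<in> chartU \<sigma>" for x using toric_map_in[OF order_refl \<Lambda>_subset_N[OF \<sigma>\<Sigma>] that] .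
  then have eq: "pull_eq (chartU \<sigma>) (toric_map \<sigma> N) (trivial_eq (XU \<sigma>) (character m)) = trivial_eq (chartU \<sigma>) (character m)"
    by (rule pull_eq_trivial_eq)
  have "m \<in> dual_lattice (\<Lambda> \<sigma>)" using mN dual_lattice_antimono[OF \<Lambda>_subset_N[OF \<sigma>\<Sigma>]] by blast
  moreover have "equivariant_iso \<sigma> (\<Lambda> \<sigma>) (trivial_eq (chartU \<sigma>) (character m)) (chart (pullback L) \<sigma>) (\<lambda>x. f (toric_map \<sigma> N x))"
    using equivariant_iso_pull[OF equivariant_morphism_quotient[OF \<sigma>\<Sigma>] f equivariant_line_bundle_trivial[OF mN]]
    unfolding eq chart_pullback[OF \<sigma>\<Sigma>] .
  ultimately show ?thesis unfolding fchar_iff by blast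
qed

text \<open>A weight on a chart of the variety is also a weight of the pull-back, and the latter is
  unique. So the characters of a bundle on the variety are those of its pull-back, and in addition
  they are integral on \<open>N\<close>.\<close>

lemma vchar_M:
  assumes "L \<in> VB" "\<sigma> \<in> max_cones \<Sigma>" shows "vchar L \<sigma> (M (pullback L) \<sigma>)"
proof -
  obtain m where m: "vchar L \<sigma> m" using vchar_exists[OF assms] by blast
  then have "m = M (pullback L) \<sigma>" using vchar_fchar[OF assms(2)] fchar_M_iff[OF pullback_in[OF assms(1)] assms(2)] by blast
  then show ?thesis using m by simp
qed

lemma M_pullback_eqI:
  assumes "L \<in> VB" "\<And>\<sigma>. \<sigma> \<in> max_cones \<Sigma> \<Longrightarrow> vchar L \<sigma> (m \<sigma>)" "m \<in> extensional (max_cones \<Sigma>)"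
  shows "M (pullback L) = m"
  by (rule M_eqI[OF pullback_in[OF assms(1)] vchar_fchar assms(3)]) (use assms(2) in auto)

lemma M_pullback_dual: "L \<in> VB \<Longrightarrow> \<sigma> \<in> max_cones \<Sigma> \<Longrightarrow> M (pullback L) \<sigma> \<in> dual_lattice N"
  using vchar_M by (simp add: vchar_def)

text \<open>The unit points of all charts map to each other under the toric maps, so it is enough to
  normalize each trivialization at the unit point of its maximal cone.\<close>

lemma normalized_vtrivialization:
  assumes L: "L \<in> VB"
  obtains f where
    "\<And>\<sigma>. \<sigma> \<in> max_cones \<Sigma> \<Longrightarrow>
       equivariant_iso \<sigma> N (trivial_eq (XU \<sigma>) (character (M (pullback L) \<sigma>))) (rchart \<sigma> L) (f \<sigma>)"
    "\<And>\<sigma> \<sigma>' \<tau> x. \<sigma> \<in> max_cones \<Sigma> \<Longrightarrow> \<sigma>' \<in> max_cones \<Sigma> \<Longrightarrow> \<tau> \<in> \<Sigma> \<Longrightarrow> \<tau> \<subseteq> \<sigma> \<Longrightarrow> \<tau> \<subseteq> \<sigma>' \<Longrightarrow> x \<in> XU \<tau> \<Longrightarrow>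
       f \<sigma> (toric_map \<sigma> N x) = f \<sigma>' (toric_map \<sigma>' N x) * x (\<lambda>v. M (pullback L) \<sigma> v - M (pullback L) \<sigma>' v)"
proof -
  let ?m = "M (pullback L)"
  have "\<exists>f. equivariant_iso \<sigma> N (trivial_eq (XU \<sigma>) (character (?m \<sigma>))) (rchart \<sigma> L) f \<and> f (unit_point \<sigma> N) = 1"
    if \<sigma>: "\<sigma> \<in> max_cones \<Sigma>" for \<sigma>
  proof -
    obtain f where f: "equivariant_iso \<sigma> N (trivial_eq (XU \<sigma>) (character (?m \<sigma>))) (rchart \<sigma> L) f"
      using vchar_M[OF L \<sigma>] unfolding vchar_def by blast
    have nz: "f (unit_point \<sigma> N) \<noteq> 0" by (rule equivariant_iso_nonzero[OF f unit_point_in])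
    show ?thesis
      using equivariant_iso_scale[OF f equivariant_line_bundle_trivial[OF M_pullback_dual[OF L \<sigma>]], of "inverse (f (unit_point \<sigma> N))"] nz
      by (intro exI[of _ "\<lambda>x. inverse (f (unit_point \<sigma> N)) * f x"]) simp
  qed
  then obtain f where f: "\<And>\<sigma>. \<sigma> \<in> max_cones \<Sigma> \<Longrightarrow> equivariant_iso \<sigma> N (trivial_eq (XU \<sigma>) (character (?m \<sigma>))) (rchart \<sigma> L) (f \<sigma>)"
    "\<And>\<sigma>. \<sigma> \<in> max_cones \<Sigma> \<Longrightarrow> f \<sigma> (unit_point \<sigma> N) = 1" by metis
  have pull: "equivariant_iso \<tau> N (trivial_eq (XU \<tau>) (character (?m \<sigma>))) (rchart \<tau> L) (\<lambda>x. f \<sigma> (toric_map \<sigma> N x))"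
    if \<sigma>: "\<sigma> \<in> max_cones \<Sigma>" and \<tau>: "\<tau> \<in> \<Sigma>" "\<tau> \<subseteq> \<sigma>" for \<sigma> \<tau>
  proof -
    note T = equivariant_line_bundle_trivial[OF M_pullback_dual[OF L \<sigma>]]
    have eq: "pull_eq (XU \<tau>) (toric_map \<sigma> N) (trivial_eq (XU \<sigma>) (character (?m \<sigma>))) = trivial_eq (XU \<tau>) (character (?m \<sigma>))"
      by (rule pull_eq_trivial_eq) (rule toric_map_in[OF \<tau>(2) order_refl])
    have "equivariant_iso \<tau> N (trivial_eq (XU \<tau>) (character (?m \<sigma>)))
       (pull_eq (XU \<tau>) (toric_map \<sigma> N) (rchart \<sigma> L)) (\<lambda>x. f \<sigma> (toric_map \<sigma> N x))"
      using equivariant_iso_pull[OF equivariant_morphism_X[OF \<tau>(2)] f(1)[OF \<sigma>] T] unfolding eq .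
    from equivariant_iso_trans[OF this rchart_iso(1)[OF L max_in_fan[OF \<sigma>] \<tau>] T rchart_iso(2)[OF L max_in_fan[OF \<sigma>] \<tau>]]
    show ?thesis by simp
  qed
  show ?thesis
  proof (rule that[OF f(1)])
    fix \<sigma> \<sigma>' \<tau> x
    assume \<sigma>: "\<sigma> \<in> max_cones \<Sigma>" "\<sigma>' \<in> max_cones \<Sigma>" and \<tau>: "\<tau> \<in> \<Sigma>" "\<tau> \<subseteq> \<sigma>" "\<tau> \<subseteq> \<sigma>'" and x: "x \<in> XU \<tau>"
    show "f \<sigma> (toric_map \<sigma> N x) = f \<sigma>' (toric_map \<sigma>' N x) * x (\<lambda>v. ?m \<sigma> v - ?m \<sigma>' v)"
    proof (rule trivializations_differ_by_monomial[OF pull[OF \<sigma>(1) \<tau>(1,2)] pull[OF \<sigma>(2) \<tau>(1,3)] VB_elb[OF L \<tau>(1)]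
          M_pullback_dual[OF L \<sigma>(1)] M_pullback_dual[OF L \<sigma>(2)] _ _ x])
      show "?m \<sigma> v = ?m \<sigma>' v" if "v \<in> \<tau>" for v
        using compatibleD(2)[OF M_compatible[OF pullback_in[OF L]] \<sigma>] \<tau> that by blast
      show "f \<sigma> (toric_map \<sigma> N (unit_point \<tau> N)) = f \<sigma>' (toric_map \<sigma>' N (unit_point \<tau> N))"
        using \<sigma> \<tau> by (simp add: toric_map_unit_point f(2))
    qed
  qed
qed

text \<open>Quotients of normalized trivializations over the maximal cones agree on overlaps,
  because both trivializations change by the same monomial. They therefore descend to one function
  of glued points, whose restriction to a smaller chart comes from a maximal one.\<close>

lemma bundle_equiv_if_M_eq:
  assumes L: "L \<in> VB" "L' \<in> VB" and M: "M (pullback L) = M (pullback L')"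
  shows "(L, L') \<in> bundle_equiv N \<Sigma>"
proof -
  let ?m = "M (pullback L)"
  obtain f where f: "\<And>\<sigma>. \<sigma> \<in> max_cones \<Sigma> \<Longrightarrow>
       equivariant_iso \<sigma> N (trivial_eq (XU \<sigma>) (character (?m \<sigma>))) (rchart \<sigma> L) (f \<sigma>)"
    "\<And>\<sigma> \<sigma>' \<tau> x. \<sigma> \<in> max_cones \<Sigma> \<Longrightarrow> \<sigma>' \<in> max_cones \<Sigma> \<Longrightarrow> \<tau> \<in> \<Sigma> \<Longrightarrow> \<tau> \<subseteq> \<sigma> \<Longrightarrow> \<tau> \<subseteq> \<sigma>' \<Longrightarrow> x \<in> XU \<tau> \<Longrightarrow>
       f \<sigma> (toric_map \<sigma> N x) = f \<sigma>' (toric_map \<sigma>' N x) * x (\<lambda>v. ?m \<sigma> v - ?m \<sigma>' v)"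
    using normalized_vtrivialization[OF L(1)] by blast
  obtain f' where f': "\<And>\<sigma>. \<sigma> \<in> max_cones \<Sigma> \<Longrightarrow>
       equivariant_iso \<sigma> N (trivial_eq (XU \<sigma>) (character (?m \<sigma>))) (rchart \<sigma> L') (f' \<sigma>)"
    "\<And>\<sigma> \<sigma>' \<tau> x. \<sigma> \<in> max_cones \<Sigma> \<Longrightarrow> \<sigma>' \<in> max_cones \<Sigma> \<Longrightarrow> \<tau> \<in> \<Sigma> \<Longrightarrow> \<tau> \<subseteq> \<sigma> \<Longrightarrow> \<tau> \<subseteq> \<sigma>' \<Longrightarrow> x \<in> XU \<tau> \<Longrightarrow>
       f' \<sigma> (toric_map \<sigma> N x) = f' \<sigma>' (toric_map \<sigma>' N x) * x (\<lambda>v. ?m \<sigma> v - ?m \<sigma>' v)"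
    using normalized_vtrivialization[OF L(2)] unfolding M[symmetric] by blast
  define F where "F \<sigma> x = f' \<sigma> x * inverse (f \<sigma> x)" for \<sigma> x
  have F_iso: "equivariant_iso \<sigma> N (rchart \<sigma> L) (rchart \<sigma> L') (F \<sigma>)" if \<sigma>: "\<sigma> \<in> max_cones \<Sigma>" for \<sigma>
  proof -
    note T = equivariant_line_bundle_trivial[OF M_pullback_dual[OF L(1) \<sigma>]]
    show ?thesis
      unfolding F_def
      by (rule equivariant_iso_trans[OF equivariant_iso_sym[OF f(1)[OF \<sigma>] T VB_elb[OF L(1) max_in_fan[OF \<sigma>]]] f'(1)[OF \<sigma>]
            VB_elb[OF L(1) max_in_fan[OF \<sigma>]] T])
  qed
  have F_eq: "F \<sigma> x = F \<sigma>' x'"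
    if \<sigma>: "\<sigma> \<in> max_cones \<Sigma>" "\<sigma>' \<in> max_cones \<Sigma>" and x: "x \<in> XU \<sigma>" and eq: "incl \<sigma> x = incl \<sigma>' x'" for \<sigma> \<sigma>' x x'
  proof -
    obtain y where y: "y \<in> XU (\<sigma> \<inter> \<sigma>')" "toric_map \<sigma> N y = x" "toric_map \<sigma>' N y = x'"
      by (rule incl_eqD[OF eq max_in_fan[OF \<sigma>(1)] x])
    note \<tau> = fan_Int[OF max_in_fan[OF \<sigma>(1)] max_in_fan[OF \<sigma>(2)]] Int_lower1[of \<sigma> \<sigma>'] Int_lower2[of \<sigma> \<sigma>']
    have "f \<sigma> x \<noteq> 0" by (rule equivariant_iso_nonzero[OF f(1)[OF \<sigma>(1)] x])
    then show ?thesis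
      using f(2)[OF \<sigma> \<tau> y(1)] f'(2)[OF \<sigma> \<tau> y(1)] unfolding y(2,3) by (simp add: F_def field_simps)
  qed
  \<comment> \<open>Evaluation in an arbitrary maximal chart containing the point;
    \<open>F_eq\<close> makes the choice harmless.\<close>
  define \<Phi> where "\<Phi> p = (let (\<sigma>, x) = (SOME (\<sigma>, x). \<sigma> \<in> max_cones \<Sigma> \<and> x \<in> XU \<sigma> \<and> p = incl \<sigma> x) in F \<sigma> x)" for p
  have \<Phi>: "\<Phi> (incl \<sigma> x) = F \<sigma> x" if \<sigma>: "\<sigma> \<in> max_cones \<Sigma>" and x: "x \<in> XU \<sigma>" for \<sigma> x
  proof -
    obtain \<sigma>' x' where s: "(SOME (\<sigma>', x'). \<sigma>' \<in> max_cones \<Sigma> \<and> x' \<in> XU \<sigma>' \<and> incl \<sigma> x = incl \<sigma>' x') = (\<sigma>', x')" by fastforce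
    have "\<exists>q. case q of (\<sigma>', x') \<Rightarrow> \<sigma>' \<in> max_cones \<Sigma> \<and> x' \<in> XU \<sigma>' \<and> incl \<sigma> x = incl \<sigma>' x'"
      using \<sigma> x by (intro exI[of _ "(\<sigma>, x)"]) simp
    from someI_ex[OF this] have "\<sigma>' \<in> max_cones \<Sigma> \<and> x' \<in> XU \<sigma>' \<and> incl \<sigma> x = incl \<sigma>' x'"
      unfolding s by simp
    then have "F \<sigma> x = F \<sigma>' x'" using F_eq[OF \<sigma> _ x] by blast
    then show ?thesis unfolding \<Phi>_def s by simp
  qed
  have "equivariant_iso \<tau> N (rchart \<tau> L) (rchart \<tau> L') (\<lambda>x. \<Phi> (incl \<tau> x))" if \<tau>: "\<tau> \<in> \<Sigma>" for \<tau>
  proof -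
    obtain \<sigma> where \<sigma>: "\<sigma> \<in> max_cones \<Sigma>" "\<tau> \<subseteq> \<sigma>" by (rule max_cone_above[OF \<tau>])
    note \<sigma>\<Sigma> = max_in_fan[OF \<sigma>(1)]
    note i = rchart_iso[OF L(1) \<sigma>\<Sigma> \<tau> \<sigma>(2)] and i' = rchart_iso[OF L(2) \<sigma>\<Sigma> \<tau> \<sigma>(2)]
    note sym = equivariant_iso_sym[OF i VB_elb[OF L(1) \<tau>]]
    note mid = equivariant_iso_pull[OF equivariant_morphism_X[OF \<sigma>(2)] F_iso[OF \<sigma>(1)] VB_elb[OF L(1) \<sigma>\<Sigma>]]
    note e1 = equivariant_iso_trans[OF sym mid VB_elb[OF L(1) \<tau>] i(2)]
    note e2 = equivariant_iso_trans[OF e1 i'(1) VB_elb[OF L(1) \<tau>] i'(2)]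
    show ?thesis
    proof (rule equivariant_iso_cong[OF e2 VB_elb[OF L(1) \<tau>]])
      fix x assume x: "x \<in> XU \<tau>"
      show "1 * (F \<sigma> (toric_map \<sigma> N x) * inverse 1) = \<Phi> (incl \<tau> x)"
        unfolding incl_max[OF \<sigma>(1) \<tau> \<sigma>(2) x] using \<Phi>[OF \<sigma>(1) toric_map_in[OF \<sigma>(2) order_refl x]] by simp
    qed
  qed
  then show ?thesis using L unfolding bundle_equiv_def by blast
qed

lemma bundle_equiv_iff:
  "bundle_equiv N \<Sigma> = {(L, L'). L \<in> VB \<and> L' \<in> VB \<and> M (pullback L) = M (pullback L')}"
proof -
  have LL: "L \<in> VB \<and> L' \<in> VB" if "(L, L') \<in> bundle_equiv N \<Sigma>" for L L'
    using that by (simp add: bundle_equiv_def)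
  have "M (pullback L) = M (pullback L')" if e: "(L, L') \<in> bundle_equiv N \<Sigma>" for L L'
  proof -
    have L: "L \<in> VB" "L' \<in> VB" using LL[OF e] by auto
    obtain F where F: "\<And>\<tau>. \<tau> \<in> \<Sigma> \<Longrightarrow> equivariant_iso \<tau> N (rchart \<tau> L) (rchart \<tau> L') (\<lambda>x. F (incl \<tau> x))"
      using e by (auto simp: bundle_equiv_def)
    have "vchar L' \<sigma> (M (pullback L) \<sigma>)" if \<sigma>: "\<sigma> \<in> max_cones \<Sigma>" for \<sigma>
    proof -
      obtain f where f: "equivariant_iso \<sigma> N (trivial_eq (XU \<sigma>) (character (M (pullback L) \<sigma>))) (rchart \<sigma> L) f"
        using vchar_M[OF L(1) \<sigma>] unfolding vchar_def by blast
      from equivariant_iso_trans[OF f F[OF max_in_fan[OF \<sigma>]] equivariant_line_bundle_trivial[OF M_pullback_dual[OF L(1) \<sigma>]]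
          VB_elb[OF L(1) max_in_fan[OF \<sigma>]]]
      show ?thesis unfolding vchar_def using M_pullback_dual[OF L(1) \<sigma>] by blast
    qed
    then show ?thesis using M_pullback_eqI[OF L(2), of "M (pullback L)"] by (simp add: M_def)
  qed
  then show ?thesis using LL bundle_equiv_if_M_eq by blast
qed

lemma VB_frames: "L \<in> VB \<Longrightarrow> (V, s) \<in> fst L \<Longrightarrow> V \<subseteq> toric_variety N \<Sigma>"
  by (auto simp: linearized_bundles_def)

lemma VB_I:
  assumes "\<And>V s. (V, s) \<in> fst L \<Longrightarrow> V \<subseteq> toric_variety N \<Sigma>"
    "\<And>\<tau>. \<tau> \<in> \<Sigma> \<Longrightarrow> equivariant_line_bundle \<tau> N (rchart \<tau> L)"
  shows "L \<in> VB"
  unfolding linearized_bundles_def using assms by auto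

lemma tensor_in_VB: assumes "L \<in> VB" "L' \<in> VB" shows "tensor_eq L L' \<in> VB"
proof (rule VB_I)
  show "V \<subseteq> toric_variety N \<Sigma>" if "(V, s) \<in> fst (tensor_eq L L')" for V s
    using that VB_frames[OF assms(1)] unfolding fst_tensor_eq by auto
  show "equivariant_line_bundle \<tau> N (rchart \<tau> (tensor_eq L L'))" if "\<tau> \<in> \<Sigma>" for \<tau>
    using equivariant_line_bundle_tensor[OF VB_elb[OF assms(1) that] VB_elb[OF assms(2) that]]
    by (simp add: restrict_chart_def pull_eq_tensor_eq)
qed

lemma dual_in_VB: assumes "L \<in> VB" shows "dual_eq L \<in> VB"
proof (rule VB_I)
  show "V \<subseteq> toric_variety N \<Sigma>" if "(V, s) \<in> fst (dual_eq L)" for V s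
    using that VB_frames[OF assms(1)] unfolding fst_dual_eq by auto
  show "equivariant_line_bundle \<tau> N (rchart \<tau> (dual_eq L))" if "\<tau> \<in> \<Sigma>" for \<tau>
    using equivariant_line_bundle_dual[OF VB_elb[OF assms(1) that]]
    by (simp add: restrict_chart_def pull_eq_dual_eq)
qed

lemma rchart_unit:
  "\<tau> \<in> \<Sigma> \<Longrightarrow> rchart \<tau> (trivial_eq (toric_variety N \<Sigma>) c) = trivial_eq (XU \<tau>) c"
  unfolding restrict_chart_def by (rule pull_eq_trivial_eq) (rule incl_in)

lemma unit_in_VB: "trivial_eq (toric_variety N \<Sigma>) (\<lambda>_. 1) \<in> VB"
  by (rule VB_I)
    (use equivariant_line_bundle_trivial[OF dual_lattice_zero] in \<open>auto simp: fst_trivial_eq rchart_unit character_zero_fun\<close>)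

lemma vchar_tensor:
  assumes "vchar L \<sigma> m" "vchar L' \<sigma> m'" shows "vchar (tensor_eq L L') \<sigma> (\<lambda>v. m v + m' v)"
proof -
  obtain f f' where m: "m \<in> dual_lattice N" "m' \<in> dual_lattice N"
    and *: "equivariant_iso \<sigma> N (trivial_eq (XU \<sigma>) (character m)) (rchart \<sigma> L) f"
    "equivariant_iso \<sigma> N (trivial_eq (XU \<sigma>) (character m')) (rchart \<sigma> L') f'"
    using assms unfolding vchar_def by blast
  have "(\<lambda>v. character m v * character m' v) = character (\<lambda>v. m v + m' v)"
    by (simp add: fun_eq_iff character_add_left)
  then show ?thesis
    unfolding vchar_def restrict_chart_def pull_eq_tensor_eq
    using equivariant_iso_tensor[OF * equivariant_line_bundle_trivial[OF m(1)]] dual_lattice_add[OF m]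
    by (auto simp: tensor_trivial_eq restrict_chart_def)
qed

lemma vchar_dual:
  assumes L: "L \<in> VB" and \<sigma>: "\<sigma> \<in> max_cones \<Sigma>" and "vchar L \<sigma> m" shows "vchar (dual_eq L) \<sigma> (\<lambda>v. - m v)"
proof -
  obtain f where m: "m \<in> dual_lattice N"
    and *: "equivariant_iso \<sigma> N (trivial_eq (XU \<sigma>) (character m)) (rchart \<sigma> L) f"
    using assms unfolding vchar_def by blast
  have "(\<lambda>v. inverse (character m v)) = character (\<lambda>v. - m v)"
    using character_diff_left[of "\<lambda>_. 0" m] by (simp add: fun_eq_iff divide_inverse)
  then show ?thesis
    unfolding vchar_def restrict_chart_def pull_eq_dual_eq
    using equivariant_iso_dual[OF * equivariant_line_bundle_trivial[OF m] VB_elb[OF L max_in_fan[OF \<sigma>]]] dual_lattice_minus[OF m]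
    by (auto simp: dual_trivial_eq restrict_chart_def)
qed

lemma variety_kernel_quotient:
  "kernel_quotient Z VB (bundle_equiv N \<Sigma>) (\<lambda>L. M (pullback L)) tensor_eq (trivial_eq (toric_variety N \<Sigma>) (\<lambda>_. 1))"
proof -
  interpret Z: comm_group Z by (rule comm_group_Z)
  have MZ: "M L \<in> carrier Z" for L by (simp add: Z_def M_def)
  show ?thesis
  proof unfold_locales
    show "M (pullback (tensor_eq L L')) = M (pullback L) \<otimes>\<^bsub>Z\<^esub> M (pullback L')" if "L \<in> VB" "L' \<in> VB" for L L'
    proof (rule M_pullback_eqI[OF tensor_in_VB[OF that]])
      show "vchar (tensor_eq L L') \<sigma> ((M (pullback L) \<otimes>\<^bsub>Z\<^esub> M (pullback L')) \<sigma>)" if \<sigma>: "\<sigma> \<in> max_cones \<Sigma>" for \<sigma>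
        using vchar_tensor[OF vchar_M[OF \<open>L \<in> VB\<close> \<sigma>] vchar_M[OF \<open>L' \<in> VB\<close> \<sigma>]] \<sigma> by (simp add: Z_def)
    qed (simp add: Z_def)
    show "M (pullback (trivial_eq (toric_variety N \<Sigma>) (\<lambda>_. 1))) = \<one>\<^bsub>Z\<^esub>"
    proof (rule M_pullback_eqI[OF unit_in_VB])
      show "vchar (trivial_eq (toric_variety N \<Sigma>) (\<lambda>_. 1)) \<sigma> (\<one>\<^bsub>Z\<^esub> \<sigma>)" if \<sigma>: "\<sigma> \<in> max_cones \<Sigma>" for \<sigma>
        using \<sigma> equivariant_iso_refl[OF equivariant_line_bundle_trivial[OF dual_lattice_zero, of \<sigma> N]]
        by (auto simp: vchar_def Z_def rchart_unit[OF max_in_fan[OF \<sigma>]] character_zero_fun)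
    qed (simp add: Z_def)
    fix L assume L: "L \<in> VB"
    have "M (pullback (dual_eq L)) = restrict (\<lambda>\<sigma> v. - M (pullback L) \<sigma> v) (max_cones \<Sigma>)"
      by (rule M_pullback_eqI[OF dual_in_VB[OF L]]) (use vchar_dual[OF L _ vchar_M[OF L]] in auto)
    also have "\<dots> = inv\<^bsub>Z\<^esub> M (pullback L)"
      by (rule Z.inv_equality[symmetric]) (use MZ in \<open>auto simp: Z_def intro!: ext\<close>)
    finally show "\<exists>L'\<in>VB. M (pullback L') = inv\<^bsub>Z\<^esub> M (pullback L)" using dual_in_VB[OF L] by blast
  qed (simp_all only: bundle_equiv_iff tensor_in_VB unit_in_VB MZ)
qed

lemma variety_Pic_eq:
  "variety_Pic N \<Sigma> = kernel_quotient.P VB (bundle_equiv N \<Sigma>) tensor_eq (trivial_eq (toric_variety N \<Sigma>) (\<lambda>_. 1))"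
  unfolding kernel_quotient.P_def[OF variety_kernel_quotient] variety_Pic_def bundle_class_def by simp

section \<open>Both Picard groups and the pull-back between them\<close>

abbreviation "forms_group k \<equiv> sum_group (rays \<Sigma>) (\<lambda>\<rho>. ray_forms_group N \<rho> (k \<rho>))"

interpretation orbi: kernel_quotient Z LB "orbi_equiv N \<Sigma> w" M orbi_tensor "orbi_unit N \<Sigma> w"
  rewrites "kernel_quotient.P LB (orbi_equiv N \<Sigma> w) orbi_tensor (orbi_unit N \<Sigma> w) = orbi_Pic N \<Sigma> w"
  by (rule orbi_kernel_quotient) (rule orbi_Pic_eq[symmetric])

interpretation var: kernel_quotient Z VB "bundle_equiv N \<Sigma>" "\<lambda>L. M (pullback L)" tensor_eq
    "trivial_eq (toric_variety N \<Sigma>) (\<lambda>_. 1)"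
  rewrites "kernel_quotient.P VB (bundle_equiv N \<Sigma>) tensor_eq (trivial_eq (toric_variety N \<Sigma>) (\<lambda>_. 1)) = variety_Pic N \<Sigma>"
  by (rule variety_kernel_quotient) (rule variety_Pic_eq[symmetric])

lemma comm_group_orbi_Pic: "comm_group (orbi_Pic N \<Sigma> w)"
  by (rule orbi.comm_group_P)

lemma comm_group_variety_Pic: "comm_group (variety_Pic N \<Sigma>)"
  by (rule var.comm_group_P)

lemma bij_orbi_m: "bij_betw orbi.m (carrier (orbi_Pic N \<Sigma> w)) (compatible_characters N \<Sigma> w)"
  unfolding bij_betw_def using orbi.inj_m orbi.m_image M_image by simp

lemmas orbi_m_compatible = bij_betwE[OF bij_orbi_m, rule_format]

lemma orbi_m_class: "L \<in> LB \<Longrightarrow> orbi.m (orbi_class N \<Sigma> w L) = M L"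
  unfolding orbi_class_def by (rule orbi.m_class)

lemma pullback_class:
  assumes L: "L \<in> VB"
  shows "Pic_pullback N \<Sigma> w (bundle_equiv N \<Sigma> `` {L}) = orbi_class N \<Sigma> w (pullback L)"
proof -
  have "orbi_class N \<Sigma> w (pullback K) = orbi_class N \<Sigma> w (pullback L)" if "K \<in> bundle_equiv N \<Sigma> `` {L}" for K
    using that pullback_in L by (simp add: orbi_class_def var.class_eq orbi.class_eq)
  moreover have "L \<in> bundle_equiv N \<Sigma> `` {L}" using L by (simp add: var.class_eq)
  ultimately show ?thesis unfolding Pic_pullback_def by blast
qed

lemma Pic_pullback_in:
  assumes "C \<in> carrier (variety_Pic N \<Sigma>)" shows "Pic_pullback N \<Sigma> w C \<in> carrier (orbi_Pic N \<Sigma> w)"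
  using assms orbi.class_in[OF pullback_in]
  by (auto elim!: var.class_cases simp: pullback_class orbi_class_def)

lemma orbi_m_pullback:
  assumes "C \<in> carrier (variety_Pic N \<Sigma>)" shows "orbi.m (Pic_pullback N \<Sigma> w C) = var.m C"
  using assms by (auto elim!: var.class_cases simp: pullback_class orbi_m_class pullback_in var.m_class)

text \<open>Pull-back preserves characters, and characters already separate the classes on the
  variety.\<close>

lemma inj_Pic_pullback: "inj_on (Pic_pullback N \<Sigma> w) (carrier (variety_Pic N \<Sigma>))"
proof (rule inj_onI)
  fix C C' assume C: "C \<in> carrier (variety_Pic N \<Sigma>)" "C' \<in> carrier (variety_Pic N \<Sigma>)"
    and "Pic_pullback N \<Sigma> w C = Pic_pullback N \<Sigma> w C'"
  then have "var.m C = var.m C'" using orbi_m_pullback by metis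
  then show "C = C'" using inj_onD[OF var.inj_m] C by blast
qed

text \<open>Since \<open>orbi.m\<close> is injective, it suffices to compare families of characters,
  and both sides have the same product of families.\<close>

lemma Pic_pullback_hom: "Pic_pullback N \<Sigma> w \<in> hom (variety_Pic N \<Sigma>) (orbi_Pic N \<Sigma> w)"
proof (rule homI)
  interpret orbi_Pic: comm_group "orbi_Pic N \<Sigma> w" by (rule comm_group_orbi_Pic)
  interpret variety_Pic: comm_group "variety_Pic N \<Sigma>" by (rule comm_group_variety_Pic)
  fix C C' assume C: "C \<in> carrier (variety_Pic N \<Sigma>)" "C' \<in> carrier (variety_Pic N \<Sigma>)"
  show "Pic_pullback N \<Sigma> w (C \<otimes>\<^bsub>variety_Pic N \<Sigma>\<^esub> C') =
      Pic_pullback N \<Sigma> w C \<otimes>\<^bsub>orbi_Pic N \<Sigma> w\<^esub> Pic_pullback N \<Sigma> w C'"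
  proof (rule inj_onD[OF orbi.inj_m])
    show "orbi.m (Pic_pullback N \<Sigma> w (C \<otimes>\<^bsub>variety_Pic N \<Sigma>\<^esub> C')) =
        orbi.m (Pic_pullback N \<Sigma> w C \<otimes>\<^bsub>orbi_Pic N \<Sigma> w\<^esub> Pic_pullback N \<Sigma> w C')"
      by (simp add: orbi_m_pullback variety_Pic.m_closed C hom_mult[OF var.m_hom C]
          hom_mult[OF orbi.m_hom Pic_pullback_in[OF C(1)] Pic_pullback_in[OF C(2)]])
  qed (simp_all add: Pic_pullback_in variety_Pic.m_closed orbi_Pic.m_closed C)
qed (rule Pic_pullback_in)

text \<open>The characters of a pull-back are integral on all of \<open>N\<close>, hence on the ray
  generator itself and not only on its weighted multiple.\<close>

lemma forms_pullback_in:
  assumes "C \<in> carrier (variety_Pic N \<Sigma>)"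
  shows "forms (orbi.m (Pic_pullback N \<Sigma> w C)) \<in> carrier (forms_group (\<lambda>_. 1))"
  unfolding carrier_forms_sum_group
proof (rule PiE_I)
  obtain L where L: "L \<in> VB" "C = bundle_equiv N \<Sigma> `` {L}" using assms by (rule var.class_cases)
  fix \<rho> assume \<rho>: "\<rho> \<in> rays \<Sigma>"
  note a = above[OF rays_in_fan[OF \<rho>]]
  have m: "M (pullback L) (above \<rho>) \<in> dual_lattice N" by (rule M_pullback_dual[OF L(1) a(1)])
  have "restrict (M (pullback L) (above \<rho>)) (ray_line N \<rho>) \<in> ray_forms N \<rho> 1"
    using m ray_generator(1)[OF \<rho>] by (intro restrict_linear_ray_forms) (auto simp: dual_lattice_def)
  moreover have "orbi.m (Pic_pullback N \<Sigma> w C) = M (pullback L)"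
    using orbi_m_pullback[OF assms] var.m_class[OF L(1)] by (simp only: L(2))
  ultimately show "forms (orbi.m (Pic_pullback N \<Sigma> w C)) \<rho> \<in> ray_forms N \<rho> 1"
    using \<rho> by (simp add: forms_def)
qed (simp add: forms_def)

lemma forms_orbi_m_mult:
  assumes "C \<in> carrier (orbi_Pic N \<Sigma> w)" "C' \<in> carrier (orbi_Pic N \<Sigma> w)"
  shows "forms (orbi.m (C \<otimes>\<^bsub>orbi_Pic N \<Sigma> w\<^esub> C')) =
     forms (orbi.m C) \<otimes>\<^bsub>forms_group k\<^esub> forms (orbi.m C')"
  unfolding hom_mult[OF orbi.m_hom assms] by (rule forms_mult) (use assms orbi_m_compatible in auto)

lemma bij_orbi_forms:
  "bij_betw (forms \<circ> orbi.m) (carrier (orbi_Pic N \<Sigma> w)) (\<Pi>\<^sub>E \<rho>\<in>rays \<Sigma>. ray_forms N \<rho> (w \<rho>))"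
  by (rule bij_betw_trans[OF bij_orbi_m bij_forms])

lemma bij_orbi_integers:
  "bij_betw (integers \<circ> forms \<circ> orbi.m) (carrier (orbi_Pic N \<Sigma> w)) (rays \<Sigma> \<rightarrow>\<^sub>E UNIV)"
  by (rule bij_betw_trans[OF bij_orbi_m bij_integers_forms])

lemma iso_orbi_forms: "forms \<circ> orbi.m \<in> iso (orbi_Pic N \<Sigma> w) (forms_group w)"
  using bij_orbi_forms forms_orbi_m_mult bij_betwE[OF bij_orbi_forms]
  unfolding iso_def hom_def carrier_forms_sum_group by simp

lemma pullback_forms_hom:
  "(\<lambda>C. forms (orbi.m (Pic_pullback N \<Sigma> w C))) \<in> hom (variety_Pic N \<Sigma>) (forms_group (\<lambda>_. 1))"
  by (rule homI)
    (simp_all del: One_nat_def add: forms_pullback_in hom_mult[OF Pic_pullback_hom] forms_orbi_m_mult[of _ _ "\<lambda>_. 1"] Pic_pullback_in)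

lemma inj_pullback_forms:
  "inj_on (\<lambda>C. forms (orbi.m (Pic_pullback N \<Sigma> w C))) (carrier (variety_Pic N \<Sigma>))"
proof (rule inj_onI)
  fix C C' assume C: "C \<in> carrier (variety_Pic N \<Sigma>)" "C' \<in> carrier (variety_Pic N \<Sigma>)"
    and eq: "forms (orbi.m (Pic_pullback N \<Sigma> w C)) = forms (orbi.m (Pic_pullback N \<Sigma> w C'))"
  have "Pic_pullback N \<Sigma> w C = Pic_pullback N \<Sigma> w C'"
    by (rule inj_onD[OF bij_betw_imp_inj_on[OF bij_orbi_forms] _ Pic_pullback_in[OF C(1)] Pic_pullback_in[OF C(2)]])
      (simp add: eq)
  then show "C = C'" by (rule inj_onD[OF inj_Pic_pullback _ C])
qed

end

theorem theorem1:
  fixes N :: "'a::euclidean_space set"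
    and \<Sigma> :: "'a set set"
    and w :: "'a set \<Rightarrow> nat"
  assumes "is_lattice N" and "weighted_fan N \<Sigma> w"
  shows "comm_group (orbi_Pic N \<Sigma> w) \<and> comm_group (variety_Pic N \<Sigma>) \<and>
    (\<exists>m h l.
      bij_betw m (carrier (orbi_Pic N \<Sigma> w)) (compatible_characters N \<Sigma> w) \<and>
      (\<forall>L\<in>linearized_orbi_bundles N \<Sigma> w. \<forall>\<sigma>\<in>max_cones \<Sigma>. \<forall>\<mu>.
         fibre_character N \<Sigma> w L \<sigma> \<mu> \<longleftrightarrow> \<mu> = m (orbi_class N \<Sigma> w L) \<sigma>) \<and>

      bij_betw h (carrier (orbi_Pic N \<Sigma> w)) (\<Pi>\<^sub>E \<rho>\<in>rays \<Sigma>. ray_forms N \<rho> (w \<rho>)) \<and>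
      (\<forall>C\<in>carrier (orbi_Pic N \<Sigma> w). \<forall>\<rho>\<in>rays \<Sigma>. \<forall>\<sigma>\<in>max_cones \<Sigma>. \<rho> \<subseteq> \<sigma> \<longrightarrow>
         h C \<rho> = restrict (m C \<sigma>) (ray_line N \<rho>)) \<and>

      bij_betw l (carrier (orbi_Pic N \<Sigma> w)) (rays \<Sigma> \<rightarrow>\<^sub>E (UNIV :: int set)) \<and>
      (\<forall>C\<in>carrier (orbi_Pic N \<Sigma> w). \<forall>\<rho>\<in>rays \<Sigma>.
         of_int (l C \<rho>) = h C \<rho> (real (w \<rho>) *\<^sub>R ray_gen N \<rho>) \<and>
         (\<forall>\<sigma>\<in>max_cones \<Sigma>. \<rho> \<subseteq> \<sigma> \<longrightarrow>
            of_int (l C \<rho>) = m C \<sigma> (real (w \<rho>) *\<^sub>R ray_gen N \<rho>))) \<and>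

      h \<in> iso (orbi_Pic N \<Sigma> w) (sum_group (rays \<Sigma>) (\<lambda>\<rho>. ray_forms_group N \<rho> (w \<rho>))) \<and>
      Pic_pullback N \<Sigma> w \<in> hom (variety_Pic N \<Sigma>) (orbi_Pic N \<Sigma> w) \<and>
      inj_on (Pic_pullback N \<Sigma> w) (carrier (variety_Pic N \<Sigma>)) \<and>
      subgroup (carrier (sum_group (rays \<Sigma>) (\<lambda>\<rho>. ray_forms_group N \<rho> 1)))
        (sum_group (rays \<Sigma>) (\<lambda>\<rho>. ray_forms_group N \<rho> (w \<rho>))) \<and>
      (\<exists>h\<^sub>0\<in>hom (variety_Pic N \<Sigma>) (sum_group (rays \<Sigma>) (\<lambda>\<rho>. ray_forms_group N \<rho> 1)).
         inj_on h\<^sub>0 (carrier (variety_Pic N \<Sigma>)) \<and>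
         (\<forall>C\<in>carrier (variety_Pic N \<Sigma>). h (Pic_pullback N \<Sigma> w C) = h\<^sub>0 C)))"
proof -
  interpret toric_fan N \<Sigma> w by unfold_locales (rule assms)+
  let ?m = "kernel_quotient.m M"
  show ?thesis
  \<comment> \<open>The witnesses are left schematic and fixed by the facts shown: the characters of
    a class, their restrictions to the ray lines, and the values of these at the weighted
    generators.\<close>
  proof (intro conjI exI)
    show "comm_group (orbi_Pic N \<Sigma> w)" "comm_group (variety_Pic N \<Sigma>)"
      by (rule comm_group_orbi_Pic comm_group_variety_Pic)+
    show "\<forall>L\<in>LB. \<forall>\<sigma>\<in>max_cones \<Sigma>. \<forall>\<mu>. fchar L \<sigma> \<mu> \<longleftrightarrow> \<mu> = ?m (orbi_class N \<Sigma> w L) \<sigma>"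
      by (simp add: orbi_m_class fchar_M_iff)
    show "\<forall>C\<in>carrier (orbi_Pic N \<Sigma> w). \<forall>\<rho>\<in>rays \<Sigma>. \<forall>\<sigma>\<in>max_cones \<Sigma>. \<rho> \<subseteq> \<sigma> \<longrightarrow>
        (forms \<circ> ?m) C \<rho> = restrict (?m C \<sigma>) (ray_line N \<rho>)"
      using forms_eq[OF orbi_m_compatible] by simp
    show "\<forall>C\<in>carrier (orbi_Pic N \<Sigma> w). \<forall>\<rho>\<in>rays \<Sigma>.
        of_int ((integers \<circ> forms \<circ> ?m) C \<rho>) = (forms \<circ> ?m) C \<rho> (real (w \<rho>) *\<^sub>R ray_gen N \<rho>) \<and>
        (\<forall>\<sigma>\<in>max_cones \<Sigma>. \<rho> \<subseteq> \<sigma> \<longrightarrow>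
           of_int ((integers \<circ> forms \<circ> ?m) C \<rho>) = ?m C \<sigma> (real (w \<rho>) *\<^sub>R ray_gen N \<rho>))"
    proof (intro ballI conjI impI)
      fix C \<rho> assume C: "C \<in> carrier (orbi_Pic N \<Sigma> w)" and \<rho>: "\<rho> \<in> rays \<Sigma>"
      note m = orbi_m_compatible[OF C]
      show l: "of_int ((integers \<circ> forms \<circ> ?m) C \<rho>) = ?m C \<sigma> (real (w \<rho>) *\<^sub>R ray_gen N \<rho>)"
        if "\<sigma> \<in> max_cones \<Sigma>" "\<rho> \<subseteq> \<sigma>" for \<sigma>
        using integers_forms[OF m \<rho> that] by (simp add: weighted_gen_def)
      note a = above[OF rays_in_fan[OF \<rho>]]
      show "of_int ((integers \<circ> forms \<circ> ?m) C \<rho>) = (forms \<circ> ?m) C \<rho> (real (w \<rho>) *\<^sub>R ray_gen N \<rho>)"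
        unfolding l[OF a] by (simp add: forms_eq[OF m \<rho> a])
    qed
    show "\<exists>h\<^sub>0\<in>hom (variety_Pic N \<Sigma>) (forms_group (\<lambda>_. 1)). inj_on h\<^sub>0 (carrier (variety_Pic N \<Sigma>)) \<and>
        (\<forall>C\<in>carrier (variety_Pic N \<Sigma>). (forms \<circ> ?m) (Pic_pullback N \<Sigma> w C) = h\<^sub>0 C)"
      by (rule bexI[OF _ pullback_forms_hom]) (simp add: inj_pullback_forms)
  qed (rule bij_orbi_m bij_orbi_forms bij_orbi_integers iso_orbi_forms Pic_pullback_hom inj_Pic_pullback subgroup_ray_forms_1)+
qed

end
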